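(* The pseudofunctors $\mathsf{Term}:\mathsf{trmTngCat}\to\mathsf{TngPair}$ and $\mathsf{Slice}:\mathsf{TngPair}\to\mathsf{trmTngCat}$ form an adjunction $\mathsf{Term}\dashv\mathsf{Slice}$ with left adjoint $\mathsf{Term}$ and right adjoint $\mathsf{Slice}$. The unit at a tangent category with terminal object $(\mathbb X,\mathbb T)$ is the isomorphism of tangent categories $(U,\eta):(\mathbb X,\mathbb T)\to\mathsf{Slice}(\mathsf{Term}(\mathbb X,\mathbb T))=(\mathbb X,\mathbb T)/\ast$ given by $U(A)=(!:A\to\ast)$, $U(f:A\to B)=f:(!:A\to\ast)\to(!:B\to\ast)$, with distributive law $\eta: U(TA)=(!:TA\to\ast)\xrightarrow{\mathrm{id}_{TA}}(!:TA\to\ast)=T(U(A))$. The counit at a tangent pair $(\mathbb X,\mathbb T;A)$ is the morphism of tangent pairs $(C,\epsilon;\varphi):\mathsf{Term}(\mathsf{Slice}(\mathbb X,\mathbb T;A))=((\mathbb X,\mathbb T)/A;\mathrm{id}_A)\to(\mathbb X,\mathbb T;A)$ given by $C(f:E\to A)=E$, $C(g:(f:E\to A)\to(f':E'\to A))=(g:E\to E')$, distributive law $\epsilon: C(T^{(A)}f)=T^{(A)}E\xrightarrow{v_f}TE=T(C(f))$, and $\varphi=\mathrm{id}_A: C(\mathrm{id}_A)=A\to A$.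
   Context: Tangent categories (Cockett–Cruttwell). A tangent category $(\mathbb X,\mathbb T)$ is a category $\mathbb X$ with an endofunctor $T$ and natural transformations $p:T\Rightarrow \mathrm{id}$ (projection), $z:\mathrm{id}\Rightarrow T$ (zero), $s:T_2\Rightarrow T$ (sum), $l:T\Rightarrow T^2$ (vertical lift), $c:T^2\Rightarrow T^2$ (canonical flip), where $T_nX$ is the $n$-fold pullback of $p_X$ along itself (assumed to exist and to be preserved by all $T^m$), such that: $(p_X,z_X,s_X)$ is a commutative monoid in $\mathbb X/X$ (an additive bundle); $(l,z):p\to Tp$ and $(c,\mathrm{id}):Tp\to p_T$ are morphisms of additive bundles; $c\circ c=\mathrm{id}$, $c\circ l=l$, $Tl\circ l=l_T\circ l$, $Tc\circ c_T\circ Tc=c_T\circ Tc\circ c_T$, $c_T\circ Tc\circ l_T=Tl\circ c$; and the square formed by $Ts\circ\langle l\pi_1,z_T\pi_2\rangle:T_2X\to T^2X$, $p\pi_1:T_2X\to X$, $Tp:T^2X\to TX$, $z:X\to TX$ is a pullback preserved by all $T^m$. A lax tangent morphism $(F,\alpha):(\mathbb X,\mathbb T)\to(\mathbb X',\mathbb T')$ is a functor $F$ with a natural transformation $\alpha:F\circ T\Rightarrow T'\circ F$ (the distributive law) satisfying $p'_F\circ\alpha=Fp$, $\alpha\circ Fz=z'_F$, $\alpha\circ Fs=s'_F\circ\alpha_2$ (with $\alpha_2=\langle\alpha\circ F\pi_1,\alpha\circ F\pi_2\rangle:F T_2\Rightarrow T_2'F$), $l'_F\circ\alpha=T'\alpha\circ\alpha_T\circ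 Fl$, $c'_F\circ T'\alpha\circ\alpha_T=T'\alpha\circ\alpha_T\circ Fc$. Slice tangent category. $(\mathbb X,\mathbb T)$ is sliceable over $A\in\mathbb X$ if for each $f:E\to A$ the pullback $T^{(A)}E$ of $Tf:TE\to TA$ along $z:A\to TA$ exists and is preserved by all $T^m$; write $v_f:T^{(A)}E\to TE$ for its projection (equivalently $v_f$ is the equalizer of $Tf$ and $z\circ p\circ Tf$). Then $(\mathbb X,\mathbb T)/A$ is the category $\mathbb X/A$ with tangent bundle functor $T^{(A)}(f)=f\circ p\circ v_f:T^{(A)}E\to A$, projection $p\circ v_f$, and with zero, sum, vertical lift and canonical flip the unique maps induced through $v_f$ (and $Tv_f\circ v_{T^{(A)}f}$) from those of $\mathbb T$. (It is recalled as known, after Rosický and Cockett–Cruttwell, that these form a tangent structure.) Tangent pairs. A tangent pair $(\mathbb X,\mathbb T;A)$ is a tangent category sliceable over an object $A$, together with $A$. A morphism $(F,\alpha;\varphi):(\mathbb X,\mathbb T;A)\to(\mathbb X',\mathbb T';B)$ is a lax tangent morphism $(F,\alpha)$ with a morphism $\varphi:FA\to B$ in $\mathbb X'$; the composite of $(F,\alpha;\varphi)$ with $(G,\beta;\psi)$ is $(G\circ F,\beta_F\circ G\alpha;\psi\circ G\varphi)$. They form the category $\mathsf{TngPair}$. A tangent category with terminal object is a tangent category with a terminal object $\ast$ such that $T\ast\to\ast$ is an isomorphism; $\mathsf{trmTngCat}$ consists of these, lax tangent morphisms, and natural transformations compatible with the distributive laws. Such a tangent category is sliceable over $\ast$ and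 $T^{(\ast)}(A\to\ast)$ is identified with $TA\to\ast$. $\mathsf{Term}(\mathbb X,\mathbb T)=(\mathbb X,\mathbb T;\ast)$, $\mathsf{Term}(F,\alpha)=(F,\alpha;!:F\ast\to\ast)$. $\mathsf{Slice}(\mathbb X,\mathbb T;A)=(\mathbb X,\mathbb T)/A$ (with terminal object $\mathrm{id}_A$), and $\mathsf{Slice}(F,\alpha;\varphi):(\mathbb X,\mathbb T)/A\to(\mathbb X',\mathbb T')/B$ is the lax tangent morphism with functor $(f:E\to A)\mapsto(\varphi\circ Ff:FE\to B)$, $g\mapsto Fg$, and distributive law $\theta_f:F T^{(A)}E\to T'^{(B)}FE$ the unique map over $B$ with $v_{\varphi\circ Ff}\circ\theta_f=\alpha_E\circ Fv_f$. Both are pseudofunctors because terminal objects and slice tangent structures are only defined up to unique isomorphism; equalities are to be read up to these canonical isomorphisms.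
   Formalization: A tangent pair is additionally required to have, in the slice over A, all n-fold pullbacks of the projection T^(A)E→E, preserved by powers of T^(A); sliceability alone does not give these, and without them the slice is not a tangent category. *)

theory Defs
  imports "HOL-Library.FuncSet"
begin

section \<open>Categories, functors, pullbacks\<close>

record ('o, 'a) cat =
  Obj :: "'o set"
  Arr :: "'a set"
  Dom :: "'a \<Rightarrow> 'o"
  Cod :: "'a \<Rightarrow> 'o"
  Id :: "'o \<Rightarrow> 'a"
  Comp :: "'a \<Rightarrow> 'a \<Rightarrow> 'a" (infixr "\<cdot>\<index>" 75)

definition Hom :: "('o, 'a, 'm) cat_scheme \<Rightarrow> 'o \<Rightarrow> 'o \<Rightarrow> 'a set" where
  "Hom C a b = {f \<in> Arr C. Dom C f = a \<and> Cod C f = b}"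

definition category :: "('o, 'a, 'm) cat_scheme \<Rightarrow> bool" where
  "category C \<longleftrightarrow>
     (\<forall>f\<in>Arr C. Dom C f \<in> Obj C \<and> Cod C f \<in> Obj C) \<and>
     (\<forall>a\<in>Obj C. Id C a \<in> Hom C a a) \<and>
     (\<forall>f\<in>Arr C. \<forall>g\<in>Arr C. Cod C f = Dom C g \<longrightarrow> g \<cdot>\<^bsub>C\<^esub> f \<in> Hom C (Dom C f) (Cod C g)) \<and>
     (\<forall>f\<in>Arr C. f \<cdot>\<^bsub>C\<^esub> Id C (Dom C f) = f \<and> Id C (Cod C f) \<cdot>\<^bsub>C\<^esub> f = f) \<and>
     (\<forall>f\<in>Arr C. \<forall>g\<in>Arr C. \<forall>h\<in>Arr C. Cod C f = Dom C g \<longrightarrow> Cod C g = Dom C h \<longrightarrow>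
        (h \<cdot>\<^bsub>C\<^esub> g) \<cdot>\<^bsub>C\<^esub> f = h \<cdot>\<^bsub>C\<^esub> (g \<cdot>\<^bsub>C\<^esub> f))"

definition is_iso :: "('o, 'a, 'm) cat_scheme \<Rightarrow> 'a \<Rightarrow> bool" where
  "is_iso C f \<longleftrightarrow> f \<in> Arr C \<and>
     (\<exists>g \<in> Hom C (Cod C f) (Dom C f). g \<cdot>\<^bsub>C\<^esub> f = Id C (Dom C f) \<and> f \<cdot>\<^bsub>C\<^esub> g = Id C (Cod C f))"

definition is_terminal :: "('o, 'a, 'm) cat_scheme \<Rightarrow> 'o \<Rightarrow> bool" where
  "is_terminal C t \<longleftrightarrow> t \<in> Obj C \<and> (\<forall>a\<in>Obj C. \<exists>!f. f \<in> Hom C a t)"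

definition bang :: "('o, 'a, 'm) cat_scheme \<Rightarrow> 'o \<Rightarrow> 'o \<Rightarrow> 'a" where
  "bang C t a = (THE f. f \<in> Hom C a t)"

record ('o, 'a, 'p, 'b) fctr =
  omap :: "'o \<Rightarrow> 'p"
  amap :: "'a \<Rightarrow> 'b"

definition is_functor ::
  "('o, 'a, 'm) cat_scheme \<Rightarrow> ('p, 'b, 'n) cat_scheme \<Rightarrow> ('o, 'a, 'p, 'b, 'k) fctr_scheme \<Rightarrow> bool" where
  "is_functor C D F \<longleftrightarrow> category C \<and> category D \<and>
     (\<forall>a\<in>Obj C. omap F a \<in> Obj D) \<and>
     (\<forall>f\<in>Arr C. amap F f \<in> Hom D (omap F (Dom C f)) (omap F (Cod C f))) \<and>
     (\<forall>a\<in>Obj C. amap F (Id C a) = Id D (omap F a)) \<and>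
     (\<forall>f\<in>Arr C. \<forall>g\<in>Arr C. Cod C f = Dom C g \<longrightarrow>
        amap F (g \<cdot>\<^bsub>C\<^esub> f) = amap F g \<cdot>\<^bsub>D\<^esub> amap F f)"

definition fid :: "('o, 'a, 'o, 'a) fctr" where
  "fid = \<lparr>omap = (\<lambda>a. a), amap = (\<lambda>f. f)\<rparr>"

definition fcomp ::
  "('p, 'b, 'q, 'c, 'j) fctr_scheme \<Rightarrow> ('o, 'a, 'p, 'b, 'k) fctr_scheme \<Rightarrow> ('o, 'a, 'q, 'c) fctr" where
  "fcomp G F = \<lparr>omap = omap G \<circ> omap F, amap = amap G \<circ> amap F\<rparr>"

definition nat_trans ::
  "('o, 'a, 'm) cat_scheme \<Rightarrow> ('p, 'b, 'n) cat_scheme \<Rightarrow>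
   ('o, 'a, 'p, 'b, 'k) fctr_scheme \<Rightarrow> ('o, 'a, 'p, 'b, 'j) fctr_scheme \<Rightarrow> ('o \<Rightarrow> 'b) \<Rightarrow> bool" where
  "nat_trans C D F G \<tau> \<longleftrightarrow>
     (\<forall>a\<in>Obj C. \<tau> a \<in> Hom D (omap F a) (omap G a)) \<and>
     (\<forall>f\<in>Arr C. \<tau> (Cod C f) \<cdot>\<^bsub>D\<^esub> amap F f = amap G f \<cdot>\<^bsub>D\<^esub> \<tau> (Dom C f))"

definition is_pullback :: "('o, 'a, 'm) cat_scheme \<Rightarrow> 'a \<Rightarrow> 'a \<Rightarrow> 'a \<Rightarrow> 'a \<Rightarrow> bool" where
  "is_pullback C f g q1 q2 \<longleftrightarrow>
     f \<in> Arr C \<and> g \<in> Arr C \<and> Cod C f = Cod C g \<and>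
     q1 \<in> Hom C (Dom C q1) (Dom C f) \<and> q2 \<in> Hom C (Dom C q1) (Dom C g) \<and>
     f \<cdot>\<^bsub>C\<^esub> q1 = g \<cdot>\<^bsub>C\<^esub> q2 \<and>
     (\<forall>w h1 h2. h1 \<in> Hom C w (Dom C f) \<longrightarrow> h2 \<in> Hom C w (Dom C g) \<longrightarrow>
        f \<cdot>\<^bsub>C\<^esub> h1 = g \<cdot>\<^bsub>C\<^esub> h2 \<longrightarrow>
        (\<exists>!k. k \<in> Hom C w (Dom C q1) \<and> q1 \<cdot>\<^bsub>C\<^esub> k = h1 \<and> q2 \<cdot>\<^bsub>C\<^esub> k = h2))"

text \<open>The map \<open>\<langle>h1, h2\<rangle>\<close> into a pullback with projections \<open>q1\<close> and \<open>q2\<close>.\<close>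

definition pairing :: "('o, 'a, 'm) cat_scheme \<Rightarrow> 'a \<Rightarrow> 'a \<Rightarrow> 'a \<Rightarrow> 'a \<Rightarrow> 'a" where
  "pairing C q1 q2 h1 h2 =
     (THE k. k \<in> Hom C (Dom C h1) (Dom C q1) \<and> q1 \<cdot>\<^bsub>C\<^esub> k = h1 \<and> q2 \<cdot>\<^bsub>C\<^esub> k = h2)"

text \<open>
  The \<open>n\<close>-fold pullback of \<open>f\<close> along itself: projections \<open>q i\<close> for \<open>i < n\<close>, and the common
  composite \<open>u\<close> of the \<open>q i\<close> with \<open>f\<close>. Keeping \<open>u\<close> explicit makes the case \<open>n = 0\<close> the codomain
  of \<open>f\<close>.
\<close>

definition is_fibre_power ::
  "('o, 'a, 'm) cat_scheme \<Rightarrow> nat \<Rightarrow> 'a \<Rightarrow> 'a \<Rightarrow> (nat \<Rightarrow> 'a) \<Rightarrow> bool" where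
  "is_fibre_power C n f u q \<longleftrightarrow>
     f \<in> Arr C \<and> u \<in> Hom C (Dom C u) (Cod C f) \<and>
     (\<forall>i<n. q i \<in> Hom C (Dom C u) (Dom C f) \<and> f \<cdot>\<^bsub>C\<^esub> q i = u) \<and>
     (\<forall>w v h. v \<in> Hom C w (Cod C f) \<longrightarrow> (\<forall>i<n. h i \<in> Hom C w (Dom C f) \<and> f \<cdot>\<^bsub>C\<^esub> h i = v) \<longrightarrow>
        (\<exists>!k. k \<in> Hom C w (Dom C u) \<and> u \<cdot>\<^bsub>C\<^esub> k = v \<and> (\<forall>i<n. q i \<cdot>\<^bsub>C\<^esub> k = h i)))"

section \<open>Additive bundles\<close>

text \<open>\<open>bpi1\<close> and \<open>bpi2\<close> are the projections of the chosen pullback of \<open>bproj\<close> along itself.\<close>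

record 'a add_bundle =
  bproj :: 'a
  bzero :: 'a
  bsum :: 'a
  bpi1 :: 'a
  bpi2 :: 'a

definition additive_bundle :: "('o, 'a, 'm) cat_scheme \<Rightarrow> 'a add_bundle \<Rightarrow> bool" where
  "additive_bundle C B \<longleftrightarrow>
     (let q = bproj B; z = bzero B; s = bsum B; p1 = bpi1 B; p2 = bpi2 B;
          add = (\<lambda>x y. s \<cdot>\<^bsub>C\<^esub> pairing C p1 p2 x y)
      in q \<in> Arr C \<and> is_pullback C q q p1 p2 \<and>
         z \<in> Hom C (Cod C q) (Dom C q) \<and> q \<cdot>\<^bsub>C\<^esub> z = Id C (Cod C q) \<and>
         s \<in> Hom C (Dom C p1) (Dom C q) \<and> q \<cdot>\<^bsub>C\<^esub> s = q \<cdot>\<^bsub>C\<^esub> p1 \<and>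
         (\<forall>u r. is_fibre_power C 3 q u r \<longrightarrow>
            add (add (r 0) (r 1)) (r 2) = add (r 0) (add (r 1) (r 2))) \<and>
         add p2 p1 = s \<and>
         add (z \<cdot>\<^bsub>C\<^esub> q) (Id C (Dom C q)) = Id C (Dom C q) \<and>
         add (Id C (Dom C q)) (z \<cdot>\<^bsub>C\<^esub> q) = Id C (Dom C q))"

text \<open>\<open>(f, g)\<close> is a morphism of additive bundles; \<open>g\<close> is the map of bases.\<close>

definition additive_bundle_morphism ::
  "('o, 'a, 'm) cat_scheme \<Rightarrow> 'a add_bundle \<Rightarrow> 'a add_bundle \<Rightarrow> 'a \<Rightarrow> 'a \<Rightarrow> bool" where
  "additive_bundle_morphism C B B' f g \<longleftrightarrow>
     f \<in> Hom C (Dom C (bproj B)) (Dom C (bproj B')) \<and>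
     g \<in> Hom C (Cod C (bproj B)) (Cod C (bproj B')) \<and>
     bproj B' \<cdot>\<^bsub>C\<^esub> f = g \<cdot>\<^bsub>C\<^esub> bproj B \<and>
     f \<cdot>\<^bsub>C\<^esub> bzero B = bzero B' \<cdot>\<^bsub>C\<^esub> g \<and>
     f \<cdot>\<^bsub>C\<^esub> bsum B =
       bsum B' \<cdot>\<^bsub>C\<^esub> pairing C (bpi1 B') (bpi2 B') (f \<cdot>\<^bsub>C\<^esub> bpi1 B) (f \<cdot>\<^bsub>C\<^esub> bpi2 B)"

section \<open>Tangent categories\<close>

text \<open>
  \<open>pi1T\<close> and \<open>pi2T\<close> give the chosen pullback \<open>T\<^sub>2\<close> on which the sum is defined.
\<close>

record ('o, 'a) tngcat =
  Cat :: "('o, 'a) cat"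
  TanF :: "('o, 'a, 'o, 'a) fctr"
  projT :: "'o \<Rightarrow> 'a"
  zeroT :: "'o \<Rightarrow> 'a"
  pi1T :: "'o \<Rightarrow> 'a"
  pi2T :: "'o \<Rightarrow> 'a"
  sumT :: "'o \<Rightarrow> 'a"
  liftT :: "'o \<Rightarrow> 'a"
  flipT :: "'o \<Rightarrow> 'a"

abbreviation TO :: "('o, 'a) tngcat \<Rightarrow> 'o \<Rightarrow> 'o" where
  "TO X \<equiv> omap (TanF X)"

abbreviation TA :: "('o, 'a) tngcat \<Rightarrow> 'a \<Rightarrow> 'a" where
  "TA X \<equiv> amap (TanF X)"

definition T_pullback :: "('o, 'a) tngcat \<Rightarrow> 'a \<Rightarrow> 'a \<Rightarrow> 'a \<Rightarrow> 'a \<Rightarrow> bool" where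
  "T_pullback X f g q1 q2 \<longleftrightarrow>
     (\<forall>m. is_pullback (Cat X) ((TA X ^^ m) f) ((TA X ^^ m) g) ((TA X ^^ m) q1) ((TA X ^^ m) q2))"

text \<open>The pullbacks \<open>T\<^sub>n\<close> exist and are preserved by all powers of the tangent bundle functor.\<close>

definition has_T_powers ::
  "('o, 'a) cat \<Rightarrow> ('o, 'a, 'o, 'a) fctr \<Rightarrow> ('o \<Rightarrow> 'a) \<Rightarrow> bool" where
  "has_T_powers C T p \<longleftrightarrow>
     (\<forall>a\<in>Obj C. \<forall>n. \<exists>u q. \<forall>m.
        is_fibre_power C n ((amap T ^^ m) (p a)) ((amap T ^^ m) u) (\<lambda>i. (amap T ^^ m) (q i)))"

definition T2 :: "('o, 'a) tngcat \<Rightarrow> ('o, 'a, 'o, 'a) fctr" where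
  "T2 X = \<lparr>omap = (\<lambda>a. Dom (Cat X) (pi1T X a)),
           amap = (\<lambda>f. pairing (Cat X) (pi1T X (Cod (Cat X) f)) (pi2T X (Cod (Cat X) f))
                         (TA X f \<cdot>\<^bsub>Cat X\<^esub> pi1T X (Dom (Cat X) f))
                         (TA X f \<cdot>\<^bsub>Cat X\<^esub> pi2T X (Dom (Cat X) f)))\<rparr>"

definition tangent_bundle :: "('o, 'a) tngcat \<Rightarrow> 'o \<Rightarrow> 'a add_bundle" where
  "tangent_bundle X a = \<lparr>bproj = projT X a, bzero = zeroT X a, bsum = sumT X a,
                         bpi1 = pi1T X a, bpi2 = pi2T X a\<rparr>"

definition T_bundle :: "('o, 'a) tngcat \<Rightarrow> 'a add_bundle \<Rightarrow> 'a add_bundle" where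
  "T_bundle X B = \<lparr>bproj = TA X (bproj B), bzero = TA X (bzero B), bsum = TA X (bsum B),
                   bpi1 = TA X (bpi1 B), bpi2 = TA X (bpi2 B)\<rparr>"

definition tangent_category :: "('o, 'a) tngcat \<Rightarrow> bool" where
  "tangent_category X \<longleftrightarrow>
     (let C = Cat X; T = TanF X; p = projT X; z = zeroT X; s = sumT X; l = liftT X; c = flipT X;
          p1 = pi1T X; p2 = pi2T X
      in is_functor C C T \<and>
         nat_trans C C T fid p \<and>
         nat_trans C C fid T z \<and>
         has_T_powers C T p \<and>
         (\<forall>a\<in>Obj C. T_pullback X (p a) (p a) (p1 a) (p2 a)) \<and>
         nat_trans C C (T2 X) T s \<and>
         nat_trans C C T (fcomp T T) l \<and>
         nat_trans C C (fcomp T T) (fcomp T T) c \<and>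
         (\<forall>a\<in>Obj C.
            additive_bundle C (tangent_bundle X a) \<and>
            additive_bundle_morphism C
              (tangent_bundle X a) (T_bundle X (tangent_bundle X a)) (l a) (z a) \<and>
            additive_bundle_morphism C
              (T_bundle X (tangent_bundle X a)) (tangent_bundle X (TO X a)) (c a) (Id C (TO X a)) \<and>
            c a \<cdot>\<^bsub>C\<^esub> c a = Id C (TO X (TO X a)) \<and>
            c a \<cdot>\<^bsub>C\<^esub> l a = l a \<and>
            TA X (l a) \<cdot>\<^bsub>C\<^esub> l a = l (TO X a) \<cdot>\<^bsub>C\<^esub> l a \<and>
            TA X (c a) \<cdot>\<^bsub>C\<^esub> c (TO X a) \<cdot>\<^bsub>C\<^esub> TA X (c a) =
              c (TO X a) \<cdot>\<^bsub>C\<^esub> TA X (c a) \<cdot>\<^bsub>C\<^esub> c (TO X a) \<and>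
            c (TO X a) \<cdot>\<^bsub>C\<^esub> TA X (c a) \<cdot>\<^bsub>C\<^esub> l (TO X a) = TA X (l a) \<cdot>\<^bsub>C\<^esub> c a \<and>
            T_pullback X (TA X (p a)) (z a)
              (TA X (s a) \<cdot>\<^bsub>C\<^esub> pairing C (TA X (p1 a)) (TA X (p2 a))
                 (l a \<cdot>\<^bsub>C\<^esub> p1 a) (z (TO X a) \<cdot>\<^bsub>C\<^esub> p2 a))
              (p a \<cdot>\<^bsub>C\<^esub> p1 a)))"

definition lax_tangent_morphism ::
  "('o, 'a) tngcat \<Rightarrow> ('p, 'b) tngcat \<Rightarrow> ('o, 'a, 'p, 'b) fctr \<Rightarrow> ('o \<Rightarrow> 'b) \<Rightarrow> bool" where
  "lax_tangent_morphism X X' F \<alpha> \<longleftrightarrow>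
     (let C = Cat X; D = Cat X'
      in is_functor C D F \<and>
         nat_trans C D (fcomp F (TanF X)) (fcomp (TanF X') F) \<alpha> \<and>
         (\<forall>a\<in>Obj C.
            projT X' (omap F a) \<cdot>\<^bsub>D\<^esub> \<alpha> a = amap F (projT X a) \<and>
            \<alpha> a \<cdot>\<^bsub>D\<^esub> amap F (zeroT X a) = zeroT X' (omap F a) \<and>
            \<alpha> a \<cdot>\<^bsub>D\<^esub> amap F (sumT X a) =
              sumT X' (omap F a) \<cdot>\<^bsub>D\<^esub> pairing D (pi1T X' (omap F a)) (pi2T X' (omap F a))
                (\<alpha> a \<cdot>\<^bsub>D\<^esub> amap F (pi1T X a)) (\<alpha> a \<cdot>\<^bsub>D\<^esub> amap F (pi2T X a)) \<and>
            liftT X' (omap F a) \<cdot>\<^bsub>D\<^esub> \<alpha> a =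
              TA X' (\<alpha> a) \<cdot>\<^bsub>D\<^esub> \<alpha> (TO X a) \<cdot>\<^bsub>D\<^esub> amap F (liftT X a) \<and>
            flipT X' (omap F a) \<cdot>\<^bsub>D\<^esub> TA X' (\<alpha> a) \<cdot>\<^bsub>D\<^esub> \<alpha> (TO X a) =
              TA X' (\<alpha> a) \<cdot>\<^bsub>D\<^esub> \<alpha> (TO X a) \<cdot>\<^bsub>D\<^esub> amap F (flipT X a)))"

section \<open>The slice tangent category\<close>

text \<open>
  Objects and arrows of the categories under consideration are taken from a type closed under
  triples, so that the slice of such a category is again such a category: \<open>Tri f g f'\<close> is the arrow
  \<open>g : f \<rightarrow> f'\<close> of a slice category.
\<close>

datatype 'b univ = Atom 'b | Tri (tsrc: "'b univ") (tmap: "'b univ") (ttrg: "'b univ")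

type_synonym 'b ucat = "('b univ, 'b univ) cat"
type_synonym 'b utng = "('b univ, 'b univ) tngcat"
type_synonym 'b choice = "'b ucat \<Rightarrow> 'b univ \<Rightarrow> 'b univ \<Rightarrow> 'b univ \<times> 'b univ"

text \<open>
  A choice of pullbacks, whenever they exist. It fixes the slice tangent structures, and the
  pseudofunctor \<open>Slice\<close> obtained from any such choice is strict.
\<close>

definition pullback_choice :: "'b choice \<Rightarrow> bool" where
  "pullback_choice pb \<longleftrightarrow>
     (\<forall>C f g. category C \<longrightarrow> (\<exists>q1 q2. is_pullback C f g q1 q2) \<longrightarrow>
        is_pullback C f g (fst (pb C f g)) (snd (pb C f g)))"

definition slice_cat :: "'b ucat \<Rightarrow> 'b univ \<Rightarrow> 'b ucat" where
  "slice_cat C A =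
     \<lparr>Obj = {f \<in> Arr C. Cod C f = A},
      Arr = {Tri f g f' | f g f'. f \<in> Arr C \<and> Cod C f = A \<and> f' \<in> Arr C \<and> Cod C f' = A \<and>
               g \<in> Hom C (Dom C f) (Dom C f') \<and> f' \<cdot>\<^bsub>C\<^esub> g = f},
      Dom = tsrc, Cod = ttrg,
      Id = (\<lambda>f. Tri f (Id C (Dom C f)) f),
      Comp = (\<lambda>h k. Tri (tsrc k) (tmap h \<cdot>\<^bsub>C\<^esub> tmap k) (ttrg h))\<rparr>"

definition sliceable :: "('o, 'a) tngcat \<Rightarrow> 'o \<Rightarrow> bool" where
  "sliceable X A \<longleftrightarrow>
     (\<forall>f\<in>Arr (Cat X). Cod (Cat X) f = A \<longrightarrow>
        (\<exists>q1 q2. T_pullback X (TA X f) (zeroT X A) q1 q2))"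

text \<open>The projection \<open>v\<^sub>f : T\<^sup>A E \<rightarrow> T E\<close> for \<open>f : E \<rightarrow> A\<close>.\<close>

definition vert :: "'b choice \<Rightarrow> 'b utng \<Rightarrow> 'b univ \<Rightarrow> 'b univ \<Rightarrow> 'b univ" where
  "vert pb X A f = fst (pb (Cat X) (TA X f) (zeroT X A))"

definition sliceTO :: "'b choice \<Rightarrow> 'b utng \<Rightarrow> 'b univ \<Rightarrow> 'b univ \<Rightarrow> 'b univ" where
  "sliceTO pb X A f = f \<cdot>\<^bsub>Cat X\<^esub> projT X (Dom (Cat X) f) \<cdot>\<^bsub>Cat X\<^esub> vert pb X A f"

text \<open>
  \<open>into\<close> and \<open>into2\<close> are the maps induced through \<open>v\<^sub>f\<close> and through \<open>T v\<^sub>f \<circ> v\<^bsub>T\<^sup>A f\<^esub>\<close>; these are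
  monic, so a factorisation of \<open>h\<close> is unique when it exists.
\<close>

definition into :: "'b choice \<Rightarrow> 'b utng \<Rightarrow> 'b univ \<Rightarrow> 'b univ \<Rightarrow> 'b univ \<Rightarrow> 'b univ" where
  "into pb X A f h =
     (THE k. k \<in> Hom (Cat X) (Dom (Cat X) h) (Dom (Cat X) (vert pb X A f)) \<and>
             vert pb X A f \<cdot>\<^bsub>Cat X\<^esub> k = h)"

definition vert2 :: "'b choice \<Rightarrow> 'b utng \<Rightarrow> 'b univ \<Rightarrow> 'b univ \<Rightarrow> 'b univ" where
  "vert2 pb X A f = TA X (vert pb X A f) \<cdot>\<^bsub>Cat X\<^esub> vert pb X A (sliceTO pb X A f)"

definition into2 :: "'b choice \<Rightarrow> 'b utng \<Rightarrow> 'b univ \<Rightarrow> 'b univ \<Rightarrow> 'b univ \<Rightarrow> 'b univ" where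
  "into2 pb X A f h =
     (THE k. k \<in> Hom (Cat X) (Dom (Cat X) h) (Dom (Cat X) (vert2 pb X A f)) \<and>
             vert2 pb X A f \<cdot>\<^bsub>Cat X\<^esub> k = h)"

definition sliceT :: "'b choice \<Rightarrow> 'b utng \<Rightarrow> 'b univ \<Rightarrow> ('b univ, 'b univ, 'b univ, 'b univ) fctr" where
  "sliceT pb X A =
     \<lparr>omap = sliceTO pb X A,
      amap = (\<lambda>g. Tri (sliceTO pb X A (tsrc g))
                      (into pb X A (ttrg g) (TA X (tmap g) \<cdot>\<^bsub>Cat X\<^esub> vert pb X A (tsrc g)))
                      (sliceTO pb X A (ttrg g)))\<rparr>"

definition sliceproj :: "'b choice \<Rightarrow> 'b utng \<Rightarrow> 'b univ \<Rightarrow> 'b univ \<Rightarrow> 'b univ" where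
  "sliceproj pb X A f =
     Tri (sliceTO pb X A f) (projT X (Dom (Cat X) f) \<cdot>\<^bsub>Cat X\<^esub> vert pb X A f) f"

definition slicepi1 :: "'b choice \<Rightarrow> 'b utng \<Rightarrow> 'b univ \<Rightarrow> 'b univ \<Rightarrow> 'b univ" where
  "slicepi1 pb X A f = fst (pb (slice_cat (Cat X) A) (sliceproj pb X A f) (sliceproj pb X A f))"

definition slicepi2 :: "'b choice \<Rightarrow> 'b utng \<Rightarrow> 'b univ \<Rightarrow> 'b univ \<Rightarrow> 'b univ" where
  "slicepi2 pb X A f = snd (pb (slice_cat (Cat X) A) (sliceproj pb X A f) (sliceproj pb X A f))"

definition slice_tng :: "'b choice \<Rightarrow> 'b utng \<Rightarrow> 'b univ \<Rightarrow> 'b utng" where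
  "slice_tng pb X A =
     (let C = Cat X; v = vert pb X A; TS = sliceTO pb X A
      in \<lparr>Cat = slice_cat C A,
          TanF = sliceT pb X A,
          projT = sliceproj pb X A,
          zeroT = (\<lambda>f. Tri f (into pb X A f (zeroT X (Dom C f))) (TS f)),
          pi1T = slicepi1 pb X A,
          pi2T = slicepi2 pb X A,
          sumT = (\<lambda>f. Tri (tsrc (slicepi1 pb X A f))
                    (into pb X A f
                       (sumT X (Dom C f) \<cdot>\<^bsub>C\<^esub>
                        pairing C (pi1T X (Dom C f)) (pi2T X (Dom C f))
                          (v f \<cdot>\<^bsub>C\<^esub> tmap (slicepi1 pb X A f))
                          (v f \<cdot>\<^bsub>C\<^esub> tmap (slicepi2 pb X A f))))
                    (TS f)),
          liftT = (\<lambda>f. Tri (TS f) (into2 pb X A f (liftT X (Dom C f) \<cdot>\<^bsub>C\<^esub> v f)) (TS (TS f))),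
          flipT = (\<lambda>f. Tri (TS (TS f))
                    (into2 pb X A f (flipT X (Dom C f) \<cdot>\<^bsub>C\<^esub> vert2 pb X A f))
                    (TS (TS f)))\<rparr>)"

section \<open>Strict 2-categories and 2-adjunctions\<close>

record ('o, 'a, 'c) cat2 = "('o, 'a) cat" +
  Cell :: "'c set"
  Src :: "'c \<Rightarrow> 'a"
  Trg :: "'c \<Rightarrow> 'a"
  VId :: "'a \<Rightarrow> 'c"
  VComp :: "'c \<Rightarrow> 'c \<Rightarrow> 'c"
  HComp :: "'c \<Rightarrow> 'c \<Rightarrow> 'c"

definition vertical :: "('o, 'a, 'c) cat2 \<Rightarrow> ('a, 'c) cat" where
  "vertical B = \<lparr>Obj = Arr B, Arr = Cell B, Dom = Src B, Cod = Trg B, Id = VId B, Comp = VComp B\<rparr>"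

definition horizontal :: "('o, 'a, 'c) cat2 \<Rightarrow> ('o, 'c) cat" where
  "horizontal B =
     \<lparr>Obj = Obj B, Arr = Cell B, Dom = (\<lambda>x. Dom B (Src B x)), Cod = (\<lambda>x. Cod B (Src B x)),
      Id = (\<lambda>a. VId B (Id B a)), Comp = HComp B\<rparr>"

definition two_category :: "('o, 'a, 'c) cat2 \<Rightarrow> bool" where
  "two_category B \<longleftrightarrow> category B \<and> category (vertical B) \<and> category (horizontal B) \<and>
     (\<forall>x\<in>Cell B. Dom B (Src B x) = Dom B (Trg B x) \<and> Cod B (Src B x) = Cod B (Trg B x)) \<and>
     (\<forall>x\<in>Cell B. \<forall>y\<in>Cell B. Cod B (Src B x) = Dom B (Src B y) \<longrightarrow>
        Src B (HComp B y x) = Src B y \<cdot>\<^bsub>B\<^esub> Src B x \<and>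
        Trg B (HComp B y x) = Trg B y \<cdot>\<^bsub>B\<^esub> Trg B x) \<and>
     (\<forall>f\<in>Arr B. \<forall>g\<in>Arr B. Cod B f = Dom B g \<longrightarrow>
        HComp B (VId B g) (VId B f) = VId B (g \<cdot>\<^bsub>B\<^esub> f)) \<and>
     (\<forall>x\<in>Cell B. \<forall>x'\<in>Cell B. \<forall>y\<in>Cell B. \<forall>y'\<in>Cell B.
        Trg B x = Src B x' \<longrightarrow> Trg B y = Src B y' \<longrightarrow> Cod B (Src B x) = Dom B (Src B y) \<longrightarrow>
        HComp B (VComp B y' y) (VComp B x' x) = VComp B (HComp B y' x') (HComp B y x))"

record ('o, 'a, 'c, 'p, 'b, 'd) fctr2 = "('o, 'a, 'p, 'b) fctr" +
  cmap :: "'c \<Rightarrow> 'd"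

definition two_functor ::
  "('o, 'a, 'c) cat2 \<Rightarrow> ('p, 'b, 'd) cat2 \<Rightarrow> ('o, 'a, 'c, 'p, 'b, 'd) fctr2 \<Rightarrow> bool" where
  "two_functor B B' F \<longleftrightarrow> two_category B \<and> two_category B' \<and>
     is_functor B B' F \<and>
     is_functor (vertical B) (vertical B') \<lparr>omap = amap F, amap = cmap F\<rparr> \<and>
     is_functor (horizontal B) (horizontal B') \<lparr>omap = omap F, amap = cmap F\<rparr>"

definition fid2 :: "('o, 'a, 'c, 'o, 'a, 'c) fctr2" where
  "fid2 = \<lparr>omap = (\<lambda>a. a), amap = (\<lambda>f. f), cmap = (\<lambda>x. x)\<rparr>"

definition fcomp2 ::
  "('p, 'b, 'd, 'q, 'e, 'g) fctr2 \<Rightarrow> ('o, 'a, 'c, 'p, 'b, 'd) fctr2 \<Rightarrow>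
   ('o, 'a, 'c, 'q, 'e, 'g) fctr2" where
  "fcomp2 G F = \<lparr>omap = omap G \<circ> omap F, amap = amap G \<circ> amap F, cmap = cmap G \<circ> cmap F\<rparr>"

definition two_natural ::
  "('o, 'a, 'c) cat2 \<Rightarrow> ('p, 'b, 'd) cat2 \<Rightarrow>
   ('o, 'a, 'c, 'p, 'b, 'd) fctr2 \<Rightarrow> ('o, 'a, 'c, 'p, 'b, 'd) fctr2 \<Rightarrow> ('o \<Rightarrow> 'b) \<Rightarrow> bool" where
  "two_natural B B' F G \<tau> \<longleftrightarrow> nat_trans B B' F G \<tau> \<and>
     (\<forall>x\<in>Cell B.
        HComp B' (VId B' (\<tau> (Cod B (Src B x)))) (cmap F x) =
        HComp B' (cmap G x) (VId B' (\<tau> (Dom B (Src B x)))))"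

definition two_adjunction ::
  "('o, 'a, 'c) cat2 \<Rightarrow> ('p, 'b, 'd) cat2 \<Rightarrow>
   ('o, 'a, 'c, 'p, 'b, 'd) fctr2 \<Rightarrow> ('p, 'b, 'd, 'o, 'a, 'c) fctr2 \<Rightarrow>
   ('o \<Rightarrow> 'a) \<Rightarrow> ('p \<Rightarrow> 'b) \<Rightarrow> bool" where
  "two_adjunction B B' L R \<eta> \<epsilon> \<longleftrightarrow>
     two_functor B B' L \<and> two_functor B' B R \<and>
     two_natural B B fid2 (fcomp2 R L) \<eta> \<and>
     two_natural B' B' (fcomp2 L R) fid2 \<epsilon> \<and>
     (\<forall>a\<in>Obj B. \<epsilon> (omap L a) \<cdot>\<^bsub>B'\<^esub> amap L (\<eta> a) = Id B' (omap L a)) \<and>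
     (\<forall>x\<in>Obj B'. amap R (\<epsilon> x) \<cdot>\<^bsub>B\<^esub> \<eta> (omap R x) = Id B (omap R x))"

section \<open>Tangent categories with terminal object, and tangent pairs\<close>

text \<open>
  A tangent category together with one of its objects. The same data serve for tangent categories
  with a terminal object and for tangent pairs.
\<close>

type_synonym 'b ptng = "'b utng \<times> 'b univ"

definition terminal_tangent_category :: "'b ptng \<Rightarrow> bool" where
  "terminal_tangent_category P \<longleftrightarrow>
     (case P of (X, t) \<Rightarrow> tangent_category X \<and> is_terminal (Cat X) t \<and>
        is_iso (Cat X) (bang (Cat X) t (TO X t)))"

text \<open>
  Sliceability alone does not give the iterated fibre products of \<open>T\<^sup>A E \<rightarrow> E\<close>, which belong to
  the slice tangent structure; for instance, let \<open>X\<close> be the full subcategory of pairs of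
  finite-dimensional vector spaces on the dimensions generated by \<open>(1,1)\<close> and \<open>(1,0)\<close> under
  multiples and \<open>(m,n) \<mapsto> (2m-1,2n)\<close>, \<open>T E = E \<oplus> E\<close>, and \<open>A\<close> of dimension \<open>(1,0)\<close>. The last
  conjunct supplies them. It does not depend on the choice \<open>pb\<close>, and it is necessary for the
  slice over \<open>A\<close> to be a tangent category.
\<close>

definition tangent_pair :: "'b choice \<Rightarrow> 'b ptng \<Rightarrow> bool" where
  "tangent_pair pb P \<longleftrightarrow>
     (case P of (X, A) \<Rightarrow> tangent_category X \<and> A \<in> Obj (Cat X) \<and> sliceable X A \<and>
        has_T_powers (slice_cat (Cat X) A) (sliceT pb X A) (sliceproj pb X A))"

record 'b laxmor =
  lsrc :: "'b ptng"
  ltrg :: "'b ptng"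
  lfun :: "('b univ, 'b univ, 'b univ, 'b univ) fctr"
  ldist :: "'b univ \<Rightarrow> 'b univ"

abbreviation lcat :: "'b ptng \<Rightarrow> 'b ucat" where
  "lcat P \<equiv> Cat (fst P)"

text \<open>
  The maps making up a morphism are \<open>undefined\<close> outside the source category, so that equality of
  morphisms is equality on that category.
\<close>

definition is_laxmor :: "'b laxmor \<Rightarrow> bool" where
  "is_laxmor m \<longleftrightarrow>
     lax_tangent_morphism (fst (lsrc m)) (fst (ltrg m)) (lfun m) (ldist m) \<and>
     omap (lfun m) \<in> extensional (Obj (lcat (lsrc m))) \<and>
     amap (lfun m) \<in> extensional (Arr (lcat (lsrc m))) \<and>
     ldist m \<in> extensional (Obj (lcat (lsrc m)))"

definition lax_id :: "'b ptng \<Rightarrow> 'b laxmor" where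
  "lax_id P =
     \<lparr>lsrc = P, ltrg = P,
      lfun = \<lparr>omap = (\<lambda>a\<in>Obj (lcat P). a), amap = (\<lambda>f\<in>Arr (lcat P). f)\<rparr>,
      ldist = (\<lambda>a\<in>Obj (lcat P). Id (lcat P) (TO (fst P) a))\<rparr>"

definition lax_comp :: "'b laxmor \<Rightarrow> 'b laxmor \<Rightarrow> 'b laxmor" where
  "lax_comp n m =
     \<lparr>lsrc = lsrc m, ltrg = ltrg n,
      lfun = \<lparr>omap = compose (Obj (lcat (lsrc m))) (omap (lfun n)) (omap (lfun m)),
              amap = compose (Arr (lcat (lsrc m))) (amap (lfun n)) (amap (lfun m))\<rparr>,
      ldist = (\<lambda>a\<in>Obj (lcat (lsrc m)).
        ldist n (omap (lfun m) a) \<cdot>\<^bsub>lcat (ltrg n)\<^esub> amap (lfun n) (ldist m a))\<rparr>"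

record ('b, 'm) cell =
  csrc :: 'm
  ctrg :: 'm
  ccomp :: "'b univ \<Rightarrow> 'b univ"

text \<open>Natural transformations compatible with the distributive laws.\<close>

definition is_lax_transformation ::
  "'b laxmor \<Rightarrow> 'b laxmor \<Rightarrow> ('b univ \<Rightarrow> 'b univ) \<Rightarrow> bool" where
  "is_lax_transformation m n \<gamma> \<longleftrightarrow>
     lsrc m = lsrc n \<and> ltrg m = ltrg n \<and>
     nat_trans (lcat (lsrc m)) (lcat (ltrg m)) (lfun m) (lfun n) \<gamma> \<and>
     (\<forall>a\<in>Obj (lcat (lsrc m)).
        ldist n a \<cdot>\<^bsub>lcat (ltrg m)\<^esub> \<gamma> (TO (fst (lsrc m)) a) =
        TA (fst (ltrg m)) (\<gamma> a) \<cdot>\<^bsub>lcat (ltrg m)\<^esub> ldist m a) \<and>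
     \<gamma> \<in> extensional (Obj (lcat (lsrc m)))"

text \<open>
  Identity, vertical and horizontal composites of cells. The parameter \<open>lx\<close> extracts the
  underlying lax tangent morphism of a 1-cell and \<open>cmp\<close> is the composition of 1-cells.
\<close>

definition cell_id :: "('m \<Rightarrow> 'b laxmor) \<Rightarrow> 'm \<Rightarrow> ('b, 'm) cell" where
  "cell_id lx m =
     \<lparr>csrc = m, ctrg = m,
      ccomp = (\<lambda>a\<in>Obj (lcat (lsrc (lx m))). Id (lcat (ltrg (lx m))) (omap (lfun (lx m)) a))\<rparr>"

definition cell_vcomp ::
  "('m \<Rightarrow> 'b laxmor) \<Rightarrow> ('b, 'm) cell \<Rightarrow> ('b, 'm) cell \<Rightarrow> ('b, 'm) cell" where
  "cell_vcomp lx y x =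
     \<lparr>csrc = csrc x, ctrg = ctrg y,
      ccomp = (\<lambda>a\<in>Obj (lcat (lsrc (lx (csrc x)))).
        ccomp y a \<cdot>\<^bsub>lcat (ltrg (lx (csrc x)))\<^esub> ccomp x a)\<rparr>"

definition cell_hcomp ::
  "('m \<Rightarrow> 'b laxmor) \<Rightarrow> ('m \<Rightarrow> 'm \<Rightarrow> 'm) \<Rightarrow> ('b, 'm) cell \<Rightarrow> ('b, 'm) cell \<Rightarrow> ('b, 'm) cell" where
  "cell_hcomp lx cmp y x =
     \<lparr>csrc = cmp (csrc y) (csrc x), ctrg = cmp (ctrg y) (ctrg x),
      ccomp = (\<lambda>a\<in>Obj (lcat (lsrc (lx (csrc x)))).
        ccomp y (omap (lfun (lx (ctrg x))) a) \<cdot>\<^bsub>lcat (ltrg (lx (csrc y)))\<^esub>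
        amap (lfun (lx (csrc y))) (ccomp x a))\<rparr>"

definition trmTngCat :: "('b ptng, 'b laxmor, ('b, 'b laxmor) cell) cat2" where
  "trmTngCat =
     \<lparr>Obj = {P. terminal_tangent_category P},
      Arr = {m. terminal_tangent_category (lsrc m) \<and> terminal_tangent_category (ltrg m) \<and>
                is_laxmor m},
      Dom = lsrc, Cod = ltrg, Id = lax_id, Comp = lax_comp,
      Cell = {x. (\<forall>m\<in>{csrc x, ctrg x}. terminal_tangent_category (lsrc m) \<and>
                    terminal_tangent_category (ltrg m) \<and> is_laxmor m) \<and>
                 is_lax_transformation (csrc x) (ctrg x) (ccomp x)},
      Src = csrc, Trg = ctrg, VId = cell_id (\<lambda>m. m), VComp = cell_vcomp (\<lambda>m. m),
      HComp = cell_hcomp (\<lambda>m. m) lax_comp\<rparr>"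

text \<open>A morphism \<open>(F, \<alpha>; \<phi>)\<close> of tangent pairs is the pair of \<open>(F, \<alpha>)\<close> and \<open>\<phi>\<close>.\<close>

type_synonym 'b pairmor = "'b laxmor \<times> 'b univ"

definition is_pairmor :: "'b choice \<Rightarrow> 'b pairmor \<Rightarrow> bool" where
  "is_pairmor pb M \<longleftrightarrow>
     (case M of (m, \<phi>) \<Rightarrow>
        tangent_pair pb (lsrc m) \<and> tangent_pair pb (ltrg m) \<and> is_laxmor m \<and>
        \<phi> \<in> Hom (lcat (ltrg m)) (omap (lfun m) (snd (lsrc m))) (snd (ltrg m)))"

definition pair_id :: "'b ptng \<Rightarrow> 'b pairmor" where
  "pair_id P = (lax_id P, Id (lcat P) (snd P))"

definition pair_comp :: "'b pairmor \<Rightarrow> 'b pairmor \<Rightarrow> 'b pairmor" where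
  "pair_comp N M =
     (lax_comp (fst N) (fst M), snd N \<cdot>\<^bsub>lcat (ltrg (fst N))\<^esub> amap (lfun (fst N)) (snd M))"

text \<open>
  A 2-cell \<open>(F, \<alpha>; \<phi>) \<Rightarrow> (G, \<beta>; \<psi>)\<close> of tangent pairs over \<open>A\<close> and \<open>B\<close> is a transformation \<open>\<gamma>\<close>
  compatible with the distributive laws such that \<open>\<psi> \<circ> \<gamma>\<^sub>A = \<phi>\<close>.
\<close>

definition TngPair :: "'b choice \<Rightarrow> ('b ptng, 'b pairmor, ('b, 'b pairmor) cell) cat2" where
  "TngPair pb =
     \<lparr>Obj = {P. tangent_pair pb P},
      Arr = {M. is_pairmor pb M},
      Dom = (\<lambda>M. lsrc (fst M)), Cod = (\<lambda>M. ltrg (fst M)), Id = pair_id, Comp = pair_comp,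
      Cell = {x. is_pairmor pb (csrc x) \<and> is_pairmor pb (ctrg x) \<and>
                 is_lax_transformation (fst (csrc x)) (fst (ctrg x)) (ccomp x) \<and>
                 snd (ctrg x) \<cdot>\<^bsub>lcat (ltrg (fst (csrc x)))\<^esub> ccomp x (snd (lsrc (fst (csrc x))))
                   = snd (csrc x)},
      Src = csrc, Trg = ctrg, VId = cell_id fst, VComp = cell_vcomp fst,
      HComp = cell_hcomp fst pair_comp\<rparr>"

section \<open>Term and Slice\<close>

definition term_mor :: "'b laxmor \<Rightarrow> 'b pairmor" where
  "term_mor m = (m, bang (lcat (ltrg m)) (snd (ltrg m)) (omap (lfun m) (snd (lsrc m))))"

definition Term ::
  "('b ptng, 'b laxmor, ('b, 'b laxmor) cell, 'b ptng, 'b pairmor, ('b, 'b pairmor) cell) fctr2" where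
  "Term =
     \<lparr>omap = (\<lambda>P. P),
      amap = term_mor,
      cmap = (\<lambda>x. \<lparr>csrc = term_mor (csrc x), ctrg = term_mor (ctrg x), ccomp = ccomp x\<rparr>)\<rparr>"

definition slice_obj :: "'b choice \<Rightarrow> 'b ptng \<Rightarrow> 'b ptng" where
  "slice_obj pb P = (case P of (X, A) \<Rightarrow> (slice_tng pb X A, Id (Cat X) A))"

definition slice_omap :: "'b pairmor \<Rightarrow> 'b univ \<Rightarrow> 'b univ" where
  "slice_omap M f = snd M \<cdot>\<^bsub>lcat (ltrg (fst M))\<^esub> amap (lfun (fst M)) f"

definition slice_mor :: "'b choice \<Rightarrow> 'b pairmor \<Rightarrow> 'b laxmor" where
  "slice_mor pb M =
     (let m = fst M; X = fst (lsrc m); A = snd (lsrc m); X' = fst (ltrg m); B = snd (ltrg m);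
          S = slice_cat (Cat X) A
      in \<lparr>lsrc = slice_obj pb (lsrc m), ltrg = slice_obj pb (ltrg m),
          lfun = \<lparr>omap = (\<lambda>f\<in>Obj S. slice_omap M f),
                  amap = (\<lambda>g\<in>Arr S. Tri (slice_omap M (tsrc g)) (amap (lfun m) (tmap g))
                                        (slice_omap M (ttrg g)))\<rparr>,
          ldist = (\<lambda>f\<in>Obj S.
            Tri (slice_omap M (sliceTO pb X A f))
                (into pb X' B (slice_omap M f)
                   (ldist m (Dom (Cat X) f) \<cdot>\<^bsub>Cat X'\<^esub> amap (lfun m) (vert pb X A f)))
                (sliceTO pb X' B (slice_omap M f)))\<rparr>)"

definition slice_cell :: "'b choice \<Rightarrow> ('b, 'b pairmor) cell \<Rightarrow> ('b, 'b laxmor) cell" where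
  "slice_cell pb x =
     (let P = lsrc (fst (csrc x))
      in \<lparr>csrc = slice_mor pb (csrc x), ctrg = slice_mor pb (ctrg x),
          ccomp = (\<lambda>f\<in>Obj (slice_cat (lcat P) (snd P)).
            Tri (slice_omap (csrc x) f) (ccomp x (Dom (lcat P) f)) (slice_omap (ctrg x) f))\<rparr>)"

definition Slice ::
  "'b choice \<Rightarrow>
   ('b ptng, 'b pairmor, ('b, 'b pairmor) cell, 'b ptng, 'b laxmor, ('b, 'b laxmor) cell) fctr2" where
  "Slice pb = \<lparr>omap = slice_obj pb, amap = slice_mor pb, cmap = slice_cell pb\<rparr>"

text \<open>
  With \<open>t\<close> terminal, the object \<open>T\<^sup>t (A \<rightarrow> t)\<close> of the slice is identified with \<open>T A \<rightarrow> t\<close> along the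
  isomorphism \<open>v\<close>, so the identity of \<open>T A\<close> becomes the map whose composite with \<open>v\<close> is \<open>id\<close>.
\<close>

definition adj_unit :: "'b choice \<Rightarrow> 'b ptng \<Rightarrow> 'b laxmor" where
  "adj_unit pb P =
     (let X = fst P; t = snd P; C = Cat X; U = bang C t
      in \<lparr>lsrc = P, ltrg = slice_obj pb P,
          lfun = \<lparr>omap = (\<lambda>a\<in>Obj C. U a),
                  amap = (\<lambda>f\<in>Arr C. Tri (U (Dom C f)) f (U (Cod C f)))\<rparr>,
          ldist = (\<lambda>a\<in>Obj C. Tri (U (TO X a)) (into pb X t (U a) (Id C (TO X a)))
                                 (sliceTO pb X t (U a)))\<rparr>)"

definition adj_counit :: "'b choice \<Rightarrow> 'b ptng \<Rightarrow> 'b pairmor" where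
  "adj_counit pb P =
     (let X = fst P; A = snd P; C = Cat X; S = slice_cat C A
      in (\<lparr>lsrc = slice_obj pb P, ltrg = P,
           lfun = \<lparr>omap = (\<lambda>f\<in>Obj S. Dom C f), amap = (\<lambda>g\<in>Arr S. tmap g)\<rparr>,
           ldist = (\<lambda>f\<in>Obj S. vert pb X A f)\<rparr>,
          Id C A))"

end

theory Submission
  imports Defs
begin

text \<open>
  Maps from \<open>w\<close> to the \<open>m\<close>-fold slice tangent bundle of \<open>f : E \<rightarrow> A\<close> correspond, by composition with
  the iterated \<open>v\<close>, to the maps \<open>h\<close> from the domain of \<open>w\<close> to \<open>T\<^sup>m E\<close> with \<open>T\<^sup>m f \<circ> h = z\<^sup>m \<circ> w\<close>,
  where \<open>z\<^sup>m : A \<rightarrow> T\<^sup>m A\<close> is the iterated zero. Equations in the slice may therefore be tested after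
  composing with the iterated \<open>v\<close>, where they become equations in \<open>X\<close>, and the pullback expressing
  universality of the lift is obtained from the one in \<open>X\<close>. The distributive laws of the slice
  functors, naturality and the triangle identities are tested in the same way. When \<open>A\<close> is
  terminal, so are all \<open>T\<^sup>m A\<close> and the condition on \<open>h\<close> is void; the counit is then inverse to
  the unit.
\<close>

section \<open>Categories and pullbacks\<close>

text \<open>Every power \<open>T^m\<close> has to be treated, not only the \<open>T\<close>,
  \<open>T^2\<close> and \<open>T^3\<close> of the axioms, because the pullbacks of a tangent
  structure must be preserved by all powers of the slice functor. The iterated \<open>v\<close> is
  monic because \<open>z_A\<close> is split by \<open>p\<close>, and \<open>T^m\<close> keeps this
  splitting. The hard point is universality of the lift: the pullback in \<open>X\<close> yields a
  map into \<open>T^m (T_2 E)\<close>, and its two components must be placed over the zero section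
  of \<open>A\<close>; universality of the lift at \<open>A\<close> itself achieves this. Fibre
  powers of the slice projection are part of a tangent pair, but over a terminal object they have to
  be derived, as otherwise \<open>Term\<close> would not land in tangent pairs. Hence the slice is
  first developed without them. Since the pullbacks are chosen once and for all, functoriality of
  \<open>Slice\<close>, naturality and the triangle identities are equations between 1-cells,
  checked on components. Both 2-categories are instances of one construction.\<close>

lemma Hom_iff [simp]: "f \<in> Hom C a b \<longleftrightarrow> f \<in> Arr C \<and> Dom C f = a \<and> Cod C f = b"
  by (auto simp: Hom_def)

context
  fixes C :: "('o, 'a, 'm) cat_scheme" (structure)
  assumes cat: "category C"
begin

lemma Dom_Obj [simp]: "f \<in> Arr C \<Longrightarrow> Dom C f \<in> Obj C"
  and Cod_Obj [simp]: "f \<in> Arr C \<Longrightarrow> Cod C f \<in> Obj C"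
  and Id_Arr [simp]: "a \<in> Obj C \<Longrightarrow> Id C a \<in> Arr C"
  and Dom_Id [simp]: "a \<in> Obj C \<Longrightarrow> Dom C (Id C a) = a"
  and Cod_Id [simp]: "a \<in> Obj C \<Longrightarrow> Cod C (Id C a) = a"
  and comp_Id [simp]: "f \<in> Arr C \<Longrightarrow> Dom C f = a \<Longrightarrow> f \<cdot> Id C a = f"
  and Id_comp [simp]: "f \<in> Arr C \<Longrightarrow> Cod C f = a \<Longrightarrow> Id C a \<cdot> f = f"
  using cat by (auto simp: category_def)

lemma comp_Arr [simp]: "f \<in> Arr C \<Longrightarrow> g \<in> Arr C \<Longrightarrow> Cod C f = Dom C g \<Longrightarrow> g \<cdot> f \<in> Arr C"
  and Dom_comp [simp]: "f \<in> Arr C \<Longrightarrow> g \<in> Arr C \<Longrightarrow> Cod C f = Dom C g \<Longrightarrow> Dom C (g \<cdot> f) = Dom C f"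
  and Cod_comp [simp]: "f \<in> Arr C \<Longrightarrow> g \<in> Arr C \<Longrightarrow> Cod C f = Dom C g \<Longrightarrow> Cod C (g \<cdot> f) = Cod C g"
  using cat by (auto simp: category_def)

lemma comp_assoc [simp]:
  "f \<in> Arr C \<Longrightarrow> g \<in> Arr C \<Longrightarrow> h \<in> Arr C \<Longrightarrow> Cod C f = Dom C g \<Longrightarrow> Cod C g = Dom C h \<Longrightarrow>
    (h \<cdot> g) \<cdot> f = h \<cdot> g \<cdot> f"
  using cat by (auto simp: category_def)

text \<open>\<open>comp_assoc\<close> brackets composites to the right, so an equation
  \<open>a \<cdot> b = c\<close> no longer matches inside a longer composite. Attaching a tail
  \<open>x\<close> makes it a rewrite rule again; \<open>reassoc3\<close> does this for three
  factors.\<close>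

lemma reassoc:
  "a \<cdot> b = c \<Longrightarrow> a \<in> Arr C \<Longrightarrow> b \<in> Arr C \<Longrightarrow> x \<in> Arr C \<Longrightarrow> Cod C b = Dom C a \<Longrightarrow>
    Cod C x = Dom C b \<Longrightarrow> a \<cdot> b \<cdot> x = c \<cdot> x"
  by (metis comp_assoc)

lemma reassoc3:
  "a \<cdot> b \<cdot> b' = c \<Longrightarrow> a \<in> Arr C \<Longrightarrow> b \<in> Arr C \<Longrightarrow> b' \<in> Arr C \<Longrightarrow> x \<in> Arr C \<Longrightarrow> Cod C b = Dom C a \<Longrightarrow>
    Cod C b' = Dom C b \<Longrightarrow> Cod C x = Dom C b' \<Longrightarrow> a \<cdot> b \<cdot> b' \<cdot> x = c \<cdot> x"
  by (metis comp_assoc comp_Arr Dom_comp Cod_comp)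

end

section \<open>Pullbacks: joint monicity, pairing, comparison of two pullbacks of one cospan\<close>

lemma pullbackI:
  assumes "f \<in> Arr C" "g \<in> Arr C" "Cod C f = Cod C g"
    "q1 \<in> Hom C (Dom C q1) (Dom C f)" "q2 \<in> Hom C (Dom C q1) (Dom C g)" "f \<cdot>\<^bsub>C\<^esub> q1 = g \<cdot>\<^bsub>C\<^esub> q2"
    "\<And>w h1 h2. h1 \<in> Hom C w (Dom C f) \<Longrightarrow> h2 \<in> Hom C w (Dom C g) \<Longrightarrow> f \<cdot>\<^bsub>C\<^esub> h1 = g \<cdot>\<^bsub>C\<^esub> h2 \<Longrightarrow>
       \<exists>k. k \<in> Hom C w (Dom C q1) \<and> q1 \<cdot>\<^bsub>C\<^esub> k = h1 \<and> q2 \<cdot>\<^bsub>C\<^esub> k = h2"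
    "\<And>w k k'. k \<in> Hom C w (Dom C q1) \<Longrightarrow> k' \<in> Hom C w (Dom C q1) \<Longrightarrow>
       q1 \<cdot>\<^bsub>C\<^esub> k = q1 \<cdot>\<^bsub>C\<^esub> k' \<Longrightarrow> q2 \<cdot>\<^bsub>C\<^esub> k = q2 \<cdot>\<^bsub>C\<^esub> k' \<Longrightarrow> k = k'"
  shows "is_pullback C f g q1 q2"
  unfolding is_pullback_def
proof (intro conjI allI impI)
  fix w h1 h2
  assume h: "h1 \<in> Hom C w (Dom C f)" "h2 \<in> Hom C w (Dom C g)" "f \<cdot>\<^bsub>C\<^esub> h1 = g \<cdot>\<^bsub>C\<^esub> h2"
  obtain k where k: "k \<in> Hom C w (Dom C q1) \<and> q1 \<cdot>\<^bsub>C\<^esub> k = h1 \<and> q2 \<cdot>\<^bsub>C\<^esub> k = h2"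
    using assms(7)[OF h] by blast
  show "\<exists>!k. k \<in> Hom C w (Dom C q1) \<and> q1 \<cdot>\<^bsub>C\<^esub> k = h1 \<and> q2 \<cdot>\<^bsub>C\<^esub> k = h2"
    using k assms(8) by metis
qed (use assms in auto)

lemma pullbackD:
  assumes "is_pullback C f g q1 q2"
  shows "f \<in> Arr C" "g \<in> Arr C" "q1 \<in> Arr C" "q2 \<in> Arr C" "Cod C q1 = Dom C f" "Cod C q2 = Dom C g"
    "Dom C q2 = Dom C q1" "Cod C f = Cod C g" "f \<cdot>\<^bsub>C\<^esub> q1 = g \<cdot>\<^bsub>C\<^esub> q2"
  using assms by (auto simp: is_pullback_def)

lemma pullback_cone:
  assumes "is_pullback C f g q1 q2" "h1 \<in> Hom C w (Dom C f)" "h2 \<in> Hom C w (Dom C g)" "f \<cdot>\<^bsub>C\<^esub> h1 = g \<cdot>\<^bsub>C\<^esub> h2"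
  shows "\<exists>!k. k \<in> Hom C w (Dom C q1) \<and> q1 \<cdot>\<^bsub>C\<^esub> k = h1 \<and> q2 \<cdot>\<^bsub>C\<^esub> k = h2"
  using assms unfolding is_pullback_def by blast

lemma pullback_obtain:
  assumes "is_pullback C f g q1 q2" "h1 \<in> Hom C w (Dom C f)" "h2 \<in> Hom C w (Dom C g)" "f \<cdot>\<^bsub>C\<^esub> h1 = g \<cdot>\<^bsub>C\<^esub> h2"
  obtains k where "k \<in> Hom C w (Dom C q1)" "q1 \<cdot>\<^bsub>C\<^esub> k = h1" "q2 \<cdot>\<^bsub>C\<^esub> k = h2"
  using pullback_cone[OF assms] by blast

context
  fixes C :: "('o, 'a, 'm) cat_scheme" (structure) and f g q1 q2
  assumes cat: "category C" and pb: "is_pullback C f g q1 q2"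
begin

text \<open>Both maps mediate the cone formed by \<open>q1 \<cdot> k\<close> and
  \<open>q2 \<cdot> k\<close>: the projections are jointly monic.\<close>

lemma pullback_unique:
  assumes k: "k \<in> Hom C w (Dom C q1)" "k' \<in> Hom C w (Dom C q1)"
    and e: "q1 \<cdot> k = q1 \<cdot> k'" "q2 \<cdot> k = q2 \<cdot> k'"
  shows "k = k'"
proof -
  note [simp] = pullbackD[OF pb] cat
  have sq: "f \<cdot> q1 \<cdot> k = g \<cdot> q2 \<cdot> k"
    using k reassoc[OF cat pullbackD(9)[OF pb], of k] by simp
  show ?thesis
    using pullback_cone[OF pb, of "q1 \<cdot> k" w "q2 \<cdot> k"] k e sq by (simp add: Ex1_def) metis
qed

lemma pairing_props:
  assumes "h1 \<in> Hom C w (Dom C f)" "h2 \<in> Hom C w (Dom C g)" "f \<cdot> h1 = g \<cdot> h2"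
  shows "pairing C q1 q2 h1 h2 \<in> Hom C w (Dom C q1)"
    "q1 \<cdot> pairing C q1 q2 h1 h2 = h1" "q2 \<cdot> pairing C q1 q2 h1 h2 = h2"
proof -
  have "Dom C h1 = w" using assms by simp
  then show "pairing C q1 q2 h1 h2 \<in> Hom C w (Dom C q1)"
    "q1 \<cdot> pairing C q1 q2 h1 h2 = h1" "q2 \<cdot> pairing C q1 q2 h1 h2 = h2"
    using theI'[OF pullback_cone[OF pb assms]] unfolding pairing_def by blast+
qed

lemma pairing_eqI:
  assumes "k \<in> Hom C w (Dom C q1)" "q1 \<cdot> k = h1" "q2 \<cdot> k = h2"
  shows "pairing C q1 q2 h1 h2 = k"
proof -
  note [simp] = pullbackD[OF pb] cat
  have sq: "f \<cdot> h1 = g \<cdot> h2"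
    using assms reassoc[OF cat pullbackD(9)[OF pb], of k] by auto
  show ?thesis
    by (rule pullback_unique[of _ w]) (use pairing_props[of h1 w h2] sq assms in auto)
qed

lemma pairing_comp:
  assumes "h1 \<in> Hom C w (Dom C f)" "h2 \<in> Hom C w (Dom C g)" "f \<cdot> h1 = g \<cdot> h2" "k \<in> Hom C w' w"
  shows "pairing C q1 q2 h1 h2 \<cdot> k = pairing C q1 q2 (h1 \<cdot> k) (h2 \<cdot> k)"
proof -
  note [simp] = pullbackD[OF pb] cat
  show ?thesis
    by (rule pairing_eqI[of _ w', symmetric])
      (use pairing_props[OF assms(1-3)] assms(4)
        reassoc[OF cat pairing_props(2)[OF assms(1-3)], of k]
        reassoc[OF cat pairing_props(3)[OF assms(1-3)], of k] in simp_all)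
qed

text \<open>The inverse \<open>k'\<close> is a parameter rather than hidden in
  \<open>is_iso\<close>, so that the lemma applies directly to the images of both maps under a power
  of the tangent functor.\<close>

lemma pullback_iso:
  assumes k: "k \<in> Hom C d (Dom C q1)" "k' \<in> Hom C (Dom C q1) d" "k \<cdot> k' = Id C (Dom C q1)" "k' \<cdot> k = Id C d"
  shows "is_pullback C f g (q1 \<cdot> k) (q2 \<cdot> k)"
proof (rule pullbackI)
  note [simp] = pullbackD[OF pb] cat
  have [simp]: "k \<cdot> k' \<cdot> x = x" if "x \<in> Arr C" "Cod C x = Dom C q1" for x
    using reassoc[OF cat k(3), of x] that k by auto
  show "f \<cdot> q1 \<cdot> k = g \<cdot> q2 \<cdot> k"
    using reassoc[OF cat pullbackD(9)[OF pb], of k] k by auto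
  show "\<exists>x. x \<in> Hom C w (Dom C (q1 \<cdot> k)) \<and> (q1 \<cdot> k) \<cdot> x = h1 \<and> (q2 \<cdot> k) \<cdot> x = h2"
    if h: "h1 \<in> Hom C w (Dom C f)" "h2 \<in> Hom C w (Dom C g)" "f \<cdot> h1 = g \<cdot> h2" for w h1 h2
  proof -
    obtain x where "x \<in> Hom C w (Dom C q1)" "q1 \<cdot> x = h1" "q2 \<cdot> x = h2"
      by (rule pullback_obtain[OF pb h])
    then show ?thesis using k(1,2) by (intro exI[of _ "k' \<cdot> x"]) simp
  qed
  show "x = x'" if "x \<in> Hom C w (Dom C (q1 \<cdot> k))" "x' \<in> Hom C w (Dom C (q1 \<cdot> k))"
    "(q1 \<cdot> k) \<cdot> x = (q1 \<cdot> k) \<cdot> x'" "(q2 \<cdot> k) \<cdot> x = (q2 \<cdot> k) \<cdot> x'" for w x x'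
  proof -
    have "k \<cdot> x = k \<cdot> x'"
      by (rule pullback_unique[of _ w]) (use that k in auto)
    moreover have "k' \<cdot> k \<cdot> x = x" "k' \<cdot> k \<cdot> x' = x'"
      using that k reassoc[OF cat k(4)] by simp_all
    ultimately show ?thesis by metis
  qed
qed (use k pullbackD[OF pb] cat in auto)

end

text \<open>The two mediating maps compose to identities by joint monicity on either side. This is
  what makes preservation by \<open>T\<close> independent of the pullback that was chosen.\<close>

lemma pullback_iso_exists:
  assumes cat: "category C" and q: "is_pullback C f g q1 q2" and r: "is_pullback C f g r1 r2"
  obtains k k' where "k \<in> Hom C (Dom C r1) (Dom C q1)" "k' \<in> Hom C (Dom C q1) (Dom C r1)"
    "k \<cdot>\<^bsub>C\<^esub> k' = Id C (Dom C q1)" "k' \<cdot>\<^bsub>C\<^esub> k = Id C (Dom C r1)" "q1 \<cdot>\<^bsub>C\<^esub> k = r1" "q2 \<cdot>\<^bsub>C\<^esub> k = r2"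
proof -
  note [simp] = pullbackD[OF q] pullbackD[OF r] cat
  obtain k where k: "k \<in> Hom C (Dom C r1) (Dom C q1)" "q1 \<cdot>\<^bsub>C\<^esub> k = r1" "q2 \<cdot>\<^bsub>C\<^esub> k = r2"
    using pullback_obtain[OF q, of r1 "Dom C r1" r2] by auto
  obtain k' where k': "k' \<in> Hom C (Dom C q1) (Dom C r1)" "r1 \<cdot>\<^bsub>C\<^esub> k' = q1" "r2 \<cdot>\<^bsub>C\<^esub> k' = q2"
    using pullback_obtain[OF r, of q1 "Dom C q1" q2] by auto
  note [simp] = reassoc[OF cat k(2)] reassoc[OF cat k(3)] reassoc[OF cat k'(2)] reassoc[OF cat k'(3)]
  have "k \<cdot>\<^bsub>C\<^esub> k' = Id C (Dom C q1)"
    by (rule pullback_unique[OF cat q, of _ "Dom C q1"]) (use k k' in simp_all)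
  moreover have "k' \<cdot>\<^bsub>C\<^esub> k = Id C (Dom C r1)"
    by (rule pullback_unique[OF cat r, of _ "Dom C r1"]) (use k k' in simp_all)
  ultimately show thesis using that k k' by blast
qed

text \<open>For two factors \<open>u\<close> is recovered as \<open>f \<cdot> q 0\<close>, so a pair
  of maps equalised by \<open>f\<close> determines a cone over the fibre power. This turns the
  powers assumed for a slice into its \<open>T_2\<close>.\<close>

lemma fibre_power_2_pullback:
  assumes "is_fibre_power C 2 f u q" and cat: "category C"
  shows "is_pullback C f f (q 0) (q 1)"
proof -
  have u: "f \<in> Arr C" "u \<in> Arr C" "Cod C u = Cod C f"
    and q: "\<And>i. i < 2 \<Longrightarrow> q i \<in> Hom C (Dom C u) (Dom C f) \<and> f \<cdot>\<^bsub>C\<^esub> q i = u"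
    and ex: "\<And>w v h. v \<in> Hom C w (Cod C f) \<Longrightarrow>
      (\<forall>i<2. h i \<in> Hom C w (Dom C f) \<and> f \<cdot>\<^bsub>C\<^esub> h i = v) \<Longrightarrow>
      \<exists>!k. k \<in> Hom C w (Dom C u) \<and> u \<cdot>\<^bsub>C\<^esub> k = v \<and> (\<forall>i<2. q i \<cdot>\<^bsub>C\<^esub> k = h i)"
    using assms(1) unfolding is_fibre_power_def by auto
  have q01: "q 0 \<in> Arr C" "Dom C (q 0) = Dom C u" "Cod C (q 0) = Dom C f" "f \<cdot>\<^bsub>C\<^esub> q 0 = u"
    "q 1 \<in> Arr C" "Dom C (q 1) = Dom C u" "Cod C (q 1) = Dom C f" "f \<cdot>\<^bsub>C\<^esub> q 1 = u"
    using q[of 0] q[of 1] by auto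
  have two: "(\<forall>i<2. P i) \<longleftrightarrow> P 0 \<and> P (1::nat)" for P
    by (auto simp: less_2_cases_iff)
  show ?thesis
  proof (rule pullbackI)
    fix w h1 h2
    assume h: "h1 \<in> Hom C w (Dom C f)" "h2 \<in> Hom C w (Dom C f)" "f \<cdot>\<^bsub>C\<^esub> h1 = f \<cdot>\<^bsub>C\<^esub> h2"
    have "\<exists>!k. k \<in> Hom C w (Dom C u) \<and> u \<cdot>\<^bsub>C\<^esub> k = f \<cdot>\<^bsub>C\<^esub> h1 \<and>
      (\<forall>i<2. q i \<cdot>\<^bsub>C\<^esub> k = (\<lambda>i. if i = 0 then h1 else h2) i)"
      using h u cat by (intro ex) (auto simp: two)
    then show "\<exists>k. k \<in> Hom C w (Dom C (q 0)) \<and> q 0 \<cdot>\<^bsub>C\<^esub> k = h1 \<and> q 1 \<cdot>\<^bsub>C\<^esub> k = h2"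
      using q01 by (auto simp: two)
  next
    fix w k k'
    assume k: "k \<in> Hom C w (Dom C (q 0))" "k' \<in> Hom C w (Dom C (q 0))"
      "q 0 \<cdot>\<^bsub>C\<^esub> k = q 0 \<cdot>\<^bsub>C\<^esub> k'" "q 1 \<cdot>\<^bsub>C\<^esub> k = q 1 \<cdot>\<^bsub>C\<^esub> k'"
    have f0: "f \<cdot>\<^bsub>C\<^esub> q 0 \<cdot>\<^bsub>C\<^esub> x = u \<cdot>\<^bsub>C\<^esub> x" if "x \<in> Hom C w (Dom C u)" for x
      using reassoc[OF cat q01(4), of x] that q01 u by auto
    have f1: "f \<cdot>\<^bsub>C\<^esub> q 1 \<cdot>\<^bsub>C\<^esub> x = u \<cdot>\<^bsub>C\<^esub> x" if "x \<in> Hom C w (Dom C u)" for x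
      using reassoc[OF cat q01(8), of x] that q01 u by auto
    have "u \<cdot>\<^bsub>C\<^esub> k = u \<cdot>\<^bsub>C\<^esub> k'"
      using f0[of k] f0[of k'] k q01 by auto
    moreover have "\<exists>!x. x \<in> Hom C w (Dom C u) \<and> u \<cdot>\<^bsub>C\<^esub> x = u \<cdot>\<^bsub>C\<^esub> k \<and>
      (\<forall>i<2. q i \<cdot>\<^bsub>C\<^esub> x = q i \<cdot>\<^bsub>C\<^esub> k)"
      using k q01 u cat f0[of k] f1[of k] by (intro ex) (auto simp: two)
    ultimately show "k = k'" using k q01 unfolding two by auto
  qed (use u q01 in auto)
qed

section \<open>Functors\<close>

locale fctr_between =
  fixes C :: "('o, 'a, 'm) cat_scheme" and D :: "('p, 'b, 'n) cat_scheme"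
    and F :: "('o, 'a, 'p, 'b, 'k) fctr_scheme"
  assumes fctr: "is_functor C D F"
begin

lemma cats [simp]: "category C" "category D"
  using fctr by (auto simp: is_functor_def)

lemma omap_Obj [simp]: "a \<in> Obj C \<Longrightarrow> omap F a \<in> Obj D"
  and amap_Arr [simp]: "f \<in> Arr C \<Longrightarrow> amap F f \<in> Arr D"
  and Dom_amap [simp]: "f \<in> Arr C \<Longrightarrow> Dom D (amap F f) = omap F (Dom C f)"
  and Cod_amap [simp]: "f \<in> Arr C \<Longrightarrow> Cod D (amap F f) = omap F (Cod C f)"
  and amap_Id [simp]: "a \<in> Obj C \<Longrightarrow> amap F (Id C a) = Id D (omap F a)"
  and amap_comp [simp]: "f \<in> Arr C \<Longrightarrow> g \<in> Arr C \<Longrightarrow> Cod C f = Dom C g \<Longrightarrow>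
    amap F (g \<cdot>\<^bsub>C\<^esub> f) = amap F g \<cdot>\<^bsub>D\<^esub> amap F f"
  using fctr by (auto simp: is_functor_def)

end

text \<open>Functoriality is separated from the tangent axioms because the facts on powers and on
  preserved pullbacks are needed for the slice functor before the slice is known to be a tangent
  category.\<close>

locale tangent_endo =
  fixes X :: "('o, 'a) tngcat"
  assumes tangent_endo: "is_functor (Cat X) (Cat X) (TanF X)"
begin

sublocale fctr_between "Cat X" "Cat X" "TanF X" by standard (rule tangent_endo)

lemma pow_Obj [simp]: "a \<in> Obj (Cat X) \<Longrightarrow> (TO X ^^ m) a \<in> Obj (Cat X)"
  by (induction m) auto

lemma pow_typing:
  "f \<in> Arr (Cat X) \<Longrightarrow> (TA X ^^ m) f \<in> Arr (Cat X) \<and>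
    Dom (Cat X) ((TA X ^^ m) f) = (TO X ^^ m) (Dom (Cat X) f) \<and>
    Cod (Cat X) ((TA X ^^ m) f) = (TO X ^^ m) (Cod (Cat X) f)"
  by (induction m) auto

lemma pow_Arr [simp]: "f \<in> Arr (Cat X) \<Longrightarrow> (TA X ^^ m) f \<in> Arr (Cat X)"
  and Dom_pow [simp]: "f \<in> Arr (Cat X) \<Longrightarrow> Dom (Cat X) ((TA X ^^ m) f) = (TO X ^^ m) (Dom (Cat X) f)"
  and Cod_pow [simp]: "f \<in> Arr (Cat X) \<Longrightarrow> Cod (Cat X) ((TA X ^^ m) f) = (TO X ^^ m) (Cod (Cat X) f)"
  using pow_typing by auto

lemma pow_Id [simp]: "a \<in> Obj (Cat X) \<Longrightarrow> (TA X ^^ m) (Id (Cat X) a) = Id (Cat X) ((TO X ^^ m) a)"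
  by (induction m) auto

lemma pow_comp [simp]: "f \<in> Arr (Cat X) \<Longrightarrow> g \<in> Arr (Cat X) \<Longrightarrow> Cod (Cat X) f = Dom (Cat X) g \<Longrightarrow>
    (TA X ^^ m) (g \<cdot>\<^bsub>Cat X\<^esub> f) = (TA X ^^ m) g \<cdot>\<^bsub>Cat X\<^esub> (TA X ^^ m) f"
  by (induction m) auto

lemma T_pullback_pow:
  "T_pullback X f g q1 q2 \<Longrightarrow>
    is_pullback (Cat X) ((TA X ^^ m) f) ((TA X ^^ m) g) ((TA X ^^ m) q1) ((TA X ^^ m) q2)"
  by (auto simp: T_pullback_def)

lemma T_pullback_pullback: "T_pullback X f g q1 q2 \<Longrightarrow> is_pullback (Cat X) f g q1 q2"
  using T_pullback_pow[where m = 0] by auto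

text \<open>One application of \<open>T\<close> only shifts the exponent, since
  \<open>T^m (T f)\<close> is \<open>T^(m+1) f\<close>.\<close>

lemma T_pullback_TA: "T_pullback X f g q1 q2 \<Longrightarrow> T_pullback X (TA X f) (TA X g) (TA X q1) (TA X q2)"
  unfolding T_pullback_def using funpow_swap1[of "TA X"] by (metis funpow.simps(2) comp_apply)

text \<open>Preservation by all powers is a property of the cospan: the comparison isomorphism
  \<open>k\<close> stays invertible under each power, so \<open>pullback_iso\<close> transports the
  image cones. A square preserved by assumption may thus be exchanged for the chosen one.\<close>

lemma T_pullback_transfer:
  assumes q: "T_pullback X f g q1 q2" and r: "is_pullback (Cat X) f g r1 r2"
  shows "T_pullback X f g r1 r2"
proof -
  have pb: "is_pullback (Cat X) f g q1 q2"
    by (rule T_pullback_pullback[OF q])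
  note [simp] = pullbackD[OF pb] pullbackD[OF r]
  obtain k k' where k: "k \<in> Hom (Cat X) (Dom (Cat X) r1) (Dom (Cat X) q1)"
      "k' \<in> Hom (Cat X) (Dom (Cat X) q1) (Dom (Cat X) r1)"
      "k \<cdot>\<^bsub>Cat X\<^esub> k' = Id (Cat X) (Dom (Cat X) q1)" "k' \<cdot>\<^bsub>Cat X\<^esub> k = Id (Cat X) (Dom (Cat X) r1)"
    and e: "q1 \<cdot>\<^bsub>Cat X\<^esub> k = r1" "q2 \<cdot>\<^bsub>Cat X\<^esub> k = r2"
    by (rule pullback_iso_exists[OF cats(1) pb r])
  show ?thesis
    unfolding T_pullback_def
  proof
    fix m
    have "is_pullback (Cat X) ((TA X ^^ m) f) ((TA X ^^ m) g)
      ((TA X ^^ m) q1 \<cdot>\<^bsub>Cat X\<^esub> (TA X ^^ m) k) ((TA X ^^ m) q2 \<cdot>\<^bsub>Cat X\<^esub> (TA X ^^ m) k)"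
      using k by (intro pullback_iso[OF cats(1) T_pullback_pow[OF q],
          where k' = "(TA X ^^ m) k'" and d = "(TO X ^^ m) (Dom (Cat X) r1)"])
        (auto simp flip: pow_comp)
    then show "is_pullback (Cat X) ((TA X ^^ m) f) ((TA X ^^ m) g) ((TA X ^^ m) r1) ((TA X ^^ m) r2)"
      using k by (simp flip: pow_comp add: e)
  qed
qed

end

section \<open>Tangent categories\<close>

text \<open>The fibrewise sum of two maps into \<open>T a\<close> with equal projections. The bundle
  axioms become equations between such generalised elements, so calculations on \<open>T_2\<close>
  itself are mostly avoided.\<close>

definition plus_T :: "('o, 'a) tngcat \<Rightarrow> 'o \<Rightarrow> 'a \<Rightarrow> 'a \<Rightarrow> 'a" where
  "plus_T X a x y = sumT X a \<cdot>\<^bsub>Cat X\<^esub> pairing (Cat X) (pi1T X a) (pi2T X a) x y"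

text \<open>The sum of the bundle \<open>T p : T^2 a \<rightarrow> T a\<close>, to be distinguished
  from that of \<open>p_T\<close>, which is \<open>plus_T X (TO X a)\<close>. The canonical flip
  takes the first to the second.\<close>

definition Tplus_T :: "('o, 'a) tngcat \<Rightarrow> 'o \<Rightarrow> 'a \<Rightarrow> 'a \<Rightarrow> 'a" where
  "Tplus_T X a x y =
     TA X (sumT X a) \<cdot>\<^bsub>Cat X\<^esub> pairing (Cat X) (TA X (pi1T X a)) (TA X (pi2T X a)) x y"

locale tangent_cat = tangent_endo X for X :: "('o, 'a) tngcat" +
  assumes tangent_cat: "tangent_category X"
begin

abbreviation "C \<equiv> Cat X"
abbreviation comp (infixr "\<cdot>" 75) where "comp \<equiv> Comp (Cat X)"

lemma nat_trans_p: "nat_trans C C (TanF X) fid (projT X)"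
  and nat_trans_z: "nat_trans C C fid (TanF X) (zeroT X)"
  and powers: "has_T_powers C (TanF X) (projT X)"
  and T2_pullback: "a \<in> Obj C \<Longrightarrow> T_pullback X (projT X a) (projT X a) (pi1T X a) (pi2T X a)"
  and nat_trans_s: "nat_trans C C (T2 X) (TanF X) (sumT X)"
  and nat_trans_l: "nat_trans C C (TanF X) (fcomp (TanF X) (TanF X)) (liftT X)"
  and nat_trans_c: "nat_trans C C (fcomp (TanF X) (TanF X)) (fcomp (TanF X) (TanF X)) (flipT X)"
  and tangent_bundle_additive: "a \<in> Obj C \<Longrightarrow> additive_bundle C (tangent_bundle X a)"
  and bundle_l: "a \<in> Obj C \<Longrightarrow> additive_bundle_morphism C
      (tangent_bundle X a) (T_bundle X (tangent_bundle X a)) (liftT X a) (zeroT X a)"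
  and bundle_c: "a \<in> Obj C \<Longrightarrow> additive_bundle_morphism C
      (T_bundle X (tangent_bundle X a)) (tangent_bundle X (TO X a)) (flipT X a) (Id C (TO X a))"
  and flip_flip: "a \<in> Obj C \<Longrightarrow> flipT X a \<cdot> flipT X a = Id C (TO X (TO X a))"
  and flip_lift: "a \<in> Obj C \<Longrightarrow> flipT X a \<cdot> liftT X a = liftT X a"
  and lift_lift: "a \<in> Obj C \<Longrightarrow> TA X (liftT X a) \<cdot> liftT X a = liftT X (TO X a) \<cdot> liftT X a"
  and flip_braid: "a \<in> Obj C \<Longrightarrow> TA X (flipT X a) \<cdot> flipT X (TO X a) \<cdot> TA X (flipT X a) =
              flipT X (TO X a) \<cdot> TA X (flipT X a) \<cdot> flipT X (TO X a)"
  and flip_flip_lift: "a \<in> Obj C \<Longrightarrow> flipT X (TO X a) \<cdot> TA X (flipT X a) \<cdot> liftT X (TO X a) = TA X (liftT X a) \<cdot> flipT X a"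
  and universal': "a \<in> Obj C \<Longrightarrow> T_pullback X (TA X (projT X a)) (zeroT X a)
      (TA X (sumT X a) \<cdot> pairing C (TA X (pi1T X a)) (TA X (pi2T X a))
        (liftT X a \<cdot> pi1T X a) (zeroT X (TO X a) \<cdot> pi2T X a))
      (projT X a \<cdot> pi1T X a)"
  using tangent_cat by (simp_all add: tangent_category_def Let_def)

lemma p_typing [simp]:
  "a \<in> Obj C \<Longrightarrow> projT X a \<in> Arr C"
  "a \<in> Obj C \<Longrightarrow> Dom C (projT X a) = TO X a"
  "a \<in> Obj C \<Longrightarrow> Cod C (projT X a) = a"
  using nat_trans_p by (auto simp: nat_trans_def fid_def)

lemma z_typing [simp]:
  "a \<in> Obj C \<Longrightarrow> zeroT X a \<in> Arr C"
  "a \<in> Obj C \<Longrightarrow> Dom C (zeroT X a) = a"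
  "a \<in> Obj C \<Longrightarrow> Cod C (zeroT X a) = TO X a"
  using nat_trans_z by (auto simp: nat_trans_def fid_def)

lemma l_typing [simp]:
  "a \<in> Obj C \<Longrightarrow> liftT X a \<in> Arr C"
  "a \<in> Obj C \<Longrightarrow> Dom C (liftT X a) = TO X a"
  "a \<in> Obj C \<Longrightarrow> Cod C (liftT X a) = TO X (TO X a)"
  using nat_trans_l by (auto simp: nat_trans_def fcomp_def)

lemma c_typing [simp]:
  "a \<in> Obj C \<Longrightarrow> flipT X a \<in> Arr C"
  "a \<in> Obj C \<Longrightarrow> Dom C (flipT X a) = TO X (TO X a)"
  "a \<in> Obj C \<Longrightarrow> Cod C (flipT X a) = TO X (TO X a)"
  using nat_trans_c by (auto simp: nat_trans_def fcomp_def)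

lemma pi_typing [simp]:
  "a \<in> Obj C \<Longrightarrow> pi1T X a \<in> Arr C"
  "a \<in> Obj C \<Longrightarrow> Cod C (pi1T X a) = TO X a"
  "a \<in> Obj C \<Longrightarrow> pi2T X a \<in> Arr C"
  "a \<in> Obj C \<Longrightarrow> Dom C (pi2T X a) = Dom C (pi1T X a)"
  "a \<in> Obj C \<Longrightarrow> Cod C (pi2T X a) = TO X a"
  using pullbackD[OF T_pullback_pullback[OF T2_pullback]] by simp_all

lemma s_typing [simp]:
  "a \<in> Obj C \<Longrightarrow> sumT X a \<in> Arr C"
  "a \<in> Obj C \<Longrightarrow> Dom C (sumT X a) = Dom C (pi1T X a)"
  "a \<in> Obj C \<Longrightarrow> Cod C (sumT X a) = TO X a"
  using nat_trans_s by (auto simp: nat_trans_def T2_def)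

lemma p_nat: "f \<in> Arr C \<Longrightarrow> projT X (Cod C f) \<cdot> TA X f = f \<cdot> projT X (Dom C f)"
  using nat_trans_p by (auto simp: nat_trans_def fid_def)

lemma z_nat: "f \<in> Arr C \<Longrightarrow> zeroT X (Cod C f) \<cdot> f = TA X f \<cdot> zeroT X (Dom C f)"
  using nat_trans_z by (auto simp: nat_trans_def fid_def)

lemma l_nat: "f \<in> Arr C \<Longrightarrow> liftT X (Cod C f) \<cdot> TA X f = TA X (TA X f) \<cdot> liftT X (Dom C f)"
  using nat_trans_l by (auto simp: nat_trans_def fcomp_def)

lemma c_nat: "f \<in> Arr C \<Longrightarrow> flipT X (Cod C f) \<cdot> TA X (TA X f) = TA X (TA X f) \<cdot> flipT X (Dom C f)"
  using nat_trans_c by (auto simp: nat_trans_def fcomp_def)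

lemma s_nat: "f \<in> Arr C \<Longrightarrow> sumT X (Cod C f) \<cdot> amap (T2 X) f = TA X f \<cdot> sumT X (Dom C f)"
  using nat_trans_s by (auto simp: nat_trans_def)

lemma pi_eq: "a \<in> Obj C \<Longrightarrow> projT X a \<cdot> pi2T X a = projT X a \<cdot> pi1T X a"
  using pullbackD(9)[OF T_pullback_pullback[OF T2_pullback]] by simp

lemma proj_zero: "a \<in> Obj C \<Longrightarrow> projT X a \<cdot> zeroT X a = Id C a"
  and proj_sum: "a \<in> Obj C \<Longrightarrow> projT X a \<cdot> sumT X a = projT X a \<cdot> pi1T X a"
  using tangent_bundle_additive[of a] by (auto simp: additive_bundle_def Let_def tangent_bundle_def)

lemmas pair_comp = pairing_comp[OF cats(1) T_pullback_pullback[OF T2_pullback]]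
lemmas pair_eqI = pairing_eqI[OF cats(1) T_pullback_pullback[OF T2_pullback]]

lemma pair_props [simp]:
  assumes "a \<in> Obj C" "x \<in> Arr C" "Cod C x = TO X a" "y \<in> Arr C" "Cod C y = TO X a" "Dom C y = Dom C x"
    "projT X a \<cdot> x = projT X a \<cdot> y"
  shows "pairing C (pi1T X a) (pi2T X a) x y \<in> Arr C"
    "Dom C (pairing C (pi1T X a) (pi2T X a) x y) = Dom C x"
    "Cod C (pairing C (pi1T X a) (pi2T X a) x y) = Dom C (pi1T X a)"
    "pi1T X a \<cdot> pairing C (pi1T X a) (pi2T X a) x y = x"
    "pi2T X a \<cdot> pairing C (pi1T X a) (pi2T X a) x y = y"
  using pairing_props[OF cats(1) T_pullback_pullback[OF T2_pullback], of a x "Dom C x" y] assms by simp_all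

lemma Tpair_props [simp]:
  assumes "a \<in> Obj C" "x \<in> Arr C" "Cod C x = TO X (TO X a)" "y \<in> Arr C" "Cod C y = TO X (TO X a)"
    "Dom C y = Dom C x" "TA X (projT X a) \<cdot> x = TA X (projT X a) \<cdot> y"
  shows "pairing C (TA X (pi1T X a)) (TA X (pi2T X a)) x y \<in> Arr C"
    "Dom C (pairing C (TA X (pi1T X a)) (TA X (pi2T X a)) x y) = Dom C x"
    "Cod C (pairing C (TA X (pi1T X a)) (TA X (pi2T X a)) x y) = TO X (Dom C (pi1T X a))"
    "TA X (pi1T X a) \<cdot> pairing C (TA X (pi1T X a)) (TA X (pi2T X a)) x y = x"
    "TA X (pi2T X a) \<cdot> pairing C (TA X (pi1T X a)) (TA X (pi2T X a)) x y = y"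
  using pairing_props[OF cats(1) T_pullback_pullback[OF T_pullback_TA[OF T2_pullback]], of a x "Dom C x" y] assms
  by simp_all

lemma plus_typing [simp]:
  assumes "a \<in> Obj C" "x \<in> Arr C" "Cod C x = TO X a" "y \<in> Arr C" "Cod C y = TO X a" "Dom C y = Dom C x"
    "projT X a \<cdot> x = projT X a \<cdot> y"
  shows "plus_T X a x y \<in> Arr C" "Dom C (plus_T X a x y) = Dom C x" "Cod C (plus_T X a x y) = TO X a"
  using assms by (simp_all add: plus_T_def)

lemma Tplus_typing [simp]:
  assumes "a \<in> Obj C" "x \<in> Arr C" "Cod C x = TO X (TO X a)" "y \<in> Arr C" "Cod C y = TO X (TO X a)"
    "Dom C y = Dom C x" "TA X (projT X a) \<cdot> x = TA X (projT X a) \<cdot> y"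
  shows "Tplus_T X a x y \<in> Arr C" "Dom C (Tplus_T X a x y) = Dom C x"
    "Cod C (Tplus_T X a x y) = TO X (TO X a)"
  using assms by (simp_all add: Tplus_T_def)

lemma p_plus:
  assumes "a \<in> Obj C" "x \<in> Arr C" "Cod C x = TO X a" "y \<in> Arr C" "Cod C y = TO X a" "Dom C y = Dom C x"
    "projT X a \<cdot> x = projT X a \<cdot> y"
  shows "projT X a \<cdot> plus_T X a x y = projT X a \<cdot> x"
  using assms reassoc[OF cats(1) proj_sum[of a], of "pairing C (pi1T X a) (pi2T X a) x y"]
  by (simp add: plus_T_def)

lemma plus_comp:
  assumes "a \<in> Obj C" "x \<in> Arr C" "Cod C x = TO X a" "y \<in> Arr C" "Cod C y = TO X a" "Dom C y = Dom C x"
    "projT X a \<cdot> x = projT X a \<cdot> y" "k \<in> Arr C" "Cod C k = Dom C x"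
  shows "plus_T X a x y \<cdot> k = plus_T X a (x \<cdot> k) (y \<cdot> k)"
  using assms pair_comp[of a x "Dom C x" y k "Dom C k"] by (simp add: plus_T_def)

lemma Tplus_comp:
  assumes "a \<in> Obj C" "x \<in> Arr C" "Cod C x = TO X (TO X a)" "y \<in> Arr C" "Cod C y = TO X (TO X a)"
    "Dom C y = Dom C x" "TA X (projT X a) \<cdot> x = TA X (projT X a) \<cdot> y" "k \<in> Arr C" "Cod C k = Dom C x"
  shows "Tplus_T X a x y \<cdot> k = Tplus_T X a (x \<cdot> k) (y \<cdot> k)"
  using assms pairing_comp[OF cats(1) T_pullback_pullback[OF T_pullback_TA[OF T2_pullback]],
      of a x "Dom C x" y k "Dom C k"]
  by (simp add: Tplus_T_def)

lemma plus_pi: "a \<in> Obj C \<Longrightarrow> plus_T X a (pi1T X a) (pi2T X a) = sumT X a"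
  using pair_eqI[of a "Id C (Dom C (pi1T X a))" "Dom C (pi1T X a)" "pi1T X a" "pi2T X a"]
  by (simp add: plus_T_def)

lemma Tpi_eq: "a \<in> Obj C \<Longrightarrow> TA X (projT X a) \<cdot> TA X (pi2T X a) = TA X (projT X a) \<cdot> TA X (pi1T X a)"
  using pi_eq[of a, THEN arg_cong, of "TA X"] by simp

text \<open>\<open>T\<close> takes the pairing for \<open>p\<close> to the pairing for
  \<open>T p\<close>, because the square defining \<open>T_2\<close> is preserved.\<close>

lemma TA_plus:
  assumes "a \<in> Obj C" "x \<in> Arr C" "Cod C x = TO X a" "y \<in> Arr C" "Cod C y = TO X a" "Dom C y = Dom C x"
    "projT X a \<cdot> x = projT X a \<cdot> y"
  shows "TA X (plus_T X a x y) = Tplus_T X a (TA X x) (TA X y)"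
proof -
  let ?k = "pairing C (pi1T X a) (pi2T X a) x y"
  have "pairing C (TA X (pi1T X a)) (TA X (pi2T X a)) (TA X x) (TA X y) = TA X ?k"
    by (rule pairing_eqI[OF cats(1) T_pullback_pullback[OF T_pullback_TA[OF T2_pullback]], of a _ "TO X (Dom C x)"])
      (use assms amap_comp[of ?k "pi1T X a"] amap_comp[of ?k "pi2T X a"] in \<open>simp_all del: amap_comp\<close>)
  then show ?thesis using assms by (simp add: plus_T_def Tplus_T_def)
qed

text \<open>Naturality of the sum says that \<open>T f\<close> is additive on fibres; the pairing
  over the codomain absorbs the map \<open>T_2 f\<close>.\<close>

lemma plus_nat:
  assumes f: "f \<in> Arr C" "Dom C f = a"
    and "x \<in> Arr C" "Cod C x = TO X a" "y \<in> Arr C" "Cod C y = TO X a" "Dom C y = Dom C x"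
    "projT X a \<cdot> x = projT X a \<cdot> y"
  shows "TA X f \<cdot> plus_T X a x y = plus_T X (Cod C f) (TA X f \<cdot> x) (TA X f \<cdot> y)"
proof -
  have a: "a \<in> Obj C" using f cats by auto
  let ?k = "pairing C (pi1T X a) (pi2T X a) x y"
  have n: "projT X (Cod C f) \<cdot> TA X f \<cdot> u = f \<cdot> projT X a \<cdot> u" if "u \<in> Arr C" "Cod C u = TO X a" for u
    using reassoc[OF cats(1) p_nat[OF f(1)], of u] f that a by simp
  have "TA X f \<cdot> plus_T X a x y = sumT X (Cod C f) \<cdot> amap (T2 X) f \<cdot> ?k"
    using reassoc[OF cats(1) s_nat[OF f(1)], of ?k] reassoc[OF cats(1) s_nat[OF f(1), symmetric], of ?k] assms a
      n[of "pi1T X a"] n[of "pi2T X a"] pi_eq[OF a]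
    by (simp add: plus_T_def T2_def)
  also have "amap (T2 X) f \<cdot> ?k = pairing C (pi1T X (Cod C f)) (pi2T X (Cod C f)) (TA X f \<cdot> x) (TA X f \<cdot> y)"
    using pair_comp[of "Cod C f" "TA X f \<cdot> pi1T X a" "Dom C (pi1T X a)" "TA X f \<cdot> pi2T X a" ?k "Dom C x"]
      assms a n[of "pi1T X a"] n[of "pi2T X a"] pi_eq[OF a]
    by (simp add: T2_def)
  finally show ?thesis by (simp add: plus_T_def)
qed

text \<open>The bundle axiom is the generic case, on the two projections of \<open>T_2\<close>; its
  restriction along the pairing of \<open>x\<close> and \<open>y\<close> is the general one.\<close>

lemma plus_commute:
  assumes "a \<in> Obj C" "x \<in> Arr C" "Cod C x = TO X a" "y \<in> Arr C" "Cod C y = TO X a" "Dom C y = Dom C x"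
    "projT X a \<cdot> x = projT X a \<cdot> y"
  shows "plus_T X a x y = plus_T X a y x"
proof -
  have "plus_T X a (pi2T X a) (pi1T X a) = sumT X a"
    using tangent_bundle_additive[OF assms(1)] by (simp add: additive_bundle_def Let_def tangent_bundle_def plus_T_def)
  then have "plus_T X a x y = plus_T X a (pi2T X a) (pi1T X a) \<cdot> pairing C (pi1T X a) (pi2T X a) x y"
    by (simp add: plus_T_def)
  also have "\<dots> = plus_T X a y x"
    using assms by (subst plus_comp) (simp_all add: pi_eq)
  finally show ?thesis .
qed

lemma plus_zero:
  assumes "a \<in> Obj C" "x \<in> Arr C" "Cod C x = TO X a"
  shows "plus_T X a (zeroT X a \<cdot> projT X a \<cdot> x) x = x" "plus_T X a x (zeroT X a \<cdot> projT X a \<cdot> x) = x"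
proof -
  have e: "plus_T X a (zeroT X a \<cdot> projT X a) (Id C (TO X a)) = Id C (TO X a)"
    "plus_T X a (Id C (TO X a)) (zeroT X a \<cdot> projT X a) = Id C (TO X a)"
    using tangent_bundle_additive[OF assms(1)] assms(1) by (simp_all add: additive_bundle_def Let_def tangent_bundle_def plus_T_def)
  have pzp: "projT X a \<cdot> zeroT X a \<cdot> projT X a = projT X a"
    using reassoc[OF cats(1) proj_zero[of a], of "projT X a"] assms by simp
  show "plus_T X a (zeroT X a \<cdot> projT X a \<cdot> x) x = x"
    using plus_comp[of a "zeroT X a \<cdot> projT X a" "Id C (TO X a)" x] assms e pzp by simp
  show "plus_T X a x (zeroT X a \<cdot> projT X a \<cdot> x) = x"
    using plus_comp[of a "Id C (TO X a)" "zeroT X a \<cdot> projT X a" x] assms e pzp by simp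
qed

text \<open>The axiom speaks about every 3-fold fibre power of \<open>p\<close>, so one has to exist
  before it gives anything. \<open>has_T_powers\<close> provides it, and its generic triple is
  restricted along the map \<open>k\<close> that classifies \<open>x\<close>, \<open>y\<close>,
  \<open>w\<close>.\<close>

lemma plus_assoc:
  assumes "a \<in> Obj C" "x \<in> Arr C" "Cod C x = TO X a" "y \<in> Arr C" "Cod C y = TO X a" "Dom C y = Dom C x"
    "w \<in> Arr C" "Cod C w = TO X a" "Dom C w = Dom C x"
    "projT X a \<cdot> x = projT X a \<cdot> y" "projT X a \<cdot> y = projT X a \<cdot> w"
  shows "plus_T X a (plus_T X a x y) w = plus_T X a x (plus_T X a y w)"
proof -
  have "\<exists>u q. \<forall>m. is_fibre_power C 3 ((TA X ^^ m) (projT X a)) ((TA X ^^ m) u) (\<lambda>i. (TA X ^^ m) (q i))"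
    using powers assms(1) unfolding has_T_powers_def by blast
  then obtain u q where "\<forall>m. is_fibre_power C 3 ((TA X ^^ m) (projT X a)) ((TA X ^^ m) u) (\<lambda>i. (TA X ^^ m) (q i))"
    by blast
  from this[THEN spec[of _ 0]] have uq: "is_fibre_power C 3 (projT X a) u q" by simp
  have three: "(\<forall>i<3. P i) \<longleftrightarrow> P 0 \<and> P 1 \<and> P (2::nat)" for P
    by (auto simp: numeral_eq_Suc less_Suc_eq)
  have q: "u \<in> Arr C" "Cod C u = a" "q 0 \<in> Arr C" "q 1 \<in> Arr C" "q 2 \<in> Arr C"
    "Dom C (q 0) = Dom C u" "Dom C (q 1) = Dom C u" "Dom C (q 2) = Dom C u"
    "Cod C (q 0) = TO X a" "Cod C (q 1) = TO X a" "Cod C (q 2) = TO X a"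
    "projT X a \<cdot> q 0 = u" "projT X a \<cdot> q 1 = u" "projT X a \<cdot> q 2 = u"
    using uq assms(1) unfolding is_fibre_power_def three by auto
  have asc: "plus_T X a (plus_T X a (q 0) (q 1)) (q 2) = plus_T X a (q 0) (plus_T X a (q 1) (q 2))"
    using tangent_bundle_additive[OF assms(1)] uq by (simp add: additive_bundle_def Let_def tangent_bundle_def plus_T_def)
  define h where "h i = (if i = 0 then x else if i = 1 then y else w)" for i :: nat
  have "\<exists>!k. k \<in> Hom C (Dom C x) (Dom C u) \<and> u \<cdot> k = projT X a \<cdot> x \<and> (\<forall>i<3. q i \<cdot> k = h i)"
    using uq[unfolded is_fibre_power_def, THEN conjunct2, THEN conjunct2, THEN conjunct2,
        THEN spec[of _ "Dom C x"], THEN spec[of _ "projT X a \<cdot> x"], THEN spec[of _ h]] assms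
    by (simp add: three h_def)
  then obtain k where "k \<in> Hom C (Dom C x) (Dom C u)" "\<forall>i<3. q i \<cdot> k = h i" by blast
  then have k: "k \<in> Arr C" "Dom C k = Dom C x" "Cod C k = Dom C u"
    "q 0 \<cdot> k = x" "q 1 \<cdot> k = y" "q 2 \<cdot> k = w" unfolding three h_def by auto
  note pp = p_plus[of a "q 0" "q 1"] p_plus[of a "q 1" "q 2"]
  have "plus_T X a (plus_T X a (q 0) (q 1)) (q 2) \<cdot> k = plus_T X a (plus_T X a x y) w"
    using q k assms(1) pp by (simp add: plus_comp)
  moreover have "plus_T X a (q 0) (plus_T X a (q 1) (q 2)) \<cdot> k = plus_T X a x (plus_T X a y w)"
    using q k assms(1) pp by (simp add: plus_comp)
  ultimately show ?thesis using asc by simp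
qed

section \<open>The vertical lift, the flip and the universality map on generalised elements\<close>

lemma Tproj_lift: "a \<in> Obj C \<Longrightarrow> TA X (projT X a) \<cdot> liftT X a = zeroT X a \<cdot> projT X a"
  and lift_zero: "a \<in> Obj C \<Longrightarrow> liftT X a \<cdot> zeroT X a = TA X (zeroT X a) \<cdot> zeroT X a"
  using bundle_l[of a] by (simp_all add: additive_bundle_morphism_def tangent_bundle_def T_bundle_def)

lemma proj_flip: "a \<in> Obj C \<Longrightarrow> projT X (TO X a) \<cdot> flipT X a = TA X (projT X a)"
  and flip_zero: "a \<in> Obj C \<Longrightarrow> flipT X a \<cdot> TA X (zeroT X a) = zeroT X (TO X a)"
  using bundle_c[of a] by (simp_all add: additive_bundle_morphism_def tangent_bundle_def T_bundle_def)

lemma Tproj_lift_comp: "a \<in> Obj C \<Longrightarrow> x \<in> Arr C \<Longrightarrow> Cod C x = TO X a \<Longrightarrow>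
    TA X (projT X a) \<cdot> liftT X a \<cdot> x = zeroT X a \<cdot> projT X a \<cdot> x"
  using reassoc[OF cats(1) Tproj_lift[of a], of x] by simp

lemma proj_flip_comp: "a \<in> Obj C \<Longrightarrow> x \<in> Arr C \<Longrightarrow> Cod C x = TO X (TO X a) \<Longrightarrow>
    projT X (TO X a) \<cdot> flipT X a \<cdot> x = TA X (projT X a) \<cdot> x"
  using reassoc[OF cats(1) proj_flip[of a], of x] by simp

text \<open>The bundle morphism axiom on the projections of \<open>T_2\<close>, restricted along the
  pairing. The sum on the right is that of \<open>T p\<close>, since \<open>(l, z)\<close> goes from
  \<open>p\<close> to \<open>T p\<close>.\<close>

lemma l_plus:
  assumes "a \<in> Obj C" "x \<in> Arr C" "Cod C x = TO X a" "y \<in> Arr C" "Cod C y = TO X a" "Dom C y = Dom C x"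
    "projT X a \<cdot> x = projT X a \<cdot> y"
  shows "liftT X a \<cdot> plus_T X a x y = Tplus_T X a (liftT X a \<cdot> x) (liftT X a \<cdot> y)"
proof -
  let ?k = "pairing C (pi1T X a) (pi2T X a) x y"
  have "liftT X a \<cdot> sumT X a = Tplus_T X a (liftT X a \<cdot> pi1T X a) (liftT X a \<cdot> pi2T X a)"
    using bundle_l[of a] assms by (simp add: additive_bundle_morphism_def tangent_bundle_def T_bundle_def Tplus_T_def)
  from reassoc[OF cats(1) this, of ?k] show ?thesis
    using assms by (simp add: plus_T_def Tplus_comp Tproj_lift_comp pi_eq)
qed

text \<open>Here the sum changes its bundle, because \<open>(c, id)\<close> goes from
  \<open>T p\<close> to \<open>p_T\<close>.\<close>

lemma c_Tplus:
  assumes "a \<in> Obj C" "x \<in> Arr C" "Cod C x = TO X (TO X a)" "y \<in> Arr C" "Cod C y = TO X (TO X a)"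
    "Dom C y = Dom C x" "TA X (projT X a) \<cdot> x = TA X (projT X a) \<cdot> y"
  shows "flipT X a \<cdot> Tplus_T X a x y = plus_T X (TO X a) (flipT X a \<cdot> x) (flipT X a \<cdot> y)"
proof -
  let ?k = "pairing C (TA X (pi1T X a)) (TA X (pi2T X a)) x y"
  have "flipT X a \<cdot> TA X (sumT X a) =
      plus_T X (TO X a) (flipT X a \<cdot> TA X (pi1T X a)) (flipT X a \<cdot> TA X (pi2T X a))"
    using bundle_c[of a] assms by (simp add: additive_bundle_morphism_def tangent_bundle_def T_bundle_def plus_T_def)
  from reassoc[OF cats(1) this, of ?k] show ?thesis
    using assms by (simp add: Tplus_T_def plus_comp proj_flip_comp Tpi_eq)
qed

text \<open>The map \<open>T s \<circ> \<langle>l \<pi>1, z_T \<pi>2\<rangle> : T_2 a \<rightarrow>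
  T^2 a\<close> of the universality axiom, written as a sum so that additivity and naturality of
  sums apply to it.\<close>

definition mu :: "'o \<Rightarrow> 'a" where
  "mu a = Tplus_T X a (liftT X a \<cdot> pi1T X a) (zeroT X (TO X a) \<cdot> pi2T X a)"

lemma universal: "a \<in> Obj C \<Longrightarrow> T_pullback X (TA X (projT X a)) (zeroT X a) (mu a) (projT X a \<cdot> pi1T X a)"
  using universal' by (simp add: mu_def Tplus_T_def)

text \<open>Naturality of zero at the map \<open>p\<close>. Together with
  \<open>Tproj_lift_comp\<close> and \<open>pi_eq\<close> it puts the two summands of
  \<open>mu\<close> into one fibre of \<open>T p\<close>.\<close>

lemma Tp_z: "a \<in> Obj C \<Longrightarrow> x \<in> Arr C \<Longrightarrow> Cod C x = TO X a \<Longrightarrow>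
    TA X (projT X a) \<cdot> zeroT X (TO X a) \<cdot> x = zeroT X a \<cdot> projT X a \<cdot> x"
  using reassoc[OF cats(1) z_nat[of "projT X a"], of x] by simp

lemma mu_typing [simp]:
  "a \<in> Obj C \<Longrightarrow> mu a \<in> Arr C" "a \<in> Obj C \<Longrightarrow> Dom C (mu a) = Dom C (pi1T X a)"
  "a \<in> Obj C \<Longrightarrow> Cod C (mu a) = TO X (TO X a)"
  unfolding mu_def by (simp_all add: Tproj_lift_comp Tp_z pi_eq)

lemma mu_pair:
  assumes "a \<in> Obj C" "x \<in> Arr C" "Cod C x = TO X a" "y \<in> Arr C" "Cod C y = TO X a" "Dom C y = Dom C x"
    "projT X a \<cdot> x = projT X a \<cdot> y"
  shows "mu a \<cdot> pairing C (pi1T X a) (pi2T X a) x y = Tplus_T X a (liftT X a \<cdot> x) (zeroT X (TO X a) \<cdot> y)"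
  using assms unfolding mu_def by (subst Tplus_comp) (simp_all add: Tproj_lift_comp Tp_z pi_eq)

text \<open>The equation 0 + 0 = 0 under \<open>T\<close>, restricted along \<open>z\<close>. It
  evaluates \<open>mu\<close> on a pair of zeros.\<close>

lemma Tplus_zero:
  assumes "a \<in> Obj C"
  shows "Tplus_T X a (TA X (zeroT X a) \<cdot> zeroT X a) (TA X (zeroT X a) \<cdot> zeroT X a) = TA X (zeroT X a) \<cdot> zeroT X a"
proof -
  have "TA X (projT X a) \<cdot> TA X (zeroT X a) = Id C (TO X a)"
    using proj_zero[OF assms, THEN arg_cong, of "TA X"] assms by simp
  moreover have "plus_T X a (zeroT X a) (zeroT X a) = zeroT X a"
    using plus_zero(1)[of a "zeroT X a"] assms proj_zero[OF assms] by simp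
  then have "Tplus_T X a (TA X (zeroT X a)) (TA X (zeroT X a)) = TA X (zeroT X a)"
    using TA_plus[of a "zeroT X a" "zeroT X a"] assms by simp
  ultimately show ?thesis
    using Tplus_comp[of a "TA X (zeroT X a)" "TA X (zeroT X a)" "zeroT X a"] assms by simp
qed

text \<open>Additivity of \<open>T f\<close> on the projections of \<open>T_2\<close> is taken under
  \<open>T\<close> and then restricted along the pairing \<open>?k\<close>.\<close>

lemma Tplus_nat:
  assumes f: "f \<in> Arr C" "Dom C f = a"
    and "x \<in> Arr C" "Cod C x = TO X (TO X a)" "y \<in> Arr C" "Cod C y = TO X (TO X a)" "Dom C y = Dom C x"
    "TA X (projT X a) \<cdot> x = TA X (projT X a) \<cdot> y"
  shows "TA X (TA X f) \<cdot> Tplus_T X a x y = Tplus_T X (Cod C f) (TA X (TA X f) \<cdot> x) (TA X (TA X f) \<cdot> y)"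
proof -
  have a: "a \<in> Obj C" using f cats by auto
  let ?k = "pairing C (TA X (pi1T X a)) (TA X (pi2T X a)) x y"
  have n: "projT X (Cod C f) \<cdot> TA X f \<cdot> u = f \<cdot> projT X a \<cdot> u" if "u \<in> Arr C" "Cod C u = TO X a" for u
    using reassoc[OF cats(1) p_nat[OF f(1)], of u] f that a by simp
  have Tn: "TA X (projT X (Cod C f)) \<cdot> TA X (TA X f) = TA X f \<cdot> TA X (projT X a)"
    using p_nat[OF f(1), THEN arg_cong, of "TA X"] f a by simp
  have "TA X f \<cdot> sumT X a = plus_T X (Cod C f) (TA X f \<cdot> pi1T X a) (TA X f \<cdot> pi2T X a)"
    using plus_nat[of f a "pi1T X a" "pi2T X a"] f a plus_pi[OF a] pi_eq[OF a] by simp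
  from arg_cong[OF this, of "TA X"]
  have e: "TA X (TA X f) \<cdot> TA X (sumT X a) =
      Tplus_T X (Cod C f) (TA X (TA X f) \<cdot> TA X (pi1T X a)) (TA X (TA X f) \<cdot> TA X (pi2T X a))"
    using f a pi_eq[OF a] n by (subst (asm) TA_plus) simp_all
  have m: "TA X (projT X (Cod C f)) \<cdot> TA X (TA X f) \<cdot> u = TA X f \<cdot> TA X (projT X a) \<cdot> u"
    if "u \<in> Arr C" "Cod C u = TO X (TO X a)" for u
    using reassoc[OF cats(1) Tn, of u] f that a by simp
  from reassoc[OF cats(1) e, of ?k] show ?thesis
    using assms a by (simp add: Tplus_comp Tpi_eq m) (simp add: Tplus_T_def)
qed

end

lemma tangent_cat_intro: "tangent_category X \<Longrightarrow> tangent_cat X"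
  by (auto simp: tangent_cat_def tangent_endo_def tangent_cat_axioms_def tangent_category_def Let_def)

section \<open>Lax tangent morphisms\<close>

lemma lax_tangent_morphismI:
  assumes "tangent_category X" "tangent_category X'" "is_functor (Cat X) (Cat X') F"
    and "\<And>a. a \<in> Obj (Cat X) \<Longrightarrow> \<alpha> a \<in> Hom (Cat X') (omap F (TO X a)) (TO X' (omap F a))"
    and "\<And>f. f \<in> Arr (Cat X) \<Longrightarrow>
      \<alpha> (Cod (Cat X) f) \<cdot>\<^bsub>Cat X'\<^esub> amap F (TA X f) = TA X' (amap F f) \<cdot>\<^bsub>Cat X'\<^esub> \<alpha> (Dom (Cat X) f)"
    and "\<And>a. a \<in> Obj (Cat X) \<Longrightarrow> projT X' (omap F a) \<cdot>\<^bsub>Cat X'\<^esub> \<alpha> a = amap F (projT X a)"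
    and "\<And>a. a \<in> Obj (Cat X) \<Longrightarrow> \<alpha> a \<cdot>\<^bsub>Cat X'\<^esub> amap F (zeroT X a) = zeroT X' (omap F a)"
    and "\<And>a. a \<in> Obj (Cat X) \<Longrightarrow> \<alpha> a \<cdot>\<^bsub>Cat X'\<^esub> amap F (sumT X a) =
      plus_T X' (omap F a) (\<alpha> a \<cdot>\<^bsub>Cat X'\<^esub> amap F (pi1T X a)) (\<alpha> a \<cdot>\<^bsub>Cat X'\<^esub> amap F (pi2T X a))"
    and "\<And>a. a \<in> Obj (Cat X) \<Longrightarrow> liftT X' (omap F a) \<cdot>\<^bsub>Cat X'\<^esub> \<alpha> a =
      TA X' (\<alpha> a) \<cdot>\<^bsub>Cat X'\<^esub> \<alpha> (TO X a) \<cdot>\<^bsub>Cat X'\<^esub> amap F (liftT X a)"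
    and "\<And>a. a \<in> Obj (Cat X) \<Longrightarrow>
      flipT X' (omap F a) \<cdot>\<^bsub>Cat X'\<^esub> TA X' (\<alpha> a) \<cdot>\<^bsub>Cat X'\<^esub> \<alpha> (TO X a) =
      TA X' (\<alpha> a) \<cdot>\<^bsub>Cat X'\<^esub> \<alpha> (TO X a) \<cdot>\<^bsub>Cat X'\<^esub> amap F (flipT X a)"
  shows "lax_tangent_morphism X X' F \<alpha>"
  using assms by (simp add: lax_tangent_morphism_def Let_def nat_trans_def fcomp_def plus_T_def)

locale lax_morphism =
  fixes X :: "('o, 'a) tngcat" and X' :: "('p, 'b) tngcat"
    and F :: "('o, 'a, 'p, 'b) fctr" and \<alpha> :: "'o \<Rightarrow> 'b"
  assumes tngX: "tangent_category X" and tngX': "tangent_category X'"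
    and lax: "lax_tangent_morphism X X' F \<alpha>"
begin

abbreviation comp' (infixr "\<bullet>" 75) where "comp' \<equiv> Comp (Cat X')"

sublocale S: tangent_cat X by (rule tangent_cat_intro[OF tngX])
sublocale T: tangent_cat X' by (rule tangent_cat_intro[OF tngX'])
sublocale F: fctr_between "Cat X" "Cat X'" F
  using lax by unfold_locales (simp add: lax_tangent_morphism_def Let_def)

lemma dist_typing [simp]:
  "a \<in> Obj (Cat X) \<Longrightarrow> \<alpha> a \<in> Arr (Cat X')"
  "a \<in> Obj (Cat X) \<Longrightarrow> Dom (Cat X') (\<alpha> a) = omap F (TO X a)"
  "a \<in> Obj (Cat X) \<Longrightarrow> Cod (Cat X') (\<alpha> a) = TO X' (omap F a)"
  using lax by (auto simp: lax_tangent_morphism_def Let_def nat_trans_def fcomp_def)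

lemma dist_nat: "f \<in> Arr (Cat X) \<Longrightarrow>
    \<alpha> (Cod (Cat X) f) \<bullet> amap F (TA X f) = TA X' (amap F f) \<bullet> \<alpha> (Dom (Cat X) f)"
  using lax by (auto simp: lax_tangent_morphism_def Let_def nat_trans_def fcomp_def)

lemma dist_p: "a \<in> Obj (Cat X) \<Longrightarrow> projT X' (omap F a) \<bullet> \<alpha> a = amap F (projT X a)"
  and dist_z: "a \<in> Obj (Cat X) \<Longrightarrow> \<alpha> a \<bullet> amap F (zeroT X a) = zeroT X' (omap F a)"
  and dist_s: "a \<in> Obj (Cat X) \<Longrightarrow> \<alpha> a \<bullet> amap F (sumT X a) =
      plus_T X' (omap F a) (\<alpha> a \<bullet> amap F (pi1T X a)) (\<alpha> a \<bullet> amap F (pi2T X a))"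
  and dist_l: "a \<in> Obj (Cat X) \<Longrightarrow> liftT X' (omap F a) \<bullet> \<alpha> a =
      TA X' (\<alpha> a) \<bullet> \<alpha> (TO X a) \<bullet> amap F (liftT X a)"
  and dist_c: "a \<in> Obj (Cat X) \<Longrightarrow>
      flipT X' (omap F a) \<bullet> TA X' (\<alpha> a) \<bullet> \<alpha> (TO X a) =
      TA X' (\<alpha> a) \<bullet> \<alpha> (TO X a) \<bullet> amap F (flipT X a)"
  using lax by (simp_all add: lax_tangent_morphism_def Let_def plus_T_def)

lemma dist_p_comp:
  "a \<in> Obj (Cat X) \<Longrightarrow> x \<in> Arr (Cat X') \<Longrightarrow> Cod (Cat X') x = omap F (TO X a) \<Longrightarrow>
    projT X' (omap F a) \<bullet> \<alpha> a \<bullet> x = amap F (projT X a) \<bullet> x"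
  using reassoc[OF T.cats(1) dist_p[of a], of x] by simp

lemma F_pi_eq: "a \<in> Obj (Cat X) \<Longrightarrow>
    amap F (projT X a) \<bullet> amap F (pi2T X a) = amap F (projT X a) \<bullet> amap F (pi1T X a)"
  using S.pi_eq[of a, THEN arg_cong, of "amap F"] by simp

text \<open>\<open>F\<close> need not preserve \<open>T_2\<close>, so the law for the sum is
  restricted along \<open>F\<close> of the pairing formed in \<open>X\<close>. Its composites with
  the images of the two projections are \<open>F x\<close> and \<open>F y\<close>.\<close>

lemma dist_plus:
  assumes "a \<in> Obj (Cat X)" "x \<in> Arr (Cat X)" "Cod (Cat X) x = TO X a" "y \<in> Arr (Cat X)" "Cod (Cat X) y = TO X a"
    "Dom (Cat X) y = Dom (Cat X) x" "projT X a \<cdot>\<^bsub>Cat X\<^esub> x = projT X a \<cdot>\<^bsub>Cat X\<^esub> y"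
  shows "\<alpha> a \<bullet> amap F (plus_T X a x y) =
    plus_T X' (omap F a) (\<alpha> a \<bullet> amap F x) (\<alpha> a \<bullet> amap F y)"
proof -
  let ?k = "pairing (Cat X) (pi1T X a) (pi2T X a) x y"
  have e: "amap F (pi1T X a) \<bullet> amap F ?k = amap F x" "amap F (pi2T X a) \<bullet> amap F ?k = amap F y"
    using assms by (simp_all flip: F.amap_comp)
  show ?thesis
    using reassoc[OF T.cats(1) dist_s[of a], of "amap F ?k"] assms e
    by (simp add: T.plus_comp dist_p_comp F_pi_eq) (simp add: plus_T_def)
qed

end

text \<open>The composite is described pointwise on \<open>X\<close>, because the components of
  \<open>lax_comp\<close> are restricted to the source category. Each law is \<open>G\<close> of the
  law for \<open>\<alpha>\<close> followed by the law for \<open>\<beta>\<close> at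
  \<open>F a\<close>; where \<open>T'\<close> is applied to \<open>\<alpha>\<close>, naturality of
  \<open>\<beta>\<close> mediates.\<close>

lemma lax_morphism_comp:
  assumes "lax_morphism X X' F \<alpha>" "lax_morphism X' X'' G \<beta>"
    and om: "\<And>a. a \<in> Obj (Cat X) \<Longrightarrow> omap H a = omap G (omap F a)"
    and am: "\<And>f. f \<in> Arr (Cat X) \<Longrightarrow> amap H f = amap G (amap F f)"
    and di: "\<And>a. a \<in> Obj (Cat X) \<Longrightarrow> \<gamma> a = \<beta> (omap F a) \<cdot>\<^bsub>Cat X''\<^esub> amap G (\<alpha> a)"
  shows "lax_tangent_morphism X X'' H \<gamma>"
proof -
  interpret F: lax_morphism X X' F \<alpha> by fact
  interpret G: lax_morphism X' X'' G \<beta> by fact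
  note [simp] = om am di
  have cat: "category (Cat X'')" by simp
  have nat: "\<beta> (omap F a) \<cdot>\<^bsub>Cat X''\<^esub> amap G (TA X' u) \<cdot>\<^bsub>Cat X''\<^esub> x =
      TA X'' (amap G u) \<cdot>\<^bsub>Cat X''\<^esub> \<beta> (Dom (Cat X') u) \<cdot>\<^bsub>Cat X''\<^esub> x"
    if "u \<in> Arr (Cat X')" "Cod (Cat X') u = omap F a" "x \<in> Arr (Cat X'')"
      "Cod (Cat X'') x = omap G (TO X' (Dom (Cat X') u))" for u a x
    using reassoc[OF cat G.dist_nat[of u], of x] Cod_Obj[of "Cat X'" u] that by simp
  show ?thesis
  proof (rule lax_tangent_morphismI)
    show "is_functor (Cat X) (Cat X'') H"
      unfolding is_functor_def by auto
    show "\<gamma> (Cod (Cat X) f) \<cdot>\<^bsub>Cat X''\<^esub> amap H (TA X f) = TA X'' (amap H f) \<cdot>\<^bsub>Cat X''\<^esub> \<gamma> (Dom (Cat X) f)"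
      if f: "f \<in> Arr (Cat X)" for f
    proof -
      have "amap G (\<alpha> (Cod (Cat X) f)) \<cdot>\<^bsub>Cat X''\<^esub> amap G (amap F (TA X f)) =
          amap G (TA X' (amap F f)) \<cdot>\<^bsub>Cat X''\<^esub> amap G (\<alpha> (Dom (Cat X) f))"
        using f F.dist_nat[OF f, THEN arg_cong, of "amap G"] by simp
      then show ?thesis using f nat[of "amap F f" "Cod (Cat X) f" "amap G (\<alpha> (Dom (Cat X) f))"] by simp
    qed
    fix a assume a: "a \<in> Obj (Cat X)"
    note [simp] = a
    show "\<gamma> a \<in> Hom (Cat X'') (omap H (TO X a)) (TO X'' (omap H a))" by simp
    show "projT X'' (omap H a) \<cdot>\<^bsub>Cat X''\<^esub> \<gamma> a = amap H (projT X a)"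
      using F.dist_p[OF a, THEN arg_cong, of "amap G"] by (simp add: G.dist_p_comp)
    have "amap G (\<alpha> a) \<cdot>\<^bsub>Cat X''\<^esub> amap G (amap F (zeroT X a)) = amap G (zeroT X' (omap F a))"
      using F.dist_z[OF a, THEN arg_cong, of "amap G"] by simp
    then show "\<gamma> a \<cdot>\<^bsub>Cat X''\<^esub> amap H (zeroT X a) = zeroT X'' (omap H a)"
      by (simp add: G.dist_z)
    have "amap G (\<alpha> a) \<cdot>\<^bsub>Cat X''\<^esub> amap G (amap F (sumT X a)) =
        amap G (plus_T X' (omap F a) (\<alpha> a \<cdot>\<^bsub>Cat X'\<^esub> amap F (pi1T X a)) (\<alpha> a \<cdot>\<^bsub>Cat X'\<^esub> amap F (pi2T X a)))"
      using F.dist_s[OF a, THEN arg_cong, of "amap G"] by simp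
    then show "\<gamma> a \<cdot>\<^bsub>Cat X''\<^esub> amap H (sumT X a) =
      plus_T X'' (omap H a) (\<gamma> a \<cdot>\<^bsub>Cat X''\<^esub> amap H (pi1T X a)) (\<gamma> a \<cdot>\<^bsub>Cat X''\<^esub> amap H (pi2T X a))"
      by (simp add: G.dist_plus F.dist_p_comp F.F_pi_eq)
    have e: "amap G (liftT X' (omap F a)) \<cdot>\<^bsub>Cat X''\<^esub> amap G (\<alpha> a) =
        amap G (TA X' (\<alpha> a)) \<cdot>\<^bsub>Cat X''\<^esub> amap G (\<alpha> (TO X a)) \<cdot>\<^bsub>Cat X''\<^esub> amap G (amap F (liftT X a))"
      using F.dist_l[OF a, THEN arg_cong, of "amap G"] by simp
    show "liftT X'' (omap H a) \<cdot>\<^bsub>Cat X''\<^esub> \<gamma> a =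
      TA X'' (\<gamma> a) \<cdot>\<^bsub>Cat X''\<^esub> \<gamma> (TO X a) \<cdot>\<^bsub>Cat X''\<^esub> amap H (liftT X a)"
      using reassoc[OF cat G.dist_l[of "omap F a"], of "amap G (\<alpha> a)"]
        reassoc[OF cat G.dist_nat[of "\<alpha> a"], of "amap G (\<alpha> (TO X a)) \<cdot>\<^bsub>Cat X''\<^esub> amap G (amap F (liftT X a))"]
      by (simp add: e)
    have e: "amap G (flipT X' (omap F a)) \<cdot>\<^bsub>Cat X''\<^esub> amap G (TA X' (\<alpha> a)) \<cdot>\<^bsub>Cat X''\<^esub> amap G (\<alpha> (TO X a)) =
        amap G (TA X' (\<alpha> a)) \<cdot>\<^bsub>Cat X''\<^esub> amap G (\<alpha> (TO X a)) \<cdot>\<^bsub>Cat X''\<^esub> amap G (amap F (flipT X a))"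
      using F.dist_c[OF a, THEN arg_cong, of "amap G"] by simp
    \<comment> \<open>Naturality of \<open>\<beta>\<close> at the component of
      \<open>\<alpha>\<close> brings the two occurrences of \<open>\<beta>\<close> next to each
      other, as the flip law of \<open>G\<close> requires.\<close>
    have n: "TA X'' (amap G (\<alpha> a)) \<cdot>\<^bsub>Cat X''\<^esub> \<beta> (omap F (TO X a)) \<cdot>\<^bsub>Cat X''\<^esub> x =
        \<beta> (TO X' (omap F a)) \<cdot>\<^bsub>Cat X''\<^esub> amap G (TA X' (\<alpha> a)) \<cdot>\<^bsub>Cat X''\<^esub> x"
      if "x \<in> Arr (Cat X'')" "Cod (Cat X'') x = omap G (TO X' (omap F (TO X a)))" for x
      using reassoc[OF cat G.dist_nat[of "\<alpha> a"], of x] that by simp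
    show "flipT X'' (omap H a) \<cdot>\<^bsub>Cat X''\<^esub> TA X'' (\<gamma> a) \<cdot>\<^bsub>Cat X''\<^esub> \<gamma> (TO X a) =
      TA X'' (\<gamma> a) \<cdot>\<^bsub>Cat X''\<^esub> \<gamma> (TO X a) \<cdot>\<^bsub>Cat X''\<^esub> amap H (flipT X a)"
      using reassoc3[OF cat G.dist_c[of "omap F a"], of "amap G (TA X' (\<alpha> a)) \<cdot>\<^bsub>Cat X''\<^esub> amap G (\<alpha> (TO X a))"]
      by (simp add: e n)
  qed (use F.tngX G.tngX' in auto)
qed

section \<open>The 2-categories of tangent categories and of tangent pairs\<close>

lemma lax_morphism_of:
  "is_laxmor m \<Longrightarrow> tangent_category (fst (lsrc m)) \<Longrightarrow> tangent_category (fst (ltrg m)) \<Longrightarrow>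
    lax_morphism (fst (lsrc m)) (fst (ltrg m)) (lfun m) (ldist m)"
  by (simp add: is_laxmor_def lax_morphism_def)

text \<open>The three components are extensional, so agreement on the source category already gives
  equality of the records.\<close>

lemma laxmor_eqI:
  assumes "is_laxmor m" "is_laxmor n" "lsrc m = lsrc n" "ltrg m = ltrg n"
    and "\<And>a. a \<in> Obj (lcat (lsrc n)) \<Longrightarrow> omap (lfun m) a = omap (lfun n) a"
    and "\<And>f. f \<in> Arr (lcat (lsrc n)) \<Longrightarrow> amap (lfun m) f = amap (lfun n) f"
    and "\<And>a. a \<in> Obj (lcat (lsrc n)) \<Longrightarrow> ldist m a = ldist n a"
  shows "m = n"
proof -
  have "omap (lfun m) = omap (lfun n)" "amap (lfun m) = amap (lfun n)" "ldist m = ldist n"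
    using assms by (auto simp: is_laxmor_def intro: extensionalityI)
  then show ?thesis using assms(3,4) by simp
qed

lemma lax_id_laxmor:
  assumes "tangent_category (fst P)"
  shows "is_laxmor (lax_id P)"
proof -
  interpret tangent_cat "fst P" by (rule tangent_cat_intro[OF assms])
  have "lax_tangent_morphism (fst P) (fst P) \<lparr>omap = (\<lambda>a\<in>Obj (lcat P). a), amap = (\<lambda>f\<in>Arr (lcat P). f)\<rparr>
      (\<lambda>a\<in>Obj (lcat P). Id (lcat P) (TO (fst P) a))"
    by (rule lax_tangent_morphismI) (simp_all add: assms is_functor_def plus_pi)
  then show ?thesis by (simp add: is_laxmor_def lax_id_def)
qed

lemma lax_comp_laxmor:
  assumes "is_laxmor m" "is_laxmor n" "ltrg m = lsrc n"
    "tangent_category (fst (lsrc m))" "tangent_category (fst (ltrg m))" "tangent_category (fst (ltrg n))"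
  shows "is_laxmor (lax_comp n m)"
proof -
  have "lax_tangent_morphism (fst (lsrc (lax_comp n m))) (fst (ltrg (lax_comp n m)))
      (lfun (lax_comp n m)) (ldist (lax_comp n m))"
    by (rule lax_morphism_comp[where X = "fst (lsrc (lax_comp n m))" and X'' = "fst (ltrg (lax_comp n m))" and
        X' = "fst (ltrg m)" and F = "lfun m" and \<alpha> = "ldist m" and G = "lfun n" and \<beta> = "ldist n"])
      (use lax_morphism_of[of m] lax_morphism_of[of n] assms in \<open>auto simp: lax_comp_def compose_eq\<close>)
  then show ?thesis by (simp add: is_laxmor_def lax_comp_def)
qed

lemma lax_comp_simps [simp]:
  "lsrc (lax_comp n m) = lsrc m" "ltrg (lax_comp n m) = ltrg n"
  "a \<in> Obj (lcat (lsrc m)) \<Longrightarrow> omap (lfun (lax_comp n m)) a = omap (lfun n) (omap (lfun m) a)"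
  "f \<in> Arr (lcat (lsrc m)) \<Longrightarrow> amap (lfun (lax_comp n m)) f = amap (lfun n) (amap (lfun m) f)"
  "a \<in> Obj (lcat (lsrc m)) \<Longrightarrow> ldist (lax_comp n m) a =
     ldist n (omap (lfun m) a) \<cdot>\<^bsub>lcat (ltrg n)\<^esub> amap (lfun n) (ldist m a)"
  by (simp_all add: lax_comp_def compose_eq)

lemma lax_id_simps [simp]:
  "lsrc (lax_id P) = P" "ltrg (lax_id P) = P"
  "a \<in> Obj (lcat P) \<Longrightarrow> omap (lfun (lax_id P)) a = a"
  "f \<in> Arr (lcat P) \<Longrightarrow> amap (lfun (lax_id P)) f = f"
  "a \<in> Obj (lcat P) \<Longrightarrow> ldist (lax_id P) a = Id (lcat P) (TO (fst P) a)"
  by (simp_all add: lax_id_def)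

lemma lax_comp_id:
  assumes "is_laxmor m" "tangent_category (fst (lsrc m))" "tangent_category (fst (ltrg m))"
  shows "lax_comp m (lax_id (lsrc m)) = m" "lax_comp (lax_id (ltrg m)) m = m"
proof -
  interpret lax_morphism "fst (lsrc m)" "fst (ltrg m)" "lfun m" "ldist m" by (rule lax_morphism_of[OF assms])
  show "lax_comp m (lax_id (lsrc m)) = m"
    by (rule laxmor_eqI) (simp_all add: assms lax_comp_laxmor lax_id_laxmor)
  show "lax_comp (lax_id (ltrg m)) m = m"
    by (rule laxmor_eqI) (simp_all add: assms lax_comp_laxmor lax_id_laxmor)
qed

lemma lax_comp_assoc:
  assumes "is_laxmor m" "is_laxmor n" "is_laxmor k" "ltrg m = lsrc n" "ltrg n = lsrc k"
    "tangent_category (fst (lsrc m))" "tangent_category (fst (ltrg m))" "tangent_category (fst (ltrg n))"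
    "tangent_category (fst (ltrg k))"
  shows "lax_comp (lax_comp k n) m = lax_comp k (lax_comp n m)"
proof -
  interpret m: lax_morphism "fst (lsrc m)" "fst (lsrc n)" "lfun m" "ldist m"
    using lax_morphism_of[of m] assms by simp
  interpret n: lax_morphism "fst (lsrc n)" "fst (lsrc k)" "lfun n" "ldist n"
    using lax_morphism_of[of n] assms by simp
  interpret k: lax_morphism "fst (lsrc k)" "fst (ltrg k)" "lfun k" "ldist k"
    using lax_morphism_of[of k] assms by simp
  show ?thesis
    by (rule laxmor_eqI) (use assms in \<open>simp_all add: lax_comp_laxmor\<close>)
qed

section \<open>2-categories whose 1-cells carry lax tangent morphisms\<close>

definition lax_cells :: "('m \<Rightarrow> 'b laxmor) \<Rightarrow> 'm set \<Rightarrow> (('b, 'm) cell \<Rightarrow> bool) \<Rightarrow> ('b, 'm) cell set" where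
  "lax_cells lx M Q = {x. csrc x \<in> M \<and> ctrg x \<in> M \<and>
     is_lax_transformation (lx (csrc x)) (lx (ctrg x)) (ccomp x) \<and> Q x}"

lemma cell_eqI: "csrc x = csrc y \<Longrightarrow> ctrg x = ctrg y \<Longrightarrow> ccomp x = ccomp y \<Longrightarrow> x = y" for x y :: "('b, 'm) cell"
  by simp

lemma cell_simps [simp]:
  "csrc (cell_id lx m) = m" "ctrg (cell_id lx m) = m"
  "a \<in> Obj (lcat (lsrc (lx m))) \<Longrightarrow> ccomp (cell_id lx m) a = Id (lcat (ltrg (lx m))) (omap (lfun (lx m)) a)"
  "csrc (cell_vcomp lx y x) = csrc x" "ctrg (cell_vcomp lx y x) = ctrg y"
  "a \<in> Obj (lcat (lsrc (lx (csrc x)))) \<Longrightarrow>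
    ccomp (cell_vcomp lx y x) a = ccomp y a \<cdot>\<^bsub>lcat (ltrg (lx (csrc x)))\<^esub> ccomp x a"
  "csrc (cell_hcomp lx cmp y x) = cmp (csrc y) (csrc x)" "ctrg (cell_hcomp lx cmp y x) = cmp (ctrg y) (ctrg x)"
  "a \<in> Obj (lcat (lsrc (lx (csrc x)))) \<Longrightarrow>
    ccomp (cell_hcomp lx cmp y x) a =
        ccomp y (omap (lfun (lx (ctrg x))) a) \<cdot>\<^bsub>lcat (ltrg (lx (csrc y)))\<^esub>
        amap (lfun (lx (csrc y))) (ccomp x a)"
  by (simp_all add: cell_id_def cell_vcomp_def cell_hcomp_def)

lemma cell_extensional:
  "ccomp (cell_id lx m) \<in> extensional (Obj (lcat (lsrc (lx m))))"
  "ccomp (cell_vcomp lx y x) \<in> extensional (Obj (lcat (lsrc (lx (csrc x)))))"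
  "ccomp (cell_hcomp lx cmp y x) \<in> extensional (Obj (lcat (lsrc (lx (csrc x)))))"
  by (simp_all add: cell_id_def cell_vcomp_def cell_hcomp_def)

locale lax_trans =
  m: lax_morphism X X' F \<alpha> + n: lax_morphism X X' G \<beta>
  for X :: "('b univ, 'b univ) tngcat" and X' :: "('b univ, 'b univ) tngcat" and F \<alpha> G \<beta> +
  fixes \<gamma> :: "'b univ \<Rightarrow> 'b univ"
  assumes nt: "nat_trans (Cat X) (Cat X') F G \<gamma>"
    and ntd: "\<And>a. a \<in> Obj (Cat X) \<Longrightarrow> \<beta> a \<cdot>\<^bsub>Cat X'\<^esub> \<gamma> (TO X a) = TA X' (\<gamma> a) \<cdot>\<^bsub>Cat X'\<^esub> \<alpha> a"
begin

lemma cell_typing [simp]: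
  "a \<in> Obj (Cat X) \<Longrightarrow> \<gamma> a \<in> Arr (Cat X')"
  "a \<in> Obj (Cat X) \<Longrightarrow> Dom (Cat X') (\<gamma> a) = omap F a"
  "a \<in> Obj (Cat X) \<Longrightarrow> Cod (Cat X') (\<gamma> a) = omap G a"
  using nt by (auto simp: nat_trans_def)

lemma cell_nat: "f \<in> Arr (Cat X) \<Longrightarrow>
    \<gamma> (Cod (Cat X) f) \<cdot>\<^bsub>Cat X'\<^esub> amap F f = amap G f \<cdot>\<^bsub>Cat X'\<^esub> \<gamma> (Dom (Cat X) f)"
  using nt by (auto simp: nat_trans_def)

end

lemma is_lax_transformationI:
  assumes "lsrc m = lsrc n" "ltrg m = ltrg n"
    and "\<And>a. a \<in> Obj (lcat (lsrc n)) \<Longrightarrow> \<gamma> a \<in> Hom (lcat (ltrg n)) (omap (lfun m) a) (omap (lfun n) a)"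
    and "\<And>f. f \<in> Arr (lcat (lsrc n)) \<Longrightarrow> \<gamma> (Cod (lcat (lsrc n)) f) \<cdot>\<^bsub>lcat (ltrg n)\<^esub> amap (lfun m) f =
      amap (lfun n) f \<cdot>\<^bsub>lcat (ltrg n)\<^esub> \<gamma> (Dom (lcat (lsrc n)) f)"
    and "\<And>a. a \<in> Obj (lcat (lsrc n)) \<Longrightarrow> ldist n a \<cdot>\<^bsub>lcat (ltrg n)\<^esub> \<gamma> (TO (fst (lsrc n)) a) =
        TA (fst (ltrg n)) (\<gamma> a) \<cdot>\<^bsub>lcat (ltrg n)\<^esub> ldist m a"
    and "\<gamma> \<in> extensional (Obj (lcat (lsrc n)))"
  shows "is_lax_transformation m n \<gamma>"
  using assms by (simp add: is_lax_transformation_def nat_trans_def)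

text \<open>This serves both 2-categories: \<open>lx\<close> is the identity for
  \<open>trmTngCat\<close> and \<open>fst\<close> for \<open>TngPair\<close>, and \<open>Q\<close>
  is the further condition on cells, trivial in the first case and
  \<open>\<psi> \<circ> \<gamma>_A = \<phi>\<close> in the second. Besides the laws of 1-cells, an
  instance only has to check that \<open>Q\<close> is closed under the cell operations.\<close>

locale lax_two_category =
  fixes Ob :: "'b ptng set" and M :: "'m set" and Q :: "('b, 'm) cell \<Rightarrow> bool"
    and lx :: "'m \<Rightarrow> 'b laxmor" and idm :: "'b ptng \<Rightarrow> 'm" and cmp :: "'m \<Rightarrow> 'm \<Rightarrow> 'm"
  assumes tan: "\<And>P. P \<in> Ob \<Longrightarrow> tangent_category (fst P)"
    and M [simp]: "\<And>m. m \<in> M \<Longrightarrow> is_laxmor (lx m)" "\<And>m. m \<in> M \<Longrightarrow> lsrc (lx m) \<in> Ob"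
      "\<And>m. m \<in> M \<Longrightarrow> ltrg (lx m) \<in> Ob"
    and lx [simp]: "\<And>P. P \<in> Ob \<Longrightarrow> lx (idm P) = lax_id P" "\<And>m n. lx (cmp n m) = lax_comp (lx n) (lx m)"
    and idm [simp]: "\<And>P. P \<in> Ob \<Longrightarrow> idm P \<in> M"
    and cmp_M [simp]: "\<And>m n. m \<in> M \<Longrightarrow> n \<in> M \<Longrightarrow> ltrg (lx m) = lsrc (lx n) \<Longrightarrow> cmp n m \<in> M"
    and cmp_id [simp]: "\<And>m. m \<in> M \<Longrightarrow> cmp m (idm (lsrc (lx m))) = m" "\<And>m. m \<in> M \<Longrightarrow> cmp (idm (ltrg (lx m))) m = m"
    and cmp_assoc: "\<And>m n k. m \<in> M \<Longrightarrow> n \<in> M \<Longrightarrow> k \<in> M \<Longrightarrow> ltrg (lx m) = lsrc (lx n) \<Longrightarrow>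
      ltrg (lx n) = lsrc (lx k) \<Longrightarrow> cmp (cmp k n) m = cmp k (cmp n m)"
    and Q_id: "\<And>m. m \<in> M \<Longrightarrow> Q (cell_id lx m)"
    and Q_v: "\<And>x y. x \<in> lax_cells lx M Q \<Longrightarrow> y \<in> lax_cells lx M Q \<Longrightarrow> ctrg x = csrc y \<Longrightarrow> Q (cell_vcomp lx y x)"
    and Q_h: "\<And>x y. x \<in> lax_cells lx M Q \<Longrightarrow> y \<in> lax_cells lx M Q \<Longrightarrow>
      ltrg (lx (csrc x)) = lsrc (lx (csrc y)) \<Longrightarrow> Q (cell_hcomp lx cmp y x)"
begin

abbreviation "K \<equiv> lax_cells lx M Q"

definition B :: "('b ptng, 'm, ('b, 'm) cell) cat2" where
  "B = \<lparr>Obj = Ob, Arr = M, Dom = (\<lambda>m. lsrc (lx m)), Cod = (\<lambda>m. ltrg (lx m)), Id = idm, Comp = cmp,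
     Cell = K, Src = csrc, Trg = ctrg, VId = cell_id lx, VComp = cell_vcomp lx,
     HComp = cell_hcomp lx cmp\<rparr>"

lemma lax_morphism_of_M: "m \<in> M \<Longrightarrow> lax_morphism (fst (lsrc (lx m))) (fst (ltrg (lx m))) (lfun (lx m)) (ldist (lx m))"
  by (rule lax_morphism_of) (simp_all add: tan)

lemma K_D:
  assumes "x \<in> K"
  shows "csrc x \<in> M" "ctrg x \<in> M" "lsrc (lx (ctrg x)) = lsrc (lx (csrc x))" "ltrg (lx (ctrg x)) = ltrg (lx (csrc x))"
    "ccomp x \<in> extensional (Obj (lcat (lsrc (lx (csrc x)))))"
    "lax_trans (fst (lsrc (lx (csrc x)))) (fst (ltrg (lx (csrc x)))) (lfun (lx (csrc x))) (ldist (lx (csrc x)))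
       (lfun (lx (ctrg x))) (ldist (lx (ctrg x))) (ccomp x)"
proof -
  show "csrc x \<in> M" "ctrg x \<in> M" "lsrc (lx (ctrg x)) = lsrc (lx (csrc x))" "ltrg (lx (ctrg x)) = ltrg (lx (csrc x))"
    "ccomp x \<in> extensional (Obj (lcat (lsrc (lx (csrc x)))))"
    using assms by (auto simp: lax_cells_def is_lax_transformation_def)
  then show "lax_trans (fst (lsrc (lx (csrc x)))) (fst (ltrg (lx (csrc x)))) (lfun (lx (csrc x))) (ldist (lx (csrc x)))
       (lfun (lx (ctrg x))) (ldist (lx (ctrg x))) (ccomp x)"
    using lax_morphism_of_M[of "csrc x"] lax_morphism_of_M[of "ctrg x"] assms
    by (auto simp: lax_trans_def lax_trans_axioms_def lax_cells_def is_lax_transformation_def)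
qed

lemma category_B: "category B"
  unfolding category_def B_def by (auto simp: cmp_assoc)

lemma cell_id_K:
  assumes "m \<in> M"
  shows "cell_id lx m \<in> K"
proof -
  interpret lax_morphism "fst (lsrc (lx m))" "fst (ltrg (lx m))" "lfun (lx m)" "ldist (lx m)" by (rule lax_morphism_of_M[OF assms])
  have "is_lax_transformation (lx m) (lx m) (ccomp (cell_id lx m))"
    by (rule is_lax_transformationI) (simp_all add: cell_extensional)
  then show ?thesis using assms by (simp add: lax_cells_def Q_id)
qed

lemma cell_vcomp_K:
  assumes "x \<in> K" "y \<in> K" "ctrg x = csrc y"
  shows "cell_vcomp lx y x \<in> K"
proof -
  note x = K_D[OF assms(1)] and y = K_D[OF assms(2)]
  let ?P = "lsrc (lx (csrc x))" and ?P' = "ltrg (lx (csrc x))"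
  interpret x: lax_trans "fst ?P" "fst ?P'" "lfun (lx (csrc x))" "ldist (lx (csrc x))"
    "lfun (lx (csrc y))" "ldist (lx (csrc y))" "ccomp x" using x assms by simp
  interpret y: lax_trans "fst ?P" "fst ?P'" "lfun (lx (csrc y))" "ldist (lx (csrc y))"
    "lfun (lx (ctrg y))" "ldist (lx (ctrg y))" "ccomp y" using x y assms by simp
  have [simp]: "lsrc (lx (ctrg y)) = ?P" "ltrg (lx (ctrg y)) = ?P'" using x y assms by auto
  have cat: "category (lcat ?P')" by simp
  have "is_lax_transformation (lx (csrc x)) (lx (ctrg y)) (ccomp (cell_vcomp lx y x))"
  proof (rule is_lax_transformationI; simp add: cell_extensional)
    fix f assume f: "f \<in> Arr (lcat ?P)"
    then show "ccomp y (Cod (lcat ?P) f) \<cdot>\<^bsub>lcat ?P'\<^esub> ccomp x (Cod (lcat ?P) f) \<cdot>\<^bsub>lcat ?P'\<^esub> amap (lfun (lx (csrc x))) f =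
      amap (lfun (lx (ctrg y))) f \<cdot>\<^bsub>lcat ?P'\<^esub> ccomp y (Dom (lcat ?P) f) \<cdot>\<^bsub>lcat ?P'\<^esub> ccomp x (Dom (lcat ?P) f)"
      using reassoc[OF cat y.cell_nat[OF f], of "ccomp x (Dom (lcat ?P) f)"] x.cell_nat[OF f] by simp
  next
    fix a assume a: "a \<in> Obj (lcat ?P)"
    then show "ldist (lx (ctrg y)) a \<cdot>\<^bsub>lcat ?P'\<^esub> ccomp y (TO (fst ?P) a) \<cdot>\<^bsub>lcat ?P'\<^esub> ccomp x (TO (fst ?P) a) =
      TA (fst ?P') (ccomp y a) \<cdot>\<^bsub>lcat ?P'\<^esub> TA (fst ?P') (ccomp x a) \<cdot>\<^bsub>lcat ?P'\<^esub> ldist (lx (csrc x)) a"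
      using reassoc[OF cat y.ntd[OF a], of "ccomp x (TO (fst ?P) a)"] x.ntd[OF a] by simp
  qed
  then show ?thesis using assms x y Q_v by (simp add: lax_cells_def)
qed

lemma cell_hcomp_K:
  assumes "x \<in> K" "y \<in> K" "ltrg (lx (csrc x)) = lsrc (lx (csrc y))"
  shows "cell_hcomp lx cmp y x \<in> K"
proof -
  note x = K_D[OF assms(1)] and y = K_D[OF assms(2)]
  let ?P = "lsrc (lx (csrc x))" and ?P' = "lsrc (lx (csrc y))" and ?P'' = "ltrg (lx (csrc y))"
  let ?F1 = "lfun (lx (csrc x))" and ?F2 = "lfun (lx (ctrg x))"
  let ?G1 = "lfun (lx (csrc y))" and ?G2 = "lfun (lx (ctrg y))"
  interpret x: lax_trans "fst ?P" "fst ?P'" ?F1 "ldist (lx (csrc x))" ?F2 "ldist (lx (ctrg x))" "ccomp x"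
    using x assms by simp
  interpret y: lax_trans "fst ?P'" "fst ?P''" ?G1 "ldist (lx (csrc y))" ?G2 "ldist (lx (ctrg y))" "ccomp y"
    using y assms by simp
  have [simp]: "lsrc (lx (ctrg x)) = ?P" "ltrg (lx (ctrg x)) = ?P'" "ltrg (lx (csrc x)) = ?P'"
    "lsrc (lx (ctrg y)) = ?P'" "ltrg (lx (ctrg y)) = ?P''" using x y assms by auto
  have cat: "category (lcat ?P'')" by simp
  have yn: "ccomp y (Cod (lcat ?P') u) \<cdot>\<^bsub>lcat ?P''\<^esub> amap ?G1 u \<cdot>\<^bsub>lcat ?P''\<^esub> w =
      amap ?G2 u \<cdot>\<^bsub>lcat ?P''\<^esub> ccomp y (Dom (lcat ?P') u) \<cdot>\<^bsub>lcat ?P''\<^esub> w"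
    if "u \<in> Arr (lcat ?P')" "w \<in> Arr (lcat ?P'')" "Cod (lcat ?P'') w = omap ?G1 (Dom (lcat ?P') u)" for u w
    using reassoc[OF cat y.cell_nat[of u], of w] that by simp
  have "is_lax_transformation (lax_comp (lx (csrc y)) (lx (csrc x))) (lax_comp (lx (ctrg y)) (lx (ctrg x)))
      (ccomp (cell_hcomp lx cmp y x))"
  proof (rule is_lax_transformationI; simp add: cell_extensional)
    fix f assume f: "f \<in> Arr (lcat ?P)"
    have "amap ?G1 (ccomp x (Cod (lcat ?P) f)) \<cdot>\<^bsub>lcat ?P''\<^esub> amap ?G1 (amap ?F1 f) =
      amap ?G1 (amap ?F2 f) \<cdot>\<^bsub>lcat ?P''\<^esub> amap ?G1 (ccomp x (Dom (lcat ?P) f))"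
      using x.cell_nat[OF f, THEN arg_cong, of "amap ?G1"] f by simp
    then show "ccomp y (omap ?F2 (Cod (lcat ?P) f)) \<cdot>\<^bsub>lcat ?P''\<^esub> amap ?G1 (ccomp x (Cod (lcat ?P) f)) \<cdot>\<^bsub>lcat ?P''\<^esub>
        amap ?G1 (amap ?F1 f) =
      amap ?G2 (amap ?F2 f) \<cdot>\<^bsub>lcat ?P''\<^esub> ccomp y (omap ?F2 (Dom (lcat ?P) f)) \<cdot>\<^bsub>lcat ?P''\<^esub>
        amap ?G1 (ccomp x (Dom (lcat ?P) f))"
      using yn[of "amap ?F2 f" "amap ?G1 (ccomp x (Dom (lcat ?P) f))"] f by simp
  next
    fix a assume a: "a \<in> Obj (lcat ?P)"
    note [simp] = a
    let ?a2 = "ldist (lx (ctrg x)) a" and ?b2 = "ldist (lx (ctrg y))"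
    \<comment> \<open>Compatibility of a horizontal composite is a chain of four moves: naturality
      of \<open>y\<close> at \<open>?a2\<close>, compatibility of \<open>y\<close>,
      \<open>?G1\<close> of the compatibility of \<open>x\<close>, and naturality of the law of
      \<open>csrc y\<close> at the component of \<open>x\<close>.\<close>
    have "amap ?G1 ?a2 \<cdot>\<^bsub>lcat ?P''\<^esub> amap ?G1 (ccomp x (TO (fst ?P) a)) =
        amap ?G1 (TA (fst ?P') (ccomp x a)) \<cdot>\<^bsub>lcat ?P''\<^esub> amap ?G1 (ldist (lx (csrc x)) a)"
      using x.ntd[OF a, THEN arg_cong, of "amap ?G1"] by simp
    moreover have "amap ?G2 ?a2 \<cdot>\<^bsub>lcat ?P''\<^esub> ccomp y (omap ?F2 (TO (fst ?P) a)) \<cdot>\<^bsub>lcat ?P''\<^esub> w =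
      ccomp y (TO (fst ?P') (omap ?F2 a)) \<cdot>\<^bsub>lcat ?P''\<^esub> amap ?G1 ?a2 \<cdot>\<^bsub>lcat ?P''\<^esub> w"
      if "w \<in> Arr (lcat ?P'')" "Cod (lcat ?P'') w = omap ?G1 (omap ?F2 (TO (fst ?P) a))" for w
      using yn[of ?a2 w] that by simp
    moreover have "?b2 (omap ?F2 a) \<cdot>\<^bsub>lcat ?P''\<^esub> ccomp y (TO (fst ?P') (omap ?F2 a)) \<cdot>\<^bsub>lcat ?P''\<^esub> w =
      TA (fst ?P'') (ccomp y (omap ?F2 a)) \<cdot>\<^bsub>lcat ?P''\<^esub> ldist (lx (csrc y)) (omap ?F2 a) \<cdot>\<^bsub>lcat ?P''\<^esub> w"
      if "w \<in> Arr (lcat ?P'')" "Cod (lcat ?P'') w = omap ?G1 (TO (fst ?P') (omap ?F2 a))" for w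
      using reassoc[OF cat y.ntd[of "omap ?F2 a"], of w] that by simp
    moreover have "ldist (lx (csrc y)) (omap ?F2 a) \<cdot>\<^bsub>lcat ?P''\<^esub> amap ?G1 (TA (fst ?P') (ccomp x a)) \<cdot>\<^bsub>lcat ?P''\<^esub> w =
      TA (fst ?P'') (amap ?G1 (ccomp x a)) \<cdot>\<^bsub>lcat ?P''\<^esub> ldist (lx (csrc y)) (omap ?F1 a) \<cdot>\<^bsub>lcat ?P''\<^esub> w"
      if "w \<in> Arr (lcat ?P'')" "Cod (lcat ?P'') w = omap ?G1 (TO (fst ?P') (omap ?F1 a))" for w
      using reassoc[OF cat y.m.dist_nat[of "ccomp x a"], of w] that by simp
    ultimately show "?b2 (omap ?F2 a) \<cdot>\<^bsub>lcat ?P''\<^esub> amap ?G2 ?a2 \<cdot>\<^bsub>lcat ?P''\<^esub>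
        ccomp y (omap ?F2 (TO (fst ?P) a)) \<cdot>\<^bsub>lcat ?P''\<^esub> amap ?G1 (ccomp x (TO (fst ?P) a)) =
      TA (fst ?P'') (ccomp y (omap ?F2 a)) \<cdot>\<^bsub>lcat ?P''\<^esub> TA (fst ?P'') (amap ?G1 (ccomp x a)) \<cdot>\<^bsub>lcat ?P''\<^esub>
        ldist (lx (csrc y)) (omap ?F1 a) \<cdot>\<^bsub>lcat ?P''\<^esub> amap ?G1 (ldist (lx (csrc x)) a)"
      by simp
  qed
  then show ?thesis using assms x y Q_h by (simp add: lax_cells_def)
qed

lemma category_vertical: "category (vertical B)"
  unfolding category_def vertical_def B_def
proof (simp add: K_D cell_id_K cell_vcomp_K, intro conjI ballI impI)
  fix x assume x: "x \<in> K"
  note xx = K_D[OF x]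
  interpret x: lax_trans "fst (lsrc (lx (csrc x)))" "fst (ltrg (lx (csrc x)))" "lfun (lx (csrc x))" "ldist (lx (csrc x))"
    "lfun (lx (ctrg x))" "ldist (lx (ctrg x))" "ccomp x" using xx by simp
  have "ccomp (cell_vcomp lx x (cell_id lx (csrc x))) = ccomp x"
    by (rule extensionalityI[OF cell_extensional(2)]) (simp_all add: xx)
  then show "cell_vcomp lx x (cell_id lx (csrc x)) = x" by (simp add: cell_eqI)
  have "ccomp (cell_vcomp lx (cell_id lx (ctrg x)) x) = ccomp x"
    by (rule extensionalityI[OF cell_extensional(2)]) (simp_all add: xx)
  then show "cell_vcomp lx (cell_id lx (ctrg x)) x = x" by (simp add: cell_eqI)
next
  fix x y z assume xyz: "x \<in> K" "y \<in> K" "z \<in> K" "ctrg x = csrc y" "ctrg y = csrc z"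
  note xx = K_D[OF xyz(1)] and yy = K_D[OF xyz(2)] and zz = K_D[OF xyz(3)]
  let ?P = "lsrc (lx (csrc x))" and ?P' = "ltrg (lx (csrc x))"
  interpret x: lax_trans "fst ?P" "fst ?P'" "lfun (lx (csrc x))" "ldist (lx (csrc x))"
    "lfun (lx (csrc y))" "ldist (lx (csrc y))" "ccomp x" using xx xyz by simp
  interpret y: lax_trans "fst ?P" "fst ?P'" "lfun (lx (csrc y))" "ldist (lx (csrc y))"
    "lfun (lx (csrc z))" "ldist (lx (csrc z))" "ccomp y" using xx yy xyz by simp
  interpret z: lax_trans "fst ?P" "fst ?P'" "lfun (lx (csrc z))" "ldist (lx (csrc z))"
    "lfun (lx (ctrg z))" "ldist (lx (ctrg z))" "ccomp z" using xx yy zz xyz by simp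
  have [simp]: "lsrc (lx (csrc y)) = ?P" "ltrg (lx (csrc y)) = ?P'" using xx yy xyz by auto
  have "ccomp (cell_vcomp lx (cell_vcomp lx z y) x) = ccomp (cell_vcomp lx z (cell_vcomp lx y x))"
    by (rule extensionalityI[OF cell_extensional(2)[of lx _ x]])
      (use cell_extensional(2)[of lx z "cell_vcomp lx y x"] in simp_all)
  then show "cell_vcomp lx (cell_vcomp lx z y) x = cell_vcomp lx z (cell_vcomp lx y x)"
    by (simp add: cell_eqI)
qed

lemma category_horizontal: "category (horizontal B)"
  unfolding category_def horizontal_def B_def
proof (simp add: K_D cell_id_K cell_hcomp_K, intro conjI ballI impI)
  fix x assume x: "x \<in> K"
  note xx = K_D[OF x]
  interpret x: lax_trans "fst (lsrc (lx (csrc x)))" "fst (ltrg (lx (csrc x)))" "lfun (lx (csrc x))" "ldist (lx (csrc x))"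
    "lfun (lx (ctrg x))" "ldist (lx (ctrg x))" "ccomp x" using xx by simp
  have [simp]: "cmp (ctrg x) (idm (lsrc (lx (csrc x)))) = ctrg x" "cmp (idm (ltrg (lx (csrc x)))) (ctrg x) = ctrg x"
    using xx cmp_id[of "ctrg x"] by simp_all
  have "ccomp (cell_hcomp lx cmp x (cell_id lx (idm (lsrc (lx (csrc x)))))) = ccomp x"
    by (rule extensionalityI[OF cell_extensional(3)]) (simp_all add: xx)
  then show "cell_hcomp lx cmp x (cell_id lx (idm (lsrc (lx (csrc x))))) = x" by (simp add: cell_eqI xx)
  have "ccomp (cell_hcomp lx cmp (cell_id lx (idm (ltrg (lx (csrc x))))) x) = ccomp x"
    by (rule extensionalityI[OF cell_extensional(3)]) (simp_all add: xx)
  then show "cell_hcomp lx cmp (cell_id lx (idm (ltrg (lx (csrc x))))) x = x" by (simp add: cell_eqI xx)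
next
  fix x y z assume xyz: "x \<in> K" "y \<in> K" "z \<in> K" "ltrg (lx (csrc x)) = lsrc (lx (csrc y))"
    "ltrg (lx (csrc y)) = lsrc (lx (csrc z))"
  note xx = K_D[OF xyz(1)] and yy = K_D[OF xyz(2)] and zz = K_D[OF xyz(3)]
  let ?P = "lsrc (lx (csrc x))" and ?P' = "lsrc (lx (csrc y))" and ?P'' = "lsrc (lx (csrc z))" and ?R = "ltrg (lx (csrc z))"
  interpret x: lax_trans "fst ?P" "fst ?P'" "lfun (lx (csrc x))" "ldist (lx (csrc x))"
    "lfun (lx (ctrg x))" "ldist (lx (ctrg x))" "ccomp x" using xx xyz by simp
  interpret y: lax_trans "fst ?P'" "fst ?P''" "lfun (lx (csrc y))" "ldist (lx (csrc y))"
    "lfun (lx (ctrg y))" "ldist (lx (ctrg y))" "ccomp y" using yy xyz by simp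
  interpret z: lax_trans "fst ?P''" "fst ?R" "lfun (lx (csrc z))" "ldist (lx (csrc z))"
    "lfun (lx (ctrg z))" "ldist (lx (ctrg z))" "ccomp z" using zz xyz by simp
  have [simp]: "lsrc (lx (ctrg x)) = ?P" using xx by simp
  have "ccomp (cell_hcomp lx cmp (cell_hcomp lx cmp z y) x) = ccomp (cell_hcomp lx cmp z (cell_hcomp lx cmp y x))"
    by (rule extensionalityI[OF cell_extensional(3)[of lx cmp _ x]])
      (use cell_extensional(3)[of lx cmp z "cell_hcomp lx cmp y x"] xyz in simp_all)
  then show "cell_hcomp lx cmp (cell_hcomp lx cmp z y) x = cell_hcomp lx cmp z (cell_hcomp lx cmp y x)"
    using xx yy zz xyz by (simp add: cell_eqI cmp_assoc)
qed

lemma hcomp_id: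
  assumes "m \<in> M" "n \<in> M" "ltrg (lx m) = lsrc (lx n)"
  shows "cell_hcomp lx cmp (cell_id lx n) (cell_id lx m) = cell_id lx (cmp n m)"
proof -
  interpret m: lax_morphism "fst (lsrc (lx m))" "fst (lsrc (lx n))" "lfun (lx m)" "ldist (lx m)"
    using lax_morphism_of_M[OF assms(1)] assms by simp
  interpret n: lax_morphism "fst (lsrc (lx n))" "fst (ltrg (lx n))" "lfun (lx n)" "ldist (lx n)" by (rule lax_morphism_of_M[OF assms(2)])
  have "ccomp (cell_hcomp lx cmp (cell_id lx n) (cell_id lx m)) = ccomp (cell_id lx (cmp n m))"
    by (rule extensionalityI[OF cell_extensional(3)])
      (use cell_extensional(1)[of lx "cmp n m"] assms in simp_all)
  then show ?thesis by (simp add: cell_eqI)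
qed

lemma interchange:
  assumes xy: "x \<in> K" "x' \<in> K" "y \<in> K" "y' \<in> K" "ctrg x = csrc x'" "ctrg y = csrc y'"
    "ltrg (lx (csrc x)) = lsrc (lx (csrc y))"
  shows "cell_hcomp lx cmp (cell_vcomp lx y' y) (cell_vcomp lx x' x) =
    cell_vcomp lx (cell_hcomp lx cmp y' x') (cell_hcomp lx cmp y x)"
proof -
  note xx = K_D[OF xy(1)] and xx' = K_D[OF xy(2)] and yy = K_D[OF xy(3)] and yy' = K_D[OF xy(4)]
  let ?P = "lsrc (lx (csrc x))" and ?P' = "lsrc (lx (csrc y))" and ?P'' = "ltrg (lx (csrc y))"
  have [simp]: "lsrc (lx (csrc x')) = ?P" "lsrc (lx (csrc y')) = ?P'" "ltrg (lx (csrc y')) = ?P''"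
    using xx xx' yy yy' xy by auto
  interpret x: lax_trans "fst ?P" "fst ?P'" "lfun (lx (csrc x))" "ldist (lx (csrc x))"
    "lfun (lx (csrc x'))" "ldist (lx (csrc x'))" "ccomp x" using xx xy by simp
  interpret x': lax_trans "fst ?P" "fst ?P'" "lfun (lx (csrc x'))" "ldist (lx (csrc x'))"
    "lfun (lx (ctrg x'))" "ldist (lx (ctrg x'))" "ccomp x'" using xx xx' xy by simp
  interpret y: lax_trans "fst ?P'" "fst ?P''" "lfun (lx (csrc y))" "ldist (lx (csrc y))"
    "lfun (lx (csrc y'))" "ldist (lx (csrc y'))" "ccomp y" using yy xy by simp
  interpret y': lax_trans "fst ?P'" "fst ?P''" "lfun (lx (csrc y'))" "ldist (lx (csrc y'))"
    "lfun (lx (ctrg y'))" "ldist (lx (ctrg y'))" "ccomp y'" using yy yy' xy by simp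
  \<comment> \<open>The interchange law rests on this square: \<open>y\<close> is natural at the
    components of \<open>x'\<close>.\<close>
  have n: "ccomp y (omap (lfun (lx (ctrg x'))) a) \<cdot>\<^bsub>lcat ?P''\<^esub> amap (lfun (lx (csrc y))) (ccomp x' a) \<cdot>\<^bsub>lcat ?P''\<^esub> w
    = amap (lfun (lx (csrc y'))) (ccomp x' a) \<cdot>\<^bsub>lcat ?P''\<^esub> ccomp y (omap (lfun (lx (csrc x'))) a) \<cdot>\<^bsub>lcat ?P''\<^esub> w"
    if "a \<in> Obj (lcat ?P)" "w \<in> Arr (lcat ?P'')" "Cod (lcat ?P'') w = omap (lfun (lx (csrc y))) (omap (lfun (lx (csrc x'))) a)"
    for a w
    using reassoc[OF y.m.T.cats(1) y.cell_nat[of "ccomp x' a"], of w] that by simp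
  have "ccomp (cell_hcomp lx cmp (cell_vcomp lx y' y) (cell_vcomp lx x' x)) =
    ccomp (cell_vcomp lx (cell_hcomp lx cmp y' x') (cell_hcomp lx cmp y x))"
    by (rule extensionalityI[OF cell_extensional(3)])
      (use cell_extensional(2)[of lx "cell_hcomp lx cmp y' x'" "cell_hcomp lx cmp y x"] xy n in simp_all)
  then show ?thesis by (simp add: cell_eqI)
qed

theorem two_category_B: "two_category B"
  unfolding two_category_def
  using category_B category_vertical category_horizontal
  by (simp add: B_def K_D hcomp_id interchange)

end

section \<open>The slice category and its tangent bundle functor\<close>

text \<open>The part of the slice that can be developed before fibre powers are available. Over a
  terminal object it serves to construct them.\<close>

locale tangent_slice0 = tangent_cat X for X :: "'b utng" +
  fixes A :: "'b univ" and pb :: "'b choice"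
  assumes choice: "pullback_choice pb" and A [simp]: "A \<in> Obj (Cat X)" and sliceable: "sliceable X A"
begin

abbreviation "Y \<equiv> slice_tng pb X A"
abbreviation "S \<equiv> Cat Y"
abbreviation "V \<equiv> vert pb X A"
abbreviation comp_S (infixr "\<star>" 75) where "comp_S \<equiv> Comp S"

text \<open>The raw constructions are folded into the fields of \<open>Y\<close>, so that the facts
  on tangent functors apply to the slice in the same form as to \<open>X\<close>.\<close>

lemma slice_cat_eq: "slice_cat C A = S"
  and sliceT_eq: "sliceT pb X A = TanF Y"
  and sliceproj_eq: "sliceproj pb X A = projT Y"
  and slicepi1_eq: "slicepi1 pb X A = pi1T Y"
  and slicepi2_eq: "slicepi2 pb X A = pi2T Y"
  and sliceTO_eq: "sliceTO pb X A = TO Y"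
  by (simp_all add: slice_tng_def Let_def sliceT_def)

lemma S_Obj: "f \<in> Obj S \<longleftrightarrow> f \<in> Arr C \<and> Cod C f = A"
  unfolding slice_cat_eq[symmetric] slice_cat_def by auto

lemma Obj_S [simp]: "f \<in> Obj S \<Longrightarrow> f \<in> Arr C" "f \<in> Obj S \<Longrightarrow> Cod C f = A"
  by (auto simp: S_Obj)

lemma S_Arr: "k \<in> Arr S \<longleftrightarrow> (\<exists>f g f'. k = Tri f g f' \<and> f \<in> Obj S \<and> f' \<in> Obj S \<and>
    g \<in> Hom C (Dom C f) (Dom C f') \<and> f' \<cdot> g = f)"
  unfolding S_Obj unfolding slice_cat_eq[symmetric] slice_cat_def by auto

lemma S_Tri [simp]: "Dom S (Tri f g f') = f" "Cod S (Tri f g f') = f'"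
  unfolding slice_cat_eq[symmetric] slice_cat_def by auto

lemma S_TriI [simp]:
  "f \<in> Obj S \<Longrightarrow> f' \<in> Obj S \<Longrightarrow> g \<in> Arr C \<Longrightarrow> Dom C g = Dom C f \<Longrightarrow> Cod C g = Dom C f' \<Longrightarrow> f' \<cdot> g = f \<Longrightarrow>
    Tri f g f' \<in> Arr S"
  unfolding S_Arr by auto

lemma S_comp: "h \<star> k = Tri (Dom S k) (tmap h \<cdot> tmap k) (Cod S h)"
  and S_Id: "Id S f = Tri f (Id C (Dom C f)) f"
  and S_src: "tsrc k = Dom S k" and S_trg: "ttrg k = Cod S k"
  unfolding slice_cat_eq[symmetric] slice_cat_def by auto

lemma Arr_S [simp]:
  assumes "k \<in> Arr S"
  shows "tmap k \<in> Arr C" "Dom C (tmap k) = Dom C (Dom S k)" "Cod C (tmap k) = Dom C (Cod S k)"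
    "Cod S k \<cdot> tmap k = Dom S k" "Dom S k \<in> Obj S" "Cod S k \<in> Obj S"
  using assms unfolding S_Arr by auto

lemma S_eqI:
  "k \<in> Arr S \<Longrightarrow> k' \<in> Arr S \<Longrightarrow> Dom S k = Dom S k' \<Longrightarrow> Cod S k = Cod S k' \<Longrightarrow> tmap k = tmap k' \<Longrightarrow> k = k'"
  unfolding S_Arr by (elim exE conjE) simp

lemma Tri_eta: "k \<in> Arr S \<Longrightarrow> Tri (Dom S k) (tmap k) (Cod S k) = k"
  unfolding S_Arr by auto

lemma tmap_comp [simp]: "tmap (h \<star> k) = tmap h \<cdot> tmap k"
  and tmap_Id [simp]: "tmap (Id S f) = Id C (Dom C f)"
  by (simp_all add: S_comp S_Id)

lemma over_comp:
  assumes "k \<in> Arr S" "x \<in> Arr C" "Cod C x = Dom C (Dom S k)" "Cod S k = f"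
  shows "f \<cdot> tmap k \<cdot> x = Dom S k \<cdot> x"
  using reassoc[OF cats(1) Arr_S(4)[OF assms(1)], of x] assms Obj_S(1)[OF Arr_S(6)[OF assms(1)]]
  by auto

lemma category_S [simp]: "category S"
  unfolding category_def
proof (intro conjI ballI impI)
  fix f g assume fg: "f \<in> Arr S" "g \<in> Arr S" "Cod S f = Dom S g"
  have "Cod S g \<cdot> tmap g \<cdot> tmap f = Dom S f"
    using fg over_comp[of g "tmap f"] Arr_S(4)[of f] by simp
  then show "g \<star> f \<in> Hom S (Dom S f) (Cod S g)"
    using fg by (simp add: S_comp del: Arr_S(4))
next
  fix f g h assume fg: "f \<in> Arr S" "g \<in> Arr S" "h \<in> Arr S" "Cod S f = Dom S g" "Cod S g = Dom S h"
  show "(h \<star> g) \<star> f = h \<star> g \<star> f"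
    using fg by (simp add: S_comp)
next
  fix f assume f: "f \<in> Arr S"
  then show "f \<star> Id S (Dom S f) = f" "Id S (Cod S f) \<star> f = f"
    using Tri_eta[of f] by (simp_all add: S_comp S_Id)
qed (simp_all add: S_Id)

text \<open>The chosen pullback is isomorphic to the one that is preserved by assumption, hence
  preserved itself. Its second projection equals \<open>f \<circ> p \<circ> v_f\<close>, by
  \<open>p \<circ> z = id\<close> and naturality of \<open>p\<close>; so it is the object
  \<open>TO Y f\<close> of the slice.\<close>

lemma vert_pullback:
  assumes f: "f \<in> Obj S"
  shows "T_pullback X (TA X f) (zeroT X A) (V f) (TO Y f)"
proof -
  obtain q1 q2 where q: "T_pullback X (TA X f) (zeroT X A) q1 q2"
    using sliceable f unfolding sliceable_def by (metis Obj_S)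
  let ?q = "snd (pb C (TA X f) (zeroT X A))"
  have pb: "is_pullback C (TA X f) (zeroT X A) (V f) ?q"
    using choice T_pullback_pullback[OF q] cats(1) unfolding pullback_choice_def vert_def by blast
  note [simp] = pullbackD(3-7)[OF pb]
  have "?q = projT X A \<cdot> zeroT X A \<cdot> ?q"
    using reassoc[OF cats(1) proj_zero[OF A], of ?q] f by simp
  also have "\<dots> = projT X A \<cdot> TA X f \<cdot> V f"
    using pullbackD(9)[OF pb] by simp
  also have "\<dots> = f \<cdot> projT X (Dom C f) \<cdot> V f"
    using f reassoc[OF cats(1) p_nat[of f], of "V f"] by simp
  finally have "?q = TO Y f" unfolding sliceTO_eq[symmetric] sliceTO_def .
  then show ?thesis using T_pullback_transfer[OF q pb] by simp
qed

lemma vert_typing [simp]: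
  assumes f: "f \<in> Obj S"
  shows "V f \<in> Arr C" "Dom C (V f) = Dom C (TO Y f)" "Cod C (V f) = TO X (Dom C f)" "TO Y f \<in> Obj S"
proof -
  note q = pullbackD[OF T_pullback_pullback[OF vert_pullback[OF f]]]
  show "TO Y f \<in> Obj S" unfolding S_Obj using q(4,6) by simp
  show "V f \<in> Arr C" "Dom C (V f) = Dom C (TO Y f)" "Cod C (V f) = TO X (Dom C f)"
    using q(3,5,7) f by simp_all
qed

lemma vert_eq: "f \<in> Obj S \<Longrightarrow> TA X f \<cdot> V f = zeroT X A \<cdot> TO Y f"
  by (rule pullbackD(9)[OF T_pullback_pullback[OF vert_pullback]])

lemma TO_Y: "f \<in> Obj S \<Longrightarrow> f \<cdot> projT X (Dom C f) \<cdot> V f = TO Y f"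
  unfolding sliceTO_eq[symmetric] sliceTO_def ..

lemma vert_eq_comp: "f \<in> Obj S \<Longrightarrow> x \<in> Arr C \<Longrightarrow> Cod C x = Dom C (TO Y f) \<Longrightarrow>
    TA X f \<cdot> V f \<cdot> x = zeroT X A \<cdot> TO Y f \<cdot> x"
  using reassoc[OF cats(1) vert_eq[of f], of x] by simp

lemma z_A_mono:
  assumes "x \<in> Arr C" "x' \<in> Arr C" "Cod C x = A" "Cod C x' = A" "zeroT X A \<cdot> x = zeroT X A \<cdot> x'"
  shows "x = x'"
proof -
  have "projT X A \<cdot> zeroT X A \<cdot> x = x" "projT X A \<cdot> zeroT X A \<cdot> x' = x'"
    using assms(1-4) reassoc[OF cats(1) proj_zero[OF A]] by simp_all
  then show ?thesis using assms(5) by metis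
qed

text \<open>\<open>V f\<close> is a pullback of \<open>z_A\<close>, which is a split
  monomorphism.\<close>

lemma vert_mono:
  assumes "f \<in> Obj S" "x \<in> Arr C" "x' \<in> Arr C" "Cod C x = Dom C (TO Y f)" "Cod C x' = Dom C (TO Y f)"
    "Dom C x = Dom C x'" "V f \<cdot> x = V f \<cdot> x'"
  shows "x = x'"
proof (rule pullback_unique[OF cats(1) T_pullback_pullback[OF vert_pullback[OF assms(1)]]])
  show "TO Y f \<cdot> x = TO Y f \<cdot> x'"
    by (rule z_A_mono) (use assms vert_eq_comp[of f x] vert_eq_comp[of f x'] in simp_all)
qed (use assms in simp_all)

text \<open>The second leg \<open>x\<close> of the cone becomes the composite with
  \<open>TO Y f\<close>, which is the triangle over \<open>A\<close> wanted in the slice.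
  \<open>vert_mono\<close> gives the uniqueness in the definite description.\<close>

lemma into_props:
  assumes "f \<in> Obj S" "h \<in> Arr C" "Cod C h = TO X (Dom C f)" "x \<in> Arr C" "Dom C x = Dom C h" "Cod C x = A"
    "TA X f \<cdot> h = zeroT X A \<cdot> x"
  shows "into pb X A f h \<in> Arr C" "Dom C (into pb X A f h) = Dom C h" "Cod C (into pb X A f h) = Dom C (TO Y f)"
    "V f \<cdot> into pb X A f h = h" "TO Y f \<cdot> into pb X A f h = x"
proof -
  obtain k where k: "k \<in> Hom C (Dom C h) (Dom C (V f))" "V f \<cdot> k = h" "TO Y f \<cdot> k = x"
    by (rule pullback_obtain[OF T_pullback_pullback[OF vert_pullback[OF assms(1)]], of h "Dom C h" x])
      (use assms in simp_all)
  have "into pb X A f h = k"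
    unfolding into_def
  proof (rule the_equality)
    show "k' = k" if "k' \<in> Hom C (Dom C h) (Dom C (V f)) \<and> V f \<cdot> k' = h" for k'
      by (rule vert_mono[of f]) (use that k assms in simp_all)
  qed (use k in simp)
  then show "into pb X A f h \<in> Arr C" "Dom C (into pb X A f h) = Dom C h" "Cod C (into pb X A f h) = Dom C (TO Y f)"
    "V f \<cdot> into pb X A f h = h" "TO Y f \<cdot> into pb X A f h = x"
    using k assms by simp_all
qed

lemma TA_Y_props:
  assumes k: "k \<in> Arr S"
  shows "TA Y k \<in> Arr S" "Dom S (TA Y k) = TO Y (Dom S k)" "Cod S (TA Y k) = TO Y (Cod S k)"
    "V (Cod S k) \<cdot> tmap (TA Y k) = TA X (tmap k) \<cdot> V (Dom S k)"
proof -
  let ?h = "TA X (tmap k) \<cdot> V (Dom S k)"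
  have e: "TA Y k = Tri (TO Y (Dom S k)) (into pb X A (Cod S k) ?h) (TO Y (Cod S k))"
    unfolding sliceT_eq[symmetric] sliceT_def by (simp add: sliceTO_eq S_src S_trg)
  \<comment> \<open>The triangle of \<open>k\<close> under \<open>T\<close>; it shows that
    \<open>?h\<close> lies over the zero section of \<open>A\<close> and so factors through
    \<open>v\<close>.\<close>
  have "TA X (Cod S k) \<cdot> TA X (tmap k) = TA X (Dom S k)"
    using k by (simp flip: amap_comp)
  then have "TA X (Cod S k) \<cdot> ?h = zeroT X A \<cdot> TO Y (Dom S k)"
    using k reassoc[OF cats(1), of "TA X (Cod S k)" "TA X (tmap k)" _ "V (Dom S k)"] by (simp add: vert_eq)
  note i = into_props[OF _ _ _ _ _ _ this]
  show "TA Y k \<in> Arr S" "Dom S (TA Y k) = TO Y (Dom S k)" "Cod S (TA Y k) = TO Y (Cod S k)"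
    "V (Cod S k) \<cdot> tmap (TA Y k) = TA X (tmap k) \<cdot> V (Dom S k)"
    using k i unfolding e by simp_all
qed

lemma TA_Y_typing [simp]:
  "k \<in> Arr S \<Longrightarrow> TA Y k \<in> Arr S" "k \<in> Arr S \<Longrightarrow> Dom S (TA Y k) = TO Y (Dom S k)"
  "k \<in> Arr S \<Longrightarrow> Cod S (TA Y k) = TO Y (Cod S k)"
  by (simp_all add: TA_Y_props)

lemma V_nat:
  assumes "k \<in> Arr S" "Cod S k = f"
  shows "V f \<cdot> tmap (TA Y k) = TA X (tmap k) \<cdot> V (Dom S k)"
  using assms TA_Y_props(4)[of k] by simp

lemma V_nat_comp:
  assumes "k \<in> Arr S" "Cod S k = f" "x \<in> Arr C" "Cod C x = Dom C (TO Y (Dom S k))"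
  shows "V f \<cdot> tmap (TA Y k) \<cdot> x = TA X (tmap k) \<cdot> V (Dom S k) \<cdot> x"
  using assms reassoc[OF cats(1) V_nat[of k f], of x] by auto

lemma TS_eqI:
  assumes "k \<in> Arr S" "k' \<in> Arr S" "Dom S k = Dom S k'" "Cod S k = TO Y f" "Cod S k' = TO Y f" "f \<in> Obj S"
    "V f \<cdot> tmap k = V f \<cdot> tmap k'"
  shows "k = k'"
  by (rule S_eqI, use assms in simp_all, rule vert_mono[of f]) (use assms in simp_all)

lemma slice_endo: "is_functor S S (TanF Y)"
  unfolding is_functor_def
proof (intro conjI ballI impI)
  fix f assume f: "f \<in> Obj S"
  show "TA Y (Id S f) = Id S (TO Y f)"
    by (rule TS_eqI[of _ _ f]) (use f in \<open>simp_all add: V_nat\<close>)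
next
  fix f g assume fg: "f \<in> Arr S" "g \<in> Arr S" "Cod S f = Dom S g"
  show "TA Y (g \<star> f) = TA Y g \<star> TA Y f"
    by (rule TS_eqI[of _ _ "Cod S g"]) (use fg in \<open>simp_all add: V_nat V_nat_comp\<close>)
qed simp_all

sublocale Y: tangent_endo Y by standard (rule slice_endo)

subsection \<open>Iterated slice tangent bundles as pullbacks along the iterated zero section\<close>

text \<open>The map belonging to \<open>f\<close> itself is applied last, so the recursion changes
  \<open>f\<close> and inductions generalise over it. For \<open>m = 2\<close> this is
  \<open>T v_f\<close> after \<open>v\<close> of \<open>TO Y f\<close>, up to an identity.\<close>

fun iter_vert :: "nat \<Rightarrow> 'b univ \<Rightarrow> 'b univ" where
  "iter_vert 0 f = Id C (Dom C f)"
| "iter_vert (Suc m) f = (TA X ^^ m) (V f) \<cdot> iter_vert m (TO Y f)"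

fun iter_zero :: "nat \<Rightarrow> 'b univ" where
  "iter_zero 0 = Id C A"
| "iter_zero (Suc m) = (TA X ^^ m) (zeroT X A) \<cdot> iter_zero m"

lemma iter_zero_typing [simp]: "iter_zero m \<in> Arr C" "Dom C (iter_zero m) = A" "Cod C (iter_zero m) = (TO X ^^ m) A"
proof -
  have "iter_zero m \<in> Arr C \<and> Dom C (iter_zero m) = A \<and> Cod C (iter_zero m) = (TO X ^^ m) A"
    by (induction m) (auto simp: funpow_swap1)
  then show "iter_zero m \<in> Arr C" "Dom C (iter_zero m) = A" "Cod C (iter_zero m) = (TO X ^^ m) A" by auto
qed

lemma iter_vert_typing [simp]:
  assumes "f \<in> Obj S"
  shows "iter_vert m f \<in> Arr C" "Dom C (iter_vert m f) = Dom C ((TO Y ^^ m) f)" "Cod C (iter_vert m f) = (TO X ^^ m) (Dom C f)"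
proof -
  have "iter_vert m f \<in> Arr C \<and> Dom C (iter_vert m f) = Dom C ((TO Y ^^ m) f) \<and> Cod C (iter_vert m f) = (TO X ^^ m) (Dom C f)"
    using assms by (induction m arbitrary: f) (auto simp: funpow_swap1)
  then show "iter_vert m f \<in> Arr C" "Dom C (iter_vert m f) = Dom C ((TO Y ^^ m) f)" "Cod C (iter_vert m f) = (TO X ^^ m) (Dom C f)"
    by auto
qed

lemma TA_pow_TA: "(TA X ^^ m) (TA X f) = TA X ((TA X ^^ m) f)"
  "(TO X ^^ m) (TO X a) = TO X ((TO X ^^ m) a)"
  "(TA Y ^^ m) (TA Y k) = TA Y ((TA Y ^^ m) k)"
  "(TO Y ^^ m) (TO Y b) = TO Y ((TO Y ^^ m) b)"
  by (simp_all add: funpow_swap1)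

lemma TA_pow_vert_eq:
  assumes "f \<in> Obj S" "x \<in> Arr C" "Cod C x = (TO X ^^ m) (Dom C (TO Y f))"
  shows "TA X ((TA X ^^ m) f) \<cdot> (TA X ^^ m) (V f) \<cdot> x = (TA X ^^ m) (zeroT X A) \<cdot> (TA X ^^ m) (TO Y f) \<cdot> x"
  using reassoc[OF cats(1) pullbackD(9)[OF T_pullback_pow[OF vert_pullback[OF assms(1)], of m]], of x] assms
  by (simp add: TA_pow_TA)

text \<open>The \<open>T^m\<close>-image of the pullback square of \<open>f\<close> trades
  \<open>T^(m+1) f\<close> for a zero and \<open>T^m (TO Y f)\<close>; the induction hypothesis at
  \<open>TO Y f\<close> does the rest.\<close>

lemma iter_vert_base:
  assumes "f \<in> Obj S" "x \<in> Arr C" "Cod C x = Dom C ((TO Y ^^ m) f)"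
  shows "(TA X ^^ m) f \<cdot> iter_vert m f \<cdot> x = iter_zero m \<cdot> (TO Y ^^ m) f \<cdot> x"
  using assms(1,3)
proof (induction m arbitrary: f)
  case 0
  then show ?case using assms(2) by simp
next
  case (Suc m)
  have "(TO Y ^^ m) (TO Y f) \<in> Obj S" using Suc by simp
  then show ?case
    using Suc.prems Suc.IH[of "TO Y f"] assms(2) TA_pow_vert_eq[of f "iter_vert m (TO Y f) \<cdot> x" m]
    by (simp add: funpow_swap1)
qed

text \<open>The last factor passes by \<open>T^m\<close> of the naturality of \<open>v\<close> at
  \<open>k\<close>, the others by the induction hypothesis at \<open>TA Y k\<close>.\<close>

lemma iter_vert_nat:
  assumes "k \<in> Arr S" "Cod S k = f"
  shows "iter_vert m f \<cdot> tmap ((TA Y ^^ m) k) = (TA X ^^ m) (tmap k) \<cdot> iter_vert m (Dom S k)"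
  using assms
proof (induction m arbitrary: k f)
  case 0
  then show ?case by auto
next
  case (Suc m)
  have "iter_vert m (TO Y f) \<cdot> tmap ((TA Y ^^ m) (TA Y k)) = (TA X ^^ m) (tmap (TA Y k)) \<cdot> iter_vert m (TO Y (Dom S k))"
    using Suc.prems Suc.IH[of "TA Y k" "TO Y f"] by auto
  moreover have "(TA X ^^ m) (V f) \<cdot> (TA X ^^ m) (tmap (TA Y k)) = (TA X ^^ m) (TA X (tmap k)) \<cdot> (TA X ^^ m) (V (Dom S k))"
    using V_nat[OF Suc.prems, THEN arg_cong, of "TA X ^^ m"] Suc.prems by auto
  from reassoc[OF cats(1) this, of "iter_vert m (TO Y (Dom S k))"]
  have "(TA X ^^ m) (V f) \<cdot> (TA X ^^ m) (tmap (TA Y k)) \<cdot> iter_vert m (TO Y (Dom S k)) =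
    (TA X ^^ m) (TA X (tmap k)) \<cdot> (TA X ^^ m) (V (Dom S k)) \<cdot> iter_vert m (TO Y (Dom S k))"
    using Suc.prems by auto
  moreover have "Dom S ((TA Y ^^ m) (TA Y k)) = (TO Y ^^ m) (TO Y (Dom S k))" "Cod S ((TA Y ^^ m) (TA Y k)) = (TO Y ^^ m) (TO Y f)"
    "(TA Y ^^ m) (TA Y k) \<in> Arr S"
    using Suc.prems by simp_all
  moreover have "TO Y f \<in> Obj S" "f \<in> Obj S" using Suc.prems by auto
  ultimately show ?case
    using Suc.prems by (simp add: TA_pow_TA)
qed

lemma iter_vert_nat_comp:
  assumes "k \<in> Arr S" "Cod S k = f" "x \<in> Arr C" "Cod C x = Dom C ((TO Y ^^ m) (Dom S k))"
  shows "iter_vert m f \<cdot> tmap ((TA Y ^^ m) k) \<cdot> x = (TA X ^^ m) (tmap k) \<cdot> iter_vert m (Dom S k) \<cdot> x"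
  using assms reassoc[OF cats(1) iter_vert_nat[of k f m], of x] by auto

text \<open>Each step lifts \<open>h\<close> through the \<open>T^m\<close>-image of the pullback of
  \<open>f\<close>. The lift lies over the iterated zero with one factor fewer, which is the
  hypothesis of the induction at \<open>TO Y f\<close>. This is where preservation by every power of
  \<open>T\<close> is used.\<close>

lemma iter_vert_lift:
  assumes "f \<in> Obj S" "w \<in> Obj S" "h \<in> Arr C" "Dom C h = Dom C w" "Cod C h = (TO X ^^ m) (Dom C f)"
    "(TA X ^^ m) f \<cdot> h = iter_zero m \<cdot> w"
  shows "\<exists>k \<in> Arr C. Dom C k = Dom C w \<and> Cod C k = Dom C ((TO Y ^^ m) f) \<and> (TO Y ^^ m) f \<cdot> k = w \<and> iter_vert m f \<cdot> k = h"
  using assms(1,3-)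
proof (induction m arbitrary: f h)
  case 0
  then show ?case using assms(2) by (intro bexI[of _ h]) simp_all
next
  case (Suc m)
  have pb: "is_pullback C ((TA X ^^ m) (TA X f)) ((TA X ^^ m) (zeroT X A)) ((TA X ^^ m) (V f)) ((TA X ^^ m) (TO Y f))"
    by (rule T_pullback_pow[OF vert_pullback[OF Suc.prems(1)]])
  obtain k0 where k0: "k0 \<in> Hom C (Dom C w) (Dom C ((TA X ^^ m) (V f)))" "(TA X ^^ m) (V f) \<cdot> k0 = h"
    "(TA X ^^ m) (TO Y f) \<cdot> k0 = iter_zero m \<cdot> w"
    by (rule pullback_obtain[OF pb, of h "Dom C w" "iter_zero m \<cdot> w"])
      (use Suc.prems assms(2) in \<open>simp_all add: TA_pow_TA\<close>)
  obtain k where k: "k \<in> Arr C" "Dom C k = Dom C w" "Cod C k = Dom C ((TO Y ^^ m) (TO Y f))"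
    "(TO Y ^^ m) (TO Y f) \<cdot> k = w" "iter_vert m (TO Y f) \<cdot> k = k0"
    using Suc.IH[of "TO Y f" k0] k0 Suc.prems by auto
  show ?case
    using k k0 Suc.prems by (intro bexI[of _ k]) (simp_all add: TA_pow_TA)
qed

lemma iter_vert_mono:
  assumes "f \<in> Obj S" "x \<in> Arr C" "x' \<in> Arr C" "Cod C x = Dom C ((TO Y ^^ m) f)" "Cod C x' = Dom C ((TO Y ^^ m) f)"
    "Dom C x = Dom C x'" "iter_vert m f \<cdot> x = iter_vert m f \<cdot> x'"
  shows "x = x'"
  using assms(1,4,5,7)
proof (induction m arbitrary: f)
  case 0
  then show ?case using assms by simp
next
  case (Suc m)
  have pb: "is_pullback C ((TA X ^^ m) (TA X f)) ((TA X ^^ m) (zeroT X A)) ((TA X ^^ m) (V f)) ((TA X ^^ m) (TO Y f))"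
    by (rule T_pullback_pow[OF vert_pullback[OF Suc.prems(1)]])
  let ?g = "TO Y f" and ?zp = "(TA X ^^ m) (projT X A)"
  \<comment> \<open>\<open>T^m p\<close> splits \<open>T^m z\<close>. So agreement after
    \<open>T^m (V f)\<close> forces agreement after \<open>T^m (TO Y f)\<close> as well, and the
    preserved pullback is jointly monic.\<close>
  have zp: "?zp \<cdot> (TA X ^^ m) (zeroT X A) = Id C ((TO X ^^ m) A)"
    using proj_zero[OF A, THEN arg_cong, of "TA X ^^ m"] by simp
  have e: "(TA X ^^ m) (V f) \<cdot> iter_vert m ?g \<cdot> x = (TA X ^^ m) (V f) \<cdot> iter_vert m ?g \<cdot> x'"
    using Suc.prems assms(2,3) by (simp add: TA_pow_TA)
  have "(TA X ^^ m) (zeroT X A) \<cdot> (TA X ^^ m) ?g \<cdot> iter_vert m ?g \<cdot> x =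
      (TA X ^^ m) (zeroT X A) \<cdot> (TA X ^^ m) ?g \<cdot> iter_vert m ?g \<cdot> x'"
    using TA_pow_vert_eq[of f "iter_vert m ?g \<cdot> x" m] TA_pow_vert_eq[of f "iter_vert m ?g \<cdot> x'" m] e Suc.prems assms(2,3)
    by (simp add: TA_pow_TA)
  then have "?zp \<cdot> (TA X ^^ m) (zeroT X A) \<cdot> (TA X ^^ m) ?g \<cdot> iter_vert m ?g \<cdot> x =
      ?zp \<cdot> (TA X ^^ m) (zeroT X A) \<cdot> (TA X ^^ m) ?g \<cdot> iter_vert m ?g \<cdot> x'" by simp
  then have e': "(TA X ^^ m) ?g \<cdot> iter_vert m ?g \<cdot> x = (TA X ^^ m) ?g \<cdot> iter_vert m ?g \<cdot> x'"
    using reassoc[OF cats(1) zp, of "(TA X ^^ m) ?g \<cdot> iter_vert m ?g \<cdot> x"]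
      reassoc[OF cats(1) zp, of "(TA X ^^ m) ?g \<cdot> iter_vert m ?g \<cdot> x'"] Suc.prems assms(2,3)
    by (simp add: TA_pow_TA)
  have "iter_vert m ?g \<cdot> x = iter_vert m ?g \<cdot> x'"
    by (rule pullback_unique[OF cats(1) pb, of _ "Dom C x"])
      (use e e' Suc.prems assms(2,3,6) in \<open>simp_all add: TA_pow_TA\<close>)
  then show ?case
    using Suc.IH[of ?g] Suc.prems by (simp add: TA_pow_TA)
qed

lemma iter_vert_eqI:
  assumes "k \<in> Arr S" "k' \<in> Arr S" "Dom S k = Dom S k'" "Cod S k = (TO Y ^^ m) f" "Cod S k' = (TO Y ^^ m) f" "f \<in> Obj S"
    "iter_vert m f \<cdot> tmap k = iter_vert m f \<cdot> tmap k'"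
  shows "k = k'"
  by (rule S_eqI, use assms in simp_all, rule iter_vert_mono[of f _ _ m]) (use assms in simp_all)

lemma iter_vert_lift_slice:
  assumes "f \<in> Obj S" "w \<in> Obj S" "h \<in> Arr C" "Dom C h = Dom C w" "Cod C h = (TO X ^^ m) (Dom C f)"
    "(TA X ^^ m) f \<cdot> h = iter_zero m \<cdot> w"
  obtains k where "k \<in> Arr S" "Dom S k = w" "Cod S k = (TO Y ^^ m) f" "iter_vert m f \<cdot> tmap k = h"
proof -
  obtain k where k: "k \<in> Arr C" "Dom C k = Dom C w" "Cod C k = Dom C ((TO Y ^^ m) f)"
      "(TO Y ^^ m) f \<cdot> k = w" "iter_vert m f \<cdot> k = h"
    using iter_vert_lift[OF assms] by blast
  show thesis
    by (rule that[of "Tri w k ((TO Y ^^ m) f)"]) (use k assms(1,2) in simp_all)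
qed

lemma iter_vert_over: "k \<in> Arr S \<Longrightarrow> Cod S k = (TO Y ^^ m) f \<Longrightarrow> f \<in> Obj S \<Longrightarrow>
    (TA X ^^ m) f \<cdot> iter_vert m f \<cdot> tmap k = iter_zero m \<cdot> Dom S k"
  using iter_vert_base[of f "tmap k" m] Arr_S(4)[of k] by simp

lemma V_over: "k \<in> Arr S \<Longrightarrow> Cod S k = TO Y f \<Longrightarrow> f \<in> Obj S \<Longrightarrow> TA X f \<cdot> V f \<cdot> tmap k = zeroT X A \<cdot> Dom S k"
  using vert_eq_comp[of f "tmap k"] Arr_S(4)[of k] by simp

end

section \<open>Rewriting inside composites under powers of the tangent functor\<close>

context tangent_endo
begin

text \<open>\<open>pow_comp\<close> splits the image of a composite, so an equation
  \<open>a \<cdot> b = c\<close> has to be offered in split form on the left and with a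
  tail.\<close>

lemma pow_reassoc:
  assumes "a \<cdot>\<^bsub>Cat X\<^esub> b = c" "a \<in> Arr (Cat X)" "b \<in> Arr (Cat X)" "Cod (Cat X) b = Dom (Cat X) a"
    "x \<in> Arr (Cat X)" "Cod (Cat X) x = (TO X ^^ m) (Dom (Cat X) b)"
  shows "(TA X ^^ m) a \<cdot>\<^bsub>Cat X\<^esub> (TA X ^^ m) b \<cdot>\<^bsub>Cat X\<^esub> x = (TA X ^^ m) c \<cdot>\<^bsub>Cat X\<^esub> x"
  using assms by (simp flip: assms(1))

lemma TA_reassoc:
  assumes "a \<cdot>\<^bsub>Cat X\<^esub> b = c" "a \<in> Arr (Cat X)" "b \<in> Arr (Cat X)" "Cod (Cat X) b = Dom (Cat X) a"
    "x \<in> Arr (Cat X)" "Cod (Cat X) x = TO X (Dom (Cat X) b)"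
  shows "TA X a \<cdot>\<^bsub>Cat X\<^esub> TA X b \<cdot>\<^bsub>Cat X\<^esub> x = TA X c \<cdot>\<^bsub>Cat X\<^esub> x"
  using pow_reassoc[OF assms(1-5), of 1] assms(6) by simp

end

section \<open>The slice tangent structure\<close>

context tangent_slice0
begin

lemma vert2_eq: "vert2 pb X A f = TA X (V f) \<cdot> V (TO Y f)"
  by (simp add: vert2_def sliceTO_eq)

text \<open>The case \<open>m = 2\<close>, followed by \<open>m = 3\<close>, of
  \<open>iter_vert_eqI\<close> with the iterated map unfolded; the equational axioms reach no higher
  than \<open>T^3\<close>.\<close>

lemma TTS_eqI:
  assumes "k \<in> Arr S" "k' \<in> Arr S" "Dom S k = Dom S k'" "Cod S k = TO Y (TO Y f)" "Cod S k' = TO Y (TO Y f)" "f \<in> Obj S"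
    "TA X (V f) \<cdot> V (TO Y f) \<cdot> tmap k = TA X (V f) \<cdot> V (TO Y f) \<cdot> tmap k'"
  shows "k = k'"
  by (rule iter_vert_eqI[of _ _ "Suc (Suc 0)" f]) (use assms in simp_all)

lemma TTTS_eqI:
  assumes "k \<in> Arr S" "k' \<in> Arr S" "Dom S k = Dom S k'" "Cod S k = TO Y (TO Y (TO Y f))" "Cod S k' = TO Y (TO Y (TO Y f))"
    "f \<in> Obj S" "TA X (TA X (V f)) \<cdot> TA X (V (TO Y f)) \<cdot> V (TO Y (TO Y f)) \<cdot> tmap k =
      TA X (TA X (V f)) \<cdot> TA X (V (TO Y f)) \<cdot> V (TO Y (TO Y f)) \<cdot> tmap k'"
  shows "k = k'"
  by (rule iter_vert_eqI[of _ _ "Suc (Suc (Suc 0))" f]) (use assms in simp_all)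

lemma into2_props:
  assumes "f \<in> Obj S" "h \<in> Arr C" "Cod C h = TO X (TO X (Dom C f))" "x \<in> Obj S" "Dom C x = Dom C h"
    "TA X (TA X f) \<cdot> h = TA X (zeroT X A) \<cdot> zeroT X A \<cdot> x"
  shows "into2 pb X A f h \<in> Arr C" "Dom C (into2 pb X A f h) = Dom C h"
    "Cod C (into2 pb X A f h) = Dom C (TO Y (TO Y f))"
    "TA X (V f) \<cdot> V (TO Y f) \<cdot> into2 pb X A f h = h" "TO Y (TO Y f) \<cdot> into2 pb X A f h = x"
proof -
  have "\<exists>k\<in>Arr C. Dom C k = Dom C x \<and> Cod C k = Dom C ((TO Y ^^ Suc (Suc 0)) f) \<and>
      (TO Y ^^ Suc (Suc 0)) f \<cdot> k = x \<and> iter_vert (Suc (Suc 0)) f \<cdot> k = h"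
    by (rule iter_vert_lift) (use assms in simp_all)
  then obtain k where k0: "k \<in> Arr C" "Dom C k = Dom C x" "Cod C k = Dom C ((TO Y ^^ Suc (Suc 0)) f)"
    "(TO Y ^^ Suc (Suc 0)) f \<cdot> k = x" "iter_vert (Suc (Suc 0)) f \<cdot> k = h" by blast
  then have k: "k \<in> Arr C" "Dom C k = Dom C h" "Cod C k = Dom C (TO Y (TO Y f))"
    "TO Y (TO Y f) \<cdot> k = x" "TA X (V f) \<cdot> V (TO Y f) \<cdot> k = h" using assms(1,5) by simp_all
  have "into2 pb X A f h = k"
    unfolding into2_def vert2_eq
  proof (rule the_equality)
    show "k' = k" if "k' \<in> Hom C (Dom C h) (Dom C (TA X (V f) \<cdot> V (TO Y f))) \<and> (TA X (V f) \<cdot> V (TO Y f)) \<cdot> k' = h" for k'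
      by (rule iter_vert_mono[of f _ _ "Suc (Suc 0)"]) (use that k assms in simp_all)
  qed (use k assms in simp)
  then show "into2 pb X A f h \<in> Arr C" "Dom C (into2 pb X A f h) = Dom C h"
    "Cod C (into2 pb X A f h) = Dom C (TO Y (TO Y f))"
    "TA X (V f) \<cdot> V (TO Y f) \<cdot> into2 pb X A f h = h" "TO Y (TO Y f) \<cdot> into2 pb X A f h = x"
    using k by simp_all
qed

lemma projT_Y: "projT Y f = Tri (TO Y f) (projT X (Dom C f) \<cdot> V f) f"
  and zeroT_Y: "zeroT Y f = Tri f (into pb X A f (zeroT X (Dom C f))) (TO Y f)"
  and liftT_Y: "liftT Y f = Tri (TO Y f) (into2 pb X A f (liftT X (Dom C f) \<cdot> V f)) (TO Y (TO Y f))"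
  and flipT_Y: "flipT Y f = Tri (TO Y (TO Y f))
      (into2 pb X A f (flipT X (Dom C f) \<cdot> TA X (V f) \<cdot> V (TO Y f))) (TO Y (TO Y f))"
  and sumT_Y: "sumT Y f = Tri (Dom S (pi1T Y f)) (into pb X A f
      (plus_T X (Dom C f) (V f \<cdot> tmap (pi1T Y f)) (V f \<cdot> tmap (pi2T Y f)))) (TO Y f)"
proof -
  show "projT Y f = Tri (TO Y f) (projT X (Dom C f) \<cdot> V f) f"
    unfolding sliceproj_eq[symmetric] sliceTO_eq[symmetric] sliceproj_def ..
  show "zeroT Y f = Tri f (into pb X A f (zeroT X (Dom C f))) (TO Y f)"
    "liftT Y f = Tri (TO Y f) (into2 pb X A f (liftT X (Dom C f) \<cdot> V f)) (TO Y (TO Y f))"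
    "flipT Y f = Tri (TO Y (TO Y f))
      (into2 pb X A f (flipT X (Dom C f) \<cdot> TA X (V f) \<cdot> V (TO Y f))) (TO Y (TO Y f))"
    unfolding sliceTO_eq[symmetric] by (simp_all only: slice_tng_def Let_def tngcat.simps vert2_def)
  show "sumT Y f = Tri (Dom S (pi1T Y f)) (into pb X A f
      (plus_T X (Dom C f) (V f \<cdot> tmap (pi1T Y f)) (V f \<cdot> tmap (pi2T Y f)))) (TO Y f)"
    unfolding sliceTO_eq[symmetric] slicepi1_eq[symmetric] slicepi2_eq[symmetric] S_src[symmetric] plus_T_def
    by (simp only: slice_tng_def Let_def tngcat.simps)
qed

lemma proj_slice [simp]:
  assumes f: "f \<in> Obj S"
  shows "projT Y f \<in> Arr S" "Dom S (projT Y f) = TO Y f" "Cod S (projT Y f) = f"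
    "tmap (projT Y f) = projT X (Dom C f) \<cdot> V f"
  using f by (simp_all add: projT_Y TO_Y)

text \<open>The zero at \<open>E\<close> factors through \<open>v\<close> because
  \<open>T f \<circ> z_E = z_A \<circ> f\<close>.\<close>

lemma zero_slice:
  assumes f: "f \<in> Obj S"
  shows "zeroT Y f \<in> Arr S" "Dom S (zeroT Y f) = f" "Cod S (zeroT Y f) = TO Y f"
    "V f \<cdot> tmap (zeroT Y f) = zeroT X (Dom C f)"
  using f into_props[of f "zeroT X (Dom C f)" f] z_nat[of f] by (simp_all add: zeroT_Y)

lemma V_over': "f \<in> Obj S \<Longrightarrow> TA X (TA X f) \<cdot> TA X (V f) \<cdot> V (TO Y f) = TA X (zeroT X A) \<cdot> zeroT X A \<cdot> TO Y (TO Y f)"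
  using TA_reassoc[OF vert_eq[of f], of "V (TO Y f)"] vert_eq[of "TO Y f"] by simp

text \<open>Naturality moves the lift to the base, where \<open>l \<circ> z = T z \<circ> z\<close>
  keeps it inside the twofold zero section.\<close>

lemma lift_slice:
  assumes f: "f \<in> Obj S"
  shows "liftT Y f \<in> Arr S" "Dom S (liftT Y f) = TO Y f" "Cod S (liftT Y f) = TO Y (TO Y f)"
    "TA X (V f) \<cdot> V (TO Y f) \<cdot> tmap (liftT Y f) = liftT X (Dom C f) \<cdot> V f"
proof -
  have "TA X (TA X f) \<cdot> liftT X (Dom C f) \<cdot> V f = liftT X A \<cdot> TA X f \<cdot> V f"
    using f reassoc[OF cats(1) l_nat[of f], of "V f"] by simp
  also have "\<dots> = TA X (zeroT X A) \<cdot> zeroT X A \<cdot> TO Y f"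
    using f reassoc[OF cats(1) lift_zero[OF A], of "TO Y f"] by (simp add: vert_eq)
  finally show "liftT Y f \<in> Arr S" "Dom S (liftT Y f) = TO Y f" "Cod S (liftT Y f) = TO Y (TO Y f)"
    "TA X (V f) \<cdot> V (TO Y f) \<cdot> tmap (liftT Y f) = liftT X (Dom C f) \<cdot> V f"
    using f into2_props[of f "liftT X (Dom C f) \<cdot> V f" "TO Y f"] by (simp_all add: liftT_Y)
qed

text \<open>In the base \<open>c \<circ> T z \<circ> z = z_T \<circ> z\<close>, and this is
  \<open>T z \<circ> z\<close> by naturality of zero; so the flip preserves the twofold zero
  section.\<close>

lemma flip_slice:
  assumes f: "f \<in> Obj S"
  shows "flipT Y f \<in> Arr S" "Dom S (flipT Y f) = TO Y (TO Y f)" "Cod S (flipT Y f) = TO Y (TO Y f)"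
    "TA X (V f) \<cdot> V (TO Y f) \<cdot> tmap (flipT Y f) = flipT X (Dom C f) \<cdot> TA X (V f) \<cdot> V (TO Y f)"
proof -
  let ?h = "flipT X (Dom C f) \<cdot> TA X (V f) \<cdot> V (TO Y f)"
  have flip_zero': "flipT X A \<cdot> TA X (zeroT X A) \<cdot> x = zeroT X (TO X A) \<cdot> x" if "x \<in> Arr C" "Cod C x = TO X A" for x
    using reassoc[OF cats(1) flip_zero[OF A], of x] that by simp
  have "TA X (TA X f) \<cdot> ?h = flipT X A \<cdot> TA X (TA X f) \<cdot> TA X (V f) \<cdot> V (TO Y f)"
    using f reassoc[OF cats(1) c_nat[of f], of "TA X (V f) \<cdot> V (TO Y f)"] by simp
  also have "\<dots> = TA X (zeroT X A) \<cdot> zeroT X A \<cdot> TO Y (TO Y f)"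
    using f reassoc[OF cats(1) z_nat[of "zeroT X A"], of "TO Y (TO Y f)"] by (simp add: V_over' flip_zero')
  finally show "flipT Y f \<in> Arr S" "Dom S (flipT Y f) = TO Y (TO Y f)" "Cod S (flipT Y f) = TO Y (TO Y f)"
    "TA X (V f) \<cdot> V (TO Y f) \<cdot> tmap (flipT Y f) = ?h"
    using f into2_props[of f ?h "TO Y (TO Y f)"] by (simp_all add: flipT_Y)
qed

lemmas structure_Y_typing [simp] = zero_slice(1-3) lift_slice(1-3) flip_slice(1-3)

section \<open>Rewrite rules carrying \<open>v\<close> through the structure maps of the
  slice\<close>

lemma V_z_comp: "f \<in> Obj S \<Longrightarrow> x \<in> Arr C \<Longrightarrow> Cod C x = Dom C f \<Longrightarrow> V f \<cdot> tmap (zeroT Y f) \<cdot> x = zeroT X (Dom C f) \<cdot> x"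
  using reassoc[OF cats(1) zero_slice(4)[of f], of x] by simp

lemma V_l_comp: "f \<in> Obj S \<Longrightarrow> x \<in> Arr C \<Longrightarrow> Cod C x = Dom C (TO Y f) \<Longrightarrow>
    TA X (V f) \<cdot> V (TO Y f) \<cdot> tmap (liftT Y f) \<cdot> x = liftT X (Dom C f) \<cdot> V f \<cdot> x"
  using reassoc3[OF cats(1) lift_slice(4)[of f], of x] by simp

lemma V_c_comp: "f \<in> Obj S \<Longrightarrow> x \<in> Arr C \<Longrightarrow> Cod C x = Dom C (TO Y (TO Y f)) \<Longrightarrow>
    TA X (V f) \<cdot> V (TO Y f) \<cdot> tmap (flipT Y f) \<cdot> x = flipT X (Dom C f) \<cdot> TA X (V f) \<cdot> V (TO Y f) \<cdot> x"
  using reassoc3[OF cats(1) flip_slice(4)[of f], of x] by simp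

lemma TV_nat:
  assumes "k \<in> Arr S" "Cod S k = f" "x \<in> Arr C" "Cod C x = TO X (Dom C (TO Y (Dom S k)))"
  shows "TA X (V f) \<cdot> TA X (tmap (TA Y k)) \<cdot> x = TA X (TA X (tmap k)) \<cdot> TA X (V (Dom S k)) \<cdot> x"
  using assms TA_reassoc[OF V_nat[of k f], of x] by auto

lemma TV_z: "f \<in> Obj S \<Longrightarrow> x \<in> Arr C \<Longrightarrow> Cod C x = TO X (Dom C f) \<Longrightarrow>
    TA X (V f) \<cdot> TA X (tmap (zeroT Y f)) \<cdot> x = TA X (zeroT X (Dom C f)) \<cdot> x"
  using TA_reassoc[OF zero_slice(4)[of f], of x] by simp

lemma TV_l:
  assumes "f \<in> Obj S" "x \<in> Arr C" "Cod C x = TO X (Dom C (TO Y f))"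
  shows "TA X (TA X (V f)) \<cdot> TA X (V (TO Y f)) \<cdot> TA X (tmap (liftT Y f)) \<cdot> x = TA X (liftT X (Dom C f)) \<cdot> TA X (V f) \<cdot> x"
  using arg_cong[OF lift_slice(4)[of f], of "TA X"] assms
    reassoc3[OF cats(1), of "TA X (TA X (V f))" "TA X (V (TO Y f))" "TA X (tmap (liftT Y f))" _ x] by simp

lemma TV_c:
  assumes "f \<in> Obj S" "x \<in> Arr C" "Cod C x = TO X (Dom C (TO Y (TO Y f)))"
  shows "TA X (TA X (V f)) \<cdot> TA X (V (TO Y f)) \<cdot> TA X (tmap (flipT Y f)) \<cdot> x =
    TA X (flipT X (Dom C f)) \<cdot> TA X (TA X (V f)) \<cdot> TA X (V (TO Y f)) \<cdot> x"
  using arg_cong[OF flip_slice(4)[of f], of "TA X"] assms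
    reassoc3[OF cats(1), of "TA X (TA X (V f))" "TA X (V (TO Y f))" "TA X (tmap (flipT Y f))" _ x] by simp

lemma p_nat_comp: "f \<in> Arr C \<Longrightarrow> x \<in> Arr C \<Longrightarrow> Cod C x = TO X (Dom C f) \<Longrightarrow> Cod C f = a \<Longrightarrow>
    projT X a \<cdot> TA X f \<cdot> x = f \<cdot> projT X (Dom C f) \<cdot> x"
  using reassoc[OF cats(1) p_nat[of f], of x] Cod_Obj[OF cats(1), of f] by simp

lemma z_nat_comp: "f \<in> Arr C \<Longrightarrow> x \<in> Arr C \<Longrightarrow> Cod C x = Dom C f \<Longrightarrow> Cod C f = a \<Longrightarrow>
    zeroT X a \<cdot> f \<cdot> x = TA X f \<cdot> zeroT X (Dom C f) \<cdot> x"
  using reassoc[OF cats(1) z_nat[of f], of x] Cod_Obj[OF cats(1), of f] by simp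

lemma l_nat_comp: "f \<in> Arr C \<Longrightarrow> x \<in> Arr C \<Longrightarrow> Cod C x = TO X (Dom C f) \<Longrightarrow> Cod C f = a \<Longrightarrow>
    liftT X a \<cdot> TA X f \<cdot> x = TA X (TA X f) \<cdot> liftT X (Dom C f) \<cdot> x"
  using reassoc[OF cats(1) l_nat[of f], of x] Cod_Obj[OF cats(1), of f] by simp

lemma c_nat_comp: "f \<in> Arr C \<Longrightarrow> x \<in> Arr C \<Longrightarrow> Cod C x = TO X (TO X (Dom C f)) \<Longrightarrow> Cod C f = a \<Longrightarrow>
    flipT X a \<cdot> TA X (TA X f) \<cdot> x = TA X (TA X f) \<cdot> flipT X (Dom C f) \<cdot> x"
  using reassoc[OF cats(1) c_nat[of f], of x] Cod_Obj[OF cats(1), of f] by simp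

subsection \<open>Naturality and the equations not involving the sum\<close>

lemma nat_p_Y: "nat_trans S S (TanF Y) fid (projT Y)"
proof -
  have "projT Y (Cod S k) \<star> TA Y k = k \<star> projT Y (Dom S k)" if k: "k \<in> Arr S" for k
    by (rule S_eqI) (use k in \<open>simp_all add: V_nat p_nat_comp\<close>)
  then show ?thesis by (simp add: nat_trans_def fid_def)
qed

lemma nat_z_Y: "nat_trans S S fid (TanF Y) (zeroT Y)"
proof -
  have "zeroT Y (Cod S k) \<star> k = TA Y k \<star> zeroT Y (Dom S k)" if k: "k \<in> Arr S" for k
    by (rule TS_eqI[of _ _ "Cod S k"]) (use k z_nat[of "tmap k"] in \<open>simp_all add: V_nat_comp V_z_comp zero_slice\<close>)
  then show ?thesis by (simp add: nat_trans_def fid_def)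
qed

lemma nat_l_Y: "nat_trans S S (TanF Y) (fcomp (TanF Y) (TanF Y)) (liftT Y)"
proof -
  have "liftT Y (Cod S k) \<star> TA Y k = TA Y (TA Y k) \<star> liftT Y (Dom S k)" if k: "k \<in> Arr S" for k
    by (rule TTS_eqI[of _ _ "Cod S k"])
      (use k in \<open>simp_all add: V_nat_comp V_l_comp V_nat l_nat_comp TV_nat lift_slice\<close>)
  then show ?thesis by (simp add: nat_trans_def fcomp_def)
qed

lemma nat_c_Y: "nat_trans S S (fcomp (TanF Y) (TanF Y)) (fcomp (TanF Y) (TanF Y)) (flipT Y)"
proof -
  have "flipT Y (Cod S k) \<star> TA Y (TA Y k) = TA Y (TA Y k) \<star> flipT Y (Dom S k)" if k: "k \<in> Arr S" for k
    by (rule TTS_eqI[of _ _ "Cod S k"])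
      (use k in \<open>simp_all add: V_nat_comp V_c_comp V_nat c_nat_comp TV_nat flip_slice\<close>)
  then show ?thesis by (simp add: nat_trans_def fcomp_def)
qed

text \<open>Here naturality of the structure of \<open>X\<close> is used at \<open>V f\<close>
  itself, and likewise in the next rules. Structure maps at the object \<open>TO Y f\<close> live on
  its domain; these rules move them to \<open>T E\<close>, where the axioms of \<open>X\<close> at
  \<open>E\<close> apply.\<close>

lemma z_vert: "f \<in> Obj S \<Longrightarrow> x \<in> Arr C \<Longrightarrow> Cod C x = Dom C (TO Y f) \<Longrightarrow>
    TA X (V f) \<cdot> zeroT X (Dom C (TO Y f)) \<cdot> x = zeroT X (TO X (Dom C f)) \<cdot> V f \<cdot> x"
  using z_nat_comp[of "V f" x "TO X (Dom C f)"] by simp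

lemma z_vert0: "f \<in> Obj S \<Longrightarrow>
    TA X (V f) \<cdot> zeroT X (Dom C (TO Y f)) = zeroT X (TO X (Dom C f)) \<cdot> V f"
  using z_nat[of "V f"] by simp

lemma p_vert: "f \<in> Obj S \<Longrightarrow> x \<in> Arr C \<Longrightarrow> Cod C x = TO X (Dom C (TO Y f)) \<Longrightarrow>
    V f \<cdot> projT X (Dom C (TO Y f)) \<cdot> x = projT X (TO X (Dom C f)) \<cdot> TA X (V f) \<cdot> x"
  using p_nat_comp[of "V f" x "TO X (Dom C f)"] by simp

lemma l_vert: "f \<in> Obj S \<Longrightarrow> x \<in> Arr C \<Longrightarrow> Cod C x = TO X (Dom C (TO Y f)) \<Longrightarrow>
    TA X (TA X (V f)) \<cdot> liftT X (Dom C (TO Y f)) \<cdot> x = liftT X (TO X (Dom C f)) \<cdot> TA X (V f) \<cdot> x"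
  using l_nat_comp[of "V f" x "TO X (Dom C f)"] by simp

lemma c_vert: "f \<in> Obj S \<Longrightarrow> x \<in> Arr C \<Longrightarrow> Cod C x = TO X (TO X (Dom C (TO Y f))) \<Longrightarrow>
    TA X (TA X (V f)) \<cdot> flipT X (Dom C (TO Y f)) \<cdot> x = flipT X (TO X (Dom C f)) \<cdot> TA X (TA X (V f)) \<cdot> x"
  using c_nat_comp[of "V f" x "TO X (Dom C f)"] by simp

lemmas vert_simps = V_nat V_nat_comp TV_nat zero_slice(4) V_z_comp TV_z lift_slice(4) V_l_comp TV_l flip_slice(4) V_c_comp TV_c
  z_vert z_vert0 p_vert l_vert c_vert

lemma equations_Y:
  assumes f: "f \<in> Obj S"
  shows "projT Y f \<star> zeroT Y f = Id S f"
    "TA Y (projT Y f) \<star> liftT Y f = zeroT Y f \<star> projT Y f"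
    "liftT Y f \<star> zeroT Y f = TA Y (zeroT Y f) \<star> zeroT Y f"
    "projT Y (TO Y f) \<star> flipT Y f = TA Y (projT Y f)"
    "flipT Y f \<star> TA Y (zeroT Y f) = zeroT Y (TO Y f)"
    "flipT Y f \<star> flipT Y f = Id S (TO Y (TO Y f))"
    "flipT Y f \<star> liftT Y f = liftT Y f"
    "TA Y (liftT Y f) \<star> liftT Y f = liftT Y (TO Y f) \<star> liftT Y f"
    "TA Y (flipT Y f) \<star> flipT Y (TO Y f) \<star> TA Y (flipT Y f) =
       flipT Y (TO Y f) \<star> TA Y (flipT Y f) \<star> flipT Y (TO Y f)"
    "flipT Y (TO Y f) \<star> TA Y (flipT Y f) \<star> liftT Y (TO Y f) = TA Y (liftT Y f) \<star> flipT Y f"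
proof -
  note [simp] = f
  let ?a = "Dom C f"
  have a: "?a \<in> Obj C" by simp
  \<comment> \<open>The axioms of \<open>X\<close> at \<open>?a\<close>, with tails where a map
    \<open>v\<close> is left standing to their right.\<close>
  note eqs = reassoc[OF cats(1) Tproj_lift[OF a]] lift_zero reassoc[OF cats(1) proj_flip[OF a]] reassoc[OF cats(1) flip_zero[OF a]]
    reassoc[OF cats(1) flip_flip[OF a]] reassoc[OF cats(1) flip_lift[OF a]] reassoc[OF cats(1) lift_lift[OF a]]
    reassoc3[OF cats(1) flip_braid[OF a]] reassoc3[OF cats(1) flip_flip_lift[OF a]]
  show "projT Y f \<star> zeroT Y f = Id S f"
    by (rule S_eqI) (simp_all add: vert_simps proj_zero)
  show "TA Y (projT Y f) \<star> liftT Y f = zeroT Y f \<star> projT Y f"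
    by (rule TS_eqI[of _ _ f]) (simp_all add: vert_simps eqs)
  show "liftT Y f \<star> zeroT Y f = TA Y (zeroT Y f) \<star> zeroT Y f"
    by (rule TTS_eqI[of _ _ f]) (simp_all add: vert_simps eqs)
  show "projT Y (TO Y f) \<star> flipT Y f = TA Y (projT Y f)"
    by (rule TS_eqI[of _ _ f]) (simp_all add: vert_simps eqs)
  show "flipT Y f \<star> TA Y (zeroT Y f) = zeroT Y (TO Y f)"
    by (rule TTS_eqI[of _ _ f]) (simp_all add: vert_simps eqs)
  show "flipT Y f \<star> flipT Y f = Id S (TO Y (TO Y f))"
    by (rule TTS_eqI[of _ _ f]) (simp_all add: vert_simps eqs)
  show "flipT Y f \<star> liftT Y f = liftT Y f"
    by (rule TTS_eqI[of _ _ f]) (simp_all add: vert_simps eqs)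
  show "TA Y (liftT Y f) \<star> liftT Y f = liftT Y (TO Y f) \<star> liftT Y f"
    by (rule TTTS_eqI[of _ _ f]) (simp_all add: vert_simps eqs)
  show "TA Y (flipT Y f) \<star> flipT Y (TO Y f) \<star> TA Y (flipT Y f) =
       flipT Y (TO Y f) \<star> TA Y (flipT Y f) \<star> flipT Y (TO Y f)"
    by (rule TTTS_eqI[of _ _ f]) (simp_all add: vert_simps eqs)
  show "flipT Y (TO Y f) \<star> TA Y (flipT Y f) \<star> liftT Y (TO Y f) = TA Y (liftT Y f) \<star> flipT Y f"
    by (rule TTTS_eqI[of _ _ f]) (simp_all add: vert_simps eqs)
qed

end

subsection \<open>Sums in the slice\<close>

locale tangent_slice = tangent_slice0 X A pb for X :: "'b utng" and A pb +
  assumes slice_powers: "has_T_powers (slice_cat (Cat X) A) (sliceT pb X A) (sliceproj pb X A)"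
begin

lemma powers_Y: "has_T_powers S (TanF Y) (projT Y)"
  using slice_powers by (simp add: slice_cat_eq sliceT_eq sliceproj_eq)

text \<open>The twofold power in \<open>has_T_powers\<close> is preserved but need not be the chosen
  one. The choice \<open>pb\<close> is a pullback of the same cospan in the slice category, so
  preservation transfers to it.\<close>

lemma T2_pullback_Y:
  assumes f: "f \<in> Obj S"
  shows "T_pullback Y (projT Y f) (projT Y f) (pi1T Y f) (pi2T Y f)"
proof -
  obtain u q where uq: "\<And>m. is_fibre_power S 2 ((TA Y ^^ m) (projT Y f)) ((TA Y ^^ m) u) (\<lambda>i. (TA Y ^^ m) (q i))"
    using powers_Y f unfolding has_T_powers_def by metis
  then have q: "T_pullback Y (projT Y f) (projT Y f) (q 0) (q 1)"
    unfolding T_pullback_def by (intro allI fibre_power_2_pullback[OF uq]) simp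
  have "is_pullback S (projT Y f) (projT Y f) (fst (pb S (projT Y f) (projT Y f))) (snd (pb S (projT Y f) (projT Y f)))"
    using choice category_S Y.T_pullback_pullback[OF q] unfolding pullback_choice_def by blast
  then have "is_pullback S (projT Y f) (projT Y f) (pi1T Y f) (pi2T Y f)"
    unfolding slicepi1_eq[symmetric] slicepi2_eq[symmetric] slicepi1_def slicepi2_def
    by (simp add: slice_cat_eq sliceproj_eq)
  then show ?thesis by (rule Y.T_pullback_transfer[OF q])
qed

lemma pi_Y [simp]:
  assumes f: "f \<in> Obj S"
  shows "pi1T Y f \<in> Arr S" "Cod S (pi1T Y f) = TO Y f" "pi2T Y f \<in> Arr S" "Cod S (pi2T Y f) = TO Y f"
    "Dom S (pi2T Y f) = Dom S (pi1T Y f)"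
  using pullbackD[OF Y.T_pullback_pullback[OF T2_pullback_Y[OF f]]] f by simp_all

lemma pi_eq_Y: "f \<in> Obj S \<Longrightarrow> projT Y f \<star> pi2T Y f = projT Y f \<star> pi1T Y f"
  using pullbackD(9)[OF Y.T_pullback_pullback[OF T2_pullback_Y]] by simp

lemma pair_Y [simp]:
  assumes "f \<in> Obj S" "x \<in> Arr S" "Cod S x = TO Y f" "y \<in> Arr S" "Cod S y = TO Y f" "Dom S y = Dom S x"
    "projT Y f \<star> x = projT Y f \<star> y"
  shows "pairing S (pi1T Y f) (pi2T Y f) x y \<in> Arr S"
    "Dom S (pairing S (pi1T Y f) (pi2T Y f) x y) = Dom S x"
    "Cod S (pairing S (pi1T Y f) (pi2T Y f) x y) = Dom S (pi1T Y f)"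
    "pi1T Y f \<star> pairing S (pi1T Y f) (pi2T Y f) x y = x"
    "pi2T Y f \<star> pairing S (pi1T Y f) (pi2T Y f) x y = y"
  using pairing_props[OF category_S Y.T_pullback_pullback[OF T2_pullback_Y], of f x "Dom S x" y] assms by simp_all

lemma Tpair_Y [simp]:
  assumes "f \<in> Obj S" "x \<in> Arr S" "Cod S x = TO Y (TO Y f)" "y \<in> Arr S" "Cod S y = TO Y (TO Y f)" "Dom S y = Dom S x"
    "TA Y (projT Y f) \<star> x = TA Y (projT Y f) \<star> y"
  shows "pairing S (TA Y (pi1T Y f)) (TA Y (pi2T Y f)) x y \<in> Arr S"
    "Dom S (pairing S (TA Y (pi1T Y f)) (TA Y (pi2T Y f)) x y) = Dom S x"
    "Cod S (pairing S (TA Y (pi1T Y f)) (TA Y (pi2T Y f)) x y) = TO Y (Dom S (pi1T Y f))"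
    "TA Y (pi1T Y f) \<star> pairing S (TA Y (pi1T Y f)) (TA Y (pi2T Y f)) x y = x"
    "TA Y (pi2T Y f) \<star> pairing S (TA Y (pi1T Y f)) (TA Y (pi2T Y f)) x y = y"
  using pairing_props[OF category_S Y.T_pullback_pullback[OF Y.T_pullback_TA[OF T2_pullback_Y]], of f x "Dom S x" y] assms
  by simp_all

lemma p_V_eq:
  assumes "f \<in> Obj S" "x \<in> Arr S" "Cod S x = TO Y f" "y \<in> Arr S" "Cod S y = TO Y f"
    "projT Y f \<star> x = projT Y f \<star> y"
  shows "projT X (Dom C f) \<cdot> V f \<cdot> tmap x = projT X (Dom C f) \<cdot> V f \<cdot> tmap y"
  using arg_cong[OF assms(6), of tmap] assms(1-5) by simp

lemma pi_V_eq: "f \<in> Obj S \<Longrightarrow>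
    projT X (Dom C f) \<cdot> V f \<cdot> tmap (pi2T Y f) = projT X (Dom C f) \<cdot> V f \<cdot> tmap (pi1T Y f)"
  by (rule p_V_eq) (simp_all add: pi_eq_Y)

text \<open>\<open>T f\<close> is additive, and both components lie over the same zero
  \<open>z_A \<cdot> ?d\<close>. As 0 + 0 = 0, their sum lies over it too and factors through
  \<open>v\<close>.\<close>

lemma sum_slice:
  assumes f: "f \<in> Obj S"
  shows "sumT Y f \<in> Arr S" "Dom S (sumT Y f) = Dom S (pi1T Y f)" "Cod S (sumT Y f) = TO Y f"
    "V f \<cdot> tmap (sumT Y f) = plus_T X (Dom C f) (V f \<cdot> tmap (pi1T Y f)) (V f \<cdot> tmap (pi2T Y f))"
proof -
  let ?h = "plus_T X (Dom C f) (V f \<cdot> tmap (pi1T Y f)) (V f \<cdot> tmap (pi2T Y f))"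
  let ?d = "Dom S (pi1T Y f)"
  have d: "TA X f \<cdot> V f \<cdot> tmap (pi1T Y f) = zeroT X A \<cdot> ?d" "TA X f \<cdot> V f \<cdot> tmap (pi2T Y f) = zeroT X A \<cdot> ?d"
    using f V_over[of "pi1T Y f" f] V_over[of "pi2T Y f" f] by simp_all
  have [simp]: "?d \<in> Obj S" using f by simp
  have "TA X f \<cdot> ?h = plus_T X A (zeroT X A \<cdot> ?d) (zeroT X A \<cdot> ?d)"
    using f by (subst plus_nat) (simp_all add: pi_V_eq d)
  also have "\<dots> = zeroT X A \<cdot> ?d"
    using plus_zero(1)[of A "zeroT X A \<cdot> ?d"] reassoc[OF cats(1) proj_zero[OF A], of "?d"] f by simp
  finally have e: "TA X f \<cdot> ?h = zeroT X A \<cdot> ?d" .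
  have h: "?h \<in> Arr C" "Cod C ?h = TO X (Dom C f)" "Dom C ?h = Dom C ?d"
    using f by (simp_all add: pi_V_eq)
  note i = into_props[OF f h(1,2) _ _ _ e]
  show "sumT Y f \<in> Arr S" "Dom S (sumT Y f) = Dom S (pi1T Y f)" "Cod S (sumT Y f) = TO Y f"
    "V f \<cdot> tmap (sumT Y f) = ?h"
    unfolding sumT_Y using f h i by simp_all
qed

lemmas s_Y_typing [simp] = sum_slice(1-3)

lemma plus_Y_typing [simp]:
  assumes "f \<in> Obj S" "x \<in> Arr S" "Cod S x = TO Y f" "y \<in> Arr S" "Cod S y = TO Y f" "Dom S y = Dom S x"
    "projT Y f \<star> x = projT Y f \<star> y"
  shows "plus_T Y f x y \<in> Arr S" "Dom S (plus_T Y f x y) = Dom S x" "Cod S (plus_T Y f x y) = TO Y f"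
  using assms by (simp_all add: plus_T_def)

lemma Tplus_Y_typing [simp]:
  assumes "f \<in> Obj S" "x \<in> Arr S" "Cod S x = TO Y (TO Y f)" "y \<in> Arr S" "Cod S y = TO Y (TO Y f)" "Dom S y = Dom S x"
    "TA Y (projT Y f) \<star> x = TA Y (projT Y f) \<star> y"
  shows "Tplus_T Y f x y \<in> Arr S" "Dom S (Tplus_T Y f x y) = Dom S x" "Cod S (Tplus_T Y f x y) = TO Y (TO Y f)"
  using assms by (simp_all add: Tplus_T_def)

text \<open>\<open>v\<close> turns sums of the slice into sums of \<open>X\<close>. The generic
  case, on the chosen \<open>T_2\<close> of the slice, is the definition of the slice sum; this one
  is its restriction along the pairing.\<close>

lemma V_plus:
  assumes "f \<in> Obj S" "x \<in> Arr S" "Cod S x = TO Y f" "y \<in> Arr S" "Cod S y = TO Y f" "Dom S y = Dom S x"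
    "projT Y f \<star> x = projT Y f \<star> y"
  shows "V f \<cdot> tmap (plus_T Y f x y) = plus_T X (Dom C f) (V f \<cdot> tmap x) (V f \<cdot> tmap y)"
proof -
  let ?k = "pairing S (pi1T Y f) (pi2T Y f) x y"
  have k: "tmap (pi1T Y f) \<cdot> tmap ?k = tmap x" "tmap (pi2T Y f) \<cdot> tmap ?k = tmap y"
    using assms unfolding tmap_comp[symmetric] by simp_all
  have "V f \<cdot> tmap (sumT Y f) \<cdot> tmap ?k =
      plus_T X (Dom C f) (V f \<cdot> tmap (pi1T Y f)) (V f \<cdot> tmap (pi2T Y f)) \<cdot> tmap ?k"
    by (rule reassoc[OF cats(1) sum_slice(4)]) (use assms in simp_all)
  also have "\<dots> = plus_T X (Dom C f) (V f \<cdot> tmap x) (V f \<cdot> tmap y)"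
    using assms by (subst plus_comp) (simp_all add: pi_V_eq k)
  finally show ?thesis by (simp add: plus_T_def)
qed

text \<open>The same for the bundle \<open>T p\<close> and the twofold \<open>v\<close>. Naturality
  of \<open>v\<close> at the slice sum first replaces \<open>v\<close> at \<open>TO Y f\<close> by
  \<open>v\<close> at the domain \<open>?d\<close> of the chosen \<open>T_2\<close>.\<close>

lemma TV_Tplus:
  assumes "f \<in> Obj S" "x \<in> Arr S" "Cod S x = TO Y (TO Y f)" "y \<in> Arr S" "Cod S y = TO Y (TO Y f)" "Dom S y = Dom S x"
    "TA Y (projT Y f) \<star> x = TA Y (projT Y f) \<star> y"
  shows "TA X (V f) \<cdot> V (TO Y f) \<cdot> tmap (Tplus_T Y f x y) =
    Tplus_T X (Dom C f) (TA X (V f) \<cdot> V (TO Y f) \<cdot> tmap x) (TA X (V f) \<cdot> V (TO Y f) \<cdot> tmap y)"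
proof -
  let ?k = "pairing S (TA Y (pi1T Y f)) (TA Y (pi2T Y f)) x y"
  let ?d = "Dom S (pi1T Y f)"
  have k: "tmap (TA Y (pi1T Y f)) \<cdot> tmap ?k = tmap x" "tmap (TA Y (pi2T Y f)) \<cdot> tmap ?k = tmap y"
    using assms unfolding tmap_comp[symmetric] by simp_all
  have k': "TA X (tmap (pi1T Y f)) \<cdot> V ?d \<cdot> tmap ?k = V (TO Y f) \<cdot> tmap x"
    "TA X (tmap (pi2T Y f)) \<cdot> V ?d \<cdot> tmap ?k = V (TO Y f) \<cdot> tmap y"
    using assms k V_nat_comp[of "pi1T Y f" "TO Y f" "tmap ?k"] V_nat_comp[of "pi2T Y f" "TO Y f" "tmap ?k"] by simp_all
  have Tpi: "TA X (projT X (Dom C f)) \<cdot> TA X (V f) \<cdot> TA X (tmap (pi2T Y f)) =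
      TA X (projT X (Dom C f)) \<cdot> TA X (V f) \<cdot> TA X (tmap (pi1T Y f))"
    using arg_cong[OF pi_V_eq[OF assms(1)], of "TA X"] assms by simp
  have "TA X (V f) \<cdot> TA X (tmap (sumT Y f)) =
      Tplus_T X (Dom C f) (TA X (V f) \<cdot> TA X (tmap (pi1T Y f))) (TA X (V f) \<cdot> TA X (tmap (pi2T Y f)))"
    using arg_cong[OF sum_slice(4)[OF assms(1)], of "TA X"] assms by (simp add: TA_plus pi_V_eq)
  from reassoc[OF cats(1) this, of "V ?d \<cdot> tmap ?k"]
  have "TA X (V f) \<cdot> TA X (tmap (sumT Y f)) \<cdot> V ?d \<cdot> tmap ?k =
      Tplus_T X (Dom C f) (TA X (V f) \<cdot> TA X (tmap (pi1T Y f))) (TA X (V f) \<cdot> TA X (tmap (pi2T Y f))) \<cdot> V ?d \<cdot> tmap ?k"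
    using assms by simp
  also have "\<dots> = Tplus_T X (Dom C f) (TA X (V f) \<cdot> V (TO Y f) \<cdot> tmap x) (TA X (V f) \<cdot> V (TO Y f) \<cdot> tmap y)"
    using assms by (subst Tplus_comp) (simp_all add: Tpi k')
  finally show ?thesis
    using assms V_nat_comp[of "sumT Y f" "TO Y f" "tmap ?k"] by (simp add: Tplus_T_def)
qed

lemma nat_s_Y: "nat_trans S S (T2 Y) (TanF Y) (sumT Y)"
proof -
  have "sumT Y (Cod S k) \<star> amap (T2 Y) k = TA Y k \<star> sumT Y (Dom S k)" if k: "k \<in> Arr S" for k
  proof -
    let ?d = "Dom S k" and ?x = "TA Y k \<star> pi1T Y (Dom S k)" and ?y = "TA Y k \<star> pi2T Y (Dom S k)"
    have np: "projT Y (Cod S k) \<star> TA Y k = k \<star> projT Y ?d"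
      using nat_p_Y k by (auto simp: nat_trans_def fid_def)
    have e: "projT Y (Cod S k) \<star> ?x = projT Y (Cod S k) \<star> ?y"
      using reassoc[OF category_S np, of "pi1T Y ?d"] reassoc[OF category_S np, of "pi2T Y ?d"] k by (simp add: pi_eq_Y)
    have "plus_T Y (Cod S k) ?x ?y = TA Y k \<star> sumT Y ?d"
    proof (rule TS_eqI[of _ _ "Cod S k"])
      show "V (Cod S k) \<cdot> tmap (plus_T Y (Cod S k) ?x ?y) = V (Cod S k) \<cdot> tmap (TA Y k \<star> sumT Y ?d)"
        using k e plus_nat[of "tmap k" "Dom C ?d" "V ?d \<cdot> tmap (pi1T Y ?d)" "V ?d \<cdot> tmap (pi2T Y ?d)"]
        by (simp add: V_plus V_nat_comp sum_slice(4) pi_V_eq)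
    qed (use k e in simp_all)
    then show ?thesis by (simp add: T2_def plus_T_def)
  qed
  moreover have "Dom S (sumT Y f) = omap (T2 Y) f" if "f \<in> Obj S" for f using that by (simp add: T2_def)
  ultimately show ?thesis by (simp add: nat_trans_def)
qed

lemma additive_bundle_Y:
  assumes f: "f \<in> Obj S"
  shows "additive_bundle S (tangent_bundle Y f)"
proof -
  note [simp] = f
  have proj_sum: "projT Y f \<star> sumT Y f = projT Y f \<star> pi1T Y f"
    by (rule S_eqI) (simp_all add: sum_slice(4) p_plus pi_V_eq)
  have p_plus: "projT Y f \<star> plus_T Y f x y = projT Y f \<star> x"
    if "x \<in> Arr S" "Cod S x = TO Y f" "y \<in> Arr S" "Cod S y = TO Y f" "Dom S y = Dom S x"
    "projT Y f \<star> x = projT Y f \<star> y" for x y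
    by (rule S_eqI) (use that p_V_eq[of f x y] in \<open>simp_all add: V_plus p_plus\<close>)
  have "plus_T Y f (plus_T Y f (r 0) (r 1)) (r 2) = plus_T Y f (r 0) (plus_T Y f (r 1) (r 2))"
    if "is_fibre_power S 3 (projT Y f) u r" for u r
  proof -
    have r: "i < 3 \<Longrightarrow> r i \<in> Arr S" "i < 3 \<Longrightarrow> Dom S (r i) = Dom S u" "i < 3 \<Longrightarrow> Cod S (r i) = TO Y f"
      "i < 3 \<Longrightarrow> projT Y f \<star> r i = u" for i
      using that unfolding is_fibre_power_def by auto
    have e: "projT X (Dom C f) \<cdot> V f \<cdot> tmap (r 0) = projT X (Dom C f) \<cdot> V f \<cdot> tmap (r 1)"
      "projT X (Dom C f) \<cdot> V f \<cdot> tmap (r 1) = projT X (Dom C f) \<cdot> V f \<cdot> tmap (r 2)"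
      by (rule p_V_eq; simp add: r)+
    show ?thesis
    proof (rule TS_eqI[of _ _ f])
      show "V f \<cdot> tmap (plus_T Y f (plus_T Y f (r 0) (r 1)) (r 2)) = V f \<cdot> tmap (plus_T Y f (r 0) (plus_T Y f (r 1) (r 2)))"
        using e plus_assoc[of "Dom C f" "V f \<cdot> tmap (r 0)" "V f \<cdot> tmap (r 1)" "V f \<cdot> tmap (r 2)"]
        by (simp add: V_plus r p_plus)
    qed (simp_all add: r p_plus)
  qed
  moreover have "plus_T Y f (pi2T Y f) (pi1T Y f) = sumT Y f"
    by (rule TS_eqI[of _ _ f]) (simp_all add: V_plus pi_eq_Y sum_slice(4) plus_commute pi_V_eq)
  moreover have pzp: "projT Y f \<star> zeroT Y f \<star> projT Y f = projT Y f"
    using reassoc[OF category_S equations_Y(1)[OF f], of "projT Y f"] by simp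
  moreover have "plus_T Y f (zeroT Y f \<star> projT Y f) (Id S (TO Y f)) = Id S (TO Y f)"
    by (rule TS_eqI[of _ _ f]) (simp_all add: V_plus pzp V_z_comp plus_zero)
  moreover have "plus_T Y f (Id S (TO Y f)) (zeroT Y f \<star> projT Y f) = Id S (TO Y f)"
    by (rule TS_eqI[of _ _ f]) (simp_all add: V_plus pzp V_z_comp plus_zero)
  ultimately show ?thesis
    using Y.T_pullback_pullback[OF T2_pullback_Y[OF f]] proj_sum equations_Y(1)[OF f]
    by (simp add: additive_bundle_def Let_def tangent_bundle_def plus_T_def)
qed

lemma bundle_l_Y:
  assumes f: "f \<in> Obj S"
  shows "additive_bundle_morphism S (tangent_bundle Y f) (T_bundle Y (tangent_bundle Y f)) (liftT Y f) (zeroT Y f)"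
proof -
  note [simp] = f
  let ?x = "liftT Y f \<star> pi1T Y f" and ?y = "liftT Y f \<star> pi2T Y f"
  have e: "TA Y (projT Y f) \<star> ?x = TA Y (projT Y f) \<star> ?y"
    using reassoc[OF category_S equations_Y(2)[OF f], of "pi1T Y f"]
      reassoc[OF category_S equations_Y(2)[OF f], of "pi2T Y f"] by (simp add: pi_eq_Y)
  have "liftT Y f \<star> sumT Y f = Tplus_T Y f ?x ?y"
  proof (rule TTS_eqI[of _ _ f])
    show "TA X (V f) \<cdot> V (TO Y f) \<cdot> tmap (liftT Y f \<star> sumT Y f) = TA X (V f) \<cdot> V (TO Y f) \<cdot> tmap (Tplus_T Y f ?x ?y)"
      using e by (simp add: TV_Tplus V_l_comp sum_slice(4) l_plus pi_V_eq)
  qed (use e in simp_all)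
  then show ?thesis
    using equations_Y[OF f]
    by (simp add: additive_bundle_morphism_def tangent_bundle_def T_bundle_def Tplus_T_def)
qed

lemma bundle_c_Y:
  assumes f: "f \<in> Obj S"
  shows "additive_bundle_morphism S (T_bundle Y (tangent_bundle Y f)) (tangent_bundle Y (TO Y f)) (flipT Y f) (Id S (TO Y f))"
proof -
  note [simp] = f
  let ?x = "flipT Y f \<star> TA Y (pi1T Y f)" and ?y = "flipT Y f \<star> TA Y (pi2T Y f)"
  let ?d = "Dom S (pi1T Y f)"
  have e0: "TA Y (projT Y f) \<star> TA Y (pi1T Y f) = TA Y (projT Y f) \<star> TA Y (pi2T Y f)"
    using arg_cong[OF pi_eq_Y[OF f], of "TA Y"] by simp
  have e: "projT Y (TO Y f) \<star> ?x = projT Y (TO Y f) \<star> ?y"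
    using reassoc[OF category_S equations_Y(4)[OF f], of "TA Y (pi1T Y f)"]
      reassoc[OF category_S equations_Y(4)[OF f], of "TA Y (pi2T Y f)"] e0 by simp
  have Tpi: "TA X (projT X (Dom C f)) \<cdot> TA X (V f) \<cdot> TA X (tmap (pi1T Y f)) \<cdot> x =
      TA X (projT X (Dom C f)) \<cdot> TA X (V f) \<cdot> TA X (tmap (pi2T Y f)) \<cdot> x"
    if "x \<in> Arr C" "Cod C x = TO X (Dom C ?d)" for x
    using arg_cong[OF pi_V_eq[OF f], of "TA X"]
      reassoc3[OF cats(1), of "TA X (projT X (Dom C f))" "TA X (V f)" "TA X (tmap (pi1T Y f))" _ x]
      reassoc3[OF cats(1), of "TA X (projT X (Dom C f))" "TA X (V f)" "TA X (tmap (pi2T Y f))" _ x] that by simp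
  have "flipT Y f \<star> TA Y (sumT Y f) = plus_T Y (TO Y f) ?x ?y"
  proof (rule TTS_eqI[of _ _ f])
    \<comment> \<open>\<open>T\<close> of the defining equation of the slice sum, restricted along
      \<open>V ?d\<close>. It exhibits a sum for \<open>T p\<close>, which \<open>c_Tplus\<close>
      converts into one for \<open>p_T\<close>.\<close>
    have Vs: "TA X (V f) \<cdot> TA X (tmap (sumT Y f)) \<cdot> V ?d =
        Tplus_T X (Dom C f) (TA X (V f) \<cdot> TA X (tmap (pi1T Y f)) \<cdot> V ?d) (TA X (V f) \<cdot> TA X (tmap (pi2T Y f)) \<cdot> V ?d)"
      using arg_cong[OF sum_slice(4)[OF f], of "TA X"] Tpi[of "Id C (TO X (Dom C ?d))"]
        reassoc[OF cats(1), of "TA X (V f)" "TA X (tmap (sumT Y f))" _ "V ?d"]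
      by (simp add: TA_plus Tplus_comp pi_V_eq)
    have "TA X (V f) \<cdot> V (TO Y f) \<cdot> tmap (plus_T Y (TO Y f) ?x ?y) =
      TA X (V f) \<cdot> plus_T X (Dom C (TO Y f)) (V (TO Y f) \<cdot> tmap ?x) (V (TO Y f) \<cdot> tmap ?y)"
      using e by (subst V_plus) simp_all
    also have "\<dots> = plus_T X (TO X (Dom C f)) (TA X (V f) \<cdot> V (TO Y f) \<cdot> tmap ?x) (TA X (V f) \<cdot> V (TO Y f) \<cdot> tmap ?y)"
      using e p_V_eq[of "TO Y f" ?x ?y] by (subst plus_nat) simp_all
    also have "\<dots> = TA X (V f) \<cdot> V (TO Y f) \<cdot> tmap (flipT Y f \<star> TA Y (sumT Y f))"
      using Tpi[of "V ?d"] by (simp add: V_c_comp V_nat Vs c_Tplus)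
    finally show "TA X (V f) \<cdot> V (TO Y f) \<cdot> tmap (flipT Y f \<star> TA Y (sumT Y f)) =
      TA X (V f) \<cdot> V (TO Y f) \<cdot> tmap (plus_T Y (TO Y f) ?x ?y)" ..
  qed (use e in simp_all)
  then show ?thesis
    using equations_Y[OF f]
    by (simp add: additive_bundle_morphism_def tangent_bundle_def T_bundle_def plus_T_def)
qed

end

subsection \<open>Universality of the vertical lift in the slice\<close>

context tangent_slice0
begin

lemma pow_V_p:
  assumes "f \<in> Obj S" "k \<in> Arr S" "Cod S k = (TO Y ^^ m) (TO Y f)"
  shows "iter_vert m f \<cdot> tmap ((TA Y ^^ m) (projT Y f)) \<cdot> tmap k =
    (TA X ^^ m) (projT X (Dom C f)) \<cdot> iter_vert (Suc m) f \<cdot> tmap k"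
  using assms by (simp add: iter_vert_nat_comp)

end

context tangent_slice
begin

definition mu_Y :: "'b univ \<Rightarrow> 'b univ" where
  "mu_Y f = Tplus_T Y f (liftT Y f \<star> pi1T Y f) (zeroT Y (TO Y f) \<star> pi2T Y f)"

text \<open>The comparison from the \<open>T_2\<close> of the slice to \<open>T_2 E\<close>, given
  by \<open>v\<close> on both components. Through it \<open>mu_Y\<close> becomes a restriction of
  \<open>mu\<close>.\<close>

definition sigma :: "'b univ \<Rightarrow> 'b univ" where
  "sigma f = pairing C (pi1T X (Dom C f)) (pi2T X (Dom C f)) (V f \<cdot> tmap (pi1T Y f)) (V f \<cdot> tmap (pi2T Y f))"

lemma sigma_props [simp]:
  assumes "f \<in> Obj S"
  shows "sigma f \<in> Arr C" "Dom C (sigma f) = Dom C (Dom S (pi1T Y f))" "Cod C (sigma f) = Dom C (pi1T X (Dom C f))"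
    "pi1T X (Dom C f) \<cdot> sigma f = V f \<cdot> tmap (pi1T Y f)" "pi2T X (Dom C f) \<cdot> sigma f = V f \<cdot> tmap (pi2T Y f)"
  using assms by (simp_all add: sigma_def pi_V_eq)

text \<open>Both summands of \<open>mu_Y\<close> project to the zero over the common projection of
  the pair, as their sum requires.\<close>

lemma mu_Y_lift_eq:
  assumes f: "f \<in> Obj S"
  shows "TA Y (projT Y f) \<star> liftT Y f \<star> pi1T Y f =
    TA Y (projT Y f) \<star> zeroT Y (TO Y f) \<star> pi2T Y f"
proof -
  have "zeroT Y f \<star> projT Y f = TA Y (projT Y f) \<star> zeroT Y (TO Y f)"
    using nat_z_Y f unfolding nat_trans_def fid_def by (metis proj_slice(1-3) fctr.simps(2))
  from reassoc[OF category_S this, of "pi2T Y f"] reassoc[OF category_S equations_Y(2)[OF f], of "pi1T Y f"]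
  show ?thesis using f by (simp add: pi_eq_Y)
qed

lemma mu_Y_props:
  assumes f: "f \<in> Obj S"
  shows "mu_Y f \<in> Arr S" "Dom S (mu_Y f) = Dom S (pi1T Y f)" "Cod S (mu_Y f) = TO Y (TO Y f)"
    "TA X (V f) \<cdot> V (TO Y f) \<cdot> tmap (mu_Y f) = mu (Dom C f) \<cdot> sigma f"
proof -
  note [simp] = f
  show "mu_Y f \<in> Arr S" "Dom S (mu_Y f) = Dom S (pi1T Y f)" "Cod S (mu_Y f) = TO Y (TO Y f)"
    using mu_Y_lift_eq[OF f] by (simp_all add: mu_Y_def)
  have "TA X (V f) \<cdot> V (TO Y f) \<cdot> tmap (mu_Y f) =
      Tplus_T X (Dom C f) (liftT X (Dom C f) \<cdot> V f \<cdot> tmap (pi1T Y f)) (zeroT X (TO X (Dom C f)) \<cdot> V f \<cdot> tmap (pi2T Y f))"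
    using mu_Y_lift_eq[OF f] by (simp add: mu_Y_def TV_Tplus V_l_comp V_z_comp z_vert)
  then show "TA X (V f) \<cdot> V (TO Y f) \<cdot> tmap (mu_Y f) = mu (Dom C f) \<cdot> sigma f"
    by (simp add: sigma_def mu_pair pi_V_eq)
qed

lemmas mu_Y_typing [simp] = mu_Y_props(1-3)

lemma mu_Y_square:
  assumes f: "f \<in> Obj S"
  shows "TA Y (projT Y f) \<star> mu_Y f = zeroT Y f \<star> projT Y f \<star> pi1T Y f"
proof (rule TS_eqI[of _ _ f])
  note [simp] = f
  have "TA X (projT X (Dom C f)) \<cdot> mu (Dom C f) \<cdot> sigma f = zeroT X (Dom C f) \<cdot> projT X (Dom C f) \<cdot> pi1T X (Dom C f) \<cdot> sigma f"
    using reassoc[OF cats(1) pullbackD(9)[OF T_pullback_pullback[OF universal[of "Dom C f"]]], of "sigma f"]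
    by (simp del: sigma_props(4))
  then show "V f \<cdot> tmap (TA Y (projT Y f) \<star> mu_Y f) = V f \<cdot> tmap (zeroT Y f \<star> projT Y f \<star> pi1T Y f)"
    by (simp add: V_nat_comp mu_Y_props(4) V_z_comp)
qed (use f in simp_all)

context
  fixes m :: nat and f :: "'b univ"
  assumes f [simp]: "f \<in> Obj S"
begin

abbreviation "P \<equiv> Dom S (pi1T Y f)"

lemma pow_V_mu_Y:
  assumes "k \<in> Arr S" "Cod S k = (TO Y ^^ m) P"
  shows "iter_vert (Suc (Suc m)) f \<cdot> tmap ((TA Y ^^ m) (mu_Y f)) \<cdot> tmap k =
    (TA X ^^ m) (mu (Dom C f)) \<cdot> (TA X ^^ m) (sigma f) \<cdot> iter_vert m P \<cdot> tmap k"
proof -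
  have "(TA X ^^ m) (TA X (V f)) \<cdot> (TA X ^^ m) (V (TO Y f)) \<cdot> (TA X ^^ m) (tmap (mu_Y f)) =
      (TA X ^^ m) (mu (Dom C f)) \<cdot> (TA X ^^ m) (sigma f)"
    using arg_cong[OF mu_Y_props(4)[OF f], of "TA X ^^ m"] by simp
  from reassoc3[OF cats(1) this, of "iter_vert m P \<cdot> tmap k"] show ?thesis
    using assms by (simp add: iter_vert_nat_comp TA_pow_TA)
qed

lemma pow_V_pi:
  assumes "k \<in> Arr S" "Cod S k = (TO Y ^^ m) P"
  shows "(TA X ^^ m) (pi1T X (Dom C f)) \<cdot> (TA X ^^ m) (sigma f) \<cdot> iter_vert m P \<cdot> tmap k =
      iter_vert (Suc m) f \<cdot> tmap ((TA Y ^^ m) (pi1T Y f)) \<cdot> tmap k"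
    "(TA X ^^ m) (pi2T X (Dom C f)) \<cdot> (TA X ^^ m) (sigma f) \<cdot> iter_vert m P \<cdot> tmap k =
      iter_vert (Suc m) f \<cdot> tmap ((TA Y ^^ m) (pi2T Y f)) \<cdot> tmap k"
  using pow_reassoc[OF sigma_props(4)[OF f], of "iter_vert m P \<cdot> tmap k" m]
    pow_reassoc[OF sigma_props(5)[OF f], of "iter_vert m P \<cdot> tmap k" m] assms
  by (simp_all add: iter_vert_nat_comp)

lemma pow_V_Tp:
  assumes "k \<in> Arr S" "Cod S k = (TO Y ^^ m) (TO Y (TO Y f))"
  shows "iter_vert (Suc m) f \<cdot> tmap ((TA Y ^^ m) (TA Y (projT Y f))) \<cdot> tmap k =
    (TA X ^^ m) (TA X (projT X (Dom C f))) \<cdot> iter_vert (Suc (Suc m)) f \<cdot> tmap k"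
proof -
  have "V f \<cdot> tmap (TA Y (projT Y f)) = TA X (projT X (Dom C f)) \<cdot> TA X (V f) \<cdot> V (TO Y f)"
    by (simp add: V_nat)
  from pow_reassoc[OF this, of "iter_vert m (TO Y (TO Y f)) \<cdot> tmap k" m] show ?thesis
    using assms iter_vert_nat_comp[of "TA Y (projT Y f)" "TO Y f" "tmap k" m] by (simp add: TA_pow_TA)
qed

lemma pow_V_z:
  assumes "k \<in> Arr S" "Cod S k = (TO Y ^^ m) f"
  shows "iter_vert (Suc m) f \<cdot> tmap ((TA Y ^^ m) (zeroT Y f)) \<cdot> tmap k =
    (TA X ^^ m) (zeroT X (Dom C f)) \<cdot> iter_vert m f \<cdot> tmap k"
  using pow_reassoc[OF zero_slice(4)[OF f], of "iter_vert m f \<cdot> tmap k" m] assms by (simp add: iter_vert_nat_comp)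

text \<open>A map into \<open>T\<^sup>m T\<^sub>2 E\<close> whose lift lies over the iterated zero section of \<open>A\<close> has both
  components there: \<open>T\<^sub>2 f\<close> sends it to the unique map whose lift in \<open>A\<close> is zero.\<close>

lemma mu_fibre:
  assumes w: "w \<in> Obj S" and G: "G \<in> Arr C" "Dom C G = Dom C w" "Cod C G = (TO X ^^ m) (Dom C (pi1T X (Dom C f)))"
    and e1: "(TA X ^^ Suc (Suc m)) f \<cdot> (TA X ^^ m) (mu (Dom C f)) \<cdot> G = iter_zero (Suc (Suc m)) \<cdot> w"
    and e2: "(TA X ^^ m) f \<cdot> (TA X ^^ m) (projT X (Dom C f) \<cdot> pi1T X (Dom C f)) \<cdot> G = iter_zero m \<cdot> w"
  shows "(TA X ^^ Suc m) f \<cdot> (TA X ^^ m) (pi1T X (Dom C f)) \<cdot> G = iter_zero (Suc m) \<cdot> w"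
    "(TA X ^^ Suc m) f \<cdot> (TA X ^^ m) (pi2T X (Dom C f)) \<cdot> G = iter_zero (Suc m) \<cdot> w"
proof -
  note [simp] = w G
  let ?E = "Dom C f"
  \<comment> \<open>\<open>?t\<close> is \<open>T_2 f\<close> and \<open>?u\<close> is the pair of
    zeros \<open>\<langle>z_A, z_A\<rangle>\<close>. Once \<open>T^m\<close> of the first after
    \<open>G\<close> equals \<open>T^m\<close> of the second after the iterated zero, both
    components can be read off.\<close>
  let ?t = "pairing C (pi1T X A) (pi2T X A) (TA X f \<cdot> pi1T X ?E) (TA X f \<cdot> pi2T X ?E)"
  let ?u = "pairing C (pi1T X A) (pi2T X A) (zeroT X A) (zeroT X A)"
  have pf: "projT X A \<cdot> TA X f \<cdot> x = f \<cdot> projT X ?E \<cdot> x" if "x \<in> Arr C" "Cod C x = TO X ?E" for x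
    using p_nat_comp[of f x A] that by simp
  have t [simp]: "?t \<in> Arr C" "Dom C ?t = Dom C (pi1T X ?E)" "Cod C ?t = Dom C (pi1T X A)"
    "pi1T X A \<cdot> ?t = TA X f \<cdot> pi1T X ?E" "pi2T X A \<cdot> ?t = TA X f \<cdot> pi2T X ?E"
    by (simp_all add: pf pi_eq)
  have mt: "mu A \<cdot> ?t = TA X (TA X f) \<cdot> mu ?E"
  proof -
    have "mu A \<cdot> ?t = Tplus_T X A (liftT X A \<cdot> TA X f \<cdot> pi1T X ?E) (zeroT X (TO X A) \<cdot> TA X f \<cdot> pi2T X ?E)"
      by (subst mu_pair) (simp_all add: pf pi_eq)
    also have "\<dots> = TA X (TA X f) \<cdot> mu ?E"
      using l_nat_comp[of f "pi1T X ?E" A] z_nat_comp[of "TA X f" "pi2T X ?E" "TO X A"]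
      by (simp add: mu_def Tplus_nat Tproj_lift_comp Tp_z pi_eq)
    finally show ?thesis .
  qed
  have mz: "mu A \<cdot> ?u = TA X (zeroT X A) \<cdot> zeroT X A"
    using z_nat[of "zeroT X A"] by (subst mu_pair) (simp_all add: lift_zero Tplus_zero)
  \<comment> \<open>At \<open>A\<close> the maps \<open>mu A\<close> and
    \<open>p \<circ> \<pi>1\<close> are jointly monic, also under \<open>T^m\<close>; here
    universality of the lift at the base enters.\<close>
  note pb = T_pullback_pow[OF universal[OF A], of m]
  have u1: "(TA X ^^ m) (mu A) \<cdot> (TA X ^^ m) ?t \<cdot> G = (TA X ^^ m) (mu A) \<cdot> (TA X ^^ m) ?u \<cdot> iter_zero m \<cdot> w"
    using pow_reassoc[OF mt, of G m] pow_reassoc[OF mz, of "iter_zero m \<cdot> w" m] e1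
    by (simp add: TA_pow_TA)
  have u2: "(TA X ^^ m) (projT X A \<cdot> pi1T X A) \<cdot> (TA X ^^ m) ?t \<cdot> G =
      (TA X ^^ m) (projT X A \<cdot> pi1T X A) \<cdot> (TA X ^^ m) ?u \<cdot> iter_zero m \<cdot> w"
  proof -
    have a: "(projT X A \<cdot> pi1T X A) \<cdot> ?t = f \<cdot> projT X ?E \<cdot> pi1T X ?E" by (simp add: pf)
    have b: "(projT X A \<cdot> pi1T X A) \<cdot> ?u = Id C A" by (simp add: proj_zero)
    show ?thesis
      using pow_reassoc[OF a, of G m] pow_reassoc[OF b, of "iter_zero m \<cdot> w" m] e2 by simp
  qed
  have tu: "(TA X ^^ m) ?t \<cdot> G = (TA X ^^ m) ?u \<cdot> iter_zero m \<cdot> w"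
    by (rule pullback_unique[OF cats(1) pb _ _ u1 u2, of "Dom C w"]) simp_all
  have "(TA X ^^ m) (pi1T X A) \<cdot> (TA X ^^ m) ?t \<cdot> G = (TA X ^^ m) (pi1T X A) \<cdot> (TA X ^^ m) ?u \<cdot> iter_zero m \<cdot> w"
    "(TA X ^^ m) (pi2T X A) \<cdot> (TA X ^^ m) ?t \<cdot> G = (TA X ^^ m) (pi2T X A) \<cdot> (TA X ^^ m) ?u \<cdot> iter_zero m \<cdot> w"
    using tu by simp_all
  then show "(TA X ^^ Suc m) f \<cdot> (TA X ^^ m) (pi1T X ?E) \<cdot> G = iter_zero (Suc m) \<cdot> w"
    "(TA X ^^ Suc m) f \<cdot> (TA X ^^ m) (pi2T X ?E) \<cdot> G = iter_zero (Suc m) \<cdot> w"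
    using pow_reassoc[OF t(4), of G m] pow_reassoc[OF t(5), of G m]
      pow_reassoc[OF pair_props(4)[of A "zeroT X A" "zeroT X A"], of "iter_zero m \<cdot> w" m]
      pow_reassoc[OF pair_props(5)[of A "zeroT X A" "zeroT X A"], of "iter_zero m \<cdot> w" m]
    by (simp_all add: TA_pow_TA)
qed

text \<open>A cone in the slice is pushed to \<open>X\<close> by the iterated \<open>v\<close> and
  mediated there by \<open>G\<close> into \<open>T^m (T_2 E)\<close>. It comes back by components:
  \<open>mu_fibre\<close> puts them over the zero section, so they lift to the slice, and the
  slice's own \<open>T_2\<close> reassembles the lifts.\<close>

lemma universal_Y_pow:
  "is_pullback S ((TA Y ^^ m) (TA Y (projT Y f))) ((TA Y ^^ m) (zeroT Y f)) ((TA Y ^^ m) (mu_Y f))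
     ((TA Y ^^ m) (projT Y f \<star> pi1T Y f))"
proof (rule pullbackI)
  let ?E = "Dom C f"
  have sq: "TA Y (projT Y f) \<star> mu_Y f = zeroT Y f \<star> projT Y f \<star> pi1T Y f"
    by (rule mu_Y_square[OF f])
  show "(TA Y ^^ m) (TA Y (projT Y f)) \<star> (TA Y ^^ m) (mu_Y f) =
      (TA Y ^^ m) (zeroT Y f) \<star> (TA Y ^^ m) (projT Y f \<star> pi1T Y f)"
    using arg_cong[OF sq, of "TA Y ^^ m"] by simp
  fix w
  {
    fix h1 h2
    assume h: "h1 \<in> Hom S w (Dom S ((TA Y ^^ m) (TA Y (projT Y f))))" "h2 \<in> Hom S w (Dom S ((TA Y ^^ m) (zeroT Y f)))"
      and eq: "(TA Y ^^ m) (TA Y (projT Y f)) \<star> h1 = (TA Y ^^ m) (zeroT Y f) \<star> h2"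
    have h1 [simp]: "h1 \<in> Arr S" "Dom S h1 = w" "Cod S h1 = TO Y (TO Y ((TO Y ^^ m) f))"
      and h2 [simp]: "h2 \<in> Arr S" "Dom S h2 = w" "Cod S h2 = (TO Y ^^ m) f"
      using h by (simp_all add: TA_pow_TA)
    have w [simp]: "w \<in> Obj S" using Arr_S(5)[OF h1(1)] by simp
    let ?H1 = "iter_vert (Suc (Suc m)) f \<cdot> tmap h1" and ?H2 = "iter_vert m f \<cdot> tmap h2"
    have H1: "?H1 \<in> Arr C" "Dom C ?H1 = Dom C w" "Cod C ?H1 = (TO X ^^ m) (TO X (TO X ?E))"
      by (simp_all add: TA_pow_TA)
    have H: "(TA X ^^ m) (TA X (projT X ?E)) \<cdot> ?H1 = (TA X ^^ m) (zeroT X ?E) \<cdot> ?H2"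
      using arg_cong[OF eq, of "\<lambda>k. iter_vert (Suc m) f \<cdot> tmap k"] pow_V_Tp[of h1] pow_V_z[of h2]
      by (simp add: TA_pow_TA del: iter_vert.simps)
    obtain G where "G \<in> Hom C (Dom C w) (Dom C ((TA X ^^ m) (mu ?E)))"
      and G1: "(TA X ^^ m) (mu ?E) \<cdot> G = ?H1" and G2: "(TA X ^^ m) (projT X ?E \<cdot> pi1T X ?E) \<cdot> G = ?H2"
      by (rule pullback_obtain[OF T_pullback_pow[OF universal[of ?E], of m] _ _ H, of "Dom C w"]) (use H1 in simp_all)
    then have G [simp]: "G \<in> Arr C" "Dom C G = Dom C w" "Cod C G = (TO X ^^ m) (Dom C (pi1T X ?E))" by simp_all
    \<comment> \<open>The iterated maps stay folded from here on, because the \<open>pow_V\<close>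
      rules match them as a whole.\<close>
    note [simp del] = iter_vert.simps iter_zero.simps
    have over: "(TA X ^^ Suc m) f \<cdot> (TA X ^^ m) (pi1T X ?E) \<cdot> G = iter_zero (Suc m) \<cdot> w"
      "(TA X ^^ Suc m) f \<cdot> (TA X ^^ m) (pi2T X ?E) \<cdot> G = iter_zero (Suc m) \<cdot> w"
      by (rule mu_fibre[OF w G]; unfold G1 G2; use iter_vert_over[of h1 "Suc (Suc m)" f] iter_vert_over[of h2 m f] in simp)+
    obtain g1 where g1: "g1 \<in> Arr S" "Dom S g1 = w" "Cod S g1 = (TO Y ^^ Suc m) f"
      "iter_vert (Suc m) f \<cdot> tmap g1 = (TA X ^^ m) (pi1T X ?E) \<cdot> G"
      by (rule iter_vert_lift_slice[OF f w _ _ _ over(1)]) (simp_all add: TA_pow_TA)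
    obtain g2 where g2: "g2 \<in> Arr S" "Dom S g2 = w" "Cod S g2 = (TO Y ^^ Suc m) f"
      "iter_vert (Suc m) f \<cdot> tmap g2 = (TA X ^^ m) (pi2T X ?E) \<cdot> G"
      by (rule iter_vert_lift_slice[OF f w _ _ _ over(2)]) (simp_all add: TA_pow_TA)
    have ppi: "(TA X ^^ m) (projT X ?E) \<cdot> (TA X ^^ m) (pi2T X ?E) \<cdot> G = (TA X ^^ m) (projT X ?E) \<cdot> (TA X ^^ m) (pi1T X ?E) \<cdot> G"
      using pow_reassoc[OF pi_eq[of ?E], of G m] by simp
    \<comment> \<open>\<open>g1\<close> and \<open>g2\<close> have equal projections because the
      components of \<open>G\<close> do; so they form a cone over the preserved \<open>T_2\<close>
      of the slice.\<close>
    have "(TA Y ^^ m) (projT Y f) \<star> g1 = (TA Y ^^ m) (projT Y f) \<star> g2"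
      by (rule iter_vert_eqI[of _ _ m f])
        (use g1 g2 pow_V_p[OF f, of g1] pow_V_p[OF f, of g2] ppi in \<open>simp_all add: TA_pow_TA\<close>)
    then obtain k where "k \<in> Hom S w (Dom S ((TA Y ^^ m) (pi1T Y f)))"
      and k12: "(TA Y ^^ m) (pi1T Y f) \<star> k = g1" "(TA Y ^^ m) (pi2T Y f) \<star> k = g2"
      by (rule pullback_obtain[OF Y.T_pullback_pow[OF T2_pullback_Y[OF f], of m], of g1 w g2, rotated 2])
        (use g1 g2 in \<open>simp_all add: TA_pow_TA\<close>)
    then have k [simp]: "k \<in> Arr S" "Dom S k = w" "Cod S k = (TO Y ^^ m) P" by simp_all
    have kk: "tmap ((TA Y ^^ m) (pi1T Y f)) \<cdot> tmap k = tmap g1" "tmap ((TA Y ^^ m) (pi2T Y f)) \<cdot> tmap k = tmap g2"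
      unfolding tmap_comp[symmetric] k12 by simp_all
    \<comment> \<open>\<open>k\<close> was built from the components of \<open>G\<close>, so
      comparing components identifies its image under \<open>sigma\<close> with
      \<open>G\<close>.\<close>
    have sG: "(TA X ^^ m) (sigma f) \<cdot> iter_vert m P \<cdot> tmap k = G"
      by (rule pullback_unique[OF cats(1) T_pullback_pow[OF T2_pullback[of ?E], of m], of _ "Dom C w"])
        (simp_all add: pow_V_pi kk g1(4) g2(4))
    have "(TA Y ^^ m) (mu_Y f) \<star> k = h1"
      by (rule iter_vert_eqI[of _ _ "Suc (Suc m)" f]) (simp_all add: TA_pow_TA pow_V_mu_Y sG G1)
    moreover have "(TA Y ^^ m) (projT Y f \<star> pi1T Y f) \<star> k = h2"
    proof (rule iter_vert_eqI[of _ _ m f])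
      show "iter_vert m f \<cdot> tmap ((TA Y ^^ m) (projT Y f \<star> pi1T Y f) \<star> k) = iter_vert m f \<cdot> tmap h2"
        using pow_V_p[OF f, of g1] g1 G2 by (simp add: kk TA_pow_TA)
    qed simp_all
    ultimately show "\<exists>k. k \<in> Hom S w (Dom S ((TA Y ^^ m) (mu_Y f))) \<and> (TA Y ^^ m) (mu_Y f) \<star> k = h1 \<and>
        (TA Y ^^ m) (projT Y f \<star> pi1T Y f) \<star> k = h2"
      by (intro exI[of _ k]) simp
  }
  fix k k'
  assume k0: "k \<in> Hom S w (Dom S ((TA Y ^^ m) (mu_Y f)))" "k' \<in> Hom S w (Dom S ((TA Y ^^ m) (mu_Y f)))"
    and e1: "(TA Y ^^ m) (mu_Y f) \<star> k = (TA Y ^^ m) (mu_Y f) \<star> k'"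
    and e2: "(TA Y ^^ m) (projT Y f \<star> pi1T Y f) \<star> k = (TA Y ^^ m) (projT Y f \<star> pi1T Y f) \<star> k'"
  have k [simp]: "k \<in> Arr S" "Dom S k = w" "Cod S k = (TO Y ^^ m) P" "k' \<in> Arr S" "Dom S k' = w" "Cod S k' = (TO Y ^^ m) P"
    using k0 by simp_all
  note [simp del] = iter_vert.simps
  have pG: "(TA X ^^ m) (projT X ?E \<cdot> pi1T X ?E) \<cdot> (TA X ^^ m) (sigma f) \<cdot> iter_vert m P \<cdot> tmap x =
      iter_vert m f \<cdot> tmap ((TA Y ^^ m) (projT Y f \<star> pi1T Y f) \<star> x)"
    if "x \<in> Arr S" "Cod S x = (TO Y ^^ m) P" for x
    using that pow_V_pi[of x] pow_V_p[OF f, of "(TA Y ^^ m) (pi1T Y f) \<star> x"] by simp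
  \<comment> \<open>For uniqueness, the images in \<open>T^m (T_2 E)\<close> are compared by
    universality in \<open>X\<close>. Equal images have equal components, and these determine a map
    into the \<open>T_2\<close> of the slice.\<close>
  have G: "(TA X ^^ m) (sigma f) \<cdot> iter_vert m P \<cdot> tmap k = (TA X ^^ m) (sigma f) \<cdot> iter_vert m P \<cdot> tmap k'"
  proof (rule pullback_unique[OF cats(1) T_pullback_pow[OF universal[of ?E], of m], of _ "Dom C w"])
    show "(TA X ^^ m) (mu ?E) \<cdot> (TA X ^^ m) (sigma f) \<cdot> iter_vert m P \<cdot> tmap k =
        (TA X ^^ m) (mu ?E) \<cdot> (TA X ^^ m) (sigma f) \<cdot> iter_vert m P \<cdot> tmap k'"
      using arg_cong[OF e1, of "\<lambda>k. iter_vert (Suc (Suc m)) f \<cdot> tmap k"] by (simp add: pow_V_mu_Y)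
    show "(TA X ^^ m) (projT X ?E \<cdot> pi1T X ?E) \<cdot> (TA X ^^ m) (sigma f) \<cdot> iter_vert m P \<cdot> tmap k =
        (TA X ^^ m) (projT X ?E \<cdot> pi1T X ?E) \<cdot> (TA X ^^ m) (sigma f) \<cdot> iter_vert m P \<cdot> tmap k'"
      using arg_cong[OF e2, of "\<lambda>k. iter_vert m f \<cdot> tmap k"] pG[of k] pG[of k'] by simp
  qed (use Arr_S(2)[of k] Arr_S(2)[of k'] in simp_all)
  show "k = k'"
  proof (rule pullback_unique[OF category_S Y.T_pullback_pow[OF T2_pullback_Y[OF f], of m], of _ w])
    show "(TA Y ^^ m) (pi1T Y f) \<star> k = (TA Y ^^ m) (pi1T Y f) \<star> k'"
      by (rule iter_vert_eqI[of _ _ "Suc m" f]) (use pow_V_pi(1)[of k] pow_V_pi(1)[of k'] G in \<open>simp_all add: TA_pow_TA\<close>)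
    show "(TA Y ^^ m) (pi2T Y f) \<star> k = (TA Y ^^ m) (pi2T Y f) \<star> k'"
      by (rule iter_vert_eqI[of _ _ "Suc m" f]) (use pow_V_pi(2)[of k] pow_V_pi(2)[of k'] G in \<open>simp_all add: TA_pow_TA\<close>)
  qed simp_all
qed simp_all

end

theorem tangent_category_Y: "tangent_category Y"
proof -
  have "T_pullback Y (TA Y (projT Y f)) (zeroT Y f) (mu_Y f) (projT Y f \<star> pi1T Y f)" if "f \<in> Obj S" for f
    unfolding T_pullback_def using universal_Y_pow[OF that] by simp
  then show ?thesis
    unfolding tangent_category_def Let_def
    using slice_endo nat_p_Y nat_z_Y powers_Y T2_pullback_Y nat_s_Y nat_l_Y nat_c_Y additive_bundle_Y bundle_l_Y bundle_c_Y
      equations_Y(6-10)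
    by (simp add: mu_Y_def Tplus_T_def)
qed

end

section \<open>Slicing over a terminal object\<close>

lemma terminal_unique:
  "is_terminal C t \<Longrightarrow> x \<in> Hom C a t \<Longrightarrow> x' \<in> Hom C a t \<Longrightarrow> a \<in> Obj C \<Longrightarrow> x = x'"
  unfolding is_terminal_def by blast

lemma bang_Hom: "is_terminal C t \<Longrightarrow> a \<in> Obj C \<Longrightarrow> bang C t a \<in> Hom C a t"
  unfolding is_terminal_def bang_def by (metis theI')

lemma bang_eqI: "is_terminal C t \<Longrightarrow> x \<in> Hom C a t \<Longrightarrow> a \<in> Obj C \<Longrightarrow> bang C t a = x"
  by (rule terminal_unique[OF _ bang_Hom])

locale terminal_tangent_cat = tangent_cat X for X :: "'b utng" +
  fixes t :: "'b univ"
  assumes terminal: "terminal_tangent_category (X, t)"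
begin

lemma is_terminal_t: "is_terminal C t" and t_Obj [simp]: "t \<in> Obj C" and t_iso: "is_iso C (bang C t (TO X t))"
  using terminal by (auto simp: terminal_tangent_category_def is_terminal_def)

lemma bang_typing [simp]:
  "a \<in> Obj C \<Longrightarrow> bang C t a \<in> Arr C" "a \<in> Obj C \<Longrightarrow> Dom C (bang C t a) = a" "a \<in> Obj C \<Longrightarrow> Cod C (bang C t a) = t"
  using bang_Hom[OF is_terminal_t] by auto

lemma bang_eq: "x \<in> Arr C \<Longrightarrow> Cod C x = t \<Longrightarrow> Dom C x = a \<Longrightarrow> bang C t a = x"
  by (rule bang_eqI[OF is_terminal_t]) auto

text \<open>\<open>T t \<rightarrow> t\<close> is invertible, hence so are its images under all
  powers, and by induction each \<open>T^m t\<close> receives at most one map from any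
  object.\<close>

lemma pow_terminal:
  assumes "x \<in> Arr C" "x' \<in> Arr C" "Cod C x = (TO X ^^ m) t" "Cod C x' = (TO X ^^ m) t" "Dom C x = Dom C x'"
  shows "x = x'"
  using assms
proof (induction m arbitrary: x x')
  case 0
  then show ?case using terminal_unique[OF is_terminal_t, of x "Dom C x" x'] by simp
next
  case (Suc m)
  let ?b = "bang C t (TO X t)"
  obtain b' where b': "b' \<in> Arr C" "Dom C b' = t" "Cod C b' = TO X t" "b' \<cdot> ?b = Id C (TO X t)"
    using t_iso unfolding is_iso_def by auto
  have "(TA X ^^ m) b' \<cdot> (TA X ^^ m) ?b \<cdot> y = y" if "y \<in> Arr C" "Cod C y = (TO X ^^ Suc m) t" for y
    using pow_reassoc[OF b'(4), of y m] b' that by (simp add: funpow_swap1)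
  moreover have "(TA X ^^ m) ?b \<cdot> x = (TA X ^^ m) ?b \<cdot> x'"
    by (rule Suc.IH) (use Suc.prems in \<open>simp_all add: funpow_swap1\<close>)
  ultimately show ?case using Suc.prems by metis
qed

text \<open>Any two parallel maps into \<open>T^m (T t)\<close> agree, so \<open>T E\<close> with
  its identity serves as the pullback.\<close>

lemma bang_pullback:
  assumes "f \<in> Arr C" "Cod C f = t"
  shows "T_pullback X (TA X f) (zeroT X t) (Id C (TO X (Dom C f))) (bang C t (TO X (Dom C f)))"
  unfolding T_pullback_def
proof
  fix m
  note [simp] = assms
  let ?a = "TO X (Dom C f)"
  show "is_pullback C ((TA X ^^ m) (TA X f)) ((TA X ^^ m) (zeroT X t)) ((TA X ^^ m) (Id C ?a)) ((TA X ^^ m) (bang C t ?a))"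
  proof (rule pullbackI)
    show "(TA X ^^ m) (TA X f) \<cdot> (TA X ^^ m) (Id C ?a) = (TA X ^^ m) (zeroT X t) \<cdot> (TA X ^^ m) (bang C t ?a)"
      by (rule pow_terminal[of _ _ "Suc m"]) (simp_all add: funpow_swap1)
    fix w h1 h2
    assume "h1 \<in> Hom C w (Dom C ((TA X ^^ m) (TA X f)))" "h2 \<in> Hom C w (Dom C ((TA X ^^ m) (zeroT X t)))"
    then have h [simp]: "h1 \<in> Arr C" "Dom C h1 = w" "Cod C h1 = (TO X ^^ m) ?a" "h2 \<in> Arr C" "Dom C h2 = w" "Cod C h2 = (TO X ^^ m) t"
      by simp_all
    have "(TA X ^^ m) (bang C t ?a) \<cdot> h1 = h2"
      by (rule pow_terminal[of _ _ m]) simp_all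
    then show "\<exists>k. k \<in> Hom C w (Dom C ((TA X ^^ m) (Id C ?a))) \<and> (TA X ^^ m) (Id C ?a) \<cdot> k = h1 \<and>
        (TA X ^^ m) (bang C t ?a) \<cdot> k = h2"
      by (intro exI[of _ h1]) simp
  qed simp_all
qed

lemma sliceable_t: "sliceable X t"
  unfolding sliceable_def using bang_pullback by blast

end

lemma terminal_tangent_cat_intro: "terminal_tangent_category P \<Longrightarrow> terminal_tangent_cat (fst P) (snd P)"
  by (cases P) (simp add: terminal_tangent_cat_def terminal_tangent_cat_axioms_def terminal_tangent_category_def tangent_cat_intro)

lemma ex1_implies_eq: "\<exists>!x. Q x \<Longrightarrow> Q a \<Longrightarrow> Q b \<Longrightarrow> a = b"
  by blast

lemma fibre_power_cone:
  assumes "is_fibre_power C n f u q" "v \<in> Hom C w (Cod C f)" "\<forall>i<n. h i \<in> Hom C w (Dom C f) \<and> f \<cdot>\<^bsub>C\<^esub> h i = v"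
  shows "\<exists>!k. k \<in> Hom C w (Dom C u) \<and> u \<cdot>\<^bsub>C\<^esub> k = v \<and> (\<forall>i<n. q i \<cdot>\<^bsub>C\<^esub> k = h i)"
  using assms unfolding is_fibre_power_def by blast

locale terminal_slice0 = terminal_tangent_cat X t + tangent_slice0 X t pb for X :: "'b utng" and t pb
begin

text \<open>The power of \<open>p\<close> in \<open>X\<close> is lifted along \<open>v\<close>: all
  conditions over \<open>t\<close> hold by \<open>pow_terminal\<close>, so the fibre power in
  \<open>X\<close> becomes one in the slice once its maps are made arrows over
  \<open>t\<close>.\<close>

lemma terminal_slice_power:
  assumes f: "f \<in> Obj S" and uq: "\<And>m. is_fibre_power C n ((TA X ^^ m) (projT X (Dom C f))) ((TA X ^^ m) u) (\<lambda>i. (TA X ^^ m) (q i))"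
  shows "is_fibre_power S n ((TA Y ^^ m) (projT Y f)) ((TA Y ^^ m) (Tri (f \<cdot> u) u f))
    (\<lambda>i. (TA Y ^^ m) (Tri (f \<cdot> u) (into pb X t f (q i)) (TO Y f)))"
proof -
  note [simp] = f
  let ?E = "Dom C f" and ?x = "f \<cdot> u"
  let ?U = "Tri ?x u f" and ?Q = "\<lambda>i. Tri ?x (into pb X t f (q i)) (TO Y f)"
  have u [simp]: "u \<in> Arr C" "Cod C u = ?E"
    and q: "i < n \<Longrightarrow> q i \<in> Arr C \<and> Dom C (q i) = Dom C u \<and> Cod C (q i) = TO X ?E \<and> projT X ?E \<cdot> q i = u" for i
    using uq[of 0] by (auto simp: is_fibre_power_def)
  have x [simp]: "?x \<in> Obj S" unfolding S_Obj by simp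
  have U [simp]: "?U \<in> Arr S" by simp
  have Q: "?Q i \<in> Arr S" "V f \<cdot> tmap (?Q i) = q i" if "i < n" for i
  proof -
    have "TA X f \<cdot> q i = zeroT X t \<cdot> ?x"
      by (rule pow_terminal[of _ _ 1]) (use q[OF that] in simp_all)
    from into_props[OF f _ _ _ _ _ this] show "?Q i \<in> Arr S" "V f \<cdot> tmap (?Q i) = q i"
      using q[OF that] by simp_all
  qed
  have pQ: "projT Y f \<cdot>\<^bsub>S\<^esub> ?Q i = ?U" if "i < n" for i
    by (rule S_eqI) (use that Q[OF that] q[OF that] Arr_S(1-3)[OF Q(1)[OF that]] in simp_all)
  have pf: "projT X ?E \<in> Arr C" by simp
  \<comment> \<open>Under the iterated \<open>v\<close> the arrows \<open>?Q i\<close> act as the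
    projections \<open>q i\<close> of the power in \<open>X\<close>.\<close>
  have key: "iter_vert (Suc m) f \<cdot> tmap ((TA Y ^^ m) (?Q i)) \<cdot> tmap k = (TA X ^^ m) (q i) \<cdot> iter_vert m ?x \<cdot> tmap k"
    if "i < n" "k \<in> Arr S" "Cod S k = (TO Y ^^ m) ?x" for i k
  proof -
    have "iter_vert m (TO Y f) \<cdot> tmap ((TA Y ^^ m) (?Q i)) \<cdot> tmap k = (TA X ^^ m) (tmap (?Q i)) \<cdot> iter_vert m ?x \<cdot> tmap k"
      using iter_vert_nat_comp[of "?Q i" "TO Y f" "tmap k" m] that Q[OF that(1)] by simp
    moreover have "tmap ((TA Y ^^ m) (?Q i)) \<in> Arr C" "Dom C (tmap ((TA Y ^^ m) (?Q i))) = Dom C ((TO Y ^^ m) ?x)"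
      "Cod C (tmap ((TA Y ^^ m) (?Q i))) = Dom C ((TO Y ^^ m) (TO Y f))"
      using Q[OF that(1)] Arr_S(1,2,3)[of "(TA Y ^^ m) (?Q i)"] by simp_all
    ultimately show ?thesis
      using pow_reassoc[OF Q(2)[OF that(1)], of "iter_vert m ?x \<cdot> tmap k" m] that Q[OF that(1)] Arr_S(1-3)[of "?Q i"] by simp
  qed
  have keyU: "iter_vert m f \<cdot> tmap ((TA Y ^^ m) ?U) \<cdot> tmap k = (TA X ^^ m) u \<cdot> iter_vert m ?x \<cdot> tmap k"
    if "k \<in> Arr S" "Cod S k = (TO Y ^^ m) ?x" for k
    using iter_vert_nat_comp[of ?U f "tmap k" m] that by simp
  show ?thesis
    unfolding is_fibre_power_def
  proof (intro conjI allI impI)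
    fix i assume i: "i < n"
    show "(TA Y ^^ m) (?Q i) \<in> Hom S (Dom S ((TA Y ^^ m) ?U)) (Dom S ((TA Y ^^ m) (projT Y f)))"
      using Q(1)[OF i] by simp
    show "(TA Y ^^ m) (projT Y f) \<cdot>\<^bsub>S\<^esub> (TA Y ^^ m) (?Q i) = (TA Y ^^ m) ?U"
      using arg_cong[OF pQ[OF i], of "TA Y ^^ m"] Q(1)[OF i] by simp
  next
    fix w v h
    assume v0: "v \<in> Hom S w (Cod S ((TA Y ^^ m) (projT Y f)))"
      and h0: "\<forall>i<n. h i \<in> Hom S w (Dom S ((TA Y ^^ m) (projT Y f))) \<and> (TA Y ^^ m) (projT Y f) \<cdot>\<^bsub>S\<^esub> h i = v"
    have v [simp]: "v \<in> Arr S" "Dom S v = w" "Cod S v = (TO Y ^^ m) f" using v0 by simp_all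
    have w [simp]: "w \<in> Obj S" using Arr_S(5)[OF v(1)] by simp
    have h: "i < n \<Longrightarrow> h i \<in> Arr S \<and> Dom S (h i) = w \<and> Cod S (h i) = (TO Y ^^ m) (TO Y f) \<and>
        (TA Y ^^ m) (projT Y f) \<cdot>\<^bsub>S\<^esub> h i = v" for i using h0 by simp
    note [simp del] = iter_vert.simps
    let ?v = "iter_vert m f \<cdot> tmap v" and ?h = "\<lambda>i. iter_vert (Suc m) f \<cdot> tmap (h i)"
    have "\<forall>i<n. ?h i \<in> Hom C (Dom C w) (Dom C ((TA X ^^ m) (projT X ?E))) \<and> (TA X ^^ m) (projT X ?E) \<cdot> ?h i = ?v"
    proof (intro allI impI)
      fix i assume i: "i < n"
      have hv: "tmap ((TA Y ^^ m) (projT Y f)) \<cdot> tmap (h i) = tmap v"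
        unfolding tmap_comp[symmetric] using h[OF i] by simp
      have "(TA X ^^ m) (projT X ?E) \<cdot> ?h i = ?v"
        using pow_V_p[OF f, of "h i" m] h[OF i] hv by simp
      then show "?h i \<in> Hom C (Dom C w) (Dom C ((TA X ^^ m) (projT X ?E))) \<and> (TA X ^^ m) (projT X ?E) \<cdot> ?h i = ?v"
        using h[OF i] by (simp add: funpow_swap1)
    qed
    then have ex: "\<exists>!k. k \<in> Hom C (Dom C w) (Dom C ((TA X ^^ m) u)) \<and> (TA X ^^ m) u \<cdot> k = ?v \<and>
        (\<forall>i<n. (TA X ^^ m) (q i) \<cdot> k = ?h i)"
      by (rule fibre_power_cone[OF uq[of m], rotated]) simp
    then obtain k' where "k' \<in> Hom C (Dom C w) (Dom C ((TA X ^^ m) u))" and k'1: "(TA X ^^ m) u \<cdot> k' = ?v"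
        and k'2: "\<And>i. i < n \<Longrightarrow> (TA X ^^ m) (q i) \<cdot> k' = ?h i" by blast
    then have k' [simp]: "k' \<in> Arr C" "Dom C k' = Dom C w" "Cod C k' = (TO X ^^ m) (Dom C u)" by simp_all
    \<comment> \<open>The condition for lifting \<open>k'\<close> to the slice is an equation
      between two maps into \<open>T^m t\<close>.\<close>
    have "(TA X ^^ m) ?x \<cdot> k' = iter_zero m \<cdot> w"
      by (rule pow_terminal[of _ _ m]) simp_all
    from iter_vert_lift_slice[OF x w _ _ _ this] obtain k where k [simp]: "k \<in> Arr S" "Dom S k = w" "Cod S k = (TO Y ^^ m) ?x"
      and kk: "iter_vert m ?x \<cdot> tmap k = k'" by auto
    show "\<exists>!k. k \<in> Hom S w (Dom S ((TA Y ^^ m) ?U)) \<and> (TA Y ^^ m) ?U \<cdot>\<^bsub>S\<^esub> k = v \<and>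
        (\<forall>i<n. (TA Y ^^ m) (?Q i) \<cdot>\<^bsub>S\<^esub> k = h i)"
    proof (rule ex1I[of _ k], intro conjI allI impI)
      show "(TA Y ^^ m) ?U \<cdot>\<^bsub>S\<^esub> k = v"
        by (rule iter_vert_eqI[of _ _ m f]) (simp_all add: keyU kk k'1)
      show "(TA Y ^^ m) (?Q i) \<cdot>\<^bsub>S\<^esub> k = h i" if "i < n" for i
        by (rule iter_vert_eqI[of _ _ "Suc m" f])
          (use key[OF that, of k] h[OF that] Q(1)[OF that] k'2[OF that] in \<open>simp_all add: kk funpow_swap1\<close>)
      fix k2 assume k2: "k2 \<in> Hom S w (Dom S ((TA Y ^^ m) ?U)) \<and> (TA Y ^^ m) ?U \<cdot>\<^bsub>S\<^esub> k2 = v \<and>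
        (\<forall>i<n. (TA Y ^^ m) (?Q i) \<cdot>\<^bsub>S\<^esub> k2 = h i)"
      then have k2': "k2 \<in> Arr S" "Dom S k2 = w" "Cod S k2 = (TO Y ^^ m) ?x" "(TA Y ^^ m) ?U \<cdot>\<^bsub>S\<^esub> k2 = v"
        "\<And>i. i < n \<Longrightarrow> (TA Y ^^ m) (?Q i) \<cdot>\<^bsub>S\<^esub> k2 = h i" by auto
      have "(TA X ^^ m) u \<cdot> iter_vert m ?x \<cdot> tmap k2 = ?v"
        using keyU[of k2] k2'(1-3) arg_cong[OF k2'(4), of tmap] by simp
      moreover have "(TA X ^^ m) (q i) \<cdot> iter_vert m ?x \<cdot> tmap k2 = ?h i" if "i < n" for i
        using key[OF that, of k2] k2'(1-3) arg_cong[OF k2'(5)[OF that], of tmap] by simp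
      ultimately have "iter_vert m ?x \<cdot> tmap k2 = k'"
        using ex k'1 k'2 k2'(1-3) k' Arr_S(1-3)[of k2] by (intro ex1_implies_eq[OF ex]) simp_all
      then show "k2 = k"
        by (intro iter_vert_eqI[of k2 k m ?x]) (simp_all add: k2' kk)
    qed simp_all
  qed simp_all
qed

lemma terminal_powers: "has_T_powers S (TanF Y) (projT Y)"
  unfolding has_T_powers_def
proof (intro ballI allI)
  fix f n assume f: "f \<in> Obj S"
  obtain u q where "\<And>m. is_fibre_power C n ((TA X ^^ m) (projT X (Dom C f))) ((TA X ^^ m) u) (\<lambda>i. (TA X ^^ m) (q i))"
    using powers f unfolding has_T_powers_def by (metis Dom_Obj Obj_S(1) cats(1))
  from terminal_slice_power[OF f this]
  show "\<exists>u q. \<forall>m. is_fibre_power S n ((TA Y ^^ m) (projT Y f)) ((TA Y ^^ m) u) (\<lambda>i. (TA Y ^^ m) (q i))"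
    by (intro exI allI)
qed

end


section \<open>Tangent pairs from terminal objects, and the terminal object of a slice\<close>

lemma tangent_slice_pair:
  "pullback_choice pb \<Longrightarrow> tangent_pair pb P \<Longrightarrow> tangent_slice (fst P) (snd P) pb"
  by (cases P) (simp add: tangent_pair_def tangent_slice_def tangent_slice0_def tangent_slice0_axioms_def tangent_slice_axioms_def tangent_cat_intro)

text \<open>The fibre powers that belong to a tangent pair are those of
  \<open>terminal_powers\<close>. This makes \<open>Term\<close> well defined on objects.\<close>

lemma terminal_tangent_pair:
  assumes "pullback_choice pb" "terminal_tangent_category P"
  shows "tangent_pair pb P"
proof -
  obtain X t where P: "P = (X, t)" by force
  interpret terminal_tangent_cat X t using terminal_tangent_cat_intro[OF assms(2)] P by simp
  interpret terminal_slice0 X t pb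
    by unfold_locales (use assms(1) sliceable_t in simp_all)
  show ?thesis
    using tangent_cat sliceable_t terminal_powers by (simp add: tangent_pair_def P slice_cat_eq sliceT_eq sliceproj_eq)
qed

context tangent_slice
begin

lemma Id_A [simp]: "Id C A \<in> Obj S"
  unfolding S_Obj by simp

lemma terminal_Id: "is_terminal S (Id C A)"
  unfolding is_terminal_def
proof (intro conjI ballI)
  fix f assume f: "f \<in> Obj S"
  show "\<exists>!k. k \<in> Hom S f (Id C A)"
  proof (rule ex1I[of _ "Tri f f (Id C A)"])
    fix k assume k: "k \<in> Hom S f (Id C A)"
    then have "tmap k = f" using Arr_S(4)[of k] Arr_S(1)[of k] Arr_S(3)[of k] by simp
    then show "k = Tri f f (Id C A)" using k Tri_eta[of k] by simp
  qed (use f in simp)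
qed simp

lemma bang_S: "f \<in> Obj S \<Longrightarrow> bang S (Id C A) f = Tri f f (Id C A)"
  by (rule bang_eqI[OF terminal_Id]) simp_all

text \<open>For the identity of \<open>A\<close> the equation of the vertical bundle reads
  \<open>V = z_A \<circ> TO\<close>, so the zero of the slice is inverse to the map to the terminal
  object.\<close>

lemma terminal_tangent_category_Y: "terminal_tangent_category (Y, Id C A)"
proof -
  let ?i = "Id C A"
  let ?b = "Tri (TO Y ?i) (TO Y ?i) ?i"
  have b: "?b \<in> Arr S" by simp
  have "zeroT Y ?i \<star> ?b = Id S (TO Y ?i)"
  proof (rule TS_eqI[of _ _ ?i])
    have "V ?i \<cdot> tmap (zeroT Y ?i) \<cdot> TO Y ?i = zeroT X A \<cdot> TO Y ?i" by (simp add: V_z_comp)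
    also have "\<dots> = V ?i" using vert_eq[of ?i] by simp
    finally show "V ?i \<cdot> tmap (zeroT Y ?i \<star> ?b) = V ?i \<cdot> tmap (Id S (TO Y ?i))" by simp
  qed (use b in simp_all)
  moreover have "?b \<star> zeroT Y ?i = Id S ?i"
    by (rule terminal_unique[OF terminal_Id, of _ ?i]) (use b in simp_all)
  ultimately have "is_iso S ?b"
    unfolding is_iso_def using b by (intro conjI bexI[of _ "zeroT Y ?i"]) simp_all
  then show ?thesis
    unfolding terminal_tangent_category_def using tangent_category_Y terminal_Id by (simp add: bang_S)
qed

end

section \<open>The morphism of slices induced by a morphism of tangent pairs\<close>

locale slice_morphism = dom: tangent_slice X A pb + cod: tangent_slice X' B pb + lax_morphism X X' F \<alpha>
  for X X' :: "'b utng" and A B pb F \<alpha> +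
  fixes \<phi> :: "'b univ"
  assumes phi [simp]: "\<phi> \<in> Arr (Cat X')" "Dom (Cat X') \<phi> = omap F A" "Cod (Cat X') \<phi> = B"
begin

text \<open>This and the next two definitions are the components of \<open>slice_mor\<close> before
  their restriction to the source category; \<open>slice_mor_simps\<close> makes the
  connection.\<close>

definition slice_ob :: "'b univ \<Rightarrow> 'b univ" where
  "slice_ob f = \<phi> \<bullet> amap F f"

definition slice_arr :: "'b univ \<Rightarrow> 'b univ" where
  "slice_arr k = Tri (slice_ob (Dom dom.S k)) (amap F (tmap k)) (slice_ob (Cod dom.S k))"

definition slice_dist :: "'b univ \<Rightarrow> 'b univ" where
  "slice_dist f = Tri (slice_ob (TO dom.Y f)) (into pb X' B (slice_ob f) (\<alpha> (Dom (Cat X) f) \<bullet> amap F (dom.V f))) (TO cod.Y (slice_ob f))"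

lemma slice_ob_Obj [simp]: "f \<in> Obj dom.S \<Longrightarrow> slice_ob f \<in> Obj cod.S"
  unfolding cod.S_Obj by (simp add: slice_ob_def)

lemma Dom_slice_ob [simp]: "f \<in> Obj dom.S \<Longrightarrow> Dom (Cat X') (slice_ob f) = omap F (Dom (Cat X) f)"
  by (simp add: slice_ob_def)

lemma slice_ob_comp: "f \<in> Obj dom.S \<Longrightarrow> x \<in> Arr (Cat X) \<Longrightarrow> Cod (Cat X) x = Dom (Cat X) f \<Longrightarrow>
    slice_ob f \<bullet> amap F x = slice_ob (f \<cdot>\<^bsub>Cat X\<^esub> x)"
  by (simp add: slice_ob_def)

lemma slice_arr_typing [simp]:
  assumes "k \<in> Arr dom.S"
  shows "slice_arr k \<in> Arr cod.S" "Dom cod.S (slice_arr k) = slice_ob (Dom dom.S k)" "Cod cod.S (slice_arr k) = slice_ob (Cod dom.S k)"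
    "tmap (slice_arr k) = amap F (tmap k)"
  using assms slice_ob_comp[of "Cod dom.S k" "tmap k"] by (simp_all add: slice_arr_def)

text \<open>\<open>\<alpha>\<close> is natural and preserves zeros, so it carries
  \<open>F v_f\<close> to a map over the zero section of \<open>F A\<close>. Naturality of zero at
  \<open>\<phi>\<close> carries this on to \<open>B\<close>.\<close>

lemma slice_dist_props:
  assumes f: "f \<in> Obj dom.S"
  shows "slice_dist f \<in> Arr cod.S" "Dom cod.S (slice_dist f) = slice_ob (TO dom.Y f)" "Cod cod.S (slice_dist f) = TO cod.Y (slice_ob f)"
    "cod.V (slice_ob f) \<bullet> tmap (slice_dist f) = \<alpha> (Dom (Cat X) f) \<bullet> amap F (dom.V f)"
proof -
  note [simp] = f
  let ?h = "\<alpha> (Dom (Cat X) f) \<bullet> amap F (dom.V f)"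
  have h: "?h \<in> Arr (Cat X')" "Cod (Cat X') ?h = TO X' (Dom (Cat X') (slice_ob f))" "slice_ob (TO dom.Y f) \<in> Arr (Cat X')"
    "Dom (Cat X') (slice_ob (TO dom.Y f)) = Dom (Cat X') ?h" "Cod (Cat X') (slice_ob (TO dom.Y f)) = B"
    by simp_all
  have 1: "TA X' (amap F f) \<bullet> ?h = \<alpha> A \<bullet> amap F (TA X f) \<bullet> amap F (dom.V f)"
    using reassoc[OF cod.cats(1) dist_nat[of f], of "amap F (dom.V f)"] by simp
  have 2: "amap F (TA X f) \<bullet> amap F (dom.V f) = amap F (zeroT X A) \<bullet> amap F (TO dom.Y f)"
    using arg_cong[OF dom.vert_eq[OF f], of "amap F"] by simp
  have 3: "\<alpha> A \<bullet> amap F (zeroT X A) \<bullet> amap F (TO dom.Y f) = zeroT X' (omap F A) \<bullet> amap F (TO dom.Y f)"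
    using reassoc[OF cod.cats(1) dist_z[of A], of "amap F (TO dom.Y f)"] by simp
  have "TA X' (slice_ob f) \<bullet> ?h = zeroT X' B \<bullet> slice_ob (TO dom.Y f)"
    using 1 2 3 reassoc[OF cod.cats(1) cod.z_nat[of \<phi>], of "amap F (TO dom.Y f)"] by (simp add: slice_ob_def)
  note i = cod.into_props[OF slice_ob_Obj[OF f] h this]
  show "slice_dist f \<in> Arr cod.S" "Dom cod.S (slice_dist f) = slice_ob (TO dom.Y f)" "Cod cod.S (slice_dist f) = TO cod.Y (slice_ob f)"
    "cod.V (slice_ob f) \<bullet> tmap (slice_dist f) = ?h"
    unfolding slice_dist_def using i h by simp_all
qed

lemmas slice_dist_typing [simp] = slice_dist_props(1-3)

lemma V_slice_dist_comp: "f \<in> Obj dom.S \<Longrightarrow> x \<in> Arr (Cat X') \<Longrightarrow> Cod (Cat X') x = omap F (Dom (Cat X) (TO dom.Y f)) \<Longrightarrow>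
    cod.V (slice_ob f) \<bullet> tmap (slice_dist f) \<bullet> x = \<alpha> (Dom (Cat X) f) \<bullet> amap F (dom.V f) \<bullet> x"
  using reassoc[OF cod.cats(1) slice_dist_props(4)[of f], of x] by simp

lemma TV_slice_dist: "f \<in> Obj dom.S \<Longrightarrow> x \<in> Arr (Cat X') \<Longrightarrow> Cod (Cat X') x = TO X' (omap F (Dom (Cat X) (TO dom.Y f))) \<Longrightarrow>
    TA X' (cod.V (slice_ob f)) \<bullet> TA X' (tmap (slice_dist f)) \<bullet> x =
    TA X' (\<alpha> (Dom (Cat X) f)) \<bullet> TA X' (amap F (dom.V f)) \<bullet> x"
  using cod.TA_reassoc[OF slice_dist_props(4)[of f], of x] by simp

lemma dist_vert: "f \<in> Obj dom.S \<Longrightarrow> x \<in> Arr (Cat X') \<Longrightarrow> Cod (Cat X') x = omap F (TO X (Dom (Cat X) (TO dom.Y f))) \<Longrightarrow>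
   TA X' (amap F (dom.V f)) \<bullet> \<alpha> (Dom (Cat X) (TO dom.Y f)) \<bullet> x =
   \<alpha> (TO X (Dom (Cat X) f)) \<bullet> amap F (TA X (dom.V f)) \<bullet> x"
  using reassoc[OF cod.cats(1) dist_nat[of "dom.V f"], of x] by simp

text \<open>\<open>G\<close> and \<open>\<theta>\<close> are prescribed only on the slice, since
  restricted maps will be substituted for them. After composition with \<open>v\<close> each law is
  the corresponding law of \<open>\<alpha>\<close>, combined with \<open>F\<close> of the equation
  that defines the structure map over \<open>A\<close>.\<close>

lemma slice_lax:
  assumes om: "\<And>f. f \<in> Obj dom.S \<Longrightarrow> omap G f = slice_ob f"
    and am: "\<And>k. k \<in> Arr dom.S \<Longrightarrow> amap G k = slice_arr k"
    and di: "\<And>f. f \<in> Obj dom.S \<Longrightarrow> \<theta> f = slice_dist f"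
  shows "lax_tangent_morphism dom.Y cod.Y G \<theta>"
proof (rule lax_tangent_morphismI)
  note [simp] = om am di
  show "is_functor dom.S cod.S G"
    unfolding is_functor_def
  proof (intro conjI ballI impI)
    fix f assume h: "f \<in> Obj dom.S"
    show "amap G (Id dom.S f) = Id cod.S (omap G f)"
      by (rule cod.S_eqI) (use h in simp_all)
  next
    fix f g assume h: "f \<in> Arr dom.S" "g \<in> Arr dom.S" "Cod dom.S f = Dom dom.S g"
    show "amap G (g \<cdot>\<^bsub>dom.S\<^esub> f) = amap G g \<cdot>\<^bsub>cod.S\<^esub> amap G f"
      by (rule cod.S_eqI) (use h in simp_all)
  qed simp_all
  show "\<theta> (Cod dom.S k) \<cdot>\<^bsub>cod.S\<^esub> amap G (TA dom.Y k) = TA cod.Y (amap G k) \<cdot>\<^bsub>cod.S\<^esub> \<theta> (Dom dom.S k)"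
    if k: "k \<in> Arr dom.S" for k
  proof (rule cod.TS_eqI[of _ _ "slice_ob (Cod dom.S k)"])
    show "cod.V (slice_ob (Cod dom.S k)) \<bullet> tmap (\<theta> (Cod dom.S k) \<cdot>\<^bsub>cod.S\<^esub> amap G (TA dom.Y k)) =
      cod.V (slice_ob (Cod dom.S k)) \<bullet> tmap (TA cod.Y (amap G k) \<cdot>\<^bsub>cod.S\<^esub> \<theta> (Dom dom.S k))"
      using k arg_cong[OF dom.V_nat[OF k refl], of "amap F"]
        reassoc[OF cod.cats(1) dist_nat[of "tmap k"], of "amap F (dom.V (Dom dom.S k))"]
      by (simp add: V_slice_dist_comp cod.V_nat_comp slice_dist_props(4))
  qed (use k in simp_all)
  fix f assume f: "f \<in> Obj dom.S"
  note [simp] = f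
  let ?E = "Dom (Cat X) f"
  show "\<theta> f \<in> Hom cod.S (omap G (TO dom.Y f)) (TO cod.Y (omap G f))" by simp
  have pth: "projT cod.Y (slice_ob f) \<cdot>\<^bsub>cod.S\<^esub> slice_dist f = slice_arr (projT dom.Y f)"
    by (rule cod.S_eqI) (simp_all add: slice_dist_props(4) dist_p_comp)
  then show "projT cod.Y (omap G f) \<cdot>\<^bsub>cod.S\<^esub> \<theta> f = amap G (projT dom.Y f)" by simp
  show "\<theta> f \<cdot>\<^bsub>cod.S\<^esub> amap G (zeroT dom.Y f) = zeroT cod.Y (omap G f)"
  proof (rule cod.TS_eqI[of _ _ "slice_ob f"])
    show "cod.V (slice_ob f) \<bullet> tmap (\<theta> f \<cdot>\<^bsub>cod.S\<^esub> amap G (zeroT dom.Y f)) =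
      cod.V (slice_ob f) \<bullet> tmap (zeroT cod.Y (omap G f))"
      using arg_cong[OF dom.zero_slice(4)[OF f], of "amap F"] by (simp add: V_slice_dist_comp cod.zero_slice(4) dist_z)
  qed simp_all
  let ?x = "slice_dist f \<cdot>\<^bsub>cod.S\<^esub> slice_arr (pi1T dom.Y f)" and ?y = "slice_dist f \<cdot>\<^bsub>cod.S\<^esub> slice_arr (pi2T dom.Y f)"
  have "slice_arr (projT dom.Y f) \<cdot>\<^bsub>cod.S\<^esub> slice_arr (pi1T dom.Y f) = slice_arr (projT dom.Y f) \<cdot>\<^bsub>cod.S\<^esub> slice_arr (pi2T dom.Y f)"
    by (rule cod.S_eqI) (use arg_cong[OF dom.pi_eq_Y[OF f], of "\<lambda>k. amap F (tmap k)"] in simp_all)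
  then have e: "projT cod.Y (slice_ob f) \<cdot>\<^bsub>cod.S\<^esub> ?x = projT cod.Y (slice_ob f) \<cdot>\<^bsub>cod.S\<^esub> ?y"
    using reassoc[OF cod.category_S pth, of "slice_arr (pi1T dom.Y f)"] reassoc[OF cod.category_S pth, of "slice_arr (pi2T dom.Y f)"] by simp
  show "\<theta> f \<cdot>\<^bsub>cod.S\<^esub> amap G (sumT dom.Y f) =
      plus_T cod.Y (omap G f) (\<theta> f \<cdot>\<^bsub>cod.S\<^esub> amap G (pi1T dom.Y f)) (\<theta> f \<cdot>\<^bsub>cod.S\<^esub> amap G (pi2T dom.Y f))"
  proof (rule cod.TS_eqI[of _ _ "slice_ob f"])
    show "cod.V (slice_ob f) \<bullet> tmap (\<theta> f \<cdot>\<^bsub>cod.S\<^esub> amap G (sumT dom.Y f)) =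
      cod.V (slice_ob f) \<bullet> tmap (plus_T cod.Y (omap G f) (\<theta> f \<cdot>\<^bsub>cod.S\<^esub> amap G (pi1T dom.Y f)) (\<theta> f \<cdot>\<^bsub>cod.S\<^esub> amap G (pi2T dom.Y f)))"
      using e arg_cong[OF dom.sum_slice(4)[OF f], of "amap F"] dom.pi_V_eq[OF f]
      by (simp add: V_slice_dist_comp cod.V_plus dist_plus)
  qed (use e in simp_all)
  show "liftT cod.Y (omap G f) \<cdot>\<^bsub>cod.S\<^esub> \<theta> f = TA cod.Y (\<theta> f) \<cdot>\<^bsub>cod.S\<^esub> \<theta> (TO dom.Y f) \<cdot>\<^bsub>cod.S\<^esub> amap G (liftT dom.Y f)"
  proof (rule cod.TTS_eqI[of _ _ "slice_ob f"])
    have "amap F (TA X (dom.V f)) \<bullet> amap F (dom.V (TO dom.Y f)) \<bullet> amap F (tmap (liftT dom.Y f)) =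
        amap F (liftT X ?E) \<bullet> amap F (dom.V f)"
      using arg_cong[OF dom.lift_slice(4)[OF f], of "amap F"] by simp
    then show "TA X' (cod.V (slice_ob f)) \<bullet> cod.V (TO cod.Y (slice_ob f)) \<bullet> tmap (liftT cod.Y (omap G f) \<cdot>\<^bsub>cod.S\<^esub> \<theta> f) =
      TA X' (cod.V (slice_ob f)) \<bullet> cod.V (TO cod.Y (slice_ob f)) \<bullet>
        tmap (TA cod.Y (\<theta> f) \<cdot>\<^bsub>cod.S\<^esub> \<theta> (TO dom.Y f) \<cdot>\<^bsub>cod.S\<^esub> amap G (liftT dom.Y f))"
      using reassoc[OF cod.cats(1) dist_l[of ?E], of "amap F (dom.V f)"]
      by (simp add: cod.V_l_comp slice_dist_props(4) cod.V_nat_comp V_slice_dist_comp TV_slice_dist dist_vert)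
  qed simp_all
  show "flipT cod.Y (omap G f) \<cdot>\<^bsub>cod.S\<^esub> TA cod.Y (\<theta> f) \<cdot>\<^bsub>cod.S\<^esub> \<theta> (TO dom.Y f) =
      TA cod.Y (\<theta> f) \<cdot>\<^bsub>cod.S\<^esub> \<theta> (TO dom.Y f) \<cdot>\<^bsub>cod.S\<^esub> amap G (flipT dom.Y f)"
  proof (rule cod.TTS_eqI[of _ _ "slice_ob f"])
    have "amap F (TA X (dom.V f)) \<bullet> amap F (dom.V (TO dom.Y f)) \<bullet> amap F (tmap (flipT dom.Y f)) =
        amap F (flipT X ?E) \<bullet> amap F (TA X (dom.V f)) \<bullet> amap F (dom.V (TO dom.Y f))"
      using arg_cong[OF dom.flip_slice(4)[OF f], of "amap F"] by simp
    then show "TA X' (cod.V (slice_ob f)) \<bullet> cod.V (TO cod.Y (slice_ob f)) \<bullet>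
        tmap (flipT cod.Y (omap G f) \<cdot>\<^bsub>cod.S\<^esub> TA cod.Y (\<theta> f) \<cdot>\<^bsub>cod.S\<^esub> \<theta> (TO dom.Y f)) =
      TA X' (cod.V (slice_ob f)) \<bullet> cod.V (TO cod.Y (slice_ob f)) \<bullet>
        tmap (TA cod.Y (\<theta> f) \<cdot>\<^bsub>cod.S\<^esub> \<theta> (TO dom.Y f) \<cdot>\<^bsub>cod.S\<^esub> amap G (flipT dom.Y f))"
      using reassoc3[OF cod.cats(1) dist_c[of ?E], of "amap F (TA X (dom.V f)) \<bullet> amap F (dom.V (TO dom.Y f))"]
      by (simp add: cod.V_c_comp slice_dist_props(4) cod.V_nat_comp V_slice_dist_comp TV_slice_dist dist_vert)
  qed simp_all
qed (simp_all add: dom.tangent_category_Y cod.tangent_category_Y)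

end

section \<open>\<open>Slice\<close> on 1-cells\<close>

lemma slice_obj_simps [simp]:
  "fst (slice_obj pb P) = slice_tng pb (fst P) (snd P)" "snd (slice_obj pb P) = Id (lcat P) (snd P)"
  by (simp_all add: slice_obj_def split: prod.split)

locale pullbacks_chosen =
  fixes pb :: "'b choice"
  assumes choice: "pullback_choice pb"
begin

abbreviation "Y P \<equiv> slice_tng pb (fst P) (snd P)"

lemma tangent_slice_of: "tangent_pair pb P \<Longrightarrow> tangent_slice (fst P) (snd P) pb"
  by (rule tangent_slice_pair[OF choice])

lemma slice_morphism_of:
  assumes "is_pairmor pb M"
  shows "slice_morphism (fst (lsrc (fst M))) (fst (ltrg (fst M))) (snd (lsrc (fst M))) (snd (ltrg (fst M))) pb
    (lfun (fst M)) (ldist (fst M)) (snd M)"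
proof -
  have M: "tangent_pair pb (lsrc (fst M))" "tangent_pair pb (ltrg (fst M))" "is_laxmor (fst M)"
    "snd M \<in> Hom (lcat (ltrg (fst M))) (omap (lfun (fst M)) (snd (lsrc (fst M)))) (snd (ltrg (fst M)))"
    using assms by (auto simp: is_pairmor_def split: prod.splits)
  interpret S: tangent_slice "fst (lsrc (fst M))" "snd (lsrc (fst M))" pb by (rule tangent_slice_of[OF M(1)])
  interpret T: tangent_slice "fst (ltrg (fst M))" "snd (ltrg (fst M))" pb by (rule tangent_slice_of[OF M(2)])
  interpret lax_morphism "fst (lsrc (fst M))" "fst (ltrg (fst M))" "lfun (fst M)" "ldist (fst M)"
    by (rule lax_morphism_of[OF M(3) S.tangent_cat T.tangent_cat])
  show ?thesis by unfold_locales (use M(4) in auto)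
qed

lemma slice_mor_simps [simp]:
  assumes "is_pairmor pb M"
  shows "lsrc (slice_mor pb M) = slice_obj pb (lsrc (fst M))" "ltrg (slice_mor pb M) = slice_obj pb (ltrg (fst M))"
    "f \<in> Obj (Cat (Y (lsrc (fst M)))) \<Longrightarrow> omap (lfun (slice_mor pb M)) f =
       slice_morphism.slice_ob (fst (ltrg (fst M))) (lfun (fst M)) (snd M) f"
    "k \<in> Arr (Cat (Y (lsrc (fst M)))) \<Longrightarrow> amap (lfun (slice_mor pb M)) k =
       slice_morphism.slice_arr (fst (lsrc (fst M))) (fst (ltrg (fst M))) (snd (lsrc (fst M))) pb (lfun (fst M)) (snd M) k"
    "f \<in> Obj (Cat (Y (lsrc (fst M)))) \<Longrightarrow> ldist (slice_mor pb M) f =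
       slice_morphism.slice_dist (fst (lsrc (fst M))) (fst (ltrg (fst M))) (snd (lsrc (fst M))) (snd (ltrg (fst M))) pb (lfun (fst M))
         (ldist (fst M)) (snd M) f"
proof -
  interpret slice_morphism "fst (lsrc (fst M))" "fst (ltrg (fst M))" "snd (lsrc (fst M))" "snd (ltrg (fst M))" pb
    "lfun (fst M)" "ldist (fst M)" "snd M" by (rule slice_morphism_of[OF assms])
  show "lsrc (slice_mor pb M) = slice_obj pb (lsrc (fst M))" "ltrg (slice_mor pb M) = slice_obj pb (ltrg (fst M))"
    "f \<in> Obj (Cat (Y (lsrc (fst M)))) \<Longrightarrow> omap (lfun (slice_mor pb M)) f = slice_ob f"
    "k \<in> Arr (Cat (Y (lsrc (fst M)))) \<Longrightarrow> amap (lfun (slice_mor pb M)) k = slice_arr k"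
    "f \<in> Obj (Cat (Y (lsrc (fst M)))) \<Longrightarrow> ldist (slice_mor pb M) f = slice_dist f"
    by (simp_all add: slice_mor_def Let_def dom.slice_cat_eq slice_omap_def slice_ob_def slice_arr_def slice_dist_def dom.S_src dom.S_trg
      dom.sliceTO_eq cod.sliceTO_eq)
qed

lemma slice_mor_laxmor:
  assumes "is_pairmor pb M"
  shows "is_laxmor (slice_mor pb M)"
proof -
  interpret slice_morphism "fst (lsrc (fst M))" "fst (ltrg (fst M))" "snd (lsrc (fst M))" "snd (ltrg (fst M))" pb
    "lfun (fst M)" "ldist (fst M)" "snd M" by (rule slice_morphism_of[OF assms])
  have "lax_tangent_morphism dom.Y cod.Y (lfun (slice_mor pb M)) (ldist (slice_mor pb M))"
    by (rule slice_lax) (simp_all add: assms)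
  moreover have "omap (lfun (slice_mor pb M)) \<in> extensional (Obj dom.S)" "amap (lfun (slice_mor pb M)) \<in> extensional (Arr dom.S)"
    "ldist (slice_mor pb M) \<in> extensional (Obj dom.S)"
    by (simp_all add: slice_mor_def Let_def dom.slice_cat_eq)
  ultimately show ?thesis using assms by (simp add: is_laxmor_def)
qed

end

section \<open>The 2-functors Term and Slice\<close>

lemma terminal_tng: "terminal_tangent_category P \<Longrightarrow> tangent_category (fst P)"
  by (cases P) (simp add: terminal_tangent_category_def)

lemma terminal_is_terminal: "terminal_tangent_category P \<Longrightarrow> is_terminal (lcat P) (snd P)"
  by (cases P) (simp add: terminal_tangent_category_def)

lemma is_terminal_Obj: "is_terminal C t \<Longrightarrow> t \<in> Obj C"
  by (simp add: is_terminal_def)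

abbreviation (input) trm_mors :: "'b laxmor set" where
  "trm_mors \<equiv> {m. terminal_tangent_category (lsrc m) \<and> terminal_tangent_category (ltrg m) \<and> is_laxmor m}"

lemma trm_lax2: "lax_two_category {P. terminal_tangent_category P} trm_mors (\<lambda>_. True) (\<lambda>m. m) lax_id lax_comp"
proof (unfold_locales; (unfold mem_Collect_eq)?)
  show "lax_comp (lax_comp k n) m = lax_comp k (lax_comp n m)"
    if "terminal_tangent_category (lsrc m) \<and> terminal_tangent_category (ltrg m) \<and> is_laxmor m"
      "terminal_tangent_category (lsrc n) \<and> terminal_tangent_category (ltrg n) \<and> is_laxmor n"
      "terminal_tangent_category (lsrc k) \<and> terminal_tangent_category (ltrg k) \<and> is_laxmor k"
      "ltrg m = lsrc n" "ltrg n = lsrc k" for m n k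
    by (rule lax_comp_assoc) (use that in \<open>simp_all add: terminal_tng\<close>)
qed (auto simp: terminal_tng lax_id_laxmor lax_comp_laxmor lax_comp_id)

abbreviation (input) trm_cells :: "('b, 'b laxmor) cell set" where
  "trm_cells \<equiv> lax_cells (\<lambda>m. m) trm_mors (\<lambda>_. True)"

lemmas trm_B_def = lax_two_category.B_def[OF trm_lax2]
lemmas trm_K_D = lax_two_category.K_D[OF trm_lax2]

lemma trm_B: "trmTngCat = lax_two_category.B {P. terminal_tangent_category P} trm_mors (\<lambda>_. True) (\<lambda>m. m) lax_id lax_comp"
  unfolding trmTngCat_def trm_B_def lax_cells_def by auto

lemma two_category_trm: "two_category trmTngCat"
  unfolding trm_B by (rule lax_two_category.two_category_B[OF trm_lax2])

section \<open>The 2-category of tangent pairs\<close>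

context pullbacks_chosen
begin

abbreviation (input) pair_ok :: "('b, 'b pairmor) cell \<Rightarrow> bool" where
  "pair_ok x \<equiv> snd (ctrg x) \<cdot>\<^bsub>lcat (ltrg (fst (csrc x)))\<^esub> ccomp x (snd (lsrc (fst (csrc x)))) = snd (csrc x)"

lemma pairD:
  assumes "is_pairmor pb M"
  shows "tangent_pair pb (lsrc (fst M))" "tangent_pair pb (ltrg (fst M))" "is_laxmor (fst M)"
    "snd M \<in> Arr (lcat (ltrg (fst M)))" "Cod (lcat (ltrg (fst M))) (snd M) = snd (ltrg (fst M))"
    "Dom (lcat (ltrg (fst M))) (snd M) = omap (lfun (fst M)) (snd (lsrc (fst M)))"
  using assms by (auto simp: is_pairmor_def split: prod.splits)

lemma pairI:
  assumes "tangent_pair pb (lsrc (fst M))" "tangent_pair pb (ltrg (fst M))" "is_laxmor (fst M)"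
    "snd M \<in> Hom (lcat (ltrg (fst M))) (omap (lfun (fst M)) (snd (lsrc (fst M)))) (snd (ltrg (fst M)))"
  shows "is_pairmor pb M"
  using assms by (auto simp: is_pairmor_def split: prod.splits)

lemma tangent_pair_tng: "tangent_pair pb P \<Longrightarrow> tangent_category (fst P)"
  and tangent_pair_Obj: "tangent_pair pb P \<Longrightarrow> snd P \<in> Obj (lcat P)"
  by (auto simp: tangent_pair_def)

lemma pair_id_mor:
  assumes "tangent_pair pb P"
  shows "is_pairmor pb (pair_id P)"
proof -
  interpret P: tangent_slice "fst P" "snd P" pb by (rule tangent_slice_of[OF assms])
  show ?thesis
    by (rule pairI) (simp_all add: pair_id_def assms lax_id_laxmor P.tangent_cat)
qed

lemma pair_comp_mor:
  assumes "is_pairmor pb M" "is_pairmor pb N" "ltrg (fst M) = lsrc (fst N)"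
  shows "is_pairmor pb (pair_comp N M)"
proof -
  interpret M: slice_morphism "fst (lsrc (fst M))" "fst (lsrc (fst N))" "snd (lsrc (fst M))" "snd (lsrc (fst N))" pb
    "lfun (fst M)" "ldist (fst M)" "snd M" using slice_morphism_of[OF assms(1)] assms(3) by simp
  interpret N: slice_morphism "fst (lsrc (fst N))" "fst (ltrg (fst N))" "snd (lsrc (fst N))" "snd (ltrg (fst N))" pb
    "lfun (fst N)" "ldist (fst N)" "snd N" by (rule slice_morphism_of[OF assms(2)])
  show ?thesis
    by (rule pairI)
      (use pairD[OF assms(1)] pairD[OF assms(2)] assms(3) in
        \<open>simp_all add: pair_comp_def lax_comp_laxmor tangent_pair_tng\<close>)
qed

lemma pair_comp_id:
  assumes "is_pairmor pb M"
  shows "pair_comp M (pair_id (lsrc (fst M))) = M" "pair_comp (pair_id (ltrg (fst M))) M = M"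
proof -
  interpret M: slice_morphism "fst (lsrc (fst M))" "fst (ltrg (fst M))" "snd (lsrc (fst M))" "snd (ltrg (fst M))" pb
    "lfun (fst M)" "ldist (fst M)" "snd M" by (rule slice_morphism_of[OF assms])
  show "pair_comp M (pair_id (lsrc (fst M))) = M" "pair_comp (pair_id (ltrg (fst M))) M = M"
    using pairD[OF assms]
    by (simp_all add: pair_comp_def pair_id_def lax_comp_id tangent_pair_tng)
qed

lemma pair_comp_assoc:
  assumes "is_pairmor pb M" "is_pairmor pb N" "is_pairmor pb L" "ltrg (fst M) = lsrc (fst N)" "ltrg (fst N) = lsrc (fst L)"
  shows "pair_comp (pair_comp L N) M = pair_comp L (pair_comp N M)"
proof -
  interpret M: slice_morphism "fst (lsrc (fst M))" "fst (lsrc (fst N))" "snd (lsrc (fst M))" "snd (lsrc (fst N))" pb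
    "lfun (fst M)" "ldist (fst M)" "snd M" using slice_morphism_of[OF assms(1)] assms(4) by simp
  interpret N: slice_morphism "fst (lsrc (fst N))" "fst (lsrc (fst L))" "snd (lsrc (fst N))" "snd (lsrc (fst L))" pb
    "lfun (fst N)" "ldist (fst N)" "snd N" using slice_morphism_of[OF assms(2)] assms(5) by simp
  interpret L: slice_morphism "fst (lsrc (fst L))" "fst (ltrg (fst L))" "snd (lsrc (fst L))" "snd (ltrg (fst L))" pb
    "lfun (fst L)" "ldist (fst L)" "snd L" by (rule slice_morphism_of[OF assms(3)])
  have "lax_comp (lax_comp (fst L) (fst N)) (fst M) = lax_comp (fst L) (lax_comp (fst N) (fst M))"
    by (rule lax_comp_assoc) (use pairD assms tangent_pair_tng in auto)
  then show ?thesis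
    using pairD[OF assms(1)] assms(4,5) by (simp add: pair_comp_def)
qed

lemma pair_cells_D:
  assumes "x \<in> lax_cells fst {M. is_pairmor pb M} pair_ok"
  shows "is_pairmor pb (csrc x)" "is_pairmor pb (ctrg x)" "lsrc (fst (ctrg x)) = lsrc (fst (csrc x))"
    "ltrg (fst (ctrg x)) = ltrg (fst (csrc x))" "ccomp x \<in> extensional (Obj (lcat (lsrc (fst (csrc x)))))"
    "lax_trans (fst (lsrc (fst (csrc x)))) (fst (ltrg (fst (csrc x)))) (lfun (fst (csrc x))) (ldist (fst (csrc x)))
       (lfun (fst (ctrg x))) (ldist (fst (ctrg x))) (ccomp x)"
    "pair_ok x"
proof -
  show x: "is_pairmor pb (csrc x)" "is_pairmor pb (ctrg x)" "lsrc (fst (ctrg x)) = lsrc (fst (csrc x))"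
    "ltrg (fst (ctrg x)) = ltrg (fst (csrc x))" "ccomp x \<in> extensional (Obj (lcat (lsrc (fst (csrc x)))))"
    "pair_ok x"
    using assms by (auto simp: lax_cells_def is_lax_transformation_def)
  have l: "lax_morphism (fst (lsrc (fst M))) (fst (ltrg (fst M))) (lfun (fst M)) (ldist (fst M))" if "is_pairmor pb M" for M
    using slice_morphism_of[OF that] by (simp add: slice_morphism_def)
  show "lax_trans (fst (lsrc (fst (csrc x)))) (fst (ltrg (fst (csrc x)))) (lfun (fst (csrc x))) (ldist (fst (csrc x)))
       (lfun (fst (ctrg x))) (ldist (fst (ctrg x))) (ccomp x)"
    using l[OF x(1)] l[OF x(2)] x(3,4) assms
    by (auto simp: lax_trans_def lax_trans_axioms_def lax_cells_def is_lax_transformation_def)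
qed

lemma pair_lax2: "lax_two_category {P. tangent_pair pb P} {M. is_pairmor pb M} pair_ok fst pair_id pair_comp"
proof (unfold_locales; (unfold mem_Collect_eq)?)
  show "tangent_category (fst P)" if "tangent_pair pb P" for P using that by (rule tangent_pair_tng)
  show "is_laxmor (fst M)" "tangent_pair pb (lsrc (fst M))" "tangent_pair pb (ltrg (fst M))" if "is_pairmor pb M" for M
    using pairD[OF that] by auto
  show "fst (pair_id P) = lax_id P" for P by (simp add: pair_id_def)
  show "fst (pair_comp N M) = lax_comp (fst N) (fst M)" for M N by (simp add: pair_comp_def)
  show "is_pairmor pb (pair_id P)" if "tangent_pair pb P" for P using that by (rule pair_id_mor)
  show "is_pairmor pb (pair_comp N M)" if "is_pairmor pb M" "is_pairmor pb N" "ltrg (fst M) = lsrc (fst N)" for M N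
    using that by (rule pair_comp_mor)
  show "pair_comp M (pair_id (lsrc (fst M))) = M" "pair_comp (pair_id (ltrg (fst M))) M = M" if "is_pairmor pb M" for M
    using pair_comp_id[OF that] by auto
  show "pair_comp (pair_comp L N) M = pair_comp L (pair_comp N M)"
    if "is_pairmor pb M" "is_pairmor pb N" "is_pairmor pb L" "ltrg (fst M) = lsrc (fst N)" "ltrg (fst N) = lsrc (fst L)"
    for M N L using that by (rule pair_comp_assoc)
  show "pair_ok (cell_id fst M)" if "is_pairmor pb M" for M
  proof -
    interpret M: slice_morphism "fst (lsrc (fst M))" "fst (ltrg (fst M))" "snd (lsrc (fst M))" "snd (ltrg (fst M))" pb
      "lfun (fst M)" "ldist (fst M)" "snd M" by (rule slice_morphism_of[OF that])
    show ?thesis by simp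
  qed
next
  fix x y :: "('b, 'b pairmor) cell"
  assume x: "x \<in> lax_cells fst {M. is_pairmor pb M} pair_ok" and y: "y \<in> lax_cells fst {M. is_pairmor pb M} pair_ok"
  note xx = pair_cells_D[OF x] and yy = pair_cells_D[OF y]
  interpret x: lax_trans "fst (lsrc (fst (csrc x)))" "fst (ltrg (fst (csrc x)))" "lfun (fst (csrc x))" "ldist (fst (csrc x))"
    "lfun (fst (ctrg x))" "ldist (fst (ctrg x))" "ccomp x" by (rule xx(6))
  interpret y: lax_trans "fst (lsrc (fst (csrc y)))" "fst (ltrg (fst (csrc y)))" "lfun (fst (csrc y))" "ldist (fst (csrc y))"
    "lfun (fst (ctrg y))" "ldist (fst (ctrg y))" "ccomp y" by (rule yy(6))
  have A: "snd (lsrc (fst (csrc x))) \<in> Obj (lcat (lsrc (fst (csrc x))))"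
    "snd (lsrc (fst (csrc y))) \<in> Obj (lcat (lsrc (fst (csrc y))))"
    using tangent_pair_Obj pairD(1)[OF xx(1)] pairD(1)[OF yy(1)] by auto
  show "pair_ok (cell_vcomp fst y x)" if c: "ctrg x = csrc y"
  proof -
    have [simp]: "lsrc (fst (csrc y)) = lsrc (fst (csrc x))" "ltrg (fst (csrc y)) = ltrg (fst (csrc x))"
      using xx(3,4) c by auto
    show ?thesis
      using xx(7) yy(7) A c pairD[OF yy(2)] yy(3,4) y.cell_typing[OF A(2)]
        reassoc[OF x.m.T.cats(1) yy(7)[simplified], of "ccomp x (snd (lsrc (fst (csrc x))))"]
      by simp
  qed
  show "pair_ok (cell_hcomp fst pair_comp y x)" if c: "ltrg (fst (csrc x)) = lsrc (fst (csrc y))"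
  proof -
    let ?C = "lcat (ltrg (fst (csrc y)))" and ?A = "snd (lsrc (fst (csrc x)))"
    let ?G1 = "lfun (fst (csrc y))" and ?G2 = "lfun (fst (ctrg y))"
    have p1: "snd (csrc x) \<in> Arr (lcat (lsrc (fst (csrc y))))" "Cod (lcat (lsrc (fst (csrc y)))) (snd (csrc x)) = snd (lsrc (fst (csrc y)))"
      "Dom (lcat (lsrc (fst (csrc y)))) (snd (csrc x)) = omap (lfun (fst (csrc x))) ?A"
      using pairD(4-6)[OF xx(1)] c by simp_all
    have p2: "snd (ctrg x) \<in> Arr (lcat (lsrc (fst (csrc y))))" "Cod (lcat (lsrc (fst (csrc y)))) (snd (ctrg x)) = snd (lsrc (fst (csrc y)))"
      "Dom (lcat (lsrc (fst (csrc y)))) (snd (ctrg x)) = omap (lfun (fst (ctrg x))) ?A"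
      using pairD(4-6)[OF xx(2)] c xx(3,4) by simp_all
    have q2: "snd (ctrg y) \<in> Arr ?C" "Dom ?C (snd (ctrg y)) = omap ?G2 (snd (lsrc (fst (csrc y))))"
      using pairD(4-6)[OF yy(2)] yy(3,4) by simp_all
    have xc: "ccomp x ?A \<in> Arr (lcat (lsrc (fst (csrc y))))"
      "Dom (lcat (lsrc (fst (csrc y)))) (ccomp x ?A) = omap (lfun (fst (csrc x))) ?A"
      "Cod (lcat (lsrc (fst (csrc y)))) (ccomp x ?A) = omap (lfun (fst (ctrg x))) ?A"
      using x.cell_typing[of ?A] A c by simp_all
    have 1: "amap ?G1 (snd (ctrg x)) \<cdot>\<^bsub>?C\<^esub> amap ?G1 (ccomp x ?A) = amap ?G1 (snd (csrc x))"
      using arg_cong[OF xx(7), of "amap ?G1"] c p2 xc by simp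
    have om: "omap (lfun (fst (ctrg x))) ?A \<in> Obj (lcat (lsrc (fst (csrc y))))"
      using p2 Dom_Obj y.m.S.cats(1) by metis
    \<comment> \<open>Naturality of \<open>y\<close> at the base map of \<open>ctrg x\<close> joins
      the two triangles: the one for \<open>x\<close> is used under \<open>?G1\<close>, the one for
      \<open>y\<close> closes the composite.\<close>
    have n: "ccomp y (snd (lsrc (fst (csrc y)))) \<cdot>\<^bsub>?C\<^esub> amap ?G1 (snd (ctrg x)) =
        amap ?G2 (snd (ctrg x)) \<cdot>\<^bsub>?C\<^esub> ccomp y (omap (lfun (fst (ctrg x))) ?A)"
      using y.cell_nat[OF p2(1)] p2 by simp
    have 2: "amap ?G2 (snd (ctrg x)) \<cdot>\<^bsub>?C\<^esub> ccomp y (omap (lfun (fst (ctrg x))) ?A) \<cdot>\<^bsub>?C\<^esub> amap ?G1 (ccomp x ?A) =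
        ccomp y (snd (lsrc (fst (csrc y)))) \<cdot>\<^bsub>?C\<^esub> amap ?G1 (snd (csrc x))"
      using reassoc[OF y.m.T.cats(1) n, of "amap ?G1 (ccomp x ?A)"] p2 xc 1 A om by simp
    have 3: "snd (ctrg y) \<cdot>\<^bsub>?C\<^esub> ccomp y (snd (lsrc (fst (csrc y)))) = snd (csrc y)"
      using yy(7) by simp
    show ?thesis
      using A p1 p2 q2 xc om xx(3,4) yy(3,4) c 2 reassoc[OF y.m.T.cats(1) 3, of "amap ?G1 (snd (csrc x))"]
      by (simp add: pair_comp_def)
  qed
qed

abbreviation (input) pair_cells :: "('b, 'b pairmor) cell set" where
  "pair_cells \<equiv> lax_cells fst {M. is_pairmor pb M} pair_ok"

lemmas pair_B_def = lax_two_category.B_def[OF pair_lax2]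

lemma pair_B: "TngPair pb = lax_two_category.B {P. tangent_pair pb P} {M. is_pairmor pb M} pair_ok fst pair_id pair_comp"
  unfolding TngPair_def pair_B_def lax_cells_def by auto

lemma two_category_pair: "two_category (TngPair pb)"
  unfolding pair_B by (rule lax_two_category.two_category_B[OF pair_lax2])

subsection \<open>Term\<close>

lemma term_mor_pair:
  assumes "m \<in> trm_mors"
  shows "is_pairmor pb (term_mor m)"
proof -
  have m: "terminal_tangent_category (lsrc m)" "terminal_tangent_category (ltrg m)" "is_laxmor m" using assms by auto
  interpret lax_morphism "fst (lsrc m)" "fst (ltrg m)" "lfun m" "ldist m"
    using m by (intro lax_morphism_of) (simp_all add: terminal_tng)
  have "snd (lsrc m) \<in> Obj (lcat (lsrc m))" by (rule is_terminal_Obj[OF terminal_is_terminal[OF m(1)]])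
  then show ?thesis
    using m terminal_tangent_pair[OF choice] bang_Hom[OF terminal_is_terminal[OF m(2)]]
    by (intro pairI) (simp_all add: term_mor_def)
qed

lemma term_mor_id: "terminal_tangent_category P \<Longrightarrow> term_mor (lax_id P) = pair_id P"
  using bang_eqI[OF terminal_is_terminal[of P], of "Id (lcat P) (snd P)" "snd P"]
    is_terminal_Obj[OF terminal_is_terminal[of P]] tangent_cat_intro[OF terminal_tng[of P]]
  by (simp add: term_mor_def pair_id_def tangent_cat_def tangent_endo_def is_functor_def)

text \<open>The base maps of both sides end in the terminal object of the target, hence
  agree.\<close>

lemma term_mor_comp:
  assumes "m \<in> trm_mors" "n \<in> trm_mors" "ltrg m = lsrc n"
  shows "term_mor (lax_comp n m) = pair_comp (term_mor n) (term_mor m)"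
proof -
  have m: "terminal_tangent_category (lsrc m)" "is_laxmor m" and n: "terminal_tangent_category (lsrc n)"
    "terminal_tangent_category (ltrg n)" "is_laxmor n" using assms by auto
  interpret m: lax_morphism "fst (lsrc m)" "fst (lsrc n)" "lfun m" "ldist m"
    using lax_morphism_of[OF m(2)] m n assms(3) by (simp add: terminal_tng)
  interpret n: lax_morphism "fst (lsrc n)" "fst (ltrg n)" "lfun n" "ldist n"
    using n by (intro lax_morphism_of) (simp_all add: terminal_tng)
  have t: "snd (lsrc m) \<in> Obj (lcat (lsrc m))" "snd (lsrc n) \<in> Obj (lcat (lsrc n))"
    using is_terminal_Obj[OF terminal_is_terminal[OF m(1)]] is_terminal_Obj[OF terminal_is_terminal[OF n(1)]] by simp_all
  show ?thesis
    using t bang_Hom[OF terminal_is_terminal[OF n(1)], of "omap (lfun m) (snd (lsrc m))"]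
      bang_Hom[OF terminal_is_terminal[OF n(2)], of "omap (lfun n) (snd (lsrc n))"] assms(3)
    by (simp add: term_mor_def pair_comp_def) (rule bang_eqI[OF terminal_is_terminal[OF n(2)]]; simp)
qed

definition term_cell :: "('b, 'b laxmor) cell \<Rightarrow> ('b, 'b pairmor) cell" where
  "term_cell x = \<lparr>csrc = term_mor (csrc x), ctrg = term_mor (ctrg x), ccomp = ccomp x\<rparr>"

lemma fst_term_mor [simp]: "fst (term_mor m) = m"
  by (simp add: term_mor_def)

text \<open>The triangle condition on a cell compares two maps into a terminal object.\<close>

lemma term_cell_pair:
  assumes "x \<in> trm_cells"
  shows "term_cell x \<in> pair_cells"
proof -
  note x = trm_K_D[OF assms]
  interpret x: lax_trans "fst (lsrc (csrc x))" "fst (ltrg (csrc x))" "lfun (csrc x)" "ldist (csrc x)"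
    "lfun (ctrg x)" "ldist (ctrg x)" "ccomp x" using x by simp
  have t: "terminal_tangent_category (lsrc (csrc x))" "terminal_tangent_category (ltrg (csrc x))" using x by auto
  have A: "snd (lsrc (csrc x)) \<in> Obj (lcat (lsrc (csrc x)))" by (rule is_terminal_Obj[OF terminal_is_terminal[OF t(1)]])
  let ?C = "lcat (ltrg (csrc x))" and ?t = "snd (ltrg (csrc x))"
  have b: "bang ?C ?t (omap (lfun (ctrg x)) (snd (lsrc (csrc x)))) \<in> Hom ?C (omap (lfun (ctrg x)) (snd (lsrc (csrc x)))) ?t"
    by (rule bang_Hom[OF terminal_is_terminal[OF t(2)]]) (use A in simp)
  have "bang ?C ?t (omap (lfun (csrc x)) (snd (lsrc (csrc x)))) =
      bang ?C ?t (omap (lfun (ctrg x)) (snd (lsrc (csrc x)))) \<cdot>\<^bsub>?C\<^esub> ccomp x (snd (lsrc (csrc x)))"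
    by (rule bang_eqI[OF terminal_is_terminal[OF t(2)]]) (use b A in simp_all)
  then have "pair_ok (term_cell x)"
    using x(3,4) by (simp add: term_cell_def) (simp add: term_mor_def)
  then show ?thesis
    using assms x term_mor_pair by (simp add: lax_cells_def term_cell_def)
qed

lemma term_cell_id: "term_cell (cell_id (\<lambda>m. m) m) = cell_id fst (term_mor m)"
  and term_cell_vcomp: "term_cell (cell_vcomp (\<lambda>m. m) y x) = cell_vcomp fst (term_cell y) (term_cell x)"
  by (simp_all add: term_cell_def cell_id_def cell_vcomp_def)

lemma term_cell_hcomp:
  assumes "x \<in> trm_cells" "y \<in> trm_cells" "ltrg (csrc x) = lsrc (csrc y)"
  shows "term_cell (cell_hcomp (\<lambda>m. m) lax_comp y x) = cell_hcomp fst pair_comp (term_cell y) (term_cell x)"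
  using trm_K_D[OF assms(1)] trm_K_D[OF assms(2)] assms(3)
  by (simp add: term_cell_def cell_hcomp_def term_mor_comp)

lemma two_functor_Term: "two_functor trmTngCat (TngPair pb) Term"
proof -
  have c: "category trmTngCat" "category (vertical trmTngCat)" "category (horizontal trmTngCat)"
    "category (TngPair pb)" "category (vertical (TngPair pb))" "category (horizontal (TngPair pb))"
    using two_category_trm two_category_pair by (auto simp: two_category_def)
  note tp = terminal_tangent_pair[OF choice]
  have T: "omap Term = (\<lambda>P. P)" "amap Term = term_mor" "cmap Term = term_cell"
    by (simp_all add: Term_def term_cell_def fun_eq_iff)
  have "is_functor trmTngCat (TngPair pb) Term"
    unfolding is_functor_def T using c
    by (simp add: trm_B pair_B trm_B_def pair_B_def tp term_mor_pair term_mor_id term_mor_comp)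
  moreover have "is_functor (vertical trmTngCat) (vertical (TngPair pb)) \<lparr>omap = amap Term, amap = cmap Term\<rparr>"
    unfolding is_functor_def T using c
    by (simp add: trm_B pair_B trm_B_def pair_B_def vertical_def term_mor_pair term_cell_pair term_cell_id term_cell_vcomp)
      (simp add: term_cell_def)
  moreover have "is_functor (horizontal trmTngCat) (horizontal (TngPair pb)) \<lparr>omap = omap Term, amap = cmap Term\<rparr>"
    unfolding is_functor_def T using c
    by (simp add: trm_B pair_B trm_B_def pair_B_def horizontal_def tp term_cell_pair term_cell_id
        term_cell_hcomp term_mor_id)
      (simp add: term_cell_def)
  ultimately show ?thesis
    using two_category_trm two_category_pair by (simp add: two_functor_def)
qed

end

subsection \<open>Slice\<close>

context pullbacks_chosen
begin

lemma slice_obj_terminal: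
  assumes "tangent_pair pb P"
  shows "terminal_tangent_category (slice_obj pb P)"
proof -
  interpret P: tangent_slice "fst P" "snd P" pb by (rule tangent_slice_of[OF assms])
  have "slice_obj pb P = (Y P, Id (lcat P) (snd P))" by (simp add: slice_obj_def split: prod.split)
  then show ?thesis using P.terminal_tangent_category_Y by simp
qed

lemma slice_mor_trm:
  assumes "is_pairmor pb M"
  shows "slice_mor pb M \<in> trm_mors"
  using pairD[OF assms] slice_mor_laxmor[OF assms] assms by (simp add: slice_obj_terminal)

lemma slice_mor_id:
  assumes "tangent_pair pb P"
  shows "slice_mor pb (pair_id P) = lax_id (slice_obj pb P)"
proof -
  note i = pair_id_mor[OF assms]
  have [simp]: "fst (pair_id P) = lax_id P" "snd (pair_id P) = Id (lcat P) (snd P)" by (simp_all add: pair_id_def)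
  interpret M: slice_morphism "fst P" "fst P" "snd P" "snd P" pb "lfun (lax_id P)" "ldist (lax_id P)" "Id (lcat P) (snd P)"
    using slice_morphism_of[OF i] by simp
  have slice_ob: "f \<in> Obj M.dom.S \<Longrightarrow> M.slice_ob f = f" for f by (simp add: M.slice_ob_def)
  show ?thesis
  proof (rule laxmor_eqI)
    show "is_laxmor (lax_id (slice_obj pb P))"
      by (rule lax_id_laxmor) (simp add: M.dom.tangent_category_Y)
    show "amap (lfun (slice_mor pb (pair_id P))) k = amap (lfun (lax_id (slice_obj pb P))) k"
      if "k \<in> Arr (lcat (lsrc (lax_id (slice_obj pb P))))" for k
      using that i M.dom.Tri_eta[of k] by (simp add: M.slice_arr_def slice_ob)
    fix f assume "f \<in> Obj (lcat (lsrc (lax_id (slice_obj pb P))))"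
    then have f [simp]: "f \<in> Obj M.dom.S" by simp
    show "omap (lfun (slice_mor pb (pair_id P))) f = omap (lfun (lax_id (slice_obj pb P))) f"
      using i by (simp add: slice_ob)
    have "M.slice_dist f = Id M.dom.S (TO M.dom.Y f)"
      by (rule M.dom.TS_eqI[of _ _ f]) (use M.slice_dist_props[OF f] in \<open>simp_all add: slice_ob\<close>)
    then show "ldist (slice_mor pb (pair_id P)) f = ldist (lax_id (slice_obj pb P)) f"
      using i by simp
  qed (use i slice_mor_laxmor[OF i] in simp_all)
qed

text \<open>Both sides use the same chosen pullbacks, so the equality is strict. The two
  distributive laws agree after \<open>v\<close>, where both become
  \<open>\<beta>_F \<circ> G \<alpha> \<circ> G F v_f\<close>.\<close>

lemma slice_mor_comp:
  assumes "is_pairmor pb M" "is_pairmor pb N" "ltrg (fst M) = lsrc (fst N)"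
  shows "slice_mor pb (pair_comp N M) = lax_comp (slice_mor pb N) (slice_mor pb M)"
proof -
  let ?P = "lsrc (fst M)" and ?P' = "lsrc (fst N)" and ?P'' = "ltrg (fst N)"
  interpret M: slice_morphism "fst ?P" "fst ?P'" "snd ?P" "snd ?P'" pb "lfun (fst M)" "ldist (fst M)" "snd M"
    using slice_morphism_of[OF assms(1)] assms(3) by simp
  interpret N: slice_morphism "fst ?P'" "fst ?P''" "snd ?P'" "snd ?P''" pb "lfun (fst N)" "ldist (fst N)" "snd N"
    by (rule slice_morphism_of[OF assms(2)])
  note c = pair_comp_mor[OF assms]
  have [simp]: "fst (pair_comp N M) = lax_comp (fst N) (fst M)"
    "snd (pair_comp N M) = snd N \<cdot>\<^bsub>lcat ?P''\<^esub> amap (lfun (fst N)) (snd M)" by (simp_all add: pair_comp_def)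
  interpret NM: slice_morphism "fst ?P" "fst ?P''" "snd ?P" "snd ?P''" pb "lfun (lax_comp (fst N) (fst M))"
    "ldist (lax_comp (fst N) (fst M))" "snd N \<cdot>\<^bsub>lcat ?P''\<^esub> amap (lfun (fst N)) (snd M)"
    using slice_morphism_of[OF c] by simp
  note M = slice_mor_simps[OF assms(1), unfolded assms(3)] and N = slice_mor_simps[OF assms(2)]
    and NM = slice_mor_simps[OF c, simplified]
  have slice_ob: "NM.slice_ob f = N.slice_ob (M.slice_ob f)" if "f \<in> Obj M.dom.S" for f
    using that by (simp add: NM.slice_ob_def N.slice_ob_def M.slice_ob_def)
  show ?thesis
  proof (rule laxmor_eqI)
    show "is_laxmor (slice_mor pb (pair_comp N M))" by (rule slice_mor_laxmor[OF c])
    show "is_laxmor (lax_comp (slice_mor pb N) (slice_mor pb M))"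
      by (rule lax_comp_laxmor)
        (use slice_mor_laxmor assms M N in \<open>simp_all add: M.dom.tangent_category_Y M.cod.tangent_category_Y N.cod.tangent_category_Y\<close>)
    show "amap (lfun (slice_mor pb (pair_comp N M))) k = amap (lfun (lax_comp (slice_mor pb N) (slice_mor pb M))) k"
      if "k \<in> Arr (lcat (lsrc (lax_comp (slice_mor pb N) (slice_mor pb M))))" for k
    proof -
      have k [simp]: "k \<in> Arr M.dom.S" using that M by simp
      have "NM.slice_arr k = N.slice_arr (M.slice_arr k)"
        by (rule N.cod.S_eqI) (use NM.slice_arr_typing[of k] in \<open>simp_all add: slice_ob\<close>)
      then show ?thesis by (simp add: M N NM)
    qed
    fix f assume "f \<in> Obj (lcat (lsrc (lax_comp (slice_mor pb N) (slice_mor pb M))))"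
    then have f [simp]: "f \<in> Obj M.dom.S" using M by simp
    show "omap (lfun (slice_mor pb (pair_comp N M))) f = omap (lfun (lax_comp (slice_mor pb N) (slice_mor pb M))) f"
      by (simp add: M N NM slice_ob)
    have "NM.slice_dist f = N.slice_dist (M.slice_ob f) \<cdot>\<^bsub>N.cod.S\<^esub> N.slice_arr (M.slice_dist f)"
    proof (rule N.cod.TS_eqI[of _ _ "N.slice_ob (M.slice_ob f)"])
      show "N.cod.V (N.slice_ob (M.slice_ob f)) \<cdot>\<^bsub>lcat ?P''\<^esub> tmap (NM.slice_dist f) =
          N.cod.V (N.slice_ob (M.slice_ob f)) \<cdot>\<^bsub>lcat ?P''\<^esub> tmap (N.slice_dist (M.slice_ob f) \<cdot>\<^bsub>N.cod.S\<^esub> N.slice_arr (M.slice_dist f))"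
        using NM.slice_dist_props(4)[OF f] arg_cong[OF M.slice_dist_props(4)[OF f], of "amap (lfun (fst N))"]
        by (simp add: slice_ob N.V_slice_dist_comp)
    qed (use NM.slice_dist_props(1-3)[OF f] slice_ob[of f] slice_ob[of "TO M.dom.Y f"] in simp_all)
    then show "ldist (slice_mor pb (pair_comp N M)) f = ldist (lax_comp (slice_mor pb N) (slice_mor pb M)) f"
      by (simp add: M N NM)
  qed (use M N NM in simp_all)
qed

lemma fst_pair_comp [simp]: "fst (pair_comp N M) = lax_comp (fst N) (fst M)"
  by (simp add: pair_comp_def)

lemma pair_cell_slice_morphism:
  assumes "x \<in> pair_cells"
  shows "slice_morphism (fst (lsrc (fst (csrc x)))) (fst (ltrg (fst (csrc x)))) (snd (lsrc (fst (csrc x)))) (snd (ltrg (fst (csrc x)))) pb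
      (lfun (fst (csrc x))) (ldist (fst (csrc x))) (snd (csrc x))"
    "slice_morphism (fst (lsrc (fst (csrc x)))) (fst (ltrg (fst (csrc x)))) (snd (lsrc (fst (csrc x)))) (snd (ltrg (fst (csrc x)))) pb
      (lfun (fst (ctrg x))) (ldist (fst (ctrg x))) (snd (ctrg x))"
  using slice_morphism_of[OF pair_cells_D(1)[OF assms]] slice_morphism_of[OF pair_cells_D(2)[OF assms]] pair_cells_D(3,4)[OF assms] by simp_all

lemma slice_cell_simps [simp]:
  "csrc (slice_cell pb x) = slice_mor pb (csrc x)" "ctrg (slice_cell pb x) = slice_mor pb (ctrg x)"
  by (simp_all add: slice_cell_def Let_def)

lemma slice_cell_ccomp:
  assumes "x \<in> pair_cells" "f \<in> Obj (Cat (Y (lsrc (fst (csrc x)))))"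
  shows "ccomp (slice_cell pb x) f =
    Tri (omap (lfun (slice_mor pb (csrc x))) f) (ccomp x (Dom (lcat (lsrc (fst (csrc x)))) f)) (omap (lfun (slice_mor pb (ctrg x))) f)"
proof -
  note x = pair_cells_D[OF assms(1)]
  interpret m: slice_morphism "fst (lsrc (fst (csrc x)))" "fst (ltrg (fst (csrc x)))" "snd (lsrc (fst (csrc x)))" "snd (ltrg (fst (csrc x)))" pb
      "lfun (fst (csrc x))" "ldist (fst (csrc x))" "snd (csrc x)" by (rule pair_cell_slice_morphism(1)[OF assms(1)])
  interpret n: slice_morphism "fst (lsrc (fst (csrc x)))" "fst (ltrg (fst (csrc x)))" "snd (lsrc (fst (csrc x)))" "snd (ltrg (fst (csrc x)))" pb
      "lfun (fst (ctrg x))" "ldist (fst (ctrg x))" "snd (ctrg x)" by (rule pair_cell_slice_morphism(2)[OF assms(1)])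
  show ?thesis
    using assms x by (simp add: slice_cell_def Let_def m.dom.slice_cat_eq slice_omap_def m.slice_ob_def n.slice_ob_def)
qed

lemma slice_cell_extensional:
  assumes "x \<in> pair_cells"
  shows "ccomp (slice_cell pb x) \<in> extensional (Obj (Cat (Y (lsrc (fst (csrc x))))))"
proof -
  interpret m: tangent_slice "fst (lsrc (fst (csrc x)))" "snd (lsrc (fst (csrc x)))" pb
    by (rule tangent_slice_of[OF pairD(1)[OF pair_cells_D(1)[OF assms]]])
  show ?thesis by (simp add: slice_cell_def Let_def m.slice_cat_eq)
qed

lemma slice_cell_trm:
  assumes "x \<in> pair_cells"
  shows "slice_cell pb x \<in> trm_cells"
proof -
  note x = pair_cells_D[OF assms]
  let ?P = "lsrc (fst (csrc x))" and ?P' = "ltrg (fst (csrc x))"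
  interpret m: slice_morphism "fst ?P" "fst ?P'" "snd ?P" "snd ?P'" pb "lfun (fst (csrc x))" "ldist (fst (csrc x))" "snd (csrc x)"
    by (rule pair_cell_slice_morphism(1)[OF assms])
  interpret n: slice_morphism "fst ?P" "fst ?P'" "snd ?P" "snd ?P'" pb "lfun (fst (ctrg x))" "ldist (fst (ctrg x))" "snd (ctrg x)"
    by (rule pair_cell_slice_morphism(2)[OF assms])
  interpret x: lax_trans "fst ?P" "fst ?P'" "lfun (fst (csrc x))" "ldist (fst (csrc x))"
    "lfun (fst (ctrg x))" "ldist (fst (ctrg x))" "ccomp x" by (rule x(6))
  note ms = slice_mor_simps[OF x(1)] and ns = slice_mor_simps[OF x(2), unfolded x(3,4)]
    and se = slice_cell_extensional[OF assms]
  let ?c = "\<lambda>f. Tri (m.slice_ob f) (ccomp x (Dom (lcat ?P) f)) (n.slice_ob f)"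
  have c: "?c f \<in> Arr m.cod.S" "ccomp (slice_cell pb x) f = ?c f" if f: "f \<in> Obj m.dom.S" for f
  proof -
    \<comment> \<open>\<open>\<psi> \<circ> G f \<circ> \<gamma>_E = \<psi> \<circ> \<gamma>_A
      \<circ> F f = \<phi> \<circ> F f\<close>: the triangle condition on cells is what makes every
      component a map over \<open>B\<close>.\<close>
    have "n.slice_ob f \<cdot>\<^bsub>lcat ?P'\<^esub> ccomp x (Dom (lcat ?P) f) = m.slice_ob f"
      using f x.cell_nat[of f] reassoc[OF m.cod.cats(1) x(7), of "amap (lfun (fst (csrc x))) f"]
      by (simp add: n.slice_ob_def m.slice_ob_def)
    then show "?c f \<in> Arr m.cod.S" using f by simp
    show "ccomp (slice_cell pb x) f = ?c f" using f assms by (simp add: slice_cell_ccomp ms ns)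
  qed
  have "is_lax_transformation (slice_mor pb (csrc x)) (slice_mor pb (ctrg x)) (ccomp (slice_cell pb x))"
  proof (rule is_lax_transformationI; simp add: ms ns se)
    fix f assume f: "f \<in> Obj m.dom.S"
    show "ccomp (slice_cell pb x) f \<in> Arr m.cod.S \<and> Dom m.cod.S (ccomp (slice_cell pb x) f) = m.slice_ob f \<and>
         Cod m.cod.S (ccomp (slice_cell pb x) f) = n.slice_ob f"
      using c[OF f] by simp
    have f' [simp]: "TO m.dom.Y f \<in> Obj m.dom.S" using f by simp
    show "n.slice_dist f \<cdot>\<^bsub>m.cod.S\<^esub> ccomp (slice_cell pb x) (TO m.dom.Y f) =
         TA m.cod.Y (ccomp (slice_cell pb x) f) \<cdot>\<^bsub>m.cod.S\<^esub> m.slice_dist f"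
    \<comment> \<open>After \<open>v\<close> this is compatibility of \<open>x\<close> at
      \<open>E\<close> combined with naturality of \<open>x\<close> at \<open>v_f\<close>.\<close>
    proof (rule m.cod.TS_eqI[of _ _ "n.slice_ob f"])
      show "m.cod.V (n.slice_ob f) \<cdot>\<^bsub>lcat ?P'\<^esub> tmap (n.slice_dist f \<cdot>\<^bsub>m.cod.S\<^esub> ccomp (slice_cell pb x) (TO m.dom.Y f)) =
        m.cod.V (n.slice_ob f) \<cdot>\<^bsub>lcat ?P'\<^esub> tmap (TA m.cod.Y (ccomp (slice_cell pb x) f) \<cdot>\<^bsub>m.cod.S\<^esub> m.slice_dist f)"
        using f c(1)[OF f] c(1)[OF f'] x.cell_nat[of "m.dom.V f"]
          reassoc[OF m.cod.cats(1) x.ntd[of "Dom (lcat ?P) f"], of "amap (lfun (fst (csrc x))) (m.dom.V f)"]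
        by (simp add: c(2) n.V_slice_dist_comp m.cod.V_nat_comp m.slice_dist_props(4))
    qed (use f c[OF f] c[OF f'] in simp_all)
  next
    fix k assume k: "k \<in> Arr m.dom.S"
    show "ccomp (slice_cell pb x) (Cod m.dom.S k) \<cdot>\<^bsub>m.cod.S\<^esub> m.slice_arr k = n.slice_arr k \<cdot>\<^bsub>m.cod.S\<^esub> ccomp (slice_cell pb x) (Dom m.dom.S k)"
      by (rule m.cod.S_eqI)
        (use k c[of "Cod m.dom.S k"] c[of "Dom m.dom.S k"] x.cell_nat[of "tmap k"] in simp_all)
  qed
  then show ?thesis using slice_mor_trm[OF x(1)] slice_mor_trm[OF x(2)] by (simp add: lax_cells_def)
qed

lemma slice_cell_id:
  assumes "is_pairmor pb M"
  shows "slice_cell pb (cell_id fst M) = cell_id (\<lambda>m. m) (slice_mor pb M)"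
proof -
  have c: "cell_id fst M \<in> pair_cells" using lax_two_category.cell_id_K[OF pair_lax2] assms by simp
  interpret m: slice_morphism "fst (lsrc (fst M))" "fst (ltrg (fst M))" "snd (lsrc (fst M))" "snd (ltrg (fst M))" pb
    "lfun (fst M)" "ldist (fst M)" "snd M" by (rule slice_morphism_of[OF assms])
  have "ccomp (slice_cell pb (cell_id fst M)) = ccomp (cell_id (\<lambda>m. m) (slice_mor pb M))"
    by (rule extensionalityI[OF slice_cell_extensional[OF c]])
      (use c assms cell_extensional(1)[of "\<lambda>m. m" "slice_mor pb M"] in \<open>simp_all add: slice_cell_ccomp m.cod.S_Id\<close>)
  then show ?thesis by (simp add: cell_eqI)
qed

lemma slice_cell_vcomp:
  assumes "x \<in> pair_cells" "y \<in> pair_cells" "ctrg x = csrc y"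
  shows "slice_cell pb (cell_vcomp fst y x) = cell_vcomp (\<lambda>m. m) (slice_cell pb y) (slice_cell pb x)"
proof -
  have c: "cell_vcomp fst y x \<in> pair_cells" using lax_two_category.cell_vcomp_K[OF pair_lax2] assms by simp
  note x = pair_cells_D[OF assms(1)] and y = pair_cells_D[OF assms(2)]
  interpret m: slice_morphism "fst (lsrc (fst (csrc x)))" "fst (ltrg (fst (csrc x)))" "snd (lsrc (fst (csrc x)))" "snd (ltrg (fst (csrc x)))" pb
      "lfun (fst (csrc x))" "ldist (fst (csrc x))" "snd (csrc x)" by (rule pair_cell_slice_morphism(1)[OF assms(1)])
  have [simp]: "lsrc (fst (csrc y)) = lsrc (fst (csrc x))" "ltrg (fst (csrc y)) = ltrg (fst (csrc x))"
    using x y assms(3) by auto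
  have "ccomp (slice_cell pb (cell_vcomp fst y x)) = ccomp (cell_vcomp (\<lambda>m. m) (slice_cell pb y) (slice_cell pb x))"
    by (rule extensionalityI[OF slice_cell_extensional[OF c]])
      (use c assms x y cell_extensional(2)[of "\<lambda>m. m" "slice_cell pb y" "slice_cell pb x"] in
        \<open>simp_all add: slice_cell_ccomp m.cod.S_comp\<close>)
  then show ?thesis by (simp add: cell_eqI)
qed

lemma slice_cell_hcomp:
  assumes "x \<in> pair_cells" "y \<in> pair_cells" "ltrg (fst (csrc x)) = lsrc (fst (csrc y))"
  shows "slice_cell pb (cell_hcomp fst pair_comp y x) = cell_hcomp (\<lambda>m. m) lax_comp (slice_cell pb y) (slice_cell pb x)"
proof -
  note x = pair_cells_D[OF assms(1)] and y = pair_cells_D[OF assms(2)]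
  have c: "cell_hcomp fst pair_comp y x \<in> pair_cells" using lax_two_category.cell_hcomp_K[OF pair_lax2] assms by simp
  let ?P = "lsrc (fst (csrc x))" and ?P' = "lsrc (fst (csrc y))" and ?P'' = "ltrg (fst (csrc y))"
  interpret m: slice_morphism "fst ?P" "fst ?P'" "snd ?P" "snd ?P'" pb "lfun (fst (csrc x))" "ldist (fst (csrc x))" "snd (csrc x)"
    using pair_cell_slice_morphism(1)[OF assms(1)] assms(3) by simp
  interpret n: slice_morphism "fst ?P" "fst ?P'" "snd ?P" "snd ?P'" pb "lfun (fst (ctrg x))" "ldist (fst (ctrg x))" "snd (ctrg x)"
    using pair_cell_slice_morphism(2)[OF assms(1)] assms(3) by simp
  interpret m': slice_morphism "fst ?P'" "fst ?P''" "snd ?P'" "snd ?P''" pb "lfun (fst (csrc y))" "ldist (fst (csrc y))" "snd (csrc y)"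
    by (rule pair_cell_slice_morphism(1)[OF assms(2)])
  interpret n': slice_morphism "fst ?P'" "fst ?P''" "snd ?P'" "snd ?P''" pb "lfun (fst (ctrg y))" "ldist (fst (ctrg y))" "snd (ctrg y)"
    by (rule pair_cell_slice_morphism(2)[OF assms(2)])
  have xy: "ltrg (fst (ctrg x)) = lsrc (fst (ctrg y))" "ltrg (fst (ctrg x)) = ?P'" using x y assms(3) by auto
  note ms = slice_mor_simps[OF x(1), unfolded assms(3)] and ns = slice_mor_simps[OF x(2), unfolded x(3,4) assms(3)]
    and ms' = slice_mor_simps[OF y(1)] and ns' = slice_mor_simps[OF y(2), unfolded y(3,4)]
  have comp: "slice_mor pb (pair_comp (csrc y) (csrc x)) = lax_comp (slice_mor pb (csrc y)) (slice_mor pb (csrc x))"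
    "slice_mor pb (pair_comp (ctrg y) (ctrg x)) = lax_comp (slice_mor pb (ctrg y)) (slice_mor pb (ctrg x))"
    using slice_mor_comp x y xy assms(3) by auto
  have "ccomp (slice_cell pb (cell_hcomp fst pair_comp y x)) f =
      ccomp (cell_hcomp (\<lambda>m. m) lax_comp (slice_cell pb y) (slice_cell pb x)) f" if f: "f \<in> Obj m.dom.S" for f
  proof -
    have sx: "ccomp (slice_cell pb x) f = Tri (m.slice_ob f) (ccomp x (Dom (lcat ?P) f)) (n.slice_ob f)"
      using slice_cell_ccomp[OF assms(1)] f by (simp add: ms ns)
    \<comment> \<open>The action of a slice morphism is known on arrows of the slice only, so the
      component must be recognised as one before its image can be computed.\<close>
    have "ccomp (slice_cell pb x) f \<in> Arr m.cod.S"
      using trm_K_D(6)[OF slice_cell_trm[OF assms(1)]] f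
      by (auto simp: lax_trans_def lax_trans_axioms_def nat_trans_def ms)
    then have a: "Tri (m.slice_ob f) (ccomp x (Dom (lcat ?P) f)) (n.slice_ob f) \<in> Arr m.cod.S" by (simp add: sx)
    have sy: "ccomp (slice_cell pb y) (n.slice_ob f) =
        Tri (m'.slice_ob (n.slice_ob f)) (ccomp y (omap (lfun (fst (ctrg x))) (Dom (lcat ?P) f))) (n'.slice_ob (n.slice_ob f))"
      using slice_cell_ccomp[OF assms(2), of "n.slice_ob f"] f by (simp add: ms' ns')
    show ?thesis
      using f a sx sy c xy x y by (simp add: slice_cell_ccomp comp ms ns ms' ns' m'.cod.S_comp m'.slice_arr_def)
  qed
  then have "ccomp (slice_cell pb (cell_hcomp fst pair_comp y x)) =
      ccomp (cell_hcomp (\<lambda>m. m) lax_comp (slice_cell pb y) (slice_cell pb x))"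
    by (intro extensionalityI[OF slice_cell_extensional[OF c]])
      (use cell_extensional(3)[of "\<lambda>m. m" lax_comp "slice_cell pb y" "slice_cell pb x"] ms in \<open>simp_all add: pair_comp_def\<close>)
  then show ?thesis by (simp add: cell_eqI comp)
qed

lemma two_functor_Slice: "two_functor (TngPair pb) trmTngCat (Slice pb)"
proof -
  have c: "category trmTngCat" "category (vertical trmTngCat)" "category (horizontal trmTngCat)"
    "category (TngPair pb)" "category (vertical (TngPair pb))" "category (horizontal (TngPair pb))"
    using two_category_trm two_category_pair by (auto simp: two_category_def)
  have T: "omap (Slice pb) = slice_obj pb" "amap (Slice pb) = slice_mor pb" "cmap (Slice pb) = slice_cell pb"
    by (simp_all add: Slice_def)
  note st = slice_mor_trm[simplified]
  have "is_functor (TngPair pb) trmTngCat (Slice pb)"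
    unfolding is_functor_def T
    by (intro conjI ballI impI c)
      (simp_all add: trm_B pair_B trm_B_def pair_B_def slice_obj_terminal st pairD(1,2) slice_mor_id slice_mor_comp)
  moreover have "is_functor (vertical (TngPair pb)) (vertical trmTngCat) \<lparr>omap = amap (Slice pb), amap = cmap (Slice pb)\<rparr>"
    unfolding is_functor_def T
    by (intro conjI ballI impI c)
      (simp_all add: trm_B pair_B trm_B_def pair_B_def vertical_def st pairD(1,2) slice_obj_terminal slice_cell_trm
        slice_cell_id slice_cell_vcomp)
  moreover have "is_functor (horizontal (TngPair pb)) (horizontal trmTngCat) \<lparr>omap = omap (Slice pb), amap = cmap (Slice pb)\<rparr>"
    unfolding is_functor_def T
    by (intro conjI ballI impI c)
      (simp_all add: trm_B pair_B trm_B_def pair_B_def horizontal_def slice_obj_terminal slice_cell_trm slice_cell_id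
        slice_cell_hcomp slice_mor_id pair_id_mor pair_cells_D(1))
  ultimately show ?thesis
    using two_category_trm two_category_pair by (simp add: two_functor_def)
qed

end

section \<open>The adjunction\<close>

locale terminal_slice = terminal_tangent_cat X t + tangent_slice X t pb for X :: "'b utng" and t pb
begin

definition unit_arr :: "'b univ \<Rightarrow> 'b univ" where
  "unit_arr k = Tri (bang C t (Dom C k)) k (bang C t (Cod C k))"

definition unit_dist :: "'b univ \<Rightarrow> 'b univ" where
  "unit_dist a = Tri (bang C t (TO X a)) (into pb X t (bang C t a) (Id C (TO X a))) (TO Y (bang C t a))"

lemma bang_S_Obj [simp]: "a \<in> Obj C \<Longrightarrow> bang C t a \<in> Obj S"
  unfolding S_Obj by simp

text \<open>An object of the slice over a terminal object is determined by its domain; hence the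
  functor of the unit is bijective on objects, with inverse \<open>Dom\<close>.\<close>

lemma bang_Dom [simp]: "f \<in> Obj S \<Longrightarrow> bang C t (Dom C f) = f"
  by (rule bang_eq) simp_all

lemma unit_arr_typing [simp]:
  assumes "k \<in> Arr C"
  shows "unit_arr k \<in> Arr S" "Dom S (unit_arr k) = bang C t (Dom C k)" "Cod S (unit_arr k) = bang C t (Cod C k)" "tmap (unit_arr k) = k"
proof -
  have "bang C t (Cod C k) \<cdot> k = bang C t (Dom C k)"
    by (rule bang_eq[symmetric]) (use assms in simp_all)
  then show "unit_arr k \<in> Arr S" "Dom S (unit_arr k) = bang C t (Dom C k)" "Cod S (unit_arr k) = bang C t (Cod C k)" "tmap (unit_arr k) = k"
    using assms by (simp_all add: unit_arr_def)
qed

text \<open>The condition over \<open>t\<close> is void, so the identity of \<open>T a\<close>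
  factors through \<open>v\<close>. As \<open>v\<close> is monic, this section is its
  inverse.\<close>

lemma unit_dist_props:
  assumes a: "a \<in> Obj C"
  shows "unit_dist a \<in> Arr S" "Dom S (unit_dist a) = bang C t (TO X a)" "Cod S (unit_dist a) = TO Y (bang C t a)"
    "V (bang C t a) \<cdot> tmap (unit_dist a) = Id C (TO X a)"
proof -
  have e: "TA X (bang C t a) \<cdot> Id C (TO X a) = zeroT X t \<cdot> bang C t (TO X a)"
    by (rule pow_terminal[of _ _ 1]) (use a in simp_all)
  show "unit_dist a \<in> Arr S" "Dom S (unit_dist a) = bang C t (TO X a)" "Cod S (unit_dist a) = TO Y (bang C t a)"
    "V (bang C t a) \<cdot> tmap (unit_dist a) = Id C (TO X a)"
    unfolding unit_dist_def using a into_props[OF _ _ _ _ _ _ e] by simp_all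
qed

lemmas unit_dist_typing [simp] = unit_dist_props(1-3)

lemma V_unit_dist_comp: "a \<in> Obj C \<Longrightarrow> x \<in> Arr C \<Longrightarrow> Cod C x = TO X a \<Longrightarrow> V (bang C t a) \<cdot> tmap (unit_dist a) \<cdot> x = x"
  using reassoc[OF cats(1) unit_dist_props(4)[of a], of x] by simp

lemma TV_unit_dist_comp: "a \<in> Obj C \<Longrightarrow> x \<in> Arr C \<Longrightarrow> Cod C x = TO X (TO X a) \<Longrightarrow>
    TA X (V (bang C t a)) \<cdot> TA X (tmap (unit_dist a)) \<cdot> x = x"
  using TA_reassoc[OF unit_dist_props(4)[of a], of x] by simp

text \<open>\<open>v\<close> cancels \<open>unit_dist\<close>, so after composition with
  \<open>v\<close> the two sides of each law become the same composite in \<open>X\<close>.\<close>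

lemma unit_lax:
  assumes om: "\<And>a. a \<in> Obj C \<Longrightarrow> omap G a = bang C t a"
    and am: "\<And>k. k \<in> Arr C \<Longrightarrow> amap G k = unit_arr k"
    and di: "\<And>a. a \<in> Obj C \<Longrightarrow> \<theta> a = unit_dist a"
  shows "lax_tangent_morphism X Y G \<theta>"
proof (rule lax_tangent_morphismI)
  note [simp] = om am di
  show "is_functor C S G"
    unfolding is_functor_def
  proof (intro conjI ballI impI)
    fix a assume h: "a \<in> Obj C"
    show "amap G (Id C a) = Id S (omap G a)"
      by (rule S_eqI) (use h in simp_all)
  next
    fix f g assume h: "f \<in> Arr C" "g \<in> Arr C" "Cod C f = Dom C g"
    show "amap G (g \<cdot> f) = amap G g \<cdot>\<^bsub>S\<^esub> amap G f"
      by (rule S_eqI) (use h in simp_all)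
  qed simp_all
  show "\<theta> (Cod C k) \<cdot>\<^bsub>S\<^esub> amap G (TA X k) = TA Y (amap G k) \<cdot>\<^bsub>S\<^esub> \<theta> (Dom C k)" if k: "k \<in> Arr C" for k
    by (rule TS_eqI[of _ _ "bang C t (Cod C k)"]) (use k in \<open>simp_all add: V_unit_dist_comp V_nat_comp unit_dist_props(4)\<close>)
  fix a assume a: "a \<in> Obj C"
  note [simp] = a
  let ?f = "bang C t a"
  show "\<theta> a \<in> Hom S (omap G (TO X a)) (TO Y (omap G a))" by simp
  have pth: "projT Y ?f \<cdot>\<^bsub>S\<^esub> unit_dist a = unit_arr (projT X a)"
    by (rule S_eqI) (simp_all add: unit_dist_props(4))
  then show "projT Y (omap G a) \<cdot>\<^bsub>S\<^esub> \<theta> a = amap G (projT X a)" by simp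
  show "\<theta> a \<cdot>\<^bsub>S\<^esub> amap G (zeroT X a) = zeroT Y (omap G a)"
    by (rule TS_eqI[of _ _ ?f]) (simp_all add: V_unit_dist_comp zero_slice(4))
  let ?x = "unit_dist a \<cdot>\<^bsub>S\<^esub> unit_arr (pi1T X a)" and ?y = "unit_dist a \<cdot>\<^bsub>S\<^esub> unit_arr (pi2T X a)"
  have "unit_arr (projT X a) \<cdot>\<^bsub>S\<^esub> unit_arr (pi1T X a) = unit_arr (projT X a) \<cdot>\<^bsub>S\<^esub> unit_arr (pi2T X a)"
    by (rule S_eqI) (simp_all add: pi_eq)
  then have e: "projT Y ?f \<cdot>\<^bsub>S\<^esub> ?x = projT Y ?f \<cdot>\<^bsub>S\<^esub> ?y"
    using reassoc[OF category_S pth, of "unit_arr (pi1T X a)"] reassoc[OF category_S pth, of "unit_arr (pi2T X a)"] by simp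
  show "\<theta> a \<cdot>\<^bsub>S\<^esub> amap G (sumT X a) =
      plus_T Y (omap G a) (\<theta> a \<cdot>\<^bsub>S\<^esub> amap G (pi1T X a)) (\<theta> a \<cdot>\<^bsub>S\<^esub> amap G (pi2T X a))"
  proof (rule TS_eqI[of _ _ ?f])
    show "V ?f \<cdot> tmap (\<theta> a \<cdot>\<^bsub>S\<^esub> amap G (sumT X a)) =
      V ?f \<cdot> tmap (plus_T Y (omap G a) (\<theta> a \<cdot>\<^bsub>S\<^esub> amap G (pi1T X a)) (\<theta> a \<cdot>\<^bsub>S\<^esub> amap G (pi2T X a)))"
      using e by (simp add: V_unit_dist_comp V_plus plus_pi)
  qed (use e in simp_all)
  show "liftT Y (omap G a) \<cdot>\<^bsub>S\<^esub> \<theta> a = TA Y (\<theta> a) \<cdot>\<^bsub>S\<^esub> \<theta> (TO X a) \<cdot>\<^bsub>S\<^esub> amap G (liftT X a)"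
    by (rule TTS_eqI[of _ _ ?f]) (simp_all add: V_l_comp unit_dist_props(4) V_nat_comp V_unit_dist_comp TV_unit_dist_comp)
  show "flipT Y (omap G a) \<cdot>\<^bsub>S\<^esub> TA Y (\<theta> a) \<cdot>\<^bsub>S\<^esub> \<theta> (TO X a) =
      TA Y (\<theta> a) \<cdot>\<^bsub>S\<^esub> \<theta> (TO X a) \<cdot>\<^bsub>S\<^esub> amap G (flipT X a)"
  proof (rule TTS_eqI[of _ _ ?f])
    have "TA X (V ?f) \<cdot> V (TO Y ?f) \<cdot> tmap (TA Y (unit_dist a)) \<cdot> tmap (unit_dist (TO X a)) = Id C (TO X (TO X a))"
      using TV_unit_dist_comp[of a "Id C (TO X (TO X a))"] by (simp add: V_nat_comp unit_dist_props(4))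
    then show "TA X (V ?f) \<cdot> V (TO Y ?f) \<cdot> tmap (flipT Y (omap G a) \<cdot>\<^bsub>S\<^esub> TA Y (\<theta> a) \<cdot>\<^bsub>S\<^esub> \<theta> (TO X a)) =
      TA X (V ?f) \<cdot> V (TO Y ?f) \<cdot> tmap (TA Y (\<theta> a) \<cdot>\<^bsub>S\<^esub> \<theta> (TO X a) \<cdot>\<^bsub>S\<^esub> amap G (flipT X a))"
      using arg_cong[OF unit_dist_props(4)[OF a], of "TA X"] by (simp add: V_c_comp V_nat_comp V_unit_dist_comp TV_unit_dist_comp unit_dist_props(4))
  qed simp_all
qed (simp_all add: tangent_cat tangent_category_Y)

end

section \<open>The counit as a lax tangent morphism\<close>

context tangent_slice
begin

text \<open>With \<open>v\<close> as distributive law, the laws for zero, sum, lift and flip are the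
  equations by which these maps of the slice were induced.\<close>

lemma counit_lax:
  assumes om: "\<And>f. f \<in> Obj S \<Longrightarrow> omap G f = Dom C f"
    and am: "\<And>k. k \<in> Arr S \<Longrightarrow> amap G k = tmap k"
    and di: "\<And>f. f \<in> Obj S \<Longrightarrow> \<theta> f = V f"
  shows "lax_tangent_morphism Y X G \<theta>"
proof (rule lax_tangent_morphismI)
  note [simp] = om am di
  show "is_functor S C G"
    unfolding is_functor_def by simp
  show "\<theta> (Cod S k) \<cdot> amap G (TA Y k) = TA X (amap G k) \<cdot> \<theta> (Dom S k)" if "k \<in> Arr S" for k
    using that by (simp add: V_nat)
  fix f assume f: "f \<in> Obj S"
  note [simp] = f
  show "\<theta> f \<in> Hom C (omap G (TO Y f)) (TO X (omap G f))" "projT X (omap G f) \<cdot> \<theta> f = amap G (projT Y f)"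
    "\<theta> f \<cdot> amap G (zeroT Y f) = zeroT X (omap G f)"
    "\<theta> f \<cdot> amap G (sumT Y f) = plus_T X (omap G f) (\<theta> f \<cdot> amap G (pi1T Y f)) (\<theta> f \<cdot> amap G (pi2T Y f))"
    "liftT X (omap G f) \<cdot> \<theta> f = TA X (\<theta> f) \<cdot> \<theta> (TO Y f) \<cdot> amap G (liftT Y f)"
    "flipT X (omap G f) \<cdot> TA X (\<theta> f) \<cdot> \<theta> (TO Y f) = TA X (\<theta> f) \<cdot> \<theta> (TO Y f) \<cdot> amap G (flipT Y f)"
    by (simp_all add: zero_slice(4) sum_slice(4) lift_slice(4) flip_slice(4))
qed (simp_all add: tangent_cat tangent_category_Y)

end

section \<open>Unit and counit as 1-cells, naturality and triangle identities\<close>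

context pullbacks_chosen
begin

lemma terminal_slice_of: "terminal_tangent_category P \<Longrightarrow> terminal_slice (fst P) (snd P) pb"
  using terminal_tangent_cat_intro[of P] tangent_slice_of[OF terminal_tangent_pair[OF choice, of P]] by (simp add: terminal_slice_def)

lemma adj_unit_simps [simp]:
  assumes "terminal_tangent_category P"
  shows "lsrc (adj_unit pb P) = P" "ltrg (adj_unit pb P) = slice_obj pb P"
    "a \<in> Obj (lcat P) \<Longrightarrow> omap (lfun (adj_unit pb P)) a = bang (lcat P) (snd P) a"
    "k \<in> Arr (lcat P) \<Longrightarrow> amap (lfun (adj_unit pb P)) k = terminal_slice.unit_arr (fst P) (snd P) k"
    "a \<in> Obj (lcat P) \<Longrightarrow> ldist (adj_unit pb P) a = terminal_slice.unit_dist (fst P) (snd P) pb a"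
proof -
  interpret P: terminal_slice "fst P" "snd P" pb by (rule terminal_slice_of[OF assms])
  show "lsrc (adj_unit pb P) = P" "ltrg (adj_unit pb P) = slice_obj pb P"
    "a \<in> Obj (lcat P) \<Longrightarrow> omap (lfun (adj_unit pb P)) a = bang (lcat P) (snd P) a"
    "k \<in> Arr (lcat P) \<Longrightarrow> amap (lfun (adj_unit pb P)) k = P.unit_arr k"
    "a \<in> Obj (lcat P) \<Longrightarrow> ldist (adj_unit pb P) a = P.unit_dist a"
    by (simp_all add: adj_unit_def Let_def P.unit_arr_def P.unit_dist_def P.sliceTO_eq)
qed

lemma adj_unit_laxmor:
  assumes "terminal_tangent_category P"
  shows "is_laxmor (adj_unit pb P)"
proof -
  interpret P: terminal_slice "fst P" "snd P" pb by (rule terminal_slice_of[OF assms])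
  have "lax_tangent_morphism (fst P) P.Y (lfun (adj_unit pb P)) (ldist (adj_unit pb P))"
    by (rule P.unit_lax) (simp_all add: assms)
  moreover have "omap (lfun (adj_unit pb P)) \<in> extensional (Obj (lcat P))" "amap (lfun (adj_unit pb P)) \<in> extensional (Arr (lcat P))"
    "ldist (adj_unit pb P) \<in> extensional (Obj (lcat P))"
    by (simp_all add: adj_unit_def Let_def)
  ultimately show ?thesis using assms by (simp add: is_laxmor_def)
qed

lemma adj_counit_simps [simp]:
  assumes "tangent_pair pb P"
  shows "lsrc (fst (adj_counit pb P)) = slice_obj pb P" "ltrg (fst (adj_counit pb P)) = P"
    "f \<in> Obj (Cat (Y P)) \<Longrightarrow> omap (lfun (fst (adj_counit pb P))) f = Dom (lcat P) f"
    "k \<in> Arr (Cat (Y P)) \<Longrightarrow> amap (lfun (fst (adj_counit pb P))) k = tmap k"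
    "f \<in> Obj (Cat (Y P)) \<Longrightarrow> ldist (fst (adj_counit pb P)) f = vert pb (fst P) (snd P) f"
    "snd (adj_counit pb P) = Id (lcat P) (snd P)"
proof -
  interpret P: tangent_slice "fst P" "snd P" pb by (rule tangent_slice_of[OF assms])
  show "lsrc (fst (adj_counit pb P)) = slice_obj pb P" "ltrg (fst (adj_counit pb P)) = P"
    "f \<in> Obj (Cat (Y P)) \<Longrightarrow> omap (lfun (fst (adj_counit pb P))) f = Dom (lcat P) f"
    "k \<in> Arr (Cat (Y P)) \<Longrightarrow> amap (lfun (fst (adj_counit pb P))) k = tmap k"
    "f \<in> Obj (Cat (Y P)) \<Longrightarrow> ldist (fst (adj_counit pb P)) f = vert pb (fst P) (snd P) f"
    "snd (adj_counit pb P) = Id (lcat P) (snd P)"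
    by (simp_all add: adj_counit_def Let_def P.slice_cat_eq)
qed

lemma adj_counit_laxmor:
  assumes "tangent_pair pb P"
  shows "is_laxmor (fst (adj_counit pb P))"
proof -
  interpret P: tangent_slice "fst P" "snd P" pb by (rule tangent_slice_of[OF assms])
  have "lax_tangent_morphism P.Y (fst P) (lfun (fst (adj_counit pb P))) (ldist (fst (adj_counit pb P)))"
    by (rule P.counit_lax) (simp_all add: assms)
  moreover have "omap (lfun (fst (adj_counit pb P))) \<in> extensional (Obj P.S)" "amap (lfun (fst (adj_counit pb P))) \<in> extensional (Arr P.S)"
    "ldist (fst (adj_counit pb P)) \<in> extensional (Obj P.S)"
    by (simp_all add: adj_counit_def Let_def P.slice_cat_eq)
  ultimately show ?thesis using assms by (simp add: is_laxmor_def)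
qed

lemma slice_obj_pair: "tangent_pair pb P \<Longrightarrow> tangent_pair pb (slice_obj pb P)"
  by (rule terminal_tangent_pair[OF choice slice_obj_terminal])

lemma adj_counit_pair:
  assumes "tangent_pair pb P"
  shows "is_pairmor pb (adj_counit pb P)"
proof -
  interpret P: tangent_slice "fst P" "snd P" pb by (rule tangent_slice_of[OF assms])
  show ?thesis
    by (rule pairI) (simp_all add: assms slice_obj_pair adj_counit_laxmor)
qed

lemma adj_unit_trm: "terminal_tangent_category P \<Longrightarrow> adj_unit pb P \<in> trm_mors"
  using terminal_tangent_pair[OF choice] by (simp add: adj_unit_laxmor slice_obj_terminal)

text \<open>On objects both composites give the unique map out of \<open>F a\<close>, since the base
  map of \<open>term_mor m\<close> ends in a terminal object. The distributive laws agree after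
  \<open>v\<close>, where both reduce to \<open>ldist m a\<close>.\<close>

lemma unit_natural:
  assumes "m \<in> trm_mors"
  shows "lax_comp (adj_unit pb (ltrg m)) m = lax_comp (slice_mor pb (term_mor m)) (adj_unit pb (lsrc m))"
proof -
  have m: "terminal_tangent_category (lsrc m)" "terminal_tangent_category (ltrg m)" "is_laxmor m" using assms by auto
  note M = term_mor_pair[OF assms]
  interpret P: terminal_slice "fst (lsrc m)" "snd (lsrc m)" pb by (rule terminal_slice_of[OF m(1)])
  interpret Q: terminal_slice "fst (ltrg m)" "snd (ltrg m)" pb by (rule terminal_slice_of[OF m(2)])
  interpret m: slice_morphism "fst (lsrc m)" "fst (ltrg m)" "snd (lsrc m)" "snd (ltrg m)" pb "lfun m" "ldist m" "snd (term_mor m)"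
    using slice_morphism_of[OF M] by simp
  note ms = slice_mor_simps[OF M, simplified] and sm = slice_mor_trm[OF M]
  have slice_ob: "m.slice_ob f = bang (lcat (ltrg m)) (snd (ltrg m)) (omap (lfun m) (Dom (lcat (lsrc m)) f))" if "f \<in> Obj P.S" for f
    by (rule Q.bang_eq[symmetric]) (use that in \<open>simp_all add: m.slice_ob_def\<close>)
  show ?thesis
  proof (rule laxmor_eqI)
    show "is_laxmor (lax_comp (adj_unit pb (ltrg m)) m)"
      using m by (intro lax_comp_laxmor) (simp_all add: adj_unit_laxmor P.tangent_cat Q.tangent_cat Q.tangent_category_Y)
    show "is_laxmor (lax_comp (slice_mor pb (term_mor m)) (adj_unit pb (lsrc m)))"
      using m sm by (intro lax_comp_laxmor) (simp_all add: adj_unit_laxmor ms P.tangent_cat P.tangent_category_Y Q.tangent_category_Y)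
    show "amap (lfun (lax_comp (adj_unit pb (ltrg m)) m)) k =
        amap (lfun (lax_comp (slice_mor pb (term_mor m)) (adj_unit pb (lsrc m)))) k"
      if "k \<in> Arr (lcat (lsrc (lax_comp (slice_mor pb (term_mor m)) (adj_unit pb (lsrc m)))))" for k
    proof -
      have k [simp]: "k \<in> Arr (lcat (lsrc m))" using that m by simp
      have "Q.unit_arr (amap (lfun m) k) = m.slice_arr (P.unit_arr k)"
        by (rule Q.S_eqI) (simp_all add: slice_ob)
      then show ?thesis using m by (simp add: ms)
    qed
    fix a assume "a \<in> Obj (lcat (lsrc (lax_comp (slice_mor pb (term_mor m)) (adj_unit pb (lsrc m)))))"
    then have a [simp]: "a \<in> Obj (lcat (lsrc m))" using m by simp
    show "omap (lfun (lax_comp (adj_unit pb (ltrg m)) m)) a =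
        omap (lfun (lax_comp (slice_mor pb (term_mor m)) (adj_unit pb (lsrc m)))) a"
      using m by (simp add: ms slice_ob)
    let ?u = "bang (lcat (lsrc m)) (snd (lsrc m)) a" and ?v = "bang (lcat (ltrg m)) (snd (ltrg m)) (omap (lfun m) a)"
    have "Q.unit_dist (omap (lfun m) a) \<cdot>\<^bsub>Q.S\<^esub> Q.unit_arr (ldist m a) = m.slice_dist ?u \<cdot>\<^bsub>Q.S\<^esub> m.slice_arr (P.unit_dist a)"
    proof (rule Q.TS_eqI[of _ _ ?v])
      have "Q.V ?v \<cdot>\<^bsub>lcat (ltrg m)\<^esub> tmap (m.slice_dist ?u) \<cdot>\<^bsub>lcat (ltrg m)\<^esub> amap (lfun m) (tmap (P.unit_dist a)) = ldist m a"
        using m.V_slice_dist_comp[of ?u "amap (lfun m) (tmap (P.unit_dist a))"] arg_cong[OF P.unit_dist_props(4)[OF a], of "amap (lfun m)"]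
        by (simp add: slice_ob)
      then show "Q.V ?v \<cdot>\<^bsub>lcat (ltrg m)\<^esub> tmap (Q.unit_dist (omap (lfun m) a) \<cdot>\<^bsub>Q.S\<^esub> Q.unit_arr (ldist m a)) =
          Q.V ?v \<cdot>\<^bsub>lcat (ltrg m)\<^esub> tmap (m.slice_dist ?u \<cdot>\<^bsub>Q.S\<^esub> m.slice_arr (P.unit_dist a))"
        by (simp add: Q.V_unit_dist_comp)
    qed (simp_all add: slice_ob)
    then show "ldist (lax_comp (adj_unit pb (ltrg m)) m) a =
        ldist (lax_comp (slice_mor pb (term_mor m)) (adj_unit pb (lsrc m))) a"
      using m by (simp add: ms)
  qed (use m ms in simp_all)
qed

lemma unit_natural_cell:
  assumes "x \<in> trm_cells"
  shows "cell_hcomp (\<lambda>m. m) lax_comp (cell_id (\<lambda>m. m) (adj_unit pb (ltrg (csrc x)))) x =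
    cell_hcomp (\<lambda>m. m) lax_comp (slice_cell pb (term_cell x)) (cell_id (\<lambda>m. m) (adj_unit pb (lsrc (csrc x))))"
proof -
  note x = trm_K_D[OF assms] and tx = term_cell_pair[OF assms]
  have t: "terminal_tangent_category (lsrc (csrc x))" "terminal_tangent_category (ltrg (csrc x))" using x by auto
  interpret P: terminal_slice "fst (lsrc (csrc x))" "snd (lsrc (csrc x))" pb by (rule terminal_slice_of[OF t(1)])
  interpret Q: terminal_slice "fst (ltrg (csrc x))" "snd (ltrg (csrc x))" pb by (rule terminal_slice_of[OF t(2)])
  interpret x: lax_trans "fst (lsrc (csrc x))" "fst (ltrg (csrc x))" "lfun (csrc x)" "ldist (csrc x)"
    "lfun (ctrg x)" "ldist (ctrg x)" "ccomp x" using x by simp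
  have tc: "csrc (term_cell x) = term_mor (csrc x)" "ctrg (term_cell x) = term_mor (ctrg x)" "ccomp (term_cell x) = ccomp x"
    by (simp_all add: term_cell_def)
  have src: "lax_comp (adj_unit pb (ltrg (csrc x))) (csrc x) = lax_comp (slice_mor pb (term_mor (csrc x))) (adj_unit pb (lsrc (csrc x)))"
    "lax_comp (adj_unit pb (ltrg (csrc x))) (ctrg x) = lax_comp (slice_mor pb (term_mor (ctrg x))) (adj_unit pb (lsrc (csrc x)))"
    using unit_natural[OF x(1)] unit_natural[OF x(2)] x(3,4) by simp_all
  note M = term_mor_pair[OF x(1)] and N = term_mor_pair[OF x(2)]
  note ms = slice_mor_simps[OF M, simplified] and ns = slice_mor_simps[OF N, simplified, unfolded x(3,4)]
  interpret m: slice_morphism "fst (lsrc (csrc x))" "fst (ltrg (csrc x))" "snd (lsrc (csrc x))" "snd (ltrg (csrc x))" pb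
    "lfun (csrc x)" "ldist (csrc x)" "snd (term_mor (csrc x))"
    using slice_morphism_of[OF M] by simp
  interpret n: slice_morphism "fst (lsrc (csrc x))" "fst (ltrg (csrc x))" "snd (lsrc (csrc x))" "snd (ltrg (csrc x))" pb
    "lfun (ctrg x)" "ldist (ctrg x)" "snd (term_mor (ctrg x))"
    using slice_morphism_of[OF N] x(3,4) by simp
  have mso: "m.slice_ob f = bang (lcat (ltrg (csrc x))) (snd (ltrg (csrc x))) (omap (lfun (csrc x)) (Dom (lcat (lsrc (csrc x))) f))"
    and nso: "n.slice_ob f = bang (lcat (ltrg (csrc x))) (snd (ltrg (csrc x))) (omap (lfun (ctrg x)) (Dom (lcat (lsrc (csrc x))) f))"
    if "f \<in> Obj P.S" for f
    by (rule Q.bang_eq[symmetric], use that in \<open>simp_all add: m.slice_ob_def n.slice_ob_def\<close>)+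
  have "ccomp (cell_hcomp (\<lambda>m. m) lax_comp (cell_id (\<lambda>m. m) (adj_unit pb (ltrg (csrc x)))) x) a =
    ccomp (cell_hcomp (\<lambda>m. m) lax_comp (slice_cell pb (term_cell x)) (cell_id (\<lambda>m. m) (adj_unit pb (lsrc (csrc x))))) a"
    if a: "a \<in> Obj (lcat (lsrc (csrc x)))" for a
  proof -
    let ?u = "bang (lcat (lsrc (csrc x))) (snd (lsrc (csrc x))) a"
    have sc: "ccomp (slice_cell pb (term_cell x)) ?u = Q.unit_arr (ccomp x a)"
      using slice_cell_ccomp[OF tx, of ?u] a by (simp add: tc ms ns mso nso Q.unit_arr_def)
    have "m.slice_arr (Id P.S ?u) = Id Q.S (m.slice_ob ?u)"
      by (rule Q.S_eqI) (use a in simp_all)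
    then show ?thesis
      using a t sc by (simp add: tc ms mso)
  qed
  note e = this
  have "ccomp (cell_hcomp (\<lambda>m. m) lax_comp (cell_id (\<lambda>m. m) (adj_unit pb (ltrg (csrc x)))) x) =
    ccomp (cell_hcomp (\<lambda>m. m) lax_comp (slice_cell pb (term_cell x)) (cell_id (\<lambda>m. m) (adj_unit pb (lsrc (csrc x)))))"
    by (rule extensionalityI[OF cell_extensional(3) _ e])
      (use t cell_extensional(3)[of "\<lambda>m. m" lax_comp "slice_cell pb (term_cell x)" "cell_id (\<lambda>m. m) (adj_unit pb (lsrc (csrc x)))"] in simp_all)
  then show ?thesis using src by (simp add: cell_eqI tc)
qed

text \<open>The lax parts agree by the equation
  \<open>v \<circ> \<theta> = \<alpha> \<circ> F v\<close> defining \<open>\<theta>\<close>. As for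
  the base maps, the unique arrow from an object of the slice to the identity of \<open>B\<close>
  has that object as underlying map, and the object in question, the image of the identity of
  \<open>A\<close>, is \<open>\<phi>\<close>.\<close>

lemma counit_natural:
  assumes "is_pairmor pb M"
  shows "pair_comp (adj_counit pb (ltrg (fst M))) (term_mor (slice_mor pb M)) = pair_comp M (adj_counit pb (lsrc (fst M)))"
proof -
  note M = pairD[OF assms]
  let ?P = "lsrc (fst M)" and ?P' = "ltrg (fst M)"
  interpret m: slice_morphism "fst ?P" "fst ?P'" "snd ?P" "snd ?P'" pb "lfun (fst M)" "ldist (fst M)" "snd M" by (rule slice_morphism_of[OF assms])
  note ms = slice_mor_simps[OF assms] and sm = slice_mor_trm[OF assms]
  have "lax_comp (fst (adj_counit pb ?P')) (slice_mor pb M) = lax_comp (fst M) (fst (adj_counit pb ?P))"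
  proof (rule laxmor_eqI)
    show "is_laxmor (lax_comp (fst (adj_counit pb ?P')) (slice_mor pb M))"
      using M sm by (intro lax_comp_laxmor)
        (simp_all add: adj_counit_laxmor ms m.dom.tangent_category_Y m.cod.tangent_category_Y m.cod.tangent_cat)
    show "is_laxmor (lax_comp (fst M) (fst (adj_counit pb ?P)))"
      using M by (intro lax_comp_laxmor)
        (simp_all add: adj_counit_laxmor m.dom.tangent_category_Y m.dom.tangent_cat m.cod.tangent_cat)
    show "amap (lfun (lax_comp (fst (adj_counit pb ?P')) (slice_mor pb M))) k = amap (lfun (lax_comp (fst M) (fst (adj_counit pb ?P)))) k"
      if "k \<in> Arr (lcat (lsrc (lax_comp (fst M) (fst (adj_counit pb ?P)))))" for k
      using that M by (simp add: ms)
    fix f assume "f \<in> Obj (lcat (lsrc (lax_comp (fst M) (fst (adj_counit pb ?P)))))"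
    then have f [simp]: "f \<in> Obj m.dom.S" using M by simp
    show "omap (lfun (lax_comp (fst (adj_counit pb ?P')) (slice_mor pb M))) f = omap (lfun (lax_comp (fst M) (fst (adj_counit pb ?P)))) f"
      "ldist (lax_comp (fst (adj_counit pb ?P')) (slice_mor pb M)) f = ldist (lax_comp (fst M) (fst (adj_counit pb ?P))) f"
      using M m.slice_dist_props(4)[OF f] by (simp_all add: ms)
  qed (use M ms in simp_all)
  moreover have "m.slice_ob (Id (lcat ?P) (snd ?P)) = snd M" by (simp add: m.slice_ob_def)
  ultimately show ?thesis
    using M m.cod.bang_S[of "snd M"] m.slice_ob_Obj[of "Id (lcat ?P) (snd ?P)"]
    by (simp add: pair_comp_def) (simp add: term_mor_def ms)
qed

lemma counit_natural_cell:
  assumes "x \<in> pair_cells"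
  shows "cell_hcomp fst pair_comp (cell_id fst (adj_counit pb (ltrg (fst (csrc x))))) (term_cell (slice_cell pb x)) =
    cell_hcomp fst pair_comp x (cell_id fst (adj_counit pb (lsrc (fst (csrc x)))))"
proof -
  note x = pair_cells_D[OF assms] and sx = slice_cell_trm[OF assms]
  let ?P = "lsrc (fst (csrc x))" and ?P' = "ltrg (fst (csrc x))"
  note t = pairD(1,2)[OF x(1)]
  interpret m: slice_morphism "fst ?P" "fst ?P'" "snd ?P" "snd ?P'" pb "lfun (fst (csrc x))" "ldist (fst (csrc x))" "snd (csrc x)"
    by (rule pair_cell_slice_morphism(1)[OF assms])
  interpret n: slice_morphism "fst ?P" "fst ?P'" "snd ?P" "snd ?P'" pb "lfun (fst (ctrg x))" "ldist (fst (ctrg x))" "snd (ctrg x)"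
    by (rule pair_cell_slice_morphism(2)[OF assms])
  interpret x: lax_trans "fst ?P" "fst ?P'" "lfun (fst (csrc x))" "ldist (fst (csrc x))"
    "lfun (fst (ctrg x))" "ldist (fst (ctrg x))" "ccomp x" by (rule x(6))
  note ms = slice_mor_simps[OF x(1)] and ns = slice_mor_simps[OF x(2), unfolded x(3,4)]
  have tc: "csrc (term_cell y) = term_mor (csrc y)" "ctrg (term_cell y) = term_mor (ctrg y)" "ccomp (term_cell y) = ccomp y" for y
    by (simp_all add: term_cell_def)
  have src: "pair_comp (adj_counit pb ?P') (term_mor (slice_mor pb (csrc x))) = pair_comp (csrc x) (adj_counit pb ?P)"
    "pair_comp (adj_counit pb ?P') (term_mor (slice_mor pb (ctrg x))) = pair_comp (ctrg x) (adj_counit pb ?P)"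
    using counit_natural[OF x(1)] counit_natural[OF x(2)] x(3,4) by simp_all
  have "ccomp (cell_hcomp fst pair_comp (cell_id fst (adj_counit pb ?P')) (term_cell (slice_cell pb x))) f =
    ccomp (cell_hcomp fst pair_comp x (cell_id fst (adj_counit pb ?P))) f" if f: "f \<in> Obj m.dom.S" for f
  proof -
    have c: "ccomp (slice_cell pb x) f = Tri (m.slice_ob f) (ccomp x (Dom (lcat ?P) f)) (n.slice_ob f)"
      using slice_cell_ccomp[OF assms f] f by (simp add: ms ns)
    have "ccomp (slice_cell pb x) f \<in> Arr m.cod.S"
      using trm_K_D(6)[OF sx] f by (auto simp: lax_trans_def lax_trans_axioms_def nat_trans_def ms)
    then have a: "Tri (m.slice_ob f) (ccomp x (Dom (lcat ?P) f)) (n.slice_ob f) \<in> Arr m.cod.S" by (simp add: c)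
    show ?thesis
      using f a t by (simp add: tc ms ns c)
  qed
  then have "ccomp (cell_hcomp fst pair_comp (cell_id fst (adj_counit pb ?P')) (term_cell (slice_cell pb x))) =
    ccomp (cell_hcomp fst pair_comp x (cell_id fst (adj_counit pb ?P)))"
    by (intro extensionalityI[OF cell_extensional(3)])
      (use t cell_extensional(3)[of fst pair_comp x "cell_id fst (adj_counit pb ?P)"] ms in \<open>simp_all add: tc\<close>)
  then show ?thesis using src by (simp add: cell_eqI tc)
qed

text \<open>The composite law is \<open>v\<close> after \<open>unit_dist\<close>, hence an identity.
  The lemma serves both the triangle identity for \<open>Term\<close> and invertibility of the
  unit.\<close>

lemma counit_unit:
  assumes "terminal_tangent_category P"
  shows "lax_comp (fst (adj_counit pb P)) (adj_unit pb P) = lax_id P"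
proof -
  interpret P: terminal_slice "fst P" "snd P" pb by (rule terminal_slice_of[OF assms])
  note tp = terminal_tangent_pair[OF choice assms]
  show ?thesis
  proof (rule laxmor_eqI)
    show "is_laxmor (lax_comp (fst (adj_counit pb P)) (adj_unit pb P))"
      using assms tp by (intro lax_comp_laxmor)
        (simp_all add: adj_unit_laxmor adj_counit_laxmor P.tangent_cat P.tangent_category_Y)
    show "is_laxmor (lax_id P)" by (rule lax_id_laxmor[OF P.tangent_cat])
  qed (use assms tp P.unit_dist_props(4) in simp_all)
qed

text \<open>\<open>bang_Dom\<close> recovers the objects of the slice, and \<open>unit_dist\<close>
  after \<open>v\<close> is an identity because it becomes one after composition with the monic
  \<open>v\<close>.\<close>

lemma unit_counit:
  assumes "terminal_tangent_category P"
  shows "lax_comp (adj_unit pb P) (fst (adj_counit pb P)) = lax_id (slice_obj pb P)"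
proof -
  interpret P: terminal_slice "fst P" "snd P" pb by (rule terminal_slice_of[OF assms])
  note tp = terminal_tangent_pair[OF choice assms]
  show ?thesis
  proof (rule laxmor_eqI)
    show "is_laxmor (lax_comp (adj_unit pb P) (fst (adj_counit pb P)))"
      using assms tp by (intro lax_comp_laxmor)
        (simp_all add: adj_unit_laxmor adj_counit_laxmor P.tangent_cat P.tangent_category_Y)
    show "is_laxmor (lax_id (slice_obj pb P))"
      by (rule lax_id_laxmor) (simp add: P.tangent_category_Y)
    show "amap (lfun (lax_comp (adj_unit pb P) (fst (adj_counit pb P)))) k = amap (lfun (lax_id (slice_obj pb P))) k"
      if "k \<in> Arr (lcat (lsrc (lax_id (slice_obj pb P))))" for k
    proof -
      have k: "k \<in> Arr P.S" using that by simp
      have "P.unit_arr (tmap k) = k" by (rule P.S_eqI) (use k in simp_all)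
      then show ?thesis using assms tp k by simp
    qed
    fix f assume "f \<in> Obj (lcat (lsrc (lax_id (slice_obj pb P))))"
    then have f [simp]: "f \<in> Obj P.S" by simp
    show "omap (lfun (lax_comp (adj_unit pb P) (fst (adj_counit pb P)))) f = omap (lfun (lax_id (slice_obj pb P))) f"
      using assms tp by simp
    have e: "bang (lcat P) (snd P) (Dom (lcat P) (TO P.Y f)) = TO P.Y f" by (rule P.bang_Dom) simp
    have "P.unit_dist (Dom (lcat P) f) \<cdot>\<^bsub>P.S\<^esub> P.unit_arr (P.V f) = Id P.S (TO P.Y f)"
      by (rule P.TS_eqI[of _ _ f])
        (use P.V_unit_dist_comp[of "Dom (lcat P) f" "P.V f"] e in simp_all)
    then show "ldist (lax_comp (adj_unit pb P) (fst (adj_counit pb P))) f = ldist (lax_id (slice_obj pb P)) f"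
      using assms tp by simp
  qed (use assms tp in simp_all)
qed

text \<open>Beyond \<open>counit_unit\<close> only the base map remains, an endomorphism of the
  terminal object.\<close>

lemma triangle_Term:
  assumes "terminal_tangent_category P"
  shows "pair_comp (adj_counit pb P) (term_mor (adj_unit pb P)) = pair_id P"
proof -
  interpret P: terminal_slice "fst P" "snd P" pb by (rule terminal_slice_of[OF assms])
  note tp = terminal_tangent_pair[OF choice assms]
  have b: "bang (lcat P) (snd P) (snd P) = Id (lcat P) (snd P)" by (rule P.bang_eq) simp_all
  show ?thesis
    using counit_unit[OF assms] assms tp b P.bang_S[of "Id (lcat P) (snd P)"]
    by (simp add: pair_comp_def pair_id_def) (simp add: term_mor_def)
qed

text \<open>The slice is sliced once more, over its terminal object. An object of this second slice
  is an arrow from some \<open>f\<close> to the identity of \<open>A\<close>, and the image of the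
  counit under \<open>Slice\<close> sends it to its underlying map, which is \<open>f\<close>
  again.\<close>

lemma triangle_Slice:
  assumes "tangent_pair pb P"
  shows "lax_comp (slice_mor pb (adj_counit pb P)) (adj_unit pb (slice_obj pb P)) = lax_id (slice_obj pb P)"
proof -
  interpret P: tangent_slice "fst P" "snd P" pb by (rule tangent_slice_of[OF assms])
  note st = slice_obj_terminal[OF assms] and c = adj_counit_pair[OF assms]
  interpret Q: terminal_slice P.Y "Id (lcat P) (snd P)" pb using terminal_slice_of[OF st] by simp
  interpret m: slice_morphism P.Y "fst P" "Id (lcat P) (snd P)" "snd P" pb "lfun (fst (adj_counit pb P))" "ldist (fst (adj_counit pb P))"
    "Id (lcat P) (snd P)" using slice_morphism_of[OF c] assms by simp
  note ms = slice_mor_simps[OF c, unfolded adj_counit_simps[OF assms] slice_obj_simps] and sm = slice_mor_trm[OF c]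
  have slice_ob: "m.slice_ob g = tmap g" if "g \<in> Obj Q.S" for g
  proof -
    have g: "g \<in> Arr P.S" "Cod P.S g = Id (lcat P) (snd P)" using Q.Obj_S[OF that] by auto
    have "Cod (lcat P) (tmap g) = snd P"
      unfolding P.Arr_S(3)[OF g(1)] g(2) by (rule Dom_Id[OF P.cats(1) P.A])
    then show ?thesis
      unfolding m.slice_ob_def adj_counit_simps(4)[OF assms g(1)] by (rule Id_comp[OF P.cats(1) P.Arr_S(1)[OF g(1)]])
  qed
  have u: "bang P.S (Id (lcat P) (snd P)) f = Tri f f (Id (lcat P) (snd P))" if "f \<in> Obj P.S" for f
    by (rule P.bang_S[OF that])
  have sou: "m.slice_ob (bang P.S (Id (lcat P) (snd P)) g) = g" if "g \<in> Obj P.S" for g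
    using that by (simp add: slice_ob) (simp add: u)
  show ?thesis
  proof (rule laxmor_eqI)
    show "is_laxmor (lax_comp (slice_mor pb (adj_counit pb P)) (adj_unit pb (slice_obj pb P)))"
      using st sm ms by (intro lax_comp_laxmor)
        (simp_all add: adj_unit_laxmor P.tangent_category_Y Q.tangent_category_Y)
    show "is_laxmor (lax_id (slice_obj pb P))"
      by (rule lax_id_laxmor) (simp add: P.tangent_category_Y)
    show "amap (lfun (lax_comp (slice_mor pb (adj_counit pb P)) (adj_unit pb (slice_obj pb P)))) k = amap (lfun (lax_id (slice_obj pb P))) k"
      if "k \<in> Arr (lcat (lsrc (lax_id (slice_obj pb P))))" for k
    proof -
      have k [simp]: "k \<in> Arr P.S" using that by simp
      have "m.slice_arr (Q.unit_arr k) = k"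
        by (rule P.S_eqI) (use assms in \<open>simp_all add: sou\<close>)
      then show ?thesis using st by (simp add: ms)
    qed
    fix f assume "f \<in> Obj (lcat (lsrc (lax_id (slice_obj pb P))))"
    then have f [simp]: "f \<in> Obj P.S" by simp
    show "omap (lfun (lax_comp (slice_mor pb (adj_counit pb P)) (adj_unit pb (slice_obj pb P)))) f = omap (lfun (lax_id (slice_obj pb P))) f"
      using st by (simp add: ms sou)
    let ?u = "bang P.S (Id (lcat P) (snd P)) f"
    have "m.slice_dist ?u \<cdot>\<^bsub>P.S\<^esub> m.slice_arr (Q.unit_dist f) = Id P.S (TO P.Y f)"
    proof (rule P.TS_eqI[of _ _ f])
      \<comment> \<open>Two levels of \<open>v\<close> occur. That of the second slice is inverted
        by \<open>unit_dist\<close>, which leaves \<open>P.V f\<close> on both sides.\<close>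
      have "tmap (Q.V ?u) \<cdot>\<^bsub>lcat P\<^esub> tmap (tmap (Q.unit_dist f)) = Id (lcat P) (Dom (lcat P) (TO P.Y f))"
        using arg_cong[OF Q.unit_dist_props(4)[OF f], of tmap] by simp
      then show "P.V f \<cdot>\<^bsub>lcat P\<^esub> tmap (m.slice_dist ?u \<cdot>\<^bsub>P.S\<^esub> m.slice_arr (Q.unit_dist f)) = P.V f \<cdot>\<^bsub>lcat P\<^esub> tmap (Id P.S (TO P.Y f))"
        using m.V_slice_dist_comp[of ?u "tmap (tmap (Q.unit_dist f))"] assms by (simp add: sou)
    qed (simp_all add: sou)
    then show "ldist (lax_comp (slice_mor pb (adj_counit pb P)) (adj_unit pb (slice_obj pb P))) f = ldist (lax_id (slice_obj pb P)) f"
      using st by (simp add: ms)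
  qed (use st ms in simp_all)
qed

theorem adjunction: "two_adjunction trmTngCat (TngPair pb) Term (Slice pb) (adj_unit pb) (adj_counit pb)"
proof -
  have T: "omap Term = (\<lambda>P. P)" "amap Term = term_mor" "cmap Term = term_cell"
    by (simp_all add: Term_def term_cell_def fun_eq_iff)
  have S: "omap (Slice pb) = slice_obj pb" "amap (Slice pb) = slice_mor pb" "cmap (Slice pb) = slice_cell pb"
    by (simp_all add: Slice_def)
  note ut = adj_unit_trm[simplified]
  have "two_natural trmTngCat trmTngCat fid2 (fcomp2 (Slice pb) Term) (adj_unit pb)"
    unfolding two_natural_def nat_trans_def fid2_def fcomp2_def
    using terminal_tangent_pair[OF choice]
    by (intro conjI ballI) (simp_all add: T S trm_B trm_B_def ut slice_obj_terminal unit_natural unit_natural_cell)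
  moreover have "two_natural (TngPair pb) (TngPair pb) (fcomp2 Term (Slice pb)) fid2 (adj_counit pb)"
    unfolding two_natural_def nat_trans_def fid2_def fcomp2_def
    by (intro conjI ballI) (simp_all add: T S pair_B pair_B_def adj_counit_pair counit_natural counit_natural_cell)
  moreover have "\<forall>P\<in>Obj trmTngCat. adj_counit pb (omap Term P) \<cdot>\<^bsub>TngPair pb\<^esub> amap Term (adj_unit pb P) = Id (TngPair pb) (omap Term P)"
    by (simp add: T pair_B pair_B_def trm_B trm_B_def triangle_Term)
  moreover have "\<forall>P\<in>Obj (TngPair pb). amap (Slice pb) (adj_counit pb P) \<cdot>\<^bsub>trmTngCat\<^esub> adj_unit pb (omap (Slice pb) P) =
      Id trmTngCat (omap (Slice pb) P)"
    by (simp add: S pair_B pair_B_def trm_B trm_B_def triangle_Slice)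
  ultimately show ?thesis
    using two_functor_Term two_functor_Slice by (simp add: two_adjunction_def)
qed

text \<open>The inverse is the lax morphism underlying the counit at the same object, regarded as a
  tangent pair.\<close>

theorem unit_iso: "P \<in> Obj trmTngCat \<Longrightarrow> is_iso trmTngCat (adj_unit pb P)"
proof -
  assume "P \<in> Obj trmTngCat"
  then have P: "terminal_tangent_category P" by (simp add: trm_B trm_B_def)
  note tp = terminal_tangent_pair[OF choice P] and u = adj_unit_trm[OF P]
  show ?thesis
    unfolding is_iso_def
    by (intro conjI bexI[of _ "fst (adj_counit pb P)"])
      (use P tp u in \<open>simp_all add: trm_B trm_B_def counit_unit unit_counit adj_counit_laxmor\<close>)
qed

end

theorem theorem3p10:
  fixes pb :: "'b choice"
  assumes "pullback_choice pb"
  shows "two_adjunction trmTngCat (TngPair pb) Term (Slice pb) (adj_unit pb) (adj_counit pb) \<and>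
         (\<forall>P \<in> Obj trmTngCat. is_iso trmTngCat (adj_unit pb P))"
proof -
  interpret pullbacks_chosen pb by unfold_locales (rule assms)
  show ?thesis using adjunction unit_iso by blast
qed

end
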